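(* Let $X=(X_t)_{t\in[0,T]}$, $X_t\in\mathbb{R}^d$, be the strong solution of the It\^o SDE $$dX_t = F(t,X_t)\,dt + B(t,X_t)\,dW_t,\qquad X_0=x_0\in\mathbb{R}^d,$$ driven by an $m$-dimensional standard Brownian motion $W=(W^{(1)},\dots,W^{(m)})$, with drift $F:[0,T]\times\mathbb{R}^d\to\mathbb{R}^d$ and diffusion coefficient $B:[0,T]\times\mathbb{R}^d\to\mathbb{R}^{d\times m}$. Then $X_t$ has the Wiener chaos expansion $$X_t=\sum_{\alpha\in\mathcal{J}}u_\alpha(t)\,\xi_\alpha,\qquad u_\alpha(t):=\mathbb{E}[X_t\,\xi_\alpha]\in\mathbb{R}^d,$$ and the coefficients (propagators) $u_\alpha$ are governed by the following coupled system of ODEs: for every $\alpha\in\mathcal{J}$ and every $j\in\{1,\dots,d\}$, $$\frac{d}{dt}u^{(j)}_\alpha(t)=\mathbb{E}\big[F^{(j)}(t,X_t)\,\xi_\alpha\big]+\sum_{k=1}^{m}\sum_{i=1}^{\infty}\sqrt{\alpha_{ki}}\;e_i(t)\,\mathbb{E}\big[B^{(j,k)}(t,X_t)\,\xi_{\alpha-e_{ki}}\big],\qquad u^{(j)}_\alpha(0)=x_0^{(j)}\,\delta_{\alpha 0}.$$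
   Context: Setting. $T>0$, $(\Omega,\mathcal{F},\mathbb{F},\mathbb{P})$ is a filtered probability space, and $W$ is an $m$-dimensional standard Brownian motion on it. The initial value $x_0$ is deterministic. $F$ and $B$ are measurable and there are constants $L,K>0$ such that for all $t\in[0,T]$ and $x,y\in\mathbb{R}^d$: $\|F(t,x)-F(t,y)\|+\|B(t,x)-B(t,y)\|_{\mathrm{Fro}}\le L\|x-y\|$ and $\|F(t,x)\|^2+\|B(t,x)\|_{\mathrm{Fro}}^2\le K^2(1+\|x\|^2)$ (Euclidean norm for vectors, Frobenius norm for matrices). Under these assumptions the SDE has a unique continuous adapted strong solution, i.e. $X_t=x_0+\int_0^tF(s,X_s)\,ds+\int_0^tB(s,X_s)\,dW_s$. The solution is a square-integrable functional of the driving noise $W$ (so $X_t\in L^2(\Omega,\sigma(\Xi),\mathbb{P})$ with $\Xi$ as below). Superscripts denote components: $F^{(j)}$, $B^{(j,k)}$, $x_0^{(j)}$, $u_\alpha^{(j)}$. Gaussian coordinates. $\{e_j\}_{j\in\mathbb{N}}\subset L^2([0,T])$ is a complete orthonormal family of functions that are continuous almost everywhere. For $k\in\{1,\dots,m\}$ and $i\in\mathbb{N}=\{1,2,\dots\}$ set $\xi_{ki}:=\int_0^Te_i(s)\,dW^{(k)}_s$; these are mutually independent standard Gaussian random variables; $\Xi=\{\xi_{ki}\}$. Wick monomials. $\mathcal{J}$ is the set of all multi-indices $\alpha=(\alpha_{ki})_{1\le k\le m,\,i\in\mathbb{N}}$ of non-negative integers with finite support. For $\alpha\in\mathcal{J}$,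 $$\xi_\alpha:=\frac{1}{\sqrt{\alpha!}}\prod_{k,i}h_{\alpha_{ki}}(\xi_{ki}),\qquad \alpha!:=\prod_{k,i}\alpha_{ki}!,$$ where $h_n(x)=(-1)^ne^{x^2/2}\frac{d^n}{dx^n}e^{-x^2/2}$ is the $n$-th probabilists' Hermite polynomial. The family $\{\xi_\alpha\}_{\alpha\in\mathcal{J}}$ is a complete orthonormal basis of $L^2(\Omega,\sigma(\Xi),\mathbb{P})$; chaos expansions converge in $L^2(\Omega)$. Conventions. $e_{ki}$ denotes the multi-index equal to $1$ at position $(k,i)$ and $0$ elsewhere (not to be confused with the function $e_i$). Terms with $\alpha_{ki}=0$ are interpreted as $0$, so the sum over $i$ is finite. $\delta_{\alpha0}=1$ if $\alpha$ is the zero multi-index and $0$ otherwise.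
   Formalization: As F and B are only measurable in t, d/dt u can fail to exist at some t (e.g. B=0, F=1_{t>T/2}); the ODE is taken in the Carathéodory sense: u_α is its initial value plus the integral of the right-hand side for all t, and the derivative equals it for almost every t. *)

theory Defs
  imports "HOL-Probability.Probability" "HOL-Library.Poly_Mapping"
begin

subsection \<open>Filtered probability spaces and Brownian motion\<close>

text \<open>Processes are families indexed by real times of which only the values on
  \<open>{0..T}\<close> matter; a filtration on \<open>{0..T}\<close> extends to all real times by clamping the index.\<close>

definition filtered_prob_space :: "'a measure \<Rightarrow> (real \<Rightarrow> 'a measure) \<Rightarrow> bool" where
  "filtered_prob_space M \<F> \<longleftrightarrow>
     prob_space M \<and> filtration (space M) \<F> \<and> (\<forall>t. sets (\<F> t) \<subseteq> sets M)"

definition brownian_motion ::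
    "'a measure \<Rightarrow> (real \<Rightarrow> 'a measure) \<Rightarrow> real \<Rightarrow> (real \<Rightarrow> 'a \<Rightarrow> real ^ 'm) \<Rightarrow> bool" where
  "brownian_motion M \<F> T W \<longleftrightarrow>
     (\<forall>t\<in>{0..T}. W t \<in> borel_measurable (\<F> t)) \<and>
     (AE \<omega> in M. W 0 \<omega> = 0) \<and>
     (AE \<omega> in M. continuous_on {0..T} (\<lambda>t. W t \<omega>)) \<and>
     (\<forall>s t. 0 \<le> s \<and> s < t \<and> t \<le> T \<longrightarrow>
        prob_space.indep_set M (sets (\<F> s))
          (sets (vimage_algebra (space M) (\<lambda>\<omega>. W t \<omega> - W s \<omega>) borel)) \<and>
        distributed M lborel (\<lambda>\<omega>. W t \<omega> - W s \<omega>)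
          (\<lambda>x. ennreal (\<Prod>k\<in>UNIV. normal_density 0 (sqrt (t - s)) (x $ k))))"

text \<open>The \<open>\<sigma>\<close>-algebra generated by \<open>W\<^sub>s\<close>, \<open>0 \<le> s \<le> t\<close>, not augmented by null sets.\<close>

definition noise_algebra ::
    "'a measure \<Rightarrow> (real \<Rightarrow> 'a \<Rightarrow> 'b::topological_space) \<Rightarrow> real \<Rightarrow> 'a measure" where
  "noise_algebra M W t =
     sigma (space M) (\<Union>s\<in>{0..t}. {W s -` A \<inter> space M | A. A \<in> sets borel})"


subsection \<open>The Ito integral\<close>

text \<open>A list of triples \<open>(a, b, H)\<close> represents the simple process that is the sum of the
  processes \<open>H \<cdot> 1\<^bsub>(a,b]\<^esub>\<close>. The intervals may overlap; by passing to a common refinement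
  one obtains the usual form over a partition.\<close>

type_synonym 'a simple_proc = "(real \<times> real \<times> ('a \<Rightarrow> real)) list"

definition simple_proc_on :: "(real \<Rightarrow> 'a measure) \<Rightarrow> real \<Rightarrow> 'a simple_proc \<Rightarrow> bool" where
  "simple_proc_on \<F> t \<Phi> \<longleftrightarrow>
     (\<forall>(a, b, H)\<in>set \<Phi>. 0 \<le> a \<and> a \<le> b \<and> b \<le> t \<and>
        H \<in> borel_measurable (\<F> a) \<and> bounded (H ` space (\<F> a)))"

definition simple_proc_val :: "'a simple_proc \<Rightarrow> real \<Rightarrow> 'a \<Rightarrow> real" where
  "simple_proc_val \<Phi> s \<omega> = (\<Sum>(a, b, H)\<leftarrow>\<Phi>. H \<omega> * indicator {a<..b} s)"

definition simple_proc_integral ::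
    "(real \<Rightarrow> 'a \<Rightarrow> real) \<Rightarrow> 'a simple_proc \<Rightarrow> 'a \<Rightarrow> real" where
  "simple_proc_integral W \<Phi> \<omega> = (\<Sum>(a, b, H)\<leftarrow>\<Phi>. H \<omega> * (W b \<omega> - W a \<omega>))"

definition progressive_on :: "(real \<Rightarrow> 'a measure) \<Rightarrow> real \<Rightarrow> (real \<Rightarrow> 'a \<Rightarrow> real) \<Rightarrow> bool" where
  "progressive_on \<F> t \<phi> \<longleftrightarrow>
     (\<forall>r\<in>{0..t}. (\<lambda>(s, \<omega>). \<phi> s \<omega>) \<in> borel_measurable (lebesgue_on {0..r} \<Otimes>\<^sub>M \<F> r))"

text \<open>\<open>I\<close> is a version of the integral of \<open>\<phi>\<close> with respect to the scalar Brownian motion \<open>W\<close>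
  over \<open>[0,t]\<close>: the mean-square limit of the integrals of simple processes converging to \<open>\<phi>\<close>
  in \<open>L\<^sup>2([0,t] \<times> \<Omega>)\<close>. As simple processes are bounded, this makes \<open>\<phi>\<close> square integrable on
  \<open>[0,t] \<times> \<Omega>\<close>.\<close>

definition is_ito_integral ::
    "'a measure \<Rightarrow> (real \<Rightarrow> 'a measure) \<Rightarrow> (real \<Rightarrow> 'a \<Rightarrow> real) \<Rightarrow> real \<Rightarrow>
     (real \<Rightarrow> 'a \<Rightarrow> real) \<Rightarrow> ('a \<Rightarrow> real) \<Rightarrow> bool" where
  "is_ito_integral M \<F> W t \<phi> I \<longleftrightarrow>
     progressive_on \<F> t \<phi> \<and> I \<in> borel_measurable M \<and>
     (\<exists>\<Phi>. (\<forall>n. simple_proc_on \<F> t (\<Phi> n)) \<and>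
        (\<lambda>n. \<integral>\<^sup>+(s, \<omega>). ennreal ((simple_proc_val (\<Phi> n) s \<omega> - \<phi> s \<omega>)\<^sup>2)
               \<partial>(lebesgue_on {0..t} \<Otimes>\<^sub>M M)) \<longlonglongrightarrow> 0 \<and>
        (\<lambda>n. \<integral>\<^sup>+\<omega>. ennreal ((simple_proc_integral W (\<Phi> n) \<omega> - I \<omega>)\<^sup>2) \<partial>M) \<longlonglongrightarrow> 0)"


subsection \<open>Strong solutions\<close>

text \<open>A strong solution is a continuous adapted process satisfying the integral equation and
  being a functional of the driving noise: \<open>X\<^sub>t\<close> is measurable for the augmentation of
  \<open>\<sigma>(W\<^sub>s, s \<le> t)\<close>, that is, almost surely equal to a \<open>\<sigma>(W\<^sub>s, s \<le> t)\<close>-measurable random variable.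
  The equation is stated in components, with the stochastic integral
  \<open>\<Sum>k. \<integral> B\<^bsup>(j,k)\<^esup> dW\<^bsup>(k)\<^esup>\<close> in component \<open>j\<close>.
  The norm of \<^typ>\<open>real ^ 'm ^ 'd\<close> is the Frobenius norm.\<close>

definition strong_solution ::
    "'a measure \<Rightarrow> (real \<Rightarrow> 'a measure) \<Rightarrow> real \<Rightarrow> (real \<Rightarrow> 'a \<Rightarrow> real ^ 'm) \<Rightarrow>
     (real \<Rightarrow> real ^ 'd \<Rightarrow> real ^ 'd) \<Rightarrow> (real \<Rightarrow> real ^ 'd \<Rightarrow> real ^ 'm ^ 'd) \<Rightarrow> real ^ 'd \<Rightarrow>
     (real \<Rightarrow> 'a \<Rightarrow> real ^ 'd) \<Rightarrow> bool" where
  "strong_solution M \<F> T W F B x0 X \<longleftrightarrow>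
     (\<forall>t\<in>{0..T}. X t \<in> borel_measurable (\<F> t)) \<and>
     (\<forall>\<omega>\<in>space M. continuous_on {0..T} (\<lambda>t. X t \<omega>)) \<and>
     (\<forall>t\<in>{0..T}. \<exists>Y\<in>borel_measurable (noise_algebra M W t). AE \<omega> in M. X t \<omega> = Y \<omega>) \<and>
     (\<forall>t\<in>{0..T}. \<exists>I :: 'd \<Rightarrow> 'm \<Rightarrow> 'a \<Rightarrow> real.
        (\<forall>j k. is_ito_integral M \<F> (\<lambda>s \<omega>. W s \<omega> $ k) t (\<lambda>s \<omega>. B s (X s \<omega>) $ j $ k) (I j k)) \<and>
        (AE \<omega> in M. \<forall>j.
           X t \<omega> $ j = x0 $ j + (LINT s|lebesgue_on {0..t}. F s (X s \<omega>) $ j) + (\<Sum>k\<in>UNIV. I j k \<omega>)))"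


subsection \<open>Gaussian coordinates and Wick monomials\<close>

definition square_integrable_fun :: "'b measure \<Rightarrow> ('b \<Rightarrow> real) \<Rightarrow> bool" where
  "square_integrable_fun N f \<longleftrightarrow> f \<in> borel_measurable N \<and> integrable N (\<lambda>x. (f x)\<^sup>2)"

text \<open>Completeness means that finite linear combinations are dense in \<open>L\<^sup>2([0,T])\<close>. The family
  is indexed by \<^typ>\<open>nat\<close> starting from 0 instead of 1.\<close>

definition complete_orthonormal :: "real \<Rightarrow> (nat \<Rightarrow> real \<Rightarrow> real) \<Rightarrow> bool" where
  "complete_orthonormal T e \<longleftrightarrow>
     (\<forall>i. square_integrable_fun (lebesgue_on {0..T}) (e i)) \<and>
     (\<forall>i j. (LINT s|lebesgue_on {0..T}. e i s * e j s) = (if i = j then 1 else 0)) \<and>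
     (\<forall>f. square_integrable_fun (lebesgue_on {0..T}) f \<longrightarrow>
        (\<forall>\<epsilon>>0. \<exists>n c. (LINT s|lebesgue_on {0..T}. (f s - (\<Sum>i<n. c i * e i s))\<^sup>2) < \<epsilon>))"

definition hermite :: "nat \<Rightarrow> real \<Rightarrow> real" where
  "hermite n x = (- 1) ^ n * exp (x\<^sup>2 / 2) * (deriv ^^ n) (\<lambda>y. exp (- (y\<^sup>2 / 2))) x"

text \<open>Finitely supported multi-indices form the type \<open>('m \<times> nat) \<Rightarrow>\<^sub>0 nat\<close>; the unit
  multi-index at \<open>(k,i)\<close> is \<open>Poly_Mapping.single (k, i) 1\<close>. The products are restricted to the
  support because \<open>0! = 1\<close> and \<open>h\<^sub>0 = 1\<close>.\<close>

type_synonym 'm multi_index = "('m \<times> nat) \<Rightarrow>\<^sub>0 nat"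

definition multi_fact :: "'m multi_index \<Rightarrow> real" where
  "multi_fact \<alpha> = (\<Prod>p\<in>Poly_Mapping.keys \<alpha>. fact (Poly_Mapping.lookup \<alpha> p))"

definition wick_monomial :: "('m \<Rightarrow> nat \<Rightarrow> 'a \<Rightarrow> real) \<Rightarrow> 'm multi_index \<Rightarrow> 'a \<Rightarrow> real" where
  "wick_monomial \<xi> \<alpha> \<omega> =
     1 / sqrt (multi_fact \<alpha>) *
     (\<Prod>(k, i)\<in>Poly_Mapping.keys \<alpha>. hermite (Poly_Mapping.lookup \<alpha> (k, i)) (\<xi> k i \<omega>))"

definition chaos_coeff ::
    "'a measure \<Rightarrow> ('m \<Rightarrow> nat \<Rightarrow> 'a \<Rightarrow> real) \<Rightarrow> (real \<Rightarrow> 'a \<Rightarrow> real ^ 'd) \<Rightarrow>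
     'm multi_index \<Rightarrow> real \<Rightarrow> real ^ 'd" where
  "chaos_coeff M \<xi> X \<alpha> t = (LINT \<omega>|M. wick_monomial \<xi> \<alpha> \<omega> *\<^sub>R X t \<omega>)"

text \<open>Unconditional convergence of the series of \<open>c\<^sub>\<alpha> \<xi>\<^sub>\<alpha>\<close> to \<open>Z\<close> in \<open>L\<^sup>2(\<Omega>)\<close>.\<close>

definition has_chaos_expansion ::
    "'a measure \<Rightarrow> ('m \<Rightarrow> nat \<Rightarrow> 'a \<Rightarrow> real) \<Rightarrow> ('m multi_index \<Rightarrow> real ^ 'd) \<Rightarrow>
     ('a \<Rightarrow> real ^ 'd) \<Rightarrow> bool" where
  "has_chaos_expansion M \<xi> c Z \<longleftrightarrow>
     ((\<lambda>A. \<integral>\<^sup>+\<omega>. ennreal ((norm (Z \<omega> - (\<Sum>\<alpha>\<in>A. wick_monomial \<xi> \<alpha> \<omega> *\<^sub>R c \<alpha>)))\<^sup>2) \<partial>M) \<longlongrightarrow> 0)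
       (finite_subsets_at_top UNIV)"


subsection \<open>Differential equations with measurable right-hand side\<close>

text \<open>As \<open>F\<close> and \<open>B\<close> are only measurable in time and \<open>e\<^sub>i\<close> is only continuous almost everywhere,
  the equation \<open>u' = g\<close> on \<open>[0,T]\<close> is understood in the sense of Caratheodory: \<open>u\<close> is absolutely
  continuous, being the indefinite integral of \<open>g\<close>, and \<open>u'(t) = g(t)\<close> for almost every \<open>t\<close>.\<close>

definition solves_ode_ae :: "real \<Rightarrow> (real \<Rightarrow> real) \<Rightarrow> (real \<Rightarrow> real) \<Rightarrow> bool" where
  "solves_ode_ae T u g \<longleftrightarrow>
     integrable (lebesgue_on {0..T}) g \<and>
     (\<forall>t\<in>{0..T}. u t = u 0 + (LINT s|lebesgue_on {0..t}. g s)) \<and>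
     (AE t in lebesgue_on {0..T}. (u has_real_derivative g t) (at t within {0..T}))"

end

theory Submission
  imports Defs
begin

text \<open>The wanted identity is the integral form of the system: \<open>u\<^sub>\<alpha>(t)\<close> equals its initial value plus the
  integral of the right-hand side over \<open>[0,t]\<close>. Multiplying the stochastic equation by \<open>\<xi>\<^sub>\<alpha>\<close> and taking
  expectations, the drift contributes by Fubini's theorem. For the stochastic integral one
  needs \<open>E[(\<integral> \<phi> dW\<^sup>k) \<xi>\<^sub>\<alpha>] = \<Sum>i. sqrt(\<alpha>\<^sub>k\<^sub>i) \<integral> e\<^sub>i(s) E[\<phi>(s) \<xi>\<^sub>\<alpha>\<^sub>-\<^sub>e\<^sub>k\<^sub>i] ds\<close>; by the Ito isometry it suffices to
  prove this for \<open>\<phi> = H \<cdot> 1\<^bsub>(a,b]\<^esub>\<close>, where it is an integration by parts: for bounded \<open>F\<^sub>a\<close>-measurable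
  \<open>H\<close> and every Wiener integral \<open>G\<close> of a deterministic \<open>f\<close>, independence of increments gives
  \<open>E[H exp(i(G + l(W\<^sub>b - W\<^sub>a)))] = E[H exp(iG)] exp(-l \<integral>\<^sub>a\<^sup>b f - l\<^sup>2(b - a)/2)\<close>, which is then
  differentiated in \<open>l\<close> and in the coordinates of \<open>G\<close>. The same identity yields orthonormality of the
  \<open>\<xi>\<^sub>\<alpha>\<close>. For completeness, a variable orthogonal to all \<open>\<xi>\<^sub>\<alpha>\<close> is orthogonal to all polynomials, hence
  to all exponentials \<open>exp(iG)\<close>, hence by uniqueness of characteristic functions to all cylinder
  events of \<open>W\<close>. The derivative almost everywhere is Lebesgue's differentiation theorem.\<close>

subsection \<open>Lebesgue differentiation on the line\<close>

text \<open>Two obstacles shape the proof. Independence is given only between \<open>\<F> s\<close>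
  and a single later increment of \<open>W\<close>, and the coordinates \<xi> are mere mean-square
  limits: neither their Gaussian law nor their independence is at hand. Both are extracted from
  formulas for E[Y exp(iG)]. These hold for linear combinations of values of \<open>W\<close>, by
  peeling off one increment at a time, and survive mean-square limits because |exp(ix) - exp(iy)| <=
  |x - y|. Moments, isometry and integration by parts are then read off from characteristic
  functions. The Ito integral of a deterministic e_i is defined through random simple processes, so
  even \<open>\<xi> k i\<close> must first be shown to be a limit of deterministic step integrals;
  taking expectations of the coefficients does this. Square integrability of \<open>X t\<close> has
  to be derived as well: it comes from the growth of \<open>F\<close> and Gronwall's inequality, the
  stochastic integral entering as a term bounded in mean square uniformly in time by the isometry on
  [0, T].\<close>

lemma negligible_bad_increments:
  fixes f :: "real \<Rightarrow> real"
  assumes f: "f integrable_on {a..b}" and "\<epsilon> > 0"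
  shows "negligible {x \<in> {a<..<b}. \<forall>\<delta>>0. \<exists>h. h \<noteq> 0 \<and> \<bar>h\<bar> < \<delta> \<and> x + h \<in> {a..b} \<and>
           \<bar>integral {a..x + h} f - integral {a..x} f - h * f x\<bar> > \<epsilon> * \<bar>h\<bar>}"
    (is "negligible ?S")
  unfolding negligible_outer_le
proof (intro allI impI)
  fix \<eta> :: real assume "\<eta> > 0"
  define F where "F = (\<lambda>x. integral {a..x} f)"
  \<comment> \<open>The ball around \<open>x + h / 2\<close> is the interval between
    \<open>x\<close> and \<open>x + h\<close>: Vitali's theorem speaks of balls, Henstock's lemma of
    boxes.\<close>
  define cb where "cb = (\<lambda>(x, h). cball (x + h / 2) (\<bar>h\<bar> / 2) :: real set)"
  have cb: "cb (x, h) = cbox (min x (x + h)) (max x (x + h))" for x h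
    unfolding cb_def cball_eq_atLeastAtMost prod.case by (auto simp: min_def max_def field_simps abs_if)
  \<comment> \<open>Over disjoint fine bad intervals the total defect is at least \<epsilon> times
    their length; the bound \<open>\<epsilon> * \<eta>\<close> thus keeps the length below
    \<eta>.\<close>
  obtain \<gamma> where \<gamma>: "gauge \<gamma>" "\<And>p. \<lbrakk>p tagged_partial_division_of (cbox a b); \<gamma> fine p\<rbrakk> \<Longrightarrow>
             sum (\<lambda>(x,k). norm(measure lborel k *\<^sub>R f x - integral k f)) p < \<epsilon> * \<eta>"
    using Henstock_lemma[of f a b "\<epsilon> * \<eta>"] f \<open>\<epsilon> > 0\<close> \<open>\<eta> > 0\<close> by auto
  define K where "K = {(x, h). x \<in> {a<..<b} \<and> h \<noteq> 0 \<and> x + h \<in> {a..b} \<and>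
           \<bar>F (x + h) - F x - h * f x\<bar> > \<epsilon> * \<bar>h\<bar> \<and> cb (x, h) \<subseteq> \<gamma> x}"
  have K_bad: "\<epsilon> * measure lebesgue (cb i) \<le> norm (measure lborel (cb i) *\<^sub>R f (fst i) - integral (cb i) f)"
    if "i \<in> K" for i
  proof -
    obtain x h where i: "i = (x, h)" by (cases i)
    have *: "x \<in> {a<..<b}" "h \<noteq> 0" "x + h \<in> {a..b}" "\<bar>F (x + h) - F x - h * f x\<bar> > \<epsilon> * \<bar>h\<bar>"
      using that by (auto simp: K_def i)
    have "integral {min x (x+h)..max x (x+h)} f = F (max x (x + h)) - F (min x (x + h))"
    proof -
      have "f integrable_on {a..max x (x + h)}"
        by (rule integrable_on_subinterval[OF f]) (use * in auto)
      then have "integral {a..min x (x+h)} f + integral {min x (x+h)..max x (x+h)} f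
          = integral {a..max x (x+h)} f"
        by (rule Henstock_Kurzweil_Integration.integral_combine[rotated 2]) (use * in auto)
      then show ?thesis by (simp add: F_def)
    qed
    then show ?thesis using * unfolding i cb
      by (cases "h > 0") (auto simp: min_def max_def abs_if split: if_splits)
  qed
  \<comment> \<open>Bad points have arbitrarily short bad intervals inside the gauge, so these form
    a Vitali cover of \<open>?S\<close>; a countable disjoint subfamily covers it up to a null
    set.\<close>
  obtain C where C: "countable C" "C \<subseteq> K"
     "pairwise (\<lambda>i j. disjnt (cball (fst i + snd i / 2) (\<bar>snd i\<bar> / 2))
        (cball (fst j + snd j / 2) (\<bar>snd j\<bar> / 2))) C"
     "negligible (?S - (\<Union>i \<in> C. cball (fst i + snd i / 2) (\<bar>snd i\<bar> / 2)))"
  proof (rule Vitali_covering_theorem_cballs[where K = K and S = ?S and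
        a = "\<lambda>i. fst i + snd i / 2" and r = "\<lambda>i. \<bar>snd i\<bar> / 2"])
    show "0 < \<bar>snd i\<bar> / 2" if "i \<in> K" for i using that by (auto simp: K_def)
    fix x d :: real assume x: "x \<in> ?S" and "0 < d"
    have "open (\<gamma> x)" "x \<in> \<gamma> x" using \<gamma>(1) by (auto simp: gauge_def)
    then obtain r where r: "r > 0" "cball x r \<subseteq> \<gamma> x" by (meson open_contains_cball)
    obtain h where h: "h \<noteq> 0" "\<bar>h\<bar> < min d r" "x + h \<in> {a..b}"
      "\<bar>F (x + h) - F x - h * f x\<bar> > \<epsilon> * \<bar>h\<bar>"
      using x r(1) \<open>0 < d\<close> unfolding F_def by (auto dest!: spec[of _ "min d r"])
    have "cb (x, h) \<subseteq> cball x r"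
      unfolding cb using h by (auto simp: cball_eq_atLeastAtMost min_def max_def abs_if split: if_splits)
    then have "(x, h) \<in> K" using x h r by (auto simp: K_def)
    then show "\<exists>i. i \<in> K \<and> x \<in> cball (fst i + snd i / 2) (\<bar>snd i\<bar> / 2) \<and> \<bar>snd i\<bar> / 2 < d"
      using h by (intro exI[of _ "(x, h)"]) (auto simp: dist_real_def)
  qed blast
  have cb_eq: "cball (fst i + snd i / 2) (\<bar>snd i\<bar> / 2) = cb i" for i
    by (cases i) (auto simp: cb_def)
  note C = C[unfolded cb_eq]
  have lm: "cb i \<in> lmeasurable" for i by (cases i) (simp only: cb lmeasurable_cbox)
  \<comment> \<open>Henstock's lemma sees only finite families; the uniform bound passes to the
    countable union afterwards.\<close>
  have bound: "measure lebesgue (\<Union>i\<in>I. cb i) \<le> \<eta>" if I: "I \<subseteq> C" "finite I" for I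
  proof -
    have ne: "fst i \<in> cb i" for i by (cases i) (auto simp: cb)
    define p where "p = (\<lambda>i. (fst i, cb i)) ` I"
    \<comment> \<open>Disjoint nonempty intervals are distinct, so the sum over \<open>p\<close>
      becomes a sum over \<open>I\<close>.\<close>
    have inj: "inj_on (\<lambda>i. (fst i, cb i)) I"
    proof (rule inj_onI, rule ccontr)
      fix i j assume ij: "i \<in> I" "j \<in> I" "(fst i, cb i) = (fst j, cb j)" "i \<noteq> j"
      then have "disjnt (cb i) (cb j)" using I by (intro pairwiseD[OF C(3)]) auto
      then have "cb i = {}" using ij(3) by (auto simp: disjnt_def)
      then show False using ne[of i] by simp
    qed
    have "p tagged_partial_division_of (cbox a b)"
      unfolding tagged_partial_division_of_def
    proof (intro conjI allI impI)
      show "finite p" using I by (simp add: p_def)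
      fix x k assume "(x, k) \<in> p"
      then obtain i where i: "i \<in> I" "x = fst i" "k = cb i" by (auto simp: p_def)
      obtain y h where yh: "i = (y, h)" by (cases i)
      show "x \<in> k" using ne i by simp
      have "i \<in> K" using i I C by auto
      then show "k \<subseteq> cbox a b" unfolding i yh cb by (auto simp: K_def min_def max_def split: if_splits)
      show "\<exists>a b. k = cbox a b" unfolding i yh cb by blast
    next
      fix x1 K1 x2 K2 assume *: "(x1, K1) \<in> p \<and> (x2, K2) \<in> p \<and> (x1, K1) \<noteq> (x2, K2)"
      then obtain i j where ij: "i \<in> I" "x1 = fst i" "K1 = cb i" "j \<in> I" "x2 = fst j" "K2 = cb j"
        by (auto simp: p_def)
      then have "i \<noteq> j" using * by auto
      then have "disjnt K1 K2" using ij C(3) I by (auto simp: pairwise_def)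
      then show "interior K1 \<inter> interior K2 = {}"
        using interior_subset[of K1] interior_subset[of K2] by (auto simp: disjnt_def)
    qed
    moreover have "cb i \<subseteq> \<gamma> (fst i)" if "i \<in> I" for i
    proof -
      have "i \<in> K" using that I C(2) by auto
      then show ?thesis by (cases i) (auto simp: K_def)
    qed
    then have "\<gamma> fine p" by (auto simp: fine_def p_def)
    ultimately have "sum (\<lambda>(x,k). norm(measure lborel k *\<^sub>R f x - integral k f)) p < \<epsilon> * \<eta>"
      by (rule \<gamma>(2))
    then have "(\<Sum>i\<in>I. norm (measure lborel (cb i) *\<^sub>R f (fst i) - integral (cb i) f)) < \<epsilon> * \<eta>"
      unfolding p_def by (subst (asm) sum.reindex[OF inj]) (simp add: o_def)
    moreover have "\<epsilon> * (\<Sum>i\<in>I. measure lebesgue (cb i)) \<le>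
        (\<Sum>i\<in>I. norm (measure lborel (cb i) *\<^sub>R f (fst i) - integral (cb i) f))"
      unfolding sum_distrib_left using I C(2) by (intro sum_mono K_bad) auto
    ultimately have "\<epsilon> * (\<Sum>i\<in>I. measure lebesgue (cb i)) \<le> \<epsilon> * \<eta>" by linarith
    then have "(\<Sum>i\<in>I. measure lebesgue (cb i)) \<le> \<eta>" using \<open>\<epsilon> > 0\<close> by simp
    moreover have "measure lebesgue (\<Union>i\<in>I. cb i) \<le> (\<Sum>i\<in>I. measure lebesgue (cb i))"
      by (rule measure_UNION_le[OF I(2)]) (use lm in \<open>auto simp: fmeasurable_def\<close>)
    ultimately show ?thesis by linarith
  qed
  have U: "(\<Union>i\<in>C. cb i) \<in> lmeasurable" "measure lebesgue (\<Union>i\<in>C. cb i) \<le> \<eta>"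
    using fmeasurable_UN_bound[OF C(1) lm bound] measure_UN_bound[OF C(1) lm bound] by auto
  let ?N = "?S - (\<Union>i\<in>C. cb i)"
  have N: "?N \<in> null_sets lebesgue" using C(4) by (simp add: negligible_iff_null_sets)
  show "\<exists>U. ?S \<subseteq> U \<and> U \<in> lmeasurable \<and> measure lebesgue U \<le> \<eta>"
  proof (intro exI conjI)
    show "?S \<subseteq> (\<Union>i\<in>C. cb i) \<union> ?N" by blast
    show "(\<Union>i\<in>C. cb i) \<union> ?N \<in> lmeasurable"
      by (rule fmeasurable.Un[OF U(1) negligible_imp_measurable[OF C(4)]])
    show "measure lebesgue ((\<Union>i\<in>C. cb i) \<union> ?N) \<le> \<eta>"
      using measure_Un_null_set[OF _ N, of "\<Union>i\<in>C. cb i"] U by (auto simp: fmeasurable_def)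
  qed
qed

text \<open>Outside the bad sets for all thresholds 1 / (n + 1) the difference quotients converge.
  The endpoints are discarded too, as the bad sets contain interior points only.\<close>

theorem Lebesgue_differentiation_real:
  fixes f :: "real \<Rightarrow> real"
  assumes f: "f integrable_on {a..b}"
  obtains N where "negligible N" "\<And>x. x \<in> {a..b} - N \<Longrightarrow>
    ((\<lambda>t. integral {a..t} f) has_real_derivative f x) (at x within {a..b})"
proof
  define S where "S = (\<lambda>\<epsilon>. {x \<in> {a<..<b}. \<forall>\<delta>>0. \<exists>h. h \<noteq> 0 \<and> \<bar>h\<bar> < \<delta> \<and> x + h \<in> {a..b} \<and>
           \<bar>integral {a..x + h} f - integral {a..x} f - h * f x\<bar> > \<epsilon> * \<bar>h\<bar>})"
  have "negligible (S \<epsilon>)" if "\<epsilon> > 0" for \<epsilon>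
    unfolding S_def by (rule negligible_bad_increments[OF f that])
  then have "negligible (\<Union>n. S (1 / real (Suc n)))"
    by (intro negligible_Union_nat) simp
  then show "negligible ({a, b} \<union> (\<Union>n. S (1 / real (Suc n))))"
    by (intro negligible_Un) auto
  fix x assume x: "x \<in> {a..b} - ({a, b} \<union> (\<Union>n. S (1 / real (Suc n))))"
  let ?F = "\<lambda>t. integral {a..t} f"
  show "(?F has_real_derivative f x) (at x within {a..b})"
    unfolding has_field_derivative_iff
  proof (rule tendstoI)
    fix \<epsilon> :: real assume "\<epsilon> > 0"
    then obtain n where n: "1 / real (Suc n) < \<epsilon>" by (meson nat_approx_posE)
    from x have "x \<notin> S (1 / real (Suc n))" "x \<in> {a<..<b}" by auto
    then obtain \<delta> where \<delta>: "\<delta> > 0" "\<And>h. \<lbrakk>h \<noteq> 0; \<bar>h\<bar> < \<delta>; x + h \<in> {a..b}\<rbrakk> \<Longrightarrow>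
        \<bar>?F (x + h) - ?F x - h * f x\<bar> \<le> 1 / real (Suc n) * \<bar>h\<bar>"
      unfolding S_def mem_Collect_eq by (meson not_less)
    show "\<forall>\<^sub>F y in at x within {a..b}. dist ((?F y - ?F x) / (y - x)) (f x) < \<epsilon>"
      unfolding eventually_at
    proof (intro exI[of _ \<delta>] conjI ballI impI \<delta>(1))
      fix y assume y: "y \<in> {a..b}" "y \<noteq> x \<and> dist y x < \<delta>"
      have "\<bar>?F y - ?F x - (y - x) * f x\<bar> \<le> 1 / real (Suc n) * \<bar>y - x\<bar>"
        using \<delta>(2)[of "y - x"] y by (auto simp: dist_real_def)
      also have "\<dots> < \<epsilon> * \<bar>y - x\<bar>" using n y by (intro mult_strict_right_mono) auto
      finally have "\<bar>(?F y - ?F x - (y - x) * f x) / (y - x)\<bar> < \<epsilon>"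
        using y by (simp add: abs_divide pos_divide_less_eq)
      then show "dist ((?F y - ?F x) / (y - x)) (f x) < \<epsilon>"
        using y by (simp add: dist_real_def diff_divide_distrib)
    qed
  qed
qed

subsection \<open>Square-integrable functions\<close>

abbreviation L2 :: "'b measure \<Rightarrow> ('b \<Rightarrow> real) \<Rightarrow> bool" where
  "L2 \<equiv> square_integrable_fun"

text \<open>A seminorm on \<open>L2\<close> functions only: for other functions the integral may
  default to 0, whence the \<open>L2\<close> premises below.\<close>

definition l2norm :: "'b measure \<Rightarrow> ('b \<Rightarrow> real) \<Rightarrow> real" where
  "l2norm M f = sqrt (LINT x|M. (f x)\<^sup>2)"

lemma L2_I: "f \<in> borel_measurable M \<Longrightarrow> integrable M (\<lambda>x. (f x)\<^sup>2) \<Longrightarrow> L2 M f"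
  by (simp add: square_integrable_fun_def)

lemma L2_measurable[measurable_dest]: "L2 M f \<Longrightarrow> f \<in> borel_measurable M"
  by (simp add: square_integrable_fun_def)

lemma L2_integrable_sq: "L2 M f \<Longrightarrow> integrable M (\<lambda>x. (f x)\<^sup>2)"
  by (simp add: square_integrable_fun_def)

lemma L2_mult:
  assumes f: "L2 M f" and g: "L2 M g"
  shows "integrable M (\<lambda>x. f x * g x)"
proof (rule Bochner_Integration.integrable_bound)
  show "integrable M (\<lambda>x. (f x)\<^sup>2 + (g x)\<^sup>2)"
    using f g by (intro Bochner_Integration.integrable_add L2_integrable_sq)
  show "(\<lambda>x. f x * g x) \<in> borel_measurable M" using f g by measurable
  have "\<bar>a * b\<bar> \<le> a\<^sup>2 + b\<^sup>2" for a b :: real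
  proof -
    have "0 \<le> (\<bar>a\<bar> - \<bar>b\<bar>)\<^sup>2" "0 \<le> \<bar>a\<bar> * \<bar>b\<bar>" by auto
    then show ?thesis unfolding abs_mult power2_diff power2_abs by linarith
  qed
  then show "AE x in M. norm (f x * g x) \<le> norm ((f x)\<^sup>2 + (g x)\<^sup>2)" by (auto intro: AE_I2)
qed

lemma L2_cmult: "L2 M f \<Longrightarrow> L2 M (\<lambda>x. c * f x)"
  by (auto simp: square_integrable_fun_def power_mult_distrib)

lemma L2_add: "L2 M f \<Longrightarrow> L2 M g \<Longrightarrow> L2 M (\<lambda>x. f x + g x)"
  using L2_mult[of M f g]
  by (auto simp: square_integrable_fun_def power2_sum mult.assoc)

lemma L2_uminus: "L2 M f \<Longrightarrow> L2 M (\<lambda>x. - f x)"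
  by (auto simp: square_integrable_fun_def)

lemma L2_diff: "L2 M f \<Longrightarrow> L2 M g \<Longrightarrow> L2 M (\<lambda>x. f x - g x)"
  using L2_add[OF _ L2_uminus, of M f g] by simp

lemma L2_zero: "L2 M (\<lambda>x. 0)"
  by (auto simp: square_integrable_fun_def)

lemma L2_sum: "(\<And>i. i \<in> I \<Longrightarrow> L2 M (f i)) \<Longrightarrow> L2 M (\<lambda>x. \<Sum>i\<in>I. f i x)"
  by (induction I rule: infinite_finite_induct) (auto intro: L2_add L2_zero)

lemma L2_bound:
  assumes "L2 M g" "f \<in> borel_measurable M" "AE x in M. \<bar>f x\<bar> \<le> \<bar>g x\<bar>"
  shows "L2 M f"
proof (rule L2_I[OF assms(2)], rule Bochner_Integration.integrable_bound[OF L2_integrable_sq[OF assms(1)]])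
  show "AE x in M. norm ((f x)\<^sup>2) \<le> norm ((g x)\<^sup>2)"
    using assms(3) by (rule AE_mp) (auto intro!: AE_I2 simp: abs_le_square_iff)
qed (use assms(2) in measurable)

lemma L2_cong_AE:
  assumes "L2 M g" "f \<in> borel_measurable M" "AE x in M. f x = g x"
  shows "L2 M f"
  by (rule L2_bound[OF assms(1,2)]) (use assms(3) in auto)

lemma (in finite_measure) L2_bounded:
  assumes "f \<in> borel_measurable M" "AE x in M. \<bar>f x\<bar> \<le> C"
  shows "L2 M f"
proof (rule L2_bound[OF _ assms(1)])
  show "L2 M (\<lambda>_. C)" by (auto simp: square_integrable_fun_def)
  show "AE x in M. \<bar>f x\<bar> \<le> \<bar>C\<bar>" using assms(2) by auto
qed

lemma (in finite_measure) L2_const: "L2 M (\<lambda>_. c)"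
  by (auto simp: square_integrable_fun_def)

lemma (in finite_measure) L2_integrable: "L2 M f \<Longrightarrow> integrable M f"
  using L2_mult[OF L2_const[of 1], of f] by simp

lemma l2norm_nonneg[simp]: "0 \<le> l2norm M f"
  by (simp add: l2norm_def)

lemma l2norm_sq: "(l2norm M f)\<^sup>2 = (LINT x|M. (f x)\<^sup>2)"
  by (simp add: l2norm_def)

lemma l2norm_cmult: "l2norm M (\<lambda>x. c * f x) = \<bar>c\<bar> * l2norm M f"
  by (simp add: l2norm_def power_mult_distrib real_sqrt_mult)

lemma l2norm_uminus: "l2norm M (\<lambda>x. - f x) = l2norm M f"
  by (simp add: l2norm_def)

lemma l2norm_diff_commute: "l2norm M (\<lambda>x. f x - g x) = l2norm M (\<lambda>x. g x - f x)"
  by (simp add: l2norm_def power2_commute)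

text \<open>The quadratic form given by the integral of (s f + t g)^2 is nonnegative for all s and
  t, so its discriminant is not positive.\<close>

lemma L2_Cauchy_Schwarz:
  assumes f: "L2 M f" and g: "L2 M g"
  shows "\<bar>LINT x|M. f x * g x\<bar> \<le> l2norm M f * l2norm M g"
proof -
  let ?a = "LINT x|M. (f x)\<^sup>2" and ?b = "LINT x|M. f x * g x" and ?c = "LINT x|M. (g x)\<^sup>2"
  have i: "integrable M (\<lambda>x. (f x)\<^sup>2)" "integrable M (\<lambda>x. (g x)\<^sup>2)" "integrable M (\<lambda>x. f x * g x)"
    using f g by (auto intro: L2_integrable_sq L2_mult)
  have q: "0 \<le> s\<^sup>2 * ?a + 2 * s * t * ?b + t\<^sup>2 * ?c" for s t
  proof -
    have "0 \<le> (LINT x|M. (s * f x + t * g x)\<^sup>2)" by simp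
    also have "(\<lambda>x. (s * f x + t * g x)\<^sup>2) = (\<lambda>x. s\<^sup>2 * (f x)\<^sup>2 + 2 * s * t * (f x * g x) + t\<^sup>2 * (g x)\<^sup>2)"
      by (auto simp: power2_eq_square algebra_simps)
    also have "(LINT x|M. \<dots> x) = s\<^sup>2 * ?a + 2 * s * t * ?b + t\<^sup>2 * ?c"
      using i by simp
    finally show ?thesis .
  qed
  have a0: "?a \<ge> 0" "?c \<ge> 0" by auto
  have "?b\<^sup>2 \<le> ?a * ?c"
  proof (cases "?c = 0")
    case True
    have "?b = 0"
    proof (rule ccontr)
      assume b: "?b \<noteq> 0"
      \<comment> \<open>The second argument is chosen so that the form takes the value -1.\<close>
      have "0 \<le> ?a + 2 * (- (?a + 1) / (2 * ?b)) * ?b" using q[of 1 "- (?a + 1) / (2 * ?b)"] True by simp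
      then show False using b by (simp add: field_simps)
    qed
    then show ?thesis using a0 by simp
  next
    case False
    \<comment> \<open>At the point (c, -b) the form equals c (a c - b^2).\<close>
    have "0 \<le> ?c * (?a * ?c - ?b\<^sup>2)" using q[of ?c "- ?b"] by (simp add: power2_eq_square algebra_simps)
    then show ?thesis using a0 False by (simp add: zero_le_mult_iff)
  qed
  then have "sqrt (?b\<^sup>2) \<le> sqrt (?a * ?c)" by (rule real_sqrt_le_mono)
  then show ?thesis by (simp add: l2norm_def real_sqrt_mult)
qed

lemma l2norm_triangle:
  assumes f: "L2 M f" and g: "L2 M g"
  shows "l2norm M (\<lambda>x. f x + g x) \<le> l2norm M f + l2norm M g"
proof (rule power2_le_imp_le)
  have i: "integrable M (\<lambda>x. (f x)\<^sup>2)" "integrable M (\<lambda>x. (g x)\<^sup>2)" "integrable M (\<lambda>x. f x * g x)"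
    using f g by (auto intro: L2_integrable_sq L2_mult)
  have "(l2norm M (\<lambda>x. f x + g x))\<^sup>2 = (LINT x|M. (f x)\<^sup>2 + (g x)\<^sup>2 + 2 * (f x * g x))"
    unfolding l2norm_sq by (simp add: power2_sum mult.assoc)
  also have "\<dots> = (l2norm M f)\<^sup>2 + (l2norm M g)\<^sup>2 + 2 * (LINT x|M. f x * g x)"
    using i by (simp add: l2norm_sq)
  also have "\<dots> \<le> (l2norm M f + l2norm M g)\<^sup>2"
    using L2_Cauchy_Schwarz[OF f g] by (simp add: power2_sum)
  finally show "(l2norm M (\<lambda>x. f x + g x))\<^sup>2 \<le> (l2norm M f + l2norm M g)\<^sup>2" .
qed simp

lemma l2norm_triangle3:
  assumes "L2 M f" "L2 M g" "L2 M h"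
  shows "l2norm M (\<lambda>x. f x - h x) \<le> l2norm M (\<lambda>x. f x - g x) + l2norm M (\<lambda>x. g x - h x)"
  using l2norm_triangle[of M "\<lambda>x. f x - g x" "\<lambda>x. g x - h x"] assms by (simp add: L2_diff)

lemma l2norm_diff_ge:
  assumes "L2 M f" "L2 M g"
  shows "\<bar>l2norm M f - l2norm M g\<bar> \<le> l2norm M (\<lambda>x. f x - g x)"
  using l2norm_triangle3[of M f g "\<lambda>_. 0"] l2norm_triangle3[of M g f "\<lambda>_. 0"] assms
    l2norm_diff_commute[of M f g]
  by (simp add: L2_zero)

lemma l2norm_cong_AE:
  "AE x in M. f x = g x \<Longrightarrow> f \<in> borel_measurable M \<Longrightarrow> g \<in> borel_measurable M \<Longrightarrow> l2norm M f = l2norm M g"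
  unfolding l2norm_def by (intro arg_cong[of _ _ sqrt] integral_cong_AE) auto

lemma L2_tendsto_norm:
  assumes "\<And>n. L2 M (f n)" "L2 M g" "(\<lambda>n. l2norm M (\<lambda>x. f n x - g x)) \<longlonglongrightarrow> 0"
  shows "(\<lambda>n. l2norm M (f n)) \<longlonglongrightarrow> l2norm M g"
proof (rule LIM_zero_cancel, rule Lim_null_comparison[OF _ assms(3)], rule always_eventually, rule allI)
  show "norm (l2norm M (f n) - l2norm M g) \<le> l2norm M (\<lambda>x. f n x - g x)" for n
    unfolding real_norm_def by (rule l2norm_diff_ge[OF assms(1,2)])
qed

lemma L2_tendsto_inner:
  assumes "\<And>n. L2 M (f n)" "L2 M g" "(\<lambda>n. l2norm M (\<lambda>x. f n x - g x)) \<longlonglongrightarrow> 0" and h: "L2 M h"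
  shows "(\<lambda>n. LINT x|M. f n x * h x) \<longlonglongrightarrow> (LINT x|M. g x * h x)"
proof -
  have "\<bar>(LINT x|M. f n x * h x) - (LINT x|M. g x * h x)\<bar> \<le> l2norm M (\<lambda>x. f n x - g x) * l2norm M h" for n
  proof -
    have "(LINT x|M. f n x * h x) - (LINT x|M. g x * h x) = (LINT x|M. (f n x - g x) * h x)"
      using L2_mult[OF assms(1)[of n] h] L2_mult[OF assms(2) h] by (simp add: left_diff_distrib)
    then show ?thesis using L2_Cauchy_Schwarz[OF L2_diff[OF assms(1)[of n] assms(2)] h] by (simp only:)
  qed
  note bound = this
  show ?thesis
  proof (rule LIM_zero_cancel, rule Lim_null_comparison[where g = "\<lambda>n. l2norm M (\<lambda>x. f n x - g x) * l2norm M h"],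
      rule always_eventually, rule allI)
    show "norm ((LINT x|M. f n x * h x) - (LINT x|M. g x * h x)) \<le> l2norm M (\<lambda>x. f n x - g x) * l2norm M h" for n
      unfolding real_norm_def by (rule bound)
  qed (rule tendsto_mult_left_zero[OF assms(3)])
qed

lemma nn_integral_L2:
  assumes "L2 M f"
  shows "(\<integral>\<^sup>+x. ennreal ((f x)\<^sup>2) \<partial>M) = ennreal ((l2norm M f)\<^sup>2)"
  unfolding l2norm_sq by (intro nn_integral_eq_integral L2_integrable_sq assms) auto

lemma L2_of_nn_integral:
  assumes "f \<in> borel_measurable M" "(\<integral>\<^sup>+x. ennreal ((f x)\<^sup>2) \<partial>M) < \<infinity>"
  shows "L2 M f"
  using assms by (intro L2_I integrableI_bounded) auto

text \<open>The nonnegative integrals in the definitions presuppose nothing about \<open>g\<close>.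
  One finite distance to some \<open>f n\<close> puts \<open>g\<close> into \<open>L2\<close>, and
  then the convergence can be expressed by \<open>l2norm\<close>.\<close>

lemma L2_limit_of_nn_integral:
  assumes f: "\<And>n. L2 M (f n)" and g: "g \<in> borel_measurable M"
    and lim: "(\<lambda>n. \<integral>\<^sup>+x. ennreal ((f n x - g x)\<^sup>2) \<partial>M) \<longlonglongrightarrow> 0"
  shows "L2 M g" "(\<lambda>n. l2norm M (\<lambda>x. f n x - g x)) \<longlonglongrightarrow> 0"
proof -
  have [measurable]: "f n \<in> borel_measurable M" for n using f by measurable
  note [measurable] = g
  have "\<forall>\<^sub>F n in sequentially. (\<integral>\<^sup>+x. ennreal ((f n x - g x)\<^sup>2) \<partial>M) < 1"
    by (rule order_tendstoD[OF lim]) simp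
  then obtain n where n: "(\<integral>\<^sup>+x. ennreal ((f n x - g x)\<^sup>2) \<partial>M) < 1"
    by (auto dest: eventually_happens)
  have "L2 M (\<lambda>x. f n x - g x)"
    by (rule L2_of_nn_integral) (auto intro: order.strict_trans[OF n])
  from L2_diff[OF f[of n] this] show g2: "L2 M g" by simp
  have d: "L2 M (\<lambda>x. f n x - g x)" for n using f g2 by (rule L2_diff)
  have "(\<lambda>n. ennreal ((l2norm M (\<lambda>x. f n x - g x))\<^sup>2)) \<longlonglongrightarrow> ennreal 0"
    using lim by (simp add: nn_integral_L2[OF d])
  then have "(\<lambda>n. (l2norm M (\<lambda>x. f n x - g x))\<^sup>2) \<longlonglongrightarrow> 0"
    by (rule tendsto_ennrealD) auto
  from tendsto_real_sqrt[OF this] show "(\<lambda>n. l2norm M (\<lambda>x. f n x - g x)) \<longlonglongrightarrow> 0" by simp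
qed

text \<open>Riesz-Fischer: a subsequence with geometrically decreasing gaps converges almost
  everywhere, and Fatou's lemma carries the Cauchy estimate over to its limit.\<close>

theorem (in finite_measure) L2_complete:
  assumes f: "\<And>n. L2 M (f n)"
    and cauchy: "\<And>\<epsilon>. \<epsilon> > 0 \<Longrightarrow> \<exists>N. \<forall>m\<ge>N. \<forall>n\<ge>N. l2norm M (\<lambda>x. f m x - f n x) < \<epsilon>"
  obtains g where "L2 M g" "(\<lambda>n. l2norm M (\<lambda>x. f n x - g x)) \<longlonglongrightarrow> 0"
proof -
  have [measurable]: "f n \<in> borel_measurable M" for n using f by measurable
  have "\<forall>k. \<exists>N. \<forall>m\<ge>N. \<forall>n\<ge>N. l2norm M (\<lambda>x. f m x - f n x) < (1/2)^k"
    by (intro allI cauchy) simp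
  from choice[OF this] obtain N where
    N: "\<And>k m n. m \<ge> N k \<Longrightarrow> n \<ge> N k \<Longrightarrow> l2norm M (\<lambda>x. f m x - f n x) < (1/2)^k"
    by auto
  \<comment> \<open>Partial sums of \<open>N\<close> dominate all earlier values of
    \<open>N\<close>, which makes every tail of \<open>r\<close> fine enough.\<close>
  define r where "r = (\<lambda>k. \<Sum>i\<le>k. N i)"
  have rN: "r m \<ge> N k" if "m \<ge> k" for m k
    unfolding r_def by (rule member_le_sum) (use that in auto)
  let ?d = "\<lambda>k x. f (r (Suc k)) x - f (r k) x"
  have d2: "L2 M (?d k)" for k by (intro L2_diff f)
  \<comment> \<open>On a finite measure space Cauchy-Schwarz against the constant 1 bounds the L1
    norm by the L2 norm, so the L1 norms of the gaps are summable.\<close>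
  have dk: "(\<integral>\<^sup>+x. ennreal \<bar>?d k x\<bar> \<partial>M) \<le> ennreal (l2norm M (\<lambda>_. 1) * (1/2)^k)" for k
  proof -
    have "L2 M (\<lambda>x. \<bar>?d k x\<bar>)" by (rule L2_bound[OF d2[of k]]) simp_all
    from L2_Cauchy_Schwarz[OF this L2_const[of 1]]
    have "(LINT x|M. \<bar>?d k x\<bar> * 1) \<le> l2norm M (?d k) * l2norm M (\<lambda>_. 1)"
      by (simp add: l2norm_def)
    also have "\<dots> \<le> (1/2)^k * l2norm M (\<lambda>_. 1)"
      using N[of k "r (Suc k)" "r k"] rN by (intro mult_right_mono) (simp_all add: less_imp_le)
    finally have "(LINT x|M. \<bar>?d k x\<bar>) \<le> l2norm M (\<lambda>_. 1) * (1/2)^k"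
      by (simp add: mult.commute)
    moreover have "(\<integral>\<^sup>+x. ennreal \<bar>?d k x\<bar> \<partial>M) = ennreal (LINT x|M. \<bar>?d k x\<bar>)"
      using L2_integrable[OF d2[of k]] by (subst nn_integral_eq_integral) auto
    ultimately show ?thesis by (simp add: ennreal_leI)
  qed
  have "(\<integral>\<^sup>+x. (suminf (\<lambda>k. ennreal \<bar>?d k x\<bar>)) \<partial>M) = suminf (\<lambda>k. \<integral>\<^sup>+x. ennreal \<bar>?d k x\<bar> \<partial>M)"
    by (rule nn_integral_suminf) auto
  also have "\<dots> \<le> suminf (\<lambda>k. ennreal (l2norm M (\<lambda>_. 1) * (1/2)^k))"
    by (intro suminf_le dk) auto
  also have "\<dots> = ennreal (suminf (\<lambda>k. l2norm M (\<lambda>_. 1) * (1/2)^k))"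
    by (intro suminf_ennreal2 summable_mult summable_geometric) auto
  finally have "(\<integral>\<^sup>+x. (suminf (\<lambda>k. ennreal \<bar>?d k x\<bar>)) \<partial>M) \<noteq> \<infinity>"
    by (auto simp: top_unique)
  then have "AE x in M. (suminf (\<lambda>k. ennreal \<bar>?d k x\<bar>)) \<noteq> \<infinity>"
    by (intro nn_integral_PInf_AE) auto
  then have conv: "AE x in M. convergent (\<lambda>k. f (r k) x)"
  proof (rule AE_mp, intro AE_I2 impI)
    fix x assume "(suminf (\<lambda>k. ennreal \<bar>?d k x\<bar>)) \<noteq> \<infinity>"
    then have "summable (\<lambda>k. \<bar>?d k x\<bar>)" by (intro summable_suminf_not_top) auto
    then have "summable (\<lambda>k. ?d k x)" by (rule summable_rabs_cancel)
    then have "convergent (\<lambda>n. \<Sum>k<n. ?d k x)" by (simp add: summable_iff_convergent)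
    then have "convergent (\<lambda>n. f (r n) x - f (r 0) x)"
      by (simp add: sum_lessThan_telescope[of "\<lambda>k. f (r k) x"])
    then have "convergent (\<lambda>n. (f (r n) x - f (r 0) x) + f (r 0) x)"
      by (intro convergent_add convergent_const)
    then show "convergent (\<lambda>k. f (r k) x)" by simp
  qed
  define g where "g = (\<lambda>x. lim (\<lambda>k. f (r k) x))"
  have [measurable]: "g \<in> borel_measurable M" unfolding g_def by measurable
  have fatou: "(\<integral>\<^sup>+x. ennreal ((f n x - g x)\<^sup>2) \<partial>M) \<le> ennreal (((1/2)^k)\<^sup>2)" if n: "n \<ge> N k" for n k
  proof -
    have "(\<integral>\<^sup>+x. ennreal ((f n x - g x)\<^sup>2) \<partial>M) =
        (\<integral>\<^sup>+x. liminf (\<lambda>j. ennreal ((f n x - f (r j) x)\<^sup>2)) \<partial>M)"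
    proof (rule nn_integral_cong_AE, rule AE_mp[OF conv], intro AE_I2 impI)
      fix x assume "convergent (\<lambda>k. f (r k) x)"
      then have "(\<lambda>j. f (r j) x) \<longlonglongrightarrow> g x" unfolding g_def by (simp add: convergent_LIMSEQ_iff)
      then have "(\<lambda>j. ennreal ((f n x - f (r j) x)\<^sup>2)) \<longlonglongrightarrow> ennreal ((f n x - g x)\<^sup>2)"
        by (intro tendsto_ennrealI tendsto_intros)
      then show "ennreal ((f n x - g x)\<^sup>2) = liminf (\<lambda>j. ennreal ((f n x - f (r j) x)\<^sup>2))"
        by (rule lim_imp_Liminf[symmetric, rotated]) simp
    qed
    also have "\<dots> \<le> liminf (\<lambda>j. \<integral>\<^sup>+x. ennreal ((f n x - f (r j) x)\<^sup>2) \<partial>M)"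
      by (rule nn_integral_liminf) auto
    also have "\<dots> \<le> ennreal (((1/2)^k)\<^sup>2)"
    proof (rule Liminf_le, simp)
      have "(\<integral>\<^sup>+x. ennreal ((f n x - f (r j) x)\<^sup>2) \<partial>M) \<le> ennreal (((1/2)^k)\<^sup>2)" if "j \<ge> k" for j
        using N[OF n rN[OF that]] by (subst nn_integral_L2[OF L2_diff[OF f f]])
           (auto intro!: ennreal_leI power_mono)
      then show "\<forall>\<^sub>F j in sequentially.
        (\<integral>\<^sup>+x. ennreal ((f n x - f (r j) x)\<^sup>2) \<partial>M) \<le> ennreal (((1/2)^k)\<^sup>2)"
        by (auto simp: eventually_sequentially)
    qed
    finally show ?thesis .
  qed
  have dg: "L2 M (\<lambda>x. f n x - g x)" if "n \<ge> N k" for n k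
    using fatou[OF that] by (intro L2_of_nn_integral) (auto simp: less_top[symmetric] top_unique)
  have g2: "L2 M g" using L2_diff[OF f dg[of 0 "N 0"], of "N 0"] by simp
  have "(\<lambda>n. l2norm M (\<lambda>x. f n x - g x)) \<longlonglongrightarrow> 0"
  proof (rule LIMSEQ_I)
    fix \<epsilon> :: real assume "\<epsilon> > 0"
    then obtain k where k: "(1/2)^k < \<epsilon>" using real_arch_pow_inv[of \<epsilon> "1/2"] by auto
    have "l2norm M (\<lambda>x. f n x - g x) < \<epsilon>" if "n \<ge> N k" for n
    proof -
      have "ennreal ((l2norm M (\<lambda>x. f n x - g x))\<^sup>2) \<le> ennreal (((1/2)^k)\<^sup>2)"
        using fatou[OF that] by (simp add: nn_integral_L2[OF dg[OF that]])
      then have "(l2norm M (\<lambda>x. f n x - g x))\<^sup>2 \<le> ((1/2)^k)\<^sup>2" by (subst (asm) ennreal_le_iff) auto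
      then have "l2norm M (\<lambda>x. f n x - g x) \<le> (1/2)^k" by (rule power2_le_imp_le) simp
      with k show ?thesis by simp
    qed
    then show "\<exists>no. \<forall>n\<ge>no. norm (l2norm M (\<lambda>x. f n x - g x) - 0) < \<epsilon>" by auto
  qed
  then show ?thesis using that g2 by blast
qed

subsection \<open>Characteristic functions\<close>

lemma (in prob_space) integrable_iexp_mult:
  fixes Y :: "'a \<Rightarrow> complex"
  assumes Y: "integrable M Y" and R: "R \<in> borel_measurable M"
  shows "integrable M (\<lambda>\<omega>. Y \<omega> * iexp (R \<omega>))"
  by (rule Bochner_Integration.integrable_bound[OF Y]) (use R Y in \<open>auto simp: norm_mult\<close>)

lemma (in prob_space) integral_mult_iexp:
  fixes Y :: "'a \<Rightarrow> real"
  assumes Y: "integrable M Y" and R: "R \<in> borel_measurable M"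
  shows "(LINT \<omega>|M. complex_of_real (Y \<omega>) * iexp (R \<omega>)) =
    Complex (LINT \<omega>|M. Y \<omega> * cos (R \<omega>)) (LINT \<omega>|M. Y \<omega> * sin (R \<omega>))"
proof -
  have i: "integrable M (\<lambda>\<omega>. complex_of_real (Y \<omega>) * iexp (R \<omega>))"
    using Y R by (intro integrable_iexp_mult) auto
  have "Re (complex_of_real y * iexp x) = y * cos x" "Im (complex_of_real y * iexp x) = y * sin x" for x y
    by (auto simp: Re_exp Im_exp)
  then show ?thesis
    using integral_Re[OF i] integral_Im[OF i] by (simp only: complex_eq_iff complex.sel simp_thms)
qed

text \<open>Levy's uniqueness theorem identifies the law of \<open>R / \<sigma>\<close> with the
  standard normal law, whose moments are known. The case \<open>\<sigma> = 0\<close> is included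
  since a Wiener integral can vanish; there \<open>R\<close> is 0 almost surely.\<close>

lemma (in prob_space) gaussian_moments_of_char:
  fixes R :: "'a \<Rightarrow> real"
  assumes R[measurable]: "R \<in> borel_measurable M" and "\<sigma> \<ge> 0"
    and char: "\<And>u. (LINT \<omega>|M. iexp (u * R \<omega>)) = complex_of_real (exp (- (\<sigma> * u)\<^sup>2 / 2))"
  shows "integrable M (\<lambda>\<omega>. R \<omega> ^ n)"
    and "(LINT \<omega>|M. R \<omega> ^ (2 * n)) = \<sigma> ^ (2 * n) * (fact (2 * n) / (2 ^ n * fact n))"
    and "(LINT \<omega>|M. R \<omega>) = 0"
proof -
  consider "\<sigma> = 0" | "\<sigma> > 0" using \<open>\<sigma> \<ge> 0\<close> by linarith
  then have "integrable M (\<lambda>\<omega>. R \<omega> ^ n) \<and>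
    (LINT \<omega>|M. R \<omega> ^ (2 * n)) = \<sigma> ^ (2 * n) * (fact (2 * n) / (2 ^ n * fact n)) \<and>
    (LINT \<omega>|M. R \<omega>) = 0"
  proof cases
    case 1
    let ?D = "distr M borel R"
    have "char ?D = char (return borel 0)"
    proof
      fix u
      have "char ?D u = 1" using char[of u] 1 by (simp add: char_def integral_distr)
      also have "\<dots> = char (return borel 0) u" by (simp add: char_def integral_return)
      finally show "char ?D u = char (return borel 0) u" .
    qed
    moreover have "real_distribution (return borel (0::real))"
      by (auto simp: real_distribution_def real_distribution_axioms_def intro!: prob_space_return)
    ultimately have D: "?D = return borel 0"
      by (intro Levy_uniqueness real_distribution_distr) auto
    have "AE x in ?D. x = 0" unfolding D by (subst AE_return) auto
    then have R0: "AE \<omega> in M. R \<omega> = 0" by (subst (asm) AE_distr_iff) auto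
    have 2: "AE \<omega> in M. R \<omega> ^ n = 0 ^ n" for n using R0 by eventually_elim simp
    have "integrable M (\<lambda>\<omega>. R \<omega> ^ n) = integrable M (\<lambda>\<omega>. 0 ^ n :: real)"
      by (rule integrable_cong_AE) (use 2[of n] in auto)
    moreover have "(LINT \<omega>|M. R \<omega> ^ (2 * n)) = (LINT \<omega>|M. 0 ^ (2 * n))"
      by (rule integral_cong_AE) (use 2[of "2 * n"] in auto)
    moreover have "(LINT \<omega>|M. R \<omega>) = 0" by (rule integral_eq_zero_AE[OF R0])
    ultimately show ?thesis using 1 by (cases n) (auto simp: prob_space)
  next
    case 2
    let ?D = "distr M borel (\<lambda>\<omega>. R \<omega> / \<sigma>)"
    have "char ?D = char std_normal_distribution"
    proof
      fix u
      have "char ?D u = (LINT \<omega>|M. iexp (u / \<sigma> * R \<omega>))" by (simp add: char_def integral_distr)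
      also have "\<dots> = char std_normal_distribution u"
        unfolding char char_std_normal_distribution using 2 by simp
      finally show "char ?D u = char std_normal_distribution u" .
    qed
    then have D: "?D = std_normal_distribution"
      by (intro Levy_uniqueness real_distribution_distr real_dist_normal_dist) auto
    have "integrable ?D (\<lambda>x. x ^ n)" unfolding D by (rule integrable_std_normal_distribution_moment)
    then have "integrable M (\<lambda>\<omega>. (R \<omega> / \<sigma>) ^ n)" by (subst (asm) integrable_distr_eq) auto
    then have "integrable M (\<lambda>\<omega>. \<sigma> ^ n * (R \<omega> / \<sigma>) ^ n)" by simp
    then have 1: "integrable M (\<lambda>\<omega>. R \<omega> ^ n)" using 2 by (simp add: power_divide)
    have "(LINT x|?D. x ^ (2 * n)) = fact (2 * n) / (2 ^ n * fact n)"
      unfolding D by (rule std_normal_distribution_even_moments)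
    then have "(LINT \<omega>|M. (R \<omega> / \<sigma>) ^ (2 * n)) = fact (2 * n) / (2 ^ n * fact n)"
      by (subst (asm) integral_distr) auto
    then have "\<sigma> ^ (2 * n) * (LINT \<omega>|M. (R \<omega> / \<sigma>) ^ (2 * n)) = \<sigma> ^ (2 * n) * (fact (2 * n) / (2 ^ n * fact n))"
      by simp
    also have "\<sigma> ^ (2 * n) * (LINT \<omega>|M. (R \<omega> / \<sigma>) ^ (2 * n)) = (LINT \<omega>|M. \<sigma> ^ (2 * n) * (R \<omega> / \<sigma>) ^ (2 * n))"
      by simp
    also have "(\<lambda>\<omega>. \<sigma> ^ (2 * n) * (R \<omega> / \<sigma>) ^ (2 * n)) = (\<lambda>\<omega>. R \<omega> ^ (2 * n))"
      using 2 by (simp add: power_divide)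
    finally have "(LINT \<omega>|M. R \<omega> ^ (2 * n)) = \<sigma> ^ (2 * n) * (fact (2 * n) / (2 ^ n * fact n))" .
    moreover have "(LINT x|?D. x) = 0"
      unfolding D using integral_std_normal_distribution_moment_odd[of 1] by simp
    then have "(LINT \<omega>|M. R \<omega>) = 0"
      using 2 by (subst (asm) integral_distr) auto
    ultimately show ?thesis using 1 by simp
  qed
  then show "integrable M (\<lambda>\<omega>. R \<omega> ^ n)"
    "(LINT \<omega>|M. R \<omega> ^ (2 * n)) = \<sigma> ^ (2 * n) * (fact (2 * n) / (2 ^ n * fact n))"
    "(LINT \<omega>|M. R \<omega>) = 0" by auto
qed

text \<open>Apply Levy's uniqueness theorem to the normalised images under \<open>R\<close> of the positive and the
  negative part of \<open>Y\<close>.\<close>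

lemma (in prob_space) integral_indicator_eq_0_of_char:
  fixes Y R :: "'a \<Rightarrow> real"
  assumes Y: "integrable M Y" and R[measurable]: "R \<in> borel_measurable M"
    and 0: "\<And>t. (LINT \<omega>|M. Y \<omega> * cos (t * R \<omega>)) = 0" "\<And>t. (LINT \<omega>|M. Y \<omega> * sin (t * R \<omega>)) = 0"
    and A: "A \<in> sets borel"
  shows "(LINT \<omega>|M. Y \<omega> * indicator A (R \<omega>)) = 0"
proof -
  have [measurable]: "Y \<in> borel_measurable M" "A \<in> sets borel" using Y A by auto
  define Yp where "Yp = (\<lambda>\<omega>. max (Y \<omega>) 0)"
  define Ym where "Ym = (\<lambda>\<omega>. max (- Y \<omega>) 0)"
  have pm: "Yp \<omega> - Ym \<omega> = Y \<omega>" "Yp \<omega> \<ge> 0" "Ym \<omega> \<ge> 0" for \<omega> by (auto simp: Yp_def Ym_def)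
  have int: "integrable M Yp" "integrable M Ym" using Y by (auto simp: Yp_def Ym_def)
  then have [measurable]: "Yp \<in> borel_measurable M" "Ym \<in> borel_measurable M" by auto
  define c where "c = (LINT \<omega>|M. Yp \<omega>)"
  \<comment> \<open>The hypothesis at \<open>t = 0\<close> says that \<open>Y\<close> has mean 0, so
    both parts have the same mass \<open>c\<close> and can be normalised by it.\<close>
  have "(LINT \<omega>|M. Yp \<omega> - Ym \<omega>) = 0" unfolding pm using 0(1)[of 0] by simp
  then have c: "(LINT \<omega>|M. Yp \<omega>) = c" "(LINT \<omega>|M. Ym \<omega>) = c" using int by (auto simp: c_def)
  have "c \<ge> 0" unfolding c_def using pm by simp
  then consider "c = 0" | "c > 0" by linarith
  then show ?thesis
  proof cases
    case 1
    have "AE \<omega> in M. Yp \<omega> = 0" "AE \<omega> in M. Ym \<omega> = 0"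
      using c int pm 1 by (simp_all add: integral_nonneg_eq_0_iff_AE)
    then have "AE \<omega> in M. Y \<omega> * indicator A (R \<omega>) = 0"
    proof eventually_elim
      case (elim \<omega>)
      then show ?case using pm(1)[of \<omega>] by simp
    qed
    then show ?thesis by (rule integral_eq_zero_AE)
  next
    case 2
    define D where "D = (\<lambda>Z::'a \<Rightarrow> real. distr (density M (\<lambda>\<omega>. ennreal (Z \<omega> / c))) borel R)"
    have D: "real_distribution (D Z)" "\<And>f :: real \<Rightarrow> complex. f \<in> borel_measurable borel \<Longrightarrow>
        (LINT x|D Z. f x) = (LINT \<omega>|M. complex_of_real (Z \<omega> / c) * f (R \<omega>))"
      if Z: "integrable M Z" "\<And>\<omega>. Z \<omega> \<ge> 0" "(LINT \<omega>|M. Z \<omega>) = c" for Z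
    proof -
      have [measurable]: "Z \<in> borel_measurable M" using Z by auto
      have "(\<integral>\<^sup>+\<omega>. ennreal (Z \<omega> / c) \<partial>M) = ennreal (LINT \<omega>|M. Z \<omega> / c)"
        using Z 2 by (intro nn_integral_eq_integral) auto
      also have "(LINT \<omega>|M. Z \<omega> / c) = 1" using Z 2 by simp
      finally have p: "prob_space (density M (\<lambda>\<omega>. ennreal (Z \<omega> / c)))"
        by (intro prob_spaceI) (simp add: emeasure_density cong: nn_integral_cong)
      have "prob_space (D Z)" unfolding D_def by (intro prob_space.prob_space_distr p) auto
      then show "real_distribution (D Z)"
        by (auto simp: real_distribution_def real_distribution_axioms_def D_def)
      fix f :: "real \<Rightarrow> complex" assume [measurable]: "f \<in> borel_measurable borel"
      show "(LINT x|D Z. f x) = (LINT \<omega>|M. complex_of_real (Z \<omega> / c) * f (R \<omega>))"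
        unfolding D_def using Z 2
        by (subst integral_distr, simp, simp, subst integral_density) (auto simp: scaleR_conv_of_real)
    qed
    have i: "integrable M (\<lambda>\<omega>. complex_of_real (Z \<omega> / c) * iexp (u * R \<omega>))" if "integrable M Z" for Z u
      by (rule integrable_iexp_mult) (use that in simp_all)
    have "D Yp = D Ym"
    proof (rule Levy_uniqueness)
      show "char (D Yp) = char (D Ym)"
      proof
        fix u
        have "char (D Yp) u - char (D Ym) u =
            (LINT \<omega>|M. complex_of_real (Yp \<omega> / c) * iexp (u * R \<omega>) - complex_of_real (Ym \<omega> / c) * iexp (u * R \<omega>))"
          unfolding char_def using int pm c(2)
          by (subst (1 2) D(2)) (auto simp del: of_real_divide of_real_mult simp: c intro!: Bochner_Integration.integral_diff[symmetric] i)
        also have "\<dots> = (LINT \<omega>|M. complex_of_real (1 / c) * (complex_of_real (Y \<omega>) * iexp (u * R \<omega>)))"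
          by (intro Bochner_Integration.integral_cong) (simp_all add: pm(1)[symmetric] algebra_simps diff_divide_distrib)
        also have "\<dots> = 0"
          using integral_mult_iexp[OF Y, of "\<lambda>\<omega>. u * R \<omega>"] 0 by (simp add: Complex_eq)
        finally show "char (D Yp) u = char (D Ym) u" by simp
      qed
    qed (use D int pm c in auto)
    then have "(LINT x|D Yp. complex_of_real (indicator A x)) = (LINT x|D Ym. complex_of_real (indicator A x))"
      by simp
    then have "(LINT \<omega>|M. complex_of_real (Yp \<omega> / c) * complex_of_real (indicator A (R \<omega>))) =
        (LINT \<omega>|M. complex_of_real (Ym \<omega> / c) * complex_of_real (indicator A (R \<omega>)))"
      using int pm c by (subst (asm) (1 2) D(2)) auto
    then have "complex_of_real (LINT \<omega>|M. Yp \<omega> / c * indicator A (R \<omega>)) =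
        complex_of_real (LINT \<omega>|M. Ym \<omega> / c * indicator A (R \<omega>))"
      by (subst (1 2) integral_complex_of_real[symmetric]) (simp only: of_real_mult)
    then have eq: "(LINT \<omega>|M. Yp \<omega> * indicator A (R \<omega>)) = (LINT \<omega>|M. Ym \<omega> * indicator A (R \<omega>))"
      using 2 by simp
    have ii: "integrable M (\<lambda>\<omega>. Z \<omega> * indicator A (R \<omega>))" if "integrable M Z" for Z :: "'a \<Rightarrow> real"
      by (rule Bochner_Integration.integrable_bound[OF that]) (use that in \<open>auto simp: indicator_def\<close>)
    have "(LINT \<omega>|M. Y \<omega> * indicator A (R \<omega>)) = (LINT \<omega>|M. Yp \<omega> * indicator A (R \<omega>) - Ym \<omega> * indicator A (R \<omega>))"
      by (simp only: left_diff_distrib[symmetric] pm)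
    also have "\<dots> = 0" using eq ii int by simp
    finally show ?thesis .
  qed
qed

text \<open>\<open>lborel\<close> on vectors is the image of a product over \<open>Basis\<close>,
  and \<open>axis\<close> puts the index type in bijection with \<open>Basis\<close>; the claim
  becomes Fubini's theorem for finite products.\<close>

lemma integral_lborel_vec_prod:
  fixes f :: "'m::finite \<Rightarrow> real \<Rightarrow> complex"
  assumes f: "\<And>k. integrable lborel (f k)"
  shows "(LINT x|lborel. (\<Prod>k\<in>UNIV. f k (x $ k))) = (\<Prod>k\<in>UNIV. (LINT x|lborel. f k x))"
proof -
  have [measurable]: "f k \<in> borel_measurable borel" for k
    using borel_measurable_integrable[OF f[of k]] by simp
  let ?ax = "\<lambda>k::'m. axis k (1::real)"
  define idx where "idx = inv ?ax"
  have inj: "inj ?ax" by (auto simp: inj_on_def axis_eq_axis)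
  have idx: "idx (?ax k) = k" for k unfolding idx_def by (rule inv_f_f[OF inj])
  have B: "(Basis :: (real^'m) set) = range ?ax" by (auto simp: Basis_vec_def)
  interpret product_sigma_finite "\<lambda>_ :: real^'m. lborel :: real measure" by standard
  have coord: "(\<Sum>b\<in>Basis. y b *\<^sub>R b) $ k = y (?ax k)" for y and k :: 'm
    unfolding B by (subst sum.reindex[OF inj]) (simp add: axis_def if_distrib cong: if_cong)
  have "(LINT x|lborel. (\<Prod>k\<in>UNIV. f k (x $ k))) =
      (LINT y|(\<Pi>\<^sub>M b\<in>(Basis :: (real^'m) set). lborel). (\<Prod>k\<in>UNIV. f k ((\<Sum>b\<in>Basis. y b *\<^sub>R b) $ k)))"
    by (subst lborel_eq, subst integral_distr) auto
  also have "(\<lambda>y :: real^'m \<Rightarrow> real. \<Prod>k\<in>UNIV. f k ((\<Sum>b\<in>Basis. y b *\<^sub>R b) $ k)) =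
      (\<lambda>y. \<Prod>b\<in>Basis. f (idx b) (y b))"
    unfolding coord unfolding B by (subst prod.reindex[OF inj]) (simp add: idx o_def)
  also have "(LINT y|(\<Pi>\<^sub>M b\<in>(Basis :: (real^'m) set). lborel). (\<Prod>b\<in>Basis. f (idx b) (y b))) =
      (\<Prod>b\<in>Basis. (LINT x|lborel. f (idx b) x))"
    by (rule product_integral_prod) (auto intro: f)
  also have "\<dots> = (\<Prod>k\<in>UNIV. (LINT x|lborel. f k x))"
    unfolding B by (subst prod.reindex[OF inj]) (simp add: idx o_def)
  finally show ?thesis .
qed

text \<open>Substituting \<sigma> x for x reduces this to the known transform of the standard normal
  law.\<close>

lemma normal_density_char:
  assumes "\<sigma> > 0"
  shows "integrable lborel (\<lambda>x. complex_of_real (normal_density 0 \<sigma> x) * iexp (u * x))"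
    and "(LINT x|lborel. complex_of_real (normal_density 0 \<sigma> x) * iexp (u * x)) =
      complex_of_real (exp (- (\<sigma> * u)\<^sup>2 / 2))"
proof -
  show "integrable lborel (\<lambda>x. complex_of_real (normal_density 0 \<sigma> x) * iexp (u * x))"
    by (rule Bochner_Integration.integrable_bound[OF integrable_normal_density[of \<sigma> 0, OF assms]])
      (auto simp: norm_mult)
  have "(LINT x|lborel. complex_of_real (normal_density 0 \<sigma> x) * iexp (u * x)) =
    (LINT x|lborel. \<sigma> *\<^sub>R (complex_of_real (normal_density 0 \<sigma> (\<sigma> * x)) * iexp (u * (\<sigma> * x))))"
    using lborel_integral_real_affine[of \<sigma> "\<lambda>x. complex_of_real (normal_density 0 \<sigma> x) * iexp (u * x)" 0] assms
    by (simp del: of_real_mult)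
  also have "\<dots> = (LINT x|lborel. std_normal_density x *\<^sub>R iexp (u * \<sigma> * x))"
  proof (intro Bochner_Integration.integral_cong refl)
    fix x
    have "\<sigma> * normal_density 0 \<sigma> (\<sigma> * x) = std_normal_density x"
      using assms by (simp add: normal_density_def real_sqrt_mult power_mult_distrib)
    then show "\<sigma> *\<^sub>R (complex_of_real (normal_density 0 \<sigma> (\<sigma> * x)) * iexp (u * (\<sigma> * x))) =
        std_normal_density x *\<^sub>R iexp (u * \<sigma> * x)"
      by (simp add: scaleR_conv_of_real mult.assoc[symmetric] flip: of_real_mult)
  qed
  also have "\<dots> = (LINT x|std_normal_distribution. iexp (u * \<sigma> * x))"
    by (subst integral_density) auto
  also have "\<dots> = char std_normal_distribution (u * \<sigma>)" by (simp add: char_def)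
  finally show "(LINT x|lborel. complex_of_real (normal_density 0 \<sigma> x) * iexp (u * x)) =
      complex_of_real (exp (- (\<sigma> * u)\<^sup>2 / 2))"
    by (simp add: char_std_normal_distribution mult.commute)
qed

subsection \<open>Brownian increments\<close>

lemma measurable_vec_nth[measurable (raw)]:
  fixes f :: "'b \<Rightarrow> real ^ 'n::finite"
  shows "f \<in> borel_measurable N \<Longrightarrow> (\<lambda>x. f x $ k) \<in> borel_measurable N"
  unfolding cart_eq_inner_axis[of _ k] by (intro borel_measurable_inner borel_measurable_const)

lemma norm_axis_real: "norm (axis k (u :: real)) = \<bar>u\<bar>"
  by (simp add: norm_eq_sqrt_inner inner_axis_axis)

locale brownian = prob_space M for M :: "'a measure" +
  fixes \<F> :: "real \<Rightarrow> 'a measure" and T :: real and W :: "real \<Rightarrow> 'a \<Rightarrow> real ^ 'm::finite"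
  assumes T_pos: "T > 0" and filt: "filtered_prob_space M \<F>" and bm: "brownian_motion M \<F> T W"
begin

lemma space_F[simp]: "space (\<F> t) = space M"
  using filt by (auto simp: filtered_prob_space_def filtration_def)

lemma sets_F_mono: "s \<le> t \<Longrightarrow> sets (\<F> s) \<subseteq> sets (\<F> t)"
  using filt by (auto simp: filtered_prob_space_def filtration_def)

lemma subalgebra_F: "subalgebra M (\<F> t)"
  using filt by (auto simp: filtered_prob_space_def subalgebra_def)

lemma measurable_F_M: "f \<in> measurable (\<F> t) N \<Longrightarrow> f \<in> measurable M N"
  by (rule measurable_from_subalg[OF subalgebra_F])

lemma measurable_F_mono: "f \<in> measurable (\<F> s) N \<Longrightarrow> s \<le> t \<Longrightarrow> f \<in> measurable (\<F> t) N"
  by (rule measurable_from_subalg[of "\<F> t" "\<F> s"]) (auto simp: subalgebra_def sets_F_mono)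

lemma W_measurable_F: "0 \<le> s \<Longrightarrow> s \<le> t \<Longrightarrow> t \<le> T \<Longrightarrow> W s \<in> borel_measurable (\<F> t)"
  by (rule measurable_F_mono[of _ s]) (use bm in \<open>auto simp: brownian_motion_def\<close>)

lemma W_measurable: "t \<in> {0..T} \<Longrightarrow> W t \<in> borel_measurable M"
  using W_measurable_F[of t t] by (auto intro: measurable_F_M)

lemma W_0: "AE \<omega> in M. W 0 \<omega> = 0"
  using bm by (simp add: brownian_motion_def)

text \<open>Independence is given for \<sigma>-algebras; those generated by \<open>Y\<close> and by
  a function of the increment are contained in them.\<close>

lemma incr_indep:
  assumes st: "0 \<le> s" "s < t" "t \<le> T" and Y: "Y \<in> borel_measurable (\<F> s)" and g: "g \<in> borel_measurable borel"
  shows "indep_var borel Y borel (\<lambda>\<omega>. g (W t \<omega> - W s \<omega>))"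
proof -
  have [measurable]: "W t \<in> borel_measurable M" "W s \<in> borel_measurable M" "g \<in> borel_measurable borel"
    using W_measurable st g by auto
  let ?V = "vimage_algebra (space M) (\<lambda>\<omega>. W t \<omega> - W s \<omega>) borel"
  have ind: "indep_set (sets (\<F> s)) (sets ?V)"
    using bm st by (auto simp: brownian_motion_def)
  have "indep_set (sigma_sets (space M) {Y -` A \<inter> space M |A. A \<in> sets borel})
     (sigma_sets (space M) {(\<lambda>\<omega>. g (W t \<omega> - W s \<omega>)) -` A \<inter> space M |A. A \<in> sets borel})"
    unfolding indep_set_def
  proof (rule indep_sets_mono_sets[OF ind[unfolded indep_set_def]])
    have 1: "sigma_sets (space M) {Y -` A \<inter> space M |A. A \<in> sets borel} \<subseteq> sets (\<F> s)"
      using sets.sigma_sets_subset[of "{Y -` A \<inter> space M |A. A \<in> sets borel}" "\<F> s"]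
        measurable_sets[OF Y] by auto
    have "(\<lambda>\<omega>. g (W t \<omega> - W s \<omega>)) \<in> borel_measurable ?V"
      by (rule measurable_compose[OF measurable_vimage_algebra1 g]) auto
    then have 2: "sigma_sets (space M) {(\<lambda>\<omega>. g (W t \<omega> - W s \<omega>)) -` A \<inter> space M |A. A \<in> sets borel} \<subseteq> sets ?V"
      using sets.sigma_sets_subset[of "{(\<lambda>\<omega>. g (W t \<omega> - W s \<omega>)) -` A \<inter> space M |A. A \<in> sets borel}" ?V]
        measurable_sets[of "\<lambda>\<omega>. g (W t \<omega> - W s \<omega>)" ?V borel] by auto
    show "case_bool (sigma_sets (space M) {Y -` A \<inter> space M |A. A \<in> sets borel})
        (sigma_sets (space M) {(\<lambda>\<omega>. g (W t \<omega> - W s \<omega>)) -` A \<inter> space M |A. A \<in> sets borel}) i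
        \<subseteq> case_bool (sets (\<F> s)) (sets ?V) i" for i
      using 1 2 by (cases i) auto
  qed
  then show ?thesis
    using measurable_F_M[OF Y] by (simp add: indep_var_eq)
qed

lemma incr_expectation:
  fixes Y :: "'a \<Rightarrow> 'b::{real_normed_field, banach, second_countable_topology}"
  assumes st: "0 \<le> s" "s \<le> t" "t \<le> T" and Y: "Y \<in> borel_measurable (\<F> s)" "integrable M Y"
    and g: "g \<in> borel_measurable borel" "integrable M (\<lambda>\<omega>. g (W t \<omega> - W s \<omega>))"
  shows "integrable M (\<lambda>\<omega>. Y \<omega> * g (W t \<omega> - W s \<omega>))"
    and "(LINT \<omega>|M. Y \<omega> * g (W t \<omega> - W s \<omega>)) = (LINT \<omega>|M. Y \<omega>) * (LINT \<omega>|M. g (W t \<omega> - W s \<omega>))"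
proof -
  have "integrable M (\<lambda>\<omega>. Y \<omega> * g (W t \<omega> - W s \<omega>)) \<and>
    (LINT \<omega>|M. Y \<omega> * g (W t \<omega> - W s \<omega>)) = (LINT \<omega>|M. Y \<omega>) * (LINT \<omega>|M. g (W t \<omega> - W s \<omega>))"
  proof (cases "s = t")
    case True
    then show ?thesis using Y by (simp add: prob_space)
  next
    case False
    with st have "s < t" by simp
    note ind = incr_indep[OF st(1) this st(3) Y(1) g(1)]
    show ?thesis
      using indep_var_integrable[OF ind Y(2) g(2)] indep_var_lebesgue_integral[OF ind Y(2) g(2)] by simp
  qed
  then show "integrable M (\<lambda>\<omega>. Y \<omega> * g (W t \<omega> - W s \<omega>))"
    "(LINT \<omega>|M. Y \<omega> * g (W t \<omega> - W s \<omega>)) = (LINT \<omega>|M. Y \<omega>) * (LINT \<omega>|M. g (W t \<omega> - W s \<omega>))" by auto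
qed

text \<open>Both the density and \<open>iexp (v \<bullet> x)\<close> are products over coordinates,
  so the transform splits into one-dimensional ones.\<close>

lemma incr_char:
  assumes st: "0 \<le> s" "s \<le> t" "t \<le> T"
  shows "(LINT \<omega>|M. iexp (v \<bullet> (W t \<omega> - W s \<omega>))) = complex_of_real (exp (- ((norm v)\<^sup>2 * (t - s) / 2)))"
proof (cases "s = t")
  case False
  with st have "s < t" by simp
  define \<sigma> where "\<sigma> = sqrt (t - s)"
  have \<sigma>: "\<sigma> > 0" "\<sigma>\<^sup>2 = t - s" using \<open>s < t\<close> by (auto simp: \<sigma>_def)
  have d: "distributed M lborel (\<lambda>\<omega>. W t \<omega> - W s \<omega>) (\<lambda>x. ennreal (\<Prod>k\<in>UNIV. normal_density 0 \<sigma> (x $ k)))"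
    using bm st \<open>s < t\<close> by (auto simp: brownian_motion_def \<sigma>_def)
  have [measurable]: "W t \<in> borel_measurable M" "W s \<in> borel_measurable M" using W_measurable st by auto
  have "(LINT \<omega>|M. iexp (v \<bullet> (W t \<omega> - W s \<omega>))) = (LINT x|distr M lborel (\<lambda>\<omega>. W t \<omega> - W s \<omega>). iexp (v \<bullet> x))"
    by (subst integral_distr) auto
  also have "\<dots> = (LINT x|density lborel (\<lambda>x. ennreal (\<Prod>k\<in>UNIV. normal_density 0 \<sigma> (x $ k))). iexp (v \<bullet> x))"
    by (simp only: distributed_distr_eq_density[OF d])
  also have "\<dots> = (LINT x|lborel. (\<Prod>k\<in>UNIV. normal_density 0 \<sigma> (x $ k)) *\<^sub>R iexp (v \<bullet> x))"
    by (subst integral_density) (auto intro!: prod_nonneg)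
  also have "\<dots> = (LINT x|lborel. (\<Prod>k\<in>UNIV. complex_of_real (normal_density 0 \<sigma> (x $ k)) * iexp (v $ k * x $ k)))"
    by (intro Bochner_Integration.integral_cong refl)
      (simp add: inner_vec_def scaleR_conv_of_real prod.distrib exp_sum[symmetric] sum_distrib_left)
  also have "\<dots> = (\<Prod>k\<in>UNIV. complex_of_real (exp (- (\<sigma> * v $ k)\<^sup>2 / 2)))"
    by (subst integral_lborel_vec_prod) (simp_all only: normal_density_char[OF \<sigma>(1)])
  also have "\<dots> = complex_of_real (exp (\<Sum>k\<in>UNIV. - (\<sigma> * v $ k)\<^sup>2 / 2))"
    by (simp only: of_real_prod[symmetric] exp_sum finite_class.finite_UNIV)
  also have "(\<Sum>k\<in>UNIV. - (\<sigma> * v $ k)\<^sup>2 / 2) = - ((norm v)\<^sup>2 * (t - s) / 2)"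
    by (simp add: power_mult_distrib \<sigma> norm_vec_def L2_set_def sum_nonneg sum_distrib_left[symmetric]
        sum_negf sum_divide_distrib[symmetric] mult.commute)
  finally show ?thesis .
qed (simp add: prob_space)

text \<open>Along \<open>axis k u\<close> the transform is that of a centred Gaussian with standard
  deviation \<open>sqrt (t - s)\<close>.\<close>

lemma incr_moments:
  fixes k :: 'm
  assumes st: "0 \<le> s" "s \<le> t" "t \<le> T"
  shows "integrable M (\<lambda>\<omega>. (W t \<omega> $ k - W s \<omega> $ k) ^ n)"
    and "(LINT \<omega>|M. W t \<omega> $ k - W s \<omega> $ k) = 0"
    and "(LINT \<omega>|M. (W t \<omega> $ k - W s \<omega> $ k)\<^sup>2) = t - s"
proof -
  have [measurable]: "W t \<in> borel_measurable M" "W s \<in> borel_measurable M" using W_measurable st by auto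
  have m: "(\<lambda>\<omega>. W t \<omega> $ k - W s \<omega> $ k) \<in> borel_measurable M" by simp
  have c: "(LINT \<omega>|M. iexp (u * (W t \<omega> $ k - W s \<omega> $ k))) = complex_of_real (exp (- (sqrt (t - s) * u)\<^sup>2 / 2))" for u
    using incr_char[OF st, of "axis k u"] st
    by (simp add: inner_axis' power_mult_distrib mult.commute norm_axis_real)
  note g = gaussian_moments_of_char[OF m _ c]
  show "integrable M (\<lambda>\<omega>. (W t \<omega> $ k - W s \<omega> $ k) ^ n)" "(LINT \<omega>|M. W t \<omega> $ k - W s \<omega> $ k) = 0"
    using g(1,3) st by auto
  show "(LINT \<omega>|M. (W t \<omega> $ k - W s \<omega> $ k)\<^sup>2) = t - s"
    using g(2)[of 1] st by (simp add: fact_numeral)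
qed

lemma incr_expectation1:
  fixes k :: 'm and Y :: "'a \<Rightarrow> real"
  assumes st: "0 \<le> s" "s \<le> t" "t \<le> T" and Y: "Y \<in> borel_measurable (\<F> s)" "integrable M Y"
  shows "integrable M (\<lambda>\<omega>. Y \<omega> * (W t \<omega> $ k - W s \<omega> $ k))"
    and "(LINT \<omega>|M. Y \<omega> * (W t \<omega> $ k - W s \<omega> $ k)) = 0"
  using incr_expectation[OF st Y, of "\<lambda>x. x $ k"] incr_moments[OF st, of k] incr_moments(1)[OF st, of k 1]
  by auto

lemma incr_expectation2:
  fixes k :: 'm and Y :: "'a \<Rightarrow> real"
  assumes st: "0 \<le> s" "s \<le> t" "t \<le> T" and Y: "Y \<in> borel_measurable (\<F> s)" "integrable M Y"
  shows "integrable M (\<lambda>\<omega>. Y \<omega> * (W t \<omega> $ k - W s \<omega> $ k)\<^sup>2)"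
    and "(LINT \<omega>|M. Y \<omega> * (W t \<omega> $ k - W s \<omega> $ k)\<^sup>2) = (LINT \<omega>|M. Y \<omega>) * (t - s)"
  using incr_expectation[OF st Y, of "\<lambda>x. (x $ k)\<^sup>2"] incr_moments[OF st, of k] incr_moments(1)[OF st, of k 2]
  by auto

text \<open>The coefficients allowed in simple processes. Boundedness keeps their products with
  \<open>L2\<close> variables in \<open>L2\<close>.\<close>

definition adapted_bounded :: "real \<Rightarrow> ('a \<Rightarrow> real) \<Rightarrow> bool" where
  "adapted_bounded a H \<longleftrightarrow> H \<in> borel_measurable (\<F> a) \<and> (\<exists>C. \<forall>\<omega>\<in>space M. \<bar>H \<omega>\<bar> \<le> C)"

lemma adapted_bounded_mono: "adapted_bounded a H \<Longrightarrow> a \<le> b \<Longrightarrow> adapted_bounded b H"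
  by (auto simp: adapted_bounded_def intro: measurable_F_mono)

lemma adapted_bounded_mult:
  assumes "adapted_bounded a H" "adapted_bounded a H'" shows "adapted_bounded a (\<lambda>\<omega>. H \<omega> * H' \<omega>)"
proof -
  obtain C C' where "\<forall>\<omega>\<in>space M. \<bar>H \<omega>\<bar> \<le> C" "\<forall>\<omega>\<in>space M. \<bar>H' \<omega>\<bar> \<le> C'"
    using assms by (auto simp: adapted_bounded_def)
  then have "\<bar>H \<omega> * H' \<omega>\<bar> \<le> C * C'" if "\<omega> \<in> space M" for \<omega>
    unfolding abs_mult using that order_trans[OF abs_ge_zero, of "H \<omega>" C] by (intro mult_mono) auto
  then show ?thesis using assms by (auto simp: adapted_bounded_def)
qed

lemma adapted_bounded_measurable: "adapted_bounded a H \<Longrightarrow> H \<in> borel_measurable M"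
  by (auto simp: adapted_bounded_def intro: measurable_F_M)

lemma adapted_bounded_L2: "adapted_bounded a H \<Longrightarrow> L2 M H"
  by (rule L2_bounded[OF adapted_bounded_measurable, of _ _ "SOME C. \<forall>\<omega>\<in>space M. \<bar>H \<omega>\<bar> \<le> C"])
    (auto simp: adapted_bounded_def intro!: AE_I2 dest!: someI_ex)

lemma adapted_bounded_integrable: "adapted_bounded a H \<Longrightarrow> integrable M H"
  by (intro L2_integrable adapted_bounded_L2)

lemma L2_adapted_bounded_mult:
  assumes H: "adapted_bounded a H" and f: "L2 M f"
  shows "L2 M (\<lambda>\<omega>. H \<omega> * f \<omega>)"
proof -
  obtain C where C: "\<forall>\<omega>\<in>space M. \<bar>H \<omega>\<bar> \<le> C" using H by (auto simp: adapted_bounded_def)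
  have [measurable]: "H \<in> borel_measurable M" "f \<in> borel_measurable M"
    using adapted_bounded_measurable[OF H] f by auto
  show ?thesis
  proof (rule L2_bound[OF L2_cmult[OF f, of C]])
    show "AE \<omega> in M. \<bar>H \<omega> * f \<omega>\<bar> \<le> \<bar>C * f \<omega>\<bar>"
      unfolding abs_mult using C by (intro AE_I2 mult_right_mono) force+
  qed simp
qed

lemma incr_L2:
  fixes k :: 'm
  assumes st: "0 \<le> s" "s \<le> t" "t \<le> T"
  shows "L2 M (\<lambda>\<omega>. W t \<omega> $ k - W s \<omega> $ k)"
  using incr_moments(1)[OF st, of k 2] W_measurable[of t] W_measurable[of s] st
  by (intro L2_I) auto

lemma simple_proc_on_iff:
  "simple_proc_on \<F> t \<Phi> \<longleftrightarrow> (\<forall>(a, b, H)\<in>set \<Phi>. 0 \<le> a \<and> a \<le> b \<and> b \<le> t \<and> adapted_bounded a H)"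
  by (auto simp: simple_proc_on_def adapted_bounded_def bounded_iff)

end

subsection \<open>The Ito isometry\<close>

lemma square_integral_const:
  fixes a b t :: real
  assumes "0 \<le> a" "a \<le> b" "b \<le> t"
  shows "integrable (lebesgue_on {0..t}) (indicator {a<..b} :: real \<Rightarrow> real)"
    and "(LINT s|lebesgue_on {0..t}. indicator {a<..b} s) = b - a"
proof -
  interpret finite_measure "lebesgue_on {0..t}"
    by (rule finite_measure_lebesgue_on) auto
  have m: "{a<..b} \<in> sets (lebesgue_on {0..t})"
    using assms by (auto simp: sets_restrict_space image_iff intro!: bexI[of _ "{a<..b}"])
  then show "integrable (lebesgue_on {0..t}) (indicator {a<..b} :: real \<Rightarrow> real)"
    by (intro integrable_real_indicator) (auto simp: emeasure_eq_measure)
  have "(LINT s|lebesgue_on {0..t}. indicator {a<..b} s) = measure (lebesgue_on {0..t}) {a<..b}"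
    using sets.sets_into_space[OF m] by (simp add: Int_absorb2)
  also have "\<dots> = measure lebesgue {a<..b}"
    by (rule measure_restrict_space) (use assms in auto)
  also have "\<dots> = b - a" using assms by simp
  finally show "(LINT s|lebesgue_on {0..t}. indicator {a<..b} s) = b - a" .
qed

context brownian
begin

abbreviation "Leb t \<equiv> lebesgue_on {0..t::real}"
abbreviation "PM t \<equiv> Leb t \<Otimes>\<^sub>M M"

lemma finite_measure_Leb: "finite_measure (Leb t)"
  by (rule finite_measure_lebesgue_on) auto

lemma pair_sigma_finite_PM: "pair_sigma_finite (Leb t) M"
proof -
  interpret L: finite_measure "Leb t" by (rule finite_measure_Leb)
  show ?thesis by standard
qed

lemma PM_integral_product:
  assumes f: "integrable (Leb t) f" and g: "integrable M g"
  shows "integrable (PM t) (\<lambda>(s, \<omega>). f s * g \<omega> :: real)"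
    and "(LINT (s, \<omega>)|PM t. f s * g \<omega>) = (LINT s|Leb t. f s) * (LINT \<omega>|M. g \<omega>)"
proof -
  interpret P: pair_sigma_finite "Leb t" M by (rule pair_sigma_finite_PM)
  have [measurable]: "f \<in> borel_measurable (Leb t)" "g \<in> borel_measurable M" using f g by auto
  show i: "integrable (PM t) (\<lambda>(s, \<omega>). f s * g \<omega> :: real)"
  proof (rule P.Fubini_integrable)
    show "integrable (Leb t) (\<lambda>x. LINT y|M. norm (case (x, y) of (s, \<omega>) \<Rightarrow> f s * g \<omega>))"
      using f by (simp add: abs_mult)
    show "AE x in Leb t. integrable M (\<lambda>y. case (x, y) of (s, \<omega>) \<Rightarrow> f s * g \<omega>)"
      using g by simp
  qed measurable
  show "(LINT (s, \<omega>)|PM t. f s * g \<omega>) = (LINT s|Leb t. f s) * (LINT \<omega>|M. g \<omega>)"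
    using P.integral_fst'[OF i] by simp
qed

text \<open>Both increments are cut at \<open>c\<close> and at \<open>min b d\<close>. Pieces over
  disjoint intervals are orthogonal by independence; only the common interval contributes, with its
  length. The other order of \<open>a\<close> and \<open>c\<close> is left to symmetry.\<close>

lemma simple_covariance:
  fixes k :: 'm
  assumes ab: "0 \<le> a" "a \<le> b" "b \<le> T" and cd: "a \<le> c" "c \<le> d" "d \<le> T"
    and H: "adapted_bounded a H" "adapted_bounded c H'"
  shows "(LINT \<omega>|M. (H \<omega> * (W b \<omega> $ k - W a \<omega> $ k)) * (H' \<omega> * (W d \<omega> $ k - W c \<omega> $ k))) =
    (LINT \<omega>|M. H \<omega> * H' \<omega>) * max 0 (min b d - c)"
proof -
  define \<Delta> where "\<Delta> = (\<lambda>x y \<omega>. W y \<omega> $ k - W x \<omega> $ k)"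
  have \<Delta>_F: "\<Delta> x y \<in> borel_measurable (\<F> z)" if "0 \<le> x" "x \<le> y" "y \<le> z" "z \<le> T" for x y z
    unfolding \<Delta>_def using W_measurable_F[of x z] W_measurable_F[of y z] that by auto
  have \<Delta>_2: "L2 M (\<Delta> x y)" if "0 \<le> x" "x \<le> y" "y \<le> T" for x y
    unfolding \<Delta>_def by (rule incr_L2[OF that])
  \<comment> \<open>Everything except the later increment is measurable at time \<open>y\<close>,
    and that increment has mean 0.\<close>
  have orth: "(LINT \<omega>|M. (Y \<omega> * \<Delta> x y \<omega>) * (Z \<omega> * \<Delta> y z \<omega>)) = 0"
    "integrable M (\<lambda>\<omega>. (Y \<omega> * \<Delta> x y \<omega>) * (Z \<omega> * \<Delta> y z \<omega>))"
    if "0 \<le> x" "x \<le> y" "y \<le> z" "z \<le> T" "adapted_bounded y Y" "adapted_bounded y Z" for x y z Y Z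
  proof -
    have 1: "adapted_bounded y (\<lambda>\<omega>. Y \<omega> * Z \<omega>)" using that by (intro adapted_bounded_mult)
    have m: "(\<lambda>\<omega>. (Y \<omega> * Z \<omega>) * \<Delta> x y \<omega>) \<in> borel_measurable (\<F> y)"
      using 1 \<Delta>_F[of x y y] that by (auto simp: adapted_bounded_def)
    have i: "integrable M (\<lambda>\<omega>. (Y \<omega> * Z \<omega>) * \<Delta> x y \<omega>)"
      using that by (intro L2_integrable L2_adapted_bounded_mult[OF 1] \<Delta>_2) auto
    have "(\<lambda>\<omega>. (Y \<omega> * \<Delta> x y \<omega>) * (Z \<omega> * \<Delta> y z \<omega>)) = (\<lambda>\<omega>. ((Y \<omega> * Z \<omega>) * \<Delta> x y \<omega>) * (W z \<omega> $ k - W y \<omega> $ k))"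
      by (simp add: \<Delta>_def algebra_simps)
    then show "(LINT \<omega>|M. (Y \<omega> * \<Delta> x y \<omega>) * (Z \<omega> * \<Delta> y z \<omega>)) = 0"
      "integrable M (\<lambda>\<omega>. (Y \<omega> * \<Delta> x y \<omega>) * (Z \<omega> * \<Delta> y z \<omega>))"
      using incr_expectation1[OF _ _ _ m i, where t = z and k = k] that by simp_all
  qed
  have sq: "(LINT \<omega>|M. (Y \<omega> * \<Delta> x y \<omega>) * (Z \<omega> * \<Delta> x y \<omega>)) = (LINT \<omega>|M. Y \<omega> * Z \<omega>) * (y - x)"
    "integrable M (\<lambda>\<omega>. (Y \<omega> * \<Delta> x y \<omega>) * (Z \<omega> * \<Delta> x y \<omega>))"
    if "0 \<le> x" "x \<le> y" "y \<le> T" "adapted_bounded x Y" "adapted_bounded x Z" for x y Y Z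
  proof -
    have 1: "adapted_bounded x (\<lambda>\<omega>. Y \<omega> * Z \<omega>)" using that by (intro adapted_bounded_mult)
    have 2: "(\<lambda>\<omega>. (Y \<omega> * \<Delta> x y \<omega>) * (Z \<omega> * \<Delta> x y \<omega>)) = (\<lambda>\<omega>. (Y \<omega> * Z \<omega>) * (W y \<omega> $ k - W x \<omega> $ k)\<^sup>2)"
      by (simp add: \<Delta>_def algebra_simps power2_eq_square)
    have 3: "(\<lambda>\<omega>. Y \<omega> * Z \<omega>) \<in> borel_measurable (\<F> x)" "integrable M (\<lambda>\<omega>. Y \<omega> * Z \<omega>)"
      using 1 adapted_bounded_integrable[OF 1] by (auto simp: adapted_bounded_def)
    show "(LINT \<omega>|M. (Y \<omega> * \<Delta> x y \<omega>) * (Z \<omega> * \<Delta> x y \<omega>)) = (LINT \<omega>|M. Y \<omega> * Z \<omega>) * (y - x)"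
      "integrable M (\<lambda>\<omega>. (Y \<omega> * \<Delta> x y \<omega>) * (Z \<omega> * \<Delta> x y \<omega>))"
      unfolding 2 using incr_expectation2[OF _ _ _ 3, where t = y and k = k] that by simp_all
  qed
  have Hc: "adapted_bounded c H" using H(1) cd(1) by (rule adapted_bounded_mono)
  show ?thesis
  proof (cases "b \<le> c")
    case True
    have Hb: "adapted_bounded b H" using H(1) ab(2) by (rule adapted_bounded_mono)
    have m: "(\<lambda>\<omega>. (H \<omega> * H' \<omega>) * \<Delta> a b \<omega>) \<in> borel_measurable (\<F> c)"
      using adapted_bounded_mult[OF Hc H(2)] \<Delta>_F[of a b c] ab cd True by (auto simp: adapted_bounded_def)
    have i: "integrable M (\<lambda>\<omega>. (H \<omega> * H' \<omega>) * \<Delta> a b \<omega>)"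
      using ab by (intro L2_integrable L2_adapted_bounded_mult[OF adapted_bounded_mult[OF Hc H(2)]] \<Delta>_2) auto
    have "(\<lambda>\<omega>. (H \<omega> * (W b \<omega> $ k - W a \<omega> $ k)) * (H' \<omega> * (W d \<omega> $ k - W c \<omega> $ k))) =
        (\<lambda>\<omega>. ((H \<omega> * H' \<omega>) * \<Delta> a b \<omega>) * (W d \<omega> $ k - W c \<omega> $ k))"
      by (simp add: \<Delta>_def algebra_simps)
    then show ?thesis
      using incr_expectation1[OF _ _ _ m i, where t = d and k = k] ab cd True by simp
  next
    case False
    then have bc: "c < b" by simp
    define e where "e = min b d"
    have e: "c \<le> e" "e \<le> b" "e \<le> d" "e = b \<or> e = d" using bc cd by (auto simp: e_def)
    have He: "adapted_bounded e H" "adapted_bounded e H'"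
      using adapted_bounded_mono[OF Hc e(1)] adapted_bounded_mono[OF H(2) e(1)] by auto
    \<comment> \<open>The product of the two increments beyond \<open>e\<close> is missing because
      \<open>e\<close> is \<open>b\<close> or \<open>d\<close>, so one of them vanishes.\<close>
    have eq: "(\<lambda>\<omega>. (H \<omega> * (W b \<omega> $ k - W a \<omega> $ k)) * (H' \<omega> * (W d \<omega> $ k - W c \<omega> $ k))) =
        (\<lambda>\<omega>. (H \<omega> * \<Delta> a c \<omega>) * (H' \<omega> * \<Delta> c d \<omega>) + (H \<omega> * \<Delta> c e \<omega>) * (H' \<omega> * \<Delta> c e \<omega>)
           + (H \<omega> * \<Delta> c e \<omega>) * (H' \<omega> * \<Delta> e d \<omega>) + (H' \<omega> * \<Delta> c e \<omega>) * (H \<omega> * \<Delta> e b \<omega>))"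
      using e(4) by (auto simp: \<Delta>_def algebra_simps)
    have "(LINT \<omega>|M. (H \<omega> * (W b \<omega> $ k - W a \<omega> $ k)) * (H' \<omega> * (W d \<omega> $ k - W c \<omega> $ k))) =
        (LINT \<omega>|M. H \<omega> * H' \<omega>) * (e - c)"
      unfolding eq
      using orth[of a c d H H'] sq[of c e H H'] orth[of c e d H H'] orth[of c e b H' H] ab cd e H Hc He
      by simp
    then show ?thesis using e(1) by (simp add: e_def)
  qed
qed

text \<open>The product of the two indicators is the indicator of the overlap, whose length is the
  factor in \<open>simple_covariance\<close>.\<close>

lemma simple_covariance_PM:
  fixes k :: 'm
  assumes ab: "0 \<le> a" "a \<le> b" "b \<le> t" and cd: "0 \<le> c" "c \<le> d" "d \<le> t" and "t \<le> T"
    and H: "adapted_bounded a H" "adapted_bounded c H'"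
  shows "(LINT \<omega>|M. (H \<omega> * (W b \<omega> $ k - W a \<omega> $ k)) * (H' \<omega> * (W d \<omega> $ k - W c \<omega> $ k))) =
    (LINT (s, \<omega>)|PM t. (H \<omega> * indicator {a<..b} s) * (H' \<omega> * indicator {c<..d} s))"
proof -
  have *: "(LINT (s, \<omega>)|PM t. (H \<omega> * indicator {a<..b} s) * (H' \<omega> * indicator {c<..d} s)) =
      (LINT \<omega>|M. H \<omega> * H' \<omega>) * max 0 (min b d - c)"
    if "0 \<le> a" "a \<le> b" "b \<le> t" "a \<le> c" "c \<le> d" "d \<le> t" "adapted_bounded a H" "adapted_bounded c H'"
    for a b c d H H'
  proof -
    have i: "integrable M (\<lambda>\<omega>. H \<omega> * H' \<omega>)"
      using that by (intro L2_mult adapted_bounded_L2)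
    define e where "e = max c (min b d)"
    have ind: "indicator {a<..b} s * indicator {c<..d} s = (indicator {c<..e} s :: real)" for s
      using that by (auto simp: indicator_def e_def)
    have "(LINT (s, \<omega>)|PM t. (H \<omega> * indicator {a<..b} s) * (H' \<omega> * indicator {c<..d} s)) =
        (LINT (s, \<omega>)|PM t. indicator {c<..e} s * (H \<omega> * H' \<omega>))"
      by (intro Bochner_Integration.integral_cong refl) (simp add: ind[symmetric] split: prod.splits)
    also have "\<dots> = (e - c) * (LINT \<omega>|M. H \<omega> * H' \<omega>)"
      using PM_integral_product(2)[OF square_integral_const(1)[of c e t] i]
        square_integral_const(2)[of c e t] that by (auto simp: e_def)
    also have "e - c = max 0 (min b d - c)" by (simp add: e_def)
    finally show ?thesis by simp
  qed
  show ?thesis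
  proof (cases "a \<le> c")
    case True
    then show ?thesis using *[of a b c d H H'] simple_covariance[of a b c d H H' k] assms by simp
  next
    case False
    then show ?thesis using *[of c d a b H' H] simple_covariance[of c d a b H' H k] assms
      by (simp add: mult.commute)
  qed
qed

lemma PM_L2_product:
  assumes H: "adapted_bounded a H" and ab: "0 \<le> a" "a \<le> b" "b \<le> t"
  shows "L2 (PM t) (\<lambda>(s, \<omega>). H \<omega> * indicator {a<..b} s)"
proof (rule L2_I)
  have [measurable]: "H \<in> borel_measurable M" "(indicator {a<..b} :: real \<Rightarrow> real) \<in> borel_measurable (Leb t)"
    using adapted_bounded_measurable[OF H] square_integral_const(1)[OF ab] by auto
  show "(\<lambda>(s, \<omega>). H \<omega> * indicator {a<..b} s :: real) \<in> borel_measurable (PM t)" by measurable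
  have "(\<lambda>x. (case x of (s, \<omega>) \<Rightarrow> H \<omega> * indicator {a<..b} s)\<^sup>2) =
      (\<lambda>(s, \<omega>). indicator {a<..b} s * (H \<omega>)\<^sup>2)"
    by (auto simp: indicator_def fun_eq_iff)
  then show "integrable (PM t) (\<lambda>x. (case x of (s, \<omega>) \<Rightarrow> H \<omega> * indicator {a<..b} s)\<^sup>2)"
    using PM_integral_product(1)[OF square_integral_const(1)[OF ab] L2_integrable_sq[OF adapted_bounded_L2[OF H]]]
    by simp
qed

lemma simple_proc_Cons:
  "simple_proc_val ((a, b, H) # \<Phi>) s \<omega> = H \<omega> * indicator {a<..b} s + simple_proc_val \<Phi> s \<omega>"
  "simple_proc_integral w ((a, b, H) # \<Phi>) \<omega> = H \<omega> * (w b \<omega> - w a \<omega>) + simple_proc_integral w \<Phi> \<omega>"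
  "simple_proc_val [] s \<omega> = 0" "simple_proc_integral w [] \<omega> = 0"
  by (simp_all add: simple_proc_val_def simple_proc_integral_def)

lemma simple_proc_L2:
  assumes "simple_proc_on \<F> t \<Phi>" "t \<le> T"
  shows "L2 (PM t) (\<lambda>(s, \<omega>). simple_proc_val \<Phi> s \<omega>)"
    and "L2 M (simple_proc_integral (\<lambda>s \<omega>. W s \<omega> $ k) \<Phi>)"
proof -
  have "L2 (PM t) (\<lambda>(s, \<omega>). simple_proc_val \<Phi> s \<omega>) \<and>
      L2 M (\<lambda>\<omega>. simple_proc_integral (\<lambda>s \<omega>. W s \<omega> $ k) \<Phi> \<omega>)"
    using assms
  proof (induction \<Phi>)
    case (Cons x \<Phi>)
    obtain a b H where x: "x = (a, b, H)" by (cases x)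
    have *: "0 \<le> a" "a \<le> b" "b \<le> t" "adapted_bounded a H" "simple_proc_on \<F> t \<Phi>"
      using Cons.prems by (auto simp: simple_proc_on_iff x)
    then have "L2 M (\<lambda>\<omega>. H \<omega> * (W b \<omega> $ k - W a \<omega> $ k))"
      using Cons.prems by (intro L2_adapted_bounded_mult[OF *(4)] incr_L2) auto
    then show ?case
      using L2_add[OF PM_L2_product[OF *(4,1,2,3)], of "\<lambda>(s, \<omega>). simple_proc_val \<Phi> s \<omega>"]
        L2_add[of M "\<lambda>\<omega>. H \<omega> * (W b \<omega> $ k - W a \<omega> $ k)"] Cons.IH * Cons.prems(2)
      by (simp add: x simple_proc_Cons case_prod_unfold)
  next
    case Nil
    have "simple_proc_integral (\<lambda>s \<omega>. W s \<omega> $ k) [] = (\<lambda>\<omega>. 0)" by (simp add: simple_proc_Cons fun_eq_iff)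
    then show ?case by (simp add: simple_proc_Cons L2_zero case_prod_unfold)
  qed
  then show "L2 (PM t) (\<lambda>(s, \<omega>). simple_proc_val \<Phi> s \<omega>)"
    "L2 M (simple_proc_integral (\<lambda>s \<omega>. W s \<omega> $ k) \<Phi>)" by auto
qed

text \<open>Both sides are bilinear, so induction over the two lists reduces the claim to single
  intervals. No common refinement is formed, as \<open>simple_covariance_PM\<close> allows the
  intervals to overlap.\<close>

lemma simple_proc_inner:
  fixes k :: 'm
  assumes \<Phi>: "simple_proc_on \<F> t \<Phi>" and \<Psi>: "simple_proc_on \<F> t \<Psi>" and t: "t \<le> T"
  defines "I \<equiv> simple_proc_integral (\<lambda>s \<omega>. W s \<omega> $ k)"
  shows "(LINT \<omega>|M. I \<Phi> \<omega> * I \<Psi> \<omega>) = (LINT (s, \<omega>)|PM t. simple_proc_val \<Phi> s \<omega> * simple_proc_val \<Psi> s \<omega>)"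
  using \<Phi>
proof (induction \<Phi>)
  case (Cons x \<Phi>)
  obtain a b H where x: "x = (a, b, H)" by (cases x)
  have *: "0 \<le> a" "a \<le> b" "b \<le> t" "adapted_bounded a H" "simple_proc_on \<F> t \<Phi>"
    using Cons.prems by (auto simp: simple_proc_on_iff x)
  have LM: "L2 M (\<lambda>\<omega>. H \<omega> * (W b \<omega> $ k - W a \<omega> $ k))"
    using t * by (intro L2_adapted_bounded_mult[OF *(4)] incr_L2) auto
  have LP: "L2 (PM t) (\<lambda>(s, \<omega>). H \<omega> * indicator {a<..b} s)" by (rule PM_L2_product[OF *(4,1,2,3)])
  have single: "(LINT \<omega>|M. (H \<omega> * (W b \<omega> $ k - W a \<omega> $ k)) * I \<Psi> \<omega>) =
    (LINT (s, \<omega>)|PM t. (H \<omega> * indicator {a<..b} s) * simple_proc_val \<Psi> s \<omega>)"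
    using \<Psi>
  proof (induction \<Psi>)
    case (Cons y \<Psi>)
    obtain c d H' where y: "y = (c, d, H')" by (cases y)
    have **: "0 \<le> c" "c \<le> d" "d \<le> t" "adapted_bounded c H'" "simple_proc_on \<F> t \<Psi>"
      using Cons.prems by (auto simp: simple_proc_on_iff y)
    have LM': "L2 M (\<lambda>\<omega>. H' \<omega> * (W d \<omega> $ k - W c \<omega> $ k))"
      using t ** by (intro L2_adapted_bounded_mult[OF **(4)] incr_L2) auto
    have LP': "L2 (PM t) (\<lambda>(s, \<omega>). H' \<omega> * indicator {c<..d} s)" by (rule PM_L2_product[OF **(4,1,2,3)])
    note S = simple_proc_L2(1)[OF **(5) t] simple_proc_L2(2)[OF **(5) t, where k = k, folded I_def]
    have "(LINT \<omega>|M. (H \<omega> * (W b \<omega> $ k - W a \<omega> $ k)) * I (y # \<Psi>) \<omega>) =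
        (LINT \<omega>|M. (H \<omega> * (W b \<omega> $ k - W a \<omega> $ k)) * (H' \<omega> * (W d \<omega> $ k - W c \<omega> $ k)) +
          (H \<omega> * (W b \<omega> $ k - W a \<omega> $ k)) * I \<Psi> \<omega>)"
      unfolding y I_def simple_proc_Cons by (simp only: distrib_left)
    also have "\<dots> = (LINT \<omega>|M. (H \<omega> * (W b \<omega> $ k - W a \<omega> $ k)) * (H' \<omega> * (W d \<omega> $ k - W c \<omega> $ k))) +
          (LINT \<omega>|M. (H \<omega> * (W b \<omega> $ k - W a \<omega> $ k)) * I \<Psi> \<omega>)"
      by (rule Bochner_Integration.integral_add[OF L2_mult[OF LM LM'] L2_mult[OF LM S(2)]])
    also have "\<dots> = (LINT (s, \<omega>)|PM t. (H \<omega> * indicator {a<..b} s) * (H' \<omega> * indicator {c<..d} s)) +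
        (LINT (s, \<omega>)|PM t. (H \<omega> * indicator {a<..b} s) * simple_proc_val \<Psi> s \<omega>)"
      using simple_covariance_PM[OF *(1-3) **(1-3) t *(4) **(4)] Cons.IH[OF **(5)] by simp
    also have "\<dots> = (LINT (s, \<omega>)|PM t. (H \<omega> * indicator {a<..b} s) * (H' \<omega> * indicator {c<..d} s) +
        (H \<omega> * indicator {a<..b} s) * simple_proc_val \<Psi> s \<omega>)"
      using Bochner_Integration.integral_add[OF L2_mult[OF LP LP'] L2_mult[OF LP S(1)]]
      by (simp add: case_prod_unfold)
    also have "\<dots> = (LINT (s, \<omega>)|PM t. (H \<omega> * indicator {a<..b} s) * simple_proc_val (y # \<Psi>) s \<omega>)"
      unfolding y simple_proc_Cons by (simp only: distrib_left)
    finally show ?case .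
  qed (simp add: I_def simple_proc_Cons case_prod_unfold)
  note S = simple_proc_L2(1)[OF *(5) t] simple_proc_L2(2)[OF *(5) t, where k = k, folded I_def]
  note S' = simple_proc_L2(1)[OF \<Psi> t] simple_proc_L2(2)[OF \<Psi> t, where k = k, folded I_def]
  have "(LINT \<omega>|M. I (x # \<Phi>) \<omega> * I \<Psi> \<omega>) =
      (LINT \<omega>|M. (H \<omega> * (W b \<omega> $ k - W a \<omega> $ k)) * I \<Psi> \<omega> + I \<Phi> \<omega> * I \<Psi> \<omega>)"
    unfolding x I_def simple_proc_Cons by (simp only: distrib_right)
  also have "\<dots> = (LINT \<omega>|M. (H \<omega> * (W b \<omega> $ k - W a \<omega> $ k)) * I \<Psi> \<omega>) + (LINT \<omega>|M. I \<Phi> \<omega> * I \<Psi> \<omega>)"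
    by (rule Bochner_Integration.integral_add[OF L2_mult[OF LM S'(2)] L2_mult[OF S(2) S'(2)]])
  also have "\<dots> = (LINT (s, \<omega>)|PM t. (H \<omega> * indicator {a<..b} s) * simple_proc_val \<Psi> s \<omega>) +
      (LINT (s, \<omega>)|PM t. simple_proc_val \<Phi> s \<omega> * simple_proc_val \<Psi> s \<omega>)"
    using single Cons.IH[OF *(5)] by simp
  also have "\<dots> = (LINT (s, \<omega>)|PM t. (H \<omega> * indicator {a<..b} s) * simple_proc_val \<Psi> s \<omega> +
      simple_proc_val \<Phi> s \<omega> * simple_proc_val \<Psi> s \<omega>)"
    using Bochner_Integration.integral_add[OF L2_mult[OF LP S'(1)] L2_mult[OF S(1) S'(1)]]
    by (simp add: case_prod_unfold)
  also have "\<dots> = (LINT (s, \<omega>)|PM t. simple_proc_val (x # \<Phi>) s \<omega> * simple_proc_val \<Psi> s \<omega>)"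
    unfolding x simple_proc_Cons by (simp only: distrib_right)
  finally show ?case .
qed (simp add: I_def simple_proc_Cons case_prod_unfold)

text \<open>Lists may contain overlapping intervals, so a difference is a mere concatenation. It
  lets the isometry act on differences.\<close>

definition simple_minus :: "'a simple_proc \<Rightarrow> 'a simple_proc \<Rightarrow> 'a simple_proc" where
  "simple_minus \<Phi> \<Psi> = \<Phi> @ map (\<lambda>(a, b, H). (a, b, \<lambda>\<omega>. - H \<omega>)) \<Psi>"

lemma simple_minus:
  "simple_proc_val (simple_minus \<Phi> \<Psi>) s \<omega> = simple_proc_val \<Phi> s \<omega> - simple_proc_val \<Psi> s \<omega>"
  "simple_proc_integral w (simple_minus \<Phi> \<Psi>) \<omega> = simple_proc_integral w \<Phi> \<omega> - simple_proc_integral w \<Psi> \<omega>"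
proof -
  have "(\<Sum>x\<leftarrow>\<Psi>. (case (case x of (a, b, H) \<Rightarrow> (a, b, \<lambda>\<omega>. - H \<omega>)) of (a, b, H) \<Rightarrow> H \<omega> * indicator {a<..b} s)) =
      - (\<Sum>(a, b, H)\<leftarrow>\<Psi>. H \<omega> * indicator {a<..b} s)"
    "(\<Sum>x\<leftarrow>\<Psi>. (case (case x of (a, b, H) \<Rightarrow> (a, b, \<lambda>\<omega>. - H \<omega>)) of (a, b, H) \<Rightarrow> H \<omega> * (w b \<omega> - w a \<omega>))) =
      - (\<Sum>(a, b, H)\<leftarrow>\<Psi>. H \<omega> * (w b \<omega> - w a \<omega>))"
    by (induction \<Psi>) auto
  then show "simple_proc_val (simple_minus \<Phi> \<Psi>) s \<omega> = simple_proc_val \<Phi> s \<omega> - simple_proc_val \<Psi> s \<omega>"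
    "simple_proc_integral w (simple_minus \<Phi> \<Psi>) \<omega> = simple_proc_integral w \<Phi> \<omega> - simple_proc_integral w \<Psi> \<omega>"
    by (simp_all add: simple_proc_val_def simple_proc_integral_def simple_minus_def o_def)
qed

lemma simple_minus_on:
  assumes "simple_proc_on \<F> t \<Phi>" "simple_proc_on \<F> t \<Psi>"
  shows "simple_proc_on \<F> t (simple_minus \<Phi> \<Psi>)"
proof -
  have "adapted_bounded a (\<lambda>\<omega>. - H \<omega>)" if "adapted_bounded a H" for a H
    using that by (auto simp: adapted_bounded_def)
  then show ?thesis
    using assms by (fastforce simp: simple_proc_on_iff simple_minus_def)
qed

lemma simple_proc_isometry:
  assumes "simple_proc_on \<F> t \<Phi>" "t \<le> T"
  shows "l2norm M (simple_proc_integral (\<lambda>s \<omega>. W s \<omega> $ k) \<Phi>) = l2norm (PM t) (\<lambda>(s, \<omega>). simple_proc_val \<Phi> s \<omega>)"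
  using simple_proc_inner[OF assms(1) assms(1) assms(2), of k]
  by (simp add: l2norm_def power2_eq_square case_prod_unfold)

text \<open>Progressive measurability at time \<open>t\<close> gives joint measurability with
  respect to \<open>\<F> t\<close>, hence to \<open>M\<close>; then the mean-square limits of the
  definition are limits in \<open>L2\<close>.\<close>

lemma is_ito_integral_L2:
  assumes I: "is_ito_integral M \<F> (\<lambda>s \<omega>. W s \<omega> $ k) t \<phi> I" and t: "0 \<le> t" "t \<le> T"
  obtains \<Phi> where "\<And>n. simple_proc_on \<F> t (\<Phi> n)"
    "(\<lambda>n. l2norm (PM t) (\<lambda>x. (case x of (s, \<omega>) \<Rightarrow> simple_proc_val (\<Phi> n) s \<omega>) - (case x of (s, \<omega>) \<Rightarrow> \<phi> s \<omega>))) \<longlonglongrightarrow> 0"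
    "(\<lambda>n. l2norm M (\<lambda>\<omega>. simple_proc_integral (\<lambda>s \<omega>. W s \<omega> $ k) (\<Phi> n) \<omega> - I \<omega>)) \<longlonglongrightarrow> 0"
    "L2 (PM t) (\<lambda>(s, \<omega>). \<phi> s \<omega>)" "L2 M I"
proof -
  obtain \<Phi> where \<Phi>: "\<And>n. simple_proc_on \<F> t (\<Phi> n)"
    and 1: "(\<lambda>n. \<integral>\<^sup>+(s, \<omega>). ennreal ((simple_proc_val (\<Phi> n) s \<omega> - \<phi> s \<omega>)\<^sup>2) \<partial>(PM t)) \<longlonglongrightarrow> 0"
    and 2: "(\<lambda>n. \<integral>\<^sup>+\<omega>. ennreal ((simple_proc_integral (\<lambda>s \<omega>. W s \<omega> $ k) (\<Phi> n) \<omega> - I \<omega>)\<^sup>2) \<partial>M) \<longlonglongrightarrow> 0"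
    and IM: "I \<in> borel_measurable M" and prog: "progressive_on \<F> t \<phi>"
    using I unfolding is_ito_integral_def by blast
  have "(\<lambda>(s, \<omega>). \<phi> s \<omega>) \<in> borel_measurable (Leb t \<Otimes>\<^sub>M \<F> t)"
    using prog t by (auto simp: progressive_on_def)
  moreover have "subalgebra (PM t) (Leb t \<Otimes>\<^sub>M \<F> t)"
    unfolding subalgebra_def
  proof
    show "space (Leb t \<Otimes>\<^sub>M \<F> t) = space (PM t)" by (simp add: space_pair_measure)
    show "sets (Leb t \<Otimes>\<^sub>M \<F> t) \<subseteq> sets (PM t)"
      unfolding sets_pair_measure space_F using subalgebra_F[of t]
      by (intro sigma_sets_mono') (auto simp: subalgebra_def)
  qed
  ultimately have pm: "(\<lambda>(s, \<omega>). \<phi> s \<omega>) \<in> borel_measurable (PM t)"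
    by (rule measurable_from_subalg[rotated])
  have lim1: "(\<lambda>n. \<integral>\<^sup>+x. ennreal (((case x of (s, \<omega>) \<Rightarrow> simple_proc_val (\<Phi> n) s \<omega>) - (case x of (s, \<omega>) \<Rightarrow> \<phi> s \<omega>))\<^sup>2) \<partial>(PM t)) \<longlonglongrightarrow> 0"
    using 1 by (simp add: case_prod_unfold)
  show thesis
    by (rule that[OF \<Phi> L2_limit_of_nn_integral(2)[OF simple_proc_L2(1)[OF \<Phi> t(2)] pm lim1]
      L2_limit_of_nn_integral(2)[OF simple_proc_L2(2)[OF \<Phi> t(2)] IM 2]
      L2_limit_of_nn_integral(1)[OF simple_proc_L2(1)[OF \<Phi> t(2)] pm lim1]
      L2_limit_of_nn_integral(1)[OF simple_proc_L2(2)[OF \<Phi> t(2)] IM 2]])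
qed

text \<open>The isometry of simple processes passes to the limit because norms converge along
  \<open>L2\<close> limits.\<close>

lemma ito_isometry:
  assumes I: "is_ito_integral M \<F> (\<lambda>s \<omega>. W s \<omega> $ k) t \<phi> I" and t: "0 \<le> t" "t \<le> T"
  shows "L2 M I" "L2 (PM t) (\<lambda>(s, \<omega>). \<phi> s \<omega>)" "l2norm M I = l2norm (PM t) (\<lambda>(s, \<omega>). \<phi> s \<omega>)"
proof -
  obtain \<Phi> where \<Phi>: "\<And>n. simple_proc_on \<F> t (\<Phi> n)"
    "(\<lambda>n. l2norm (PM t) (\<lambda>x. (case x of (s, \<omega>) \<Rightarrow> simple_proc_val (\<Phi> n) s \<omega>) - (case x of (s, \<omega>) \<Rightarrow> \<phi> s \<omega>))) \<longlonglongrightarrow> 0"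
    "(\<lambda>n. l2norm M (\<lambda>\<omega>. simple_proc_integral (\<lambda>s \<omega>. W s \<omega> $ k) (\<Phi> n) \<omega> - I \<omega>)) \<longlonglongrightarrow> 0"
    "L2 (PM t) (\<lambda>(s, \<omega>). \<phi> s \<omega>)" "L2 M I"
    using is_ito_integral_L2[OF I t] by blast
  show "L2 M I" "L2 (PM t) (\<lambda>(s, \<omega>). \<phi> s \<omega>)" using \<Phi> by auto
  show "l2norm M I = l2norm (PM t) (\<lambda>(s, \<omega>). \<phi> s \<omega>)"
    using L2_tendsto_norm[OF simple_proc_L2(2)[OF \<Phi>(1) t(2)] \<Phi>(5,3)]
      L2_tendsto_norm[OF simple_proc_L2(1)[OF \<Phi>(1) t(2)] \<Phi>(4,2)]
    unfolding simple_proc_isometry[OF \<Phi>(1) t(2)] by (rule LIMSEQ_unique)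
qed

end

subsection \<open>Wiener integrals of deterministic functions\<close>

lemma norm_iexp_diff: "cmod (iexp x - iexp y) \<le> \<bar>x - y\<bar>"
proof -
  have "iexp x - iexp y = iexp y * (iexp (x - y) - 1)"
    by (simp add: right_diff_distrib exp_add[symmetric] algebra_simps)
  then have "cmod (iexp x - iexp y) = cmod (iexp (x - y) - 1)" by (simp add: norm_mult)
  also have "\<dots> \<le> \<bar>x - y\<bar>" using iexp_approx1[of "x - y" 0] by simp
  finally show ?thesis .
qed

lemma norm_integral_le:
  fixes f :: "'b \<Rightarrow> 'c::{banach, second_countable_topology}"
  assumes "integrable M f" "integrable M g" "\<And>x. x \<in> space M \<Longrightarrow> norm (f x) \<le> g x"
  shows "norm (LINT x|M. f x) \<le> (LINT x|M. g x)"
  using assms by (intro order_trans[OF integral_norm_bound] Bochner_Integration.integral_mono) auto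

text \<open>The phase is Lipschitz, so the error is at most E[y |G_n - G'|], which Cauchy-Schwarz
  bounds. This carries every formula for step integrals over to their limits; \<open>R\<close> is a
  spectator phase.\<close>

lemma (in prob_space) iexp_L2_limit:
  fixes Y :: "'a \<Rightarrow> complex"
  assumes Y[measurable]: "Y \<in> borel_measurable M" and y: "L2 M y" "\<And>\<omega>. \<omega> \<in> space M \<Longrightarrow> cmod (Y \<omega>) \<le> y \<omega>"
    and G: "\<And>n. L2 M (G n)" "L2 M G'" "(\<lambda>n. l2norm M (\<lambda>\<omega>. G n \<omega> - G' \<omega>)) \<longlonglongrightarrow> 0"
    and R[measurable]: "R \<in> borel_measurable M"
  shows "(\<lambda>n. LINT \<omega>|M. Y \<omega> * iexp (G n \<omega> + R \<omega>)) \<longlonglongrightarrow> (LINT \<omega>|M. Y \<omega> * iexp (G' \<omega> + R \<omega>))"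
proof (rule LIM_zero_cancel, rule Lim_null_comparison[where g = "\<lambda>n. l2norm M y * l2norm M (\<lambda>\<omega>. G n \<omega> - G' \<omega>)"],
    rule always_eventually, rule allI)
  fix n
  have [measurable]: "G n \<in> borel_measurable M" "G' \<in> borel_measurable M" using G by auto
  have "integrable M y" by (rule L2_integrable[OF y(1)])
  then have YI: "integrable M Y"
    by (rule Bochner_Integration.integrable_bound) (use y(2) in \<open>auto intro!: AE_I2 order_trans[OF _ abs_ge_self]\<close>)
  have i: "integrable M (\<lambda>\<omega>. Y \<omega> * iexp (G n \<omega> + R \<omega>))" "integrable M (\<lambda>\<omega>. Y \<omega> * iexp (G' \<omega> + R \<omega>))"
    by (rule integrable_iexp_mult[OF YI]; measurable)+
  have d: "L2 M (\<lambda>\<omega>. \<bar>G n \<omega> - G' \<omega>\<bar>)" by (rule L2_bound[OF L2_diff[OF G(1)[of n] G(2)]]) auto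
  have "norm ((LINT \<omega>|M. Y \<omega> * iexp (G n \<omega> + R \<omega>)) - (LINT \<omega>|M. Y \<omega> * iexp (G' \<omega> + R \<omega>))) =
      norm (LINT \<omega>|M. Y \<omega> * iexp (G n \<omega> + R \<omega>) - Y \<omega> * iexp (G' \<omega> + R \<omega>))"
    by (simp only: Bochner_Integration.integral_diff[OF i])
  also have "\<dots> \<le> (LINT \<omega>|M. y \<omega> * \<bar>G n \<omega> - G' \<omega>\<bar>)"
  proof (rule norm_integral_le)
    show "integrable M (\<lambda>\<omega>. Y \<omega> * iexp (G n \<omega> + R \<omega>) - Y \<omega> * iexp (G' \<omega> + R \<omega>))" using i by simp
    show "integrable M (\<lambda>\<omega>. y \<omega> * \<bar>G n \<omega> - G' \<omega>\<bar>)" by (rule L2_mult[OF y(1) d])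
    fix \<omega> assume \<omega>: "\<omega> \<in> space M"
    have "cmod (iexp (G n \<omega> + R \<omega>) - iexp (G' \<omega> + R \<omega>)) \<le> \<bar>G n \<omega> - G' \<omega>\<bar>"
      using norm_iexp_diff[of "G n \<omega> + R \<omega>" "G' \<omega> + R \<omega>"] by simp
    then show "norm (Y \<omega> * iexp (G n \<omega> + R \<omega>) - Y \<omega> * iexp (G' \<omega> + R \<omega>)) \<le> y \<omega> * \<bar>G n \<omega> - G' \<omega>\<bar>"
      unfolding right_diff_distrib[symmetric] norm_mult using y(2)[OF \<omega>]
      by (intro mult_mono) (auto intro: order_trans[OF norm_ge_zero])
  qed
  also have "\<dots> \<le> l2norm M y * l2norm M (\<lambda>\<omega>. G n \<omega> - G' \<omega>)"
    using L2_Cauchy_Schwarz[OF y(1) d] by (simp add: l2norm_def)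
  finally show "norm ((LINT \<omega>|M. Y \<omega> * iexp (G n \<omega> + R \<omega>)) - (LINT \<omega>|M. Y \<omega> * iexp (G' \<omega> + R \<omega>)))
      \<le> l2norm M y * l2norm M (\<lambda>\<omega>. G n \<omega> - G' \<omega>)" .
qed (rule tendsto_mult_right_zero[OF G(3)])

text \<open>For adding u (W_b - W_a) to a sum over nodes \<open>S\<close>: u is added at
  \<open>b\<close> and subtracted at \<open>a\<close>, whether or not these are nodes already. The
  functional \<phi> lets one computation serve for \<open>W\<close>, for its frozen values and for
  indicators.\<close>

lemma sum_insert_two:
  fixes \<phi> :: "real \<Rightarrow> 'b::real_vector \<Rightarrow> real"
  assumes "finite S" and \<phi>: "\<And>t. linear (\<phi> t)"
  shows "(\<Sum>t\<in>insert a (insert b S). \<phi> t ((if t \<in> S then c t else 0) + (if t = b then u else 0) - (if t = a then u else 0)))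
    = (\<Sum>t\<in>S. \<phi> t (c t)) + \<phi> b u - \<phi> a u"
proof -
  let ?S = "insert a (insert b S)"
  have "(\<Sum>t\<in>?S. \<phi> t ((if t \<in> S then c t else 0) + (if t = b then u else 0) - (if t = a then u else 0))) =
      (\<Sum>t\<in>?S. (if t \<in> S then \<phi> t (c t) else 0) + (if t = b then \<phi> t u else 0) - (if t = a then \<phi> t u else 0))"
    by (intro sum.cong refl) (auto simp: linear_add[OF \<phi>] linear_diff[OF \<phi>] linear_0[OF \<phi>] linear_neg[OF \<phi>])
  also have "\<dots> = (\<Sum>t\<in>?S. (if t \<in> S then \<phi> t (c t) else 0)) + \<phi> b u - \<phi> a u"
    using assms(1) by (simp add: sum.distrib sum_subtractf)
  also have "(\<Sum>t\<in>?S. (if t \<in> S then \<phi> t (c t) else 0)) = (\<Sum>t\<in>S. \<phi> t (c t))"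
    using assms(1) by (intro sum.mono_neutral_cong_right) auto
  finally show ?thesis .
qed

context brownian
begin

text \<open>Integrands \<open>f\<close> with values in \<open>real ^ 'm\<close> are treated as scalar functions
  \<open>(k, s) \<mapsto> f\<^sub>k(s)\<close> on \<open>'m \<times> [0,T]\<close>.\<close>

definition Q :: "('m \<times> real) measure" where "Q = count_space UNIV \<Otimes>\<^sub>M Leb T"

lemma pair_sigma_finite_Q: "pair_sigma_finite (count_space (UNIV :: 'm set)) (Leb T)"
proof -
  interpret L: finite_measure "Leb T" by (rule finite_measure_Leb)
  interpret C: finite_measure "count_space (UNIV :: 'm set)" by (rule finite_measure_count_space) simp
  show ?thesis by standard
qed

lemma measurable_Q: "(\<And>k. (\<lambda>s. f (k, s)) \<in> measurable (Leb T) N) \<Longrightarrow> f \<in> measurable Q N"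
  unfolding Q_def by (rule measurable_pair_measure_countable1) auto

lemma integrable_Q:
  fixes f :: "'m \<times> real \<Rightarrow> real"
  assumes "\<And>k. integrable (Leb T) (\<lambda>s. f (k, s))"
  shows "integrable Q f"
proof -
  interpret pair_sigma_finite "count_space (UNIV :: 'm set)" "Leb T" by (rule pair_sigma_finite_Q)
  have m: "f \<in> borel_measurable Q" using assms by (intro measurable_Q) auto
  show ?thesis
    unfolding Q_def by (rule Fubini_integrable[OF m[unfolded Q_def]])
      (use assms in \<open>auto intro!: integrable_count_space simp: AE_count_space\<close>)
qed

lemma integrable_QD:
  fixes f :: "'m \<times> real \<Rightarrow> real"
  assumes "integrable Q f"
  shows "integrable (Leb T) (\<lambda>s. f (k, s))"
proof -
  interpret pair_sigma_finite "count_space (UNIV :: 'm set)" "Leb T" by (rule pair_sigma_finite_Q)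
  show ?thesis using AE_integrable_fst'[OF assms[unfolded Q_def]] by (auto simp: AE_count_space)
qed

lemma integral_Q:
  fixes f :: "'m \<times> real \<Rightarrow> real"
  assumes "integrable Q f"
  shows "(LINT x|Q. f x) = (\<Sum>k\<in>UNIV. (LINT s|Leb T. f (k, s)))"
proof -
  interpret pair_sigma_finite "count_space (UNIV :: 'm set)" "Leb T" by (rule pair_sigma_finite_Q)
  show ?thesis
    using integral_fst'[OF assms[unfolded Q_def]] by (simp add: Q_def lebesgue_integral_count_space_finite)
qed

lemma L2_Q:
  assumes "\<And>k. L2 (Leb T) (\<lambda>s. f (k, s))"
  shows "L2 Q f"
proof (rule L2_I)
  show "f \<in> borel_measurable Q" by (rule measurable_Q[OF L2_measurable[OF assms]])
  show "integrable Q (\<lambda>x. (f x)\<^sup>2)" by (rule integrable_Q[OF L2_integrable_sq[OF assms]])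
qed

section \<open>Step integrands and their characteristic functions\<close>

definition stepf :: "real set \<Rightarrow> (real \<Rightarrow> real ^ 'm) \<Rightarrow> 'm \<times> real \<Rightarrow> real" where
  "stepf S c = (\<lambda>(k, s). \<Sum>t\<in>S. indicator {0<..t} s * c t $ k)"

text \<open>The Wiener integral of \<open>stepf S c\<close>: an indicator anchored at 0 integrates
  to a value of \<open>W\<close>, as \<open>W 0\<close> vanishes almost surely.\<close>

definition stepG :: "real set \<Rightarrow> (real \<Rightarrow> real ^ 'm) \<Rightarrow> 'a \<Rightarrow> real" where
  "stepG S c = (\<lambda>\<omega>. \<Sum>t\<in>S. c t \<bullet> W t \<omega>)"

text \<open>The integrand whose Wiener integral is the increment of \<open>v \<bullet> W\<close>
  from \<open>a\<close> to \<open>b\<close>.\<close>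

definition incf :: "real \<Rightarrow> real \<Rightarrow> real ^ 'm \<Rightarrow> 'm \<times> real \<Rightarrow> real" where
  "incf a b v = (\<lambda>(k, s). v $ k * indicator {a<..b} s)"

lemma L2_indicator: "0 \<le> a \<Longrightarrow> a \<le> b \<Longrightarrow> b \<le> T \<Longrightarrow> L2 (Leb T) (indicator {a<..b})"
  using square_integral_const(1)[of a b T]
  by (intro L2_I) (auto simp: power2_eq_square simp flip: indicator_inter_arith)

lemma L2_incf: "0 \<le> a \<Longrightarrow> a \<le> b \<Longrightarrow> b \<le> T \<Longrightarrow> L2 Q (incf a b v)"
  unfolding incf_def by (intro L2_Q) (auto intro!: L2_cmult L2_indicator)

lemma incf_inner:
  assumes ab: "0 \<le> a" "a \<le> b" "b \<le> T"
  shows "(LINT x|Q. (incf a b v x)\<^sup>2) = (norm v)\<^sup>2 * (b - a)"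
proof -
  have "(LINT s|Leb T. (incf a b v (k, s))\<^sup>2) = (v $ k)\<^sup>2 * (b - a)" for k
  proof -
    have "(\<lambda>s. (incf a b v (k, s))\<^sup>2) = (\<lambda>s. (v $ k)\<^sup>2 * indicator {a<..b} s)"
      by (auto simp: incf_def indicator_def fun_eq_iff)
    then show ?thesis using square_integral_const(2)[OF ab] by simp
  qed
  then show ?thesis
    by (subst integral_Q[OF L2_integrable_sq[OF L2_incf[OF ab]]])
      (simp add: sum_distrib_right[symmetric] norm_vec_def L2_set_def sum_nonneg)
qed

lemma L2_stepf:
  assumes "finite S" "S \<subseteq> {0..T}"
  shows "L2 Q (stepf S c)"
proof (rule L2_Q)
  have "L2 (Leb T) (\<lambda>s. \<Sum>t\<in>S. c t $ k * indicator {0<..t} s)" for k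
    by (rule L2_sum, rule L2_cmult, rule L2_indicator) (use assms in auto)
  then show "L2 (Leb T) (\<lambda>s. stepf S c (k, s))" for k
    by (simp add: stepf_def mult.commute)
qed

lemma L2_W:
  assumes "t \<in> {0..T}"
  shows "L2 M (\<lambda>\<omega>. W t \<omega> $ k)" "L2 M (\<lambda>\<omega>. u \<bullet> W t \<omega>)"
proof -
  show *: "L2 M (\<lambda>\<omega>. W t \<omega> $ k)" for k
  proof (rule L2_cong_AE[OF incr_L2[of 0 t k]])
    show "AE \<omega> in M. W t \<omega> $ k = W t \<omega> $ k - W 0 \<omega> $ k" using W_0 by eventually_elim simp
  qed (use assms W_measurable in auto)
  show "L2 M (\<lambda>\<omega>. u \<bullet> W t \<omega>)"
    unfolding inner_vec_def inner_real_def by (intro L2_sum L2_cmult *)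
qed

lemma L2_stepG: "S \<subseteq> {0..T} \<Longrightarrow> L2 M (stepG S c)"
  unfolding stepG_def by (intro L2_sum L2_W) auto

lemma stepf_eq: "stepf S c x = (\<Sum>t\<in>S. indicator {0<..t} (snd x) * c t $ fst x)"
  by (simp add: stepf_def case_prod_unfold)

lemma measurable_Leb_indicator: "(indicator {a<..} :: real \<Rightarrow> real) \<in> borel_measurable (Leb T)"
  by (intro measurable_restrict_space1 measurable_completion) simp

lemma L2_tail:
  assumes "L2 Q f"
  shows "L2 Q (\<lambda>x. indicator {a<..} (snd x) * f x)"
proof (rule L2_bound[OF assms])
  have "(\<lambda>x :: 'm \<times> real. indicator {a<..} (snd x) :: real) \<in> borel_measurable Q"
    by (rule measurable_Q) (simp add: measurable_Leb_indicator)
  then show "(\<lambda>x. indicator {a<..} (snd x) * f x) \<in> borel_measurable Q"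
    by (rule borel_measurable_times[OF _ L2_measurable[OF assms]])
qed (auto simp: indicator_def)

text \<open>The earliest node \<open>b\<close> is peeled off: with \<open>v\<close> the sum of all
  coefficients, the exponent is the increment of \<open>v \<bullet> W\<close> over (a, b] plus a sum
  of the same kind started at \<open>b\<close>. The first factor joins \<open>Y\<close>, which is
  why \<open>a\<close> and \<open>Y\<close> vary in the induction.\<close>

lemma step_char_forward:
  fixes Y :: "'a \<Rightarrow> complex"
  assumes "finite S" "S \<subseteq> {a..T}" "0 \<le> a" "a \<le> T" "Y \<in> borel_measurable (\<F> a)" "integrable M Y"
  shows "(LINT \<omega>|M. Y \<omega> * iexp (\<Sum>t\<in>S. c t \<bullet> (W t \<omega> - W a \<omega>))) =
    (LINT \<omega>|M. Y \<omega>) * complex_of_real (exp (- (LINT x|Q. (indicator {a<..} (snd x) * stepf S c x)\<^sup>2) / 2))"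
  using assms
proof (induction S arbitrary: a Y rule: finite_linorder_min_induct)
  case empty
  then show ?case by (simp add: stepf_def case_prod_unfold)
next
  case (insert b A)
  then have ab: "0 \<le> a" "a \<le> b" "b \<le> T" by auto
  have A: "finite A" "A \<subseteq> {b..T}" "b \<notin> A" using insert by (auto simp: less_imp_le)
  define v where "v = (\<Sum>t\<in>insert b A. c t)"
  define Y' where "Y' = (\<lambda>\<omega>. Y \<omega> * iexp (v \<bullet> (W b \<omega> - W a \<omega>)))"
  have Y: "Y \<in> borel_measurable (\<F> a)" "integrable M Y" by fact+
  have [measurable]: "W a \<in> borel_measurable (\<F> b)" "W b \<in> borel_measurable (\<F> b)" "Y \<in> borel_measurable (\<F> b)"
    using W_measurable_F[of a b] W_measurable_F[of b b] ab measurable_F_mono[OF Y(1) ab(2)] by auto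
  have wM[measurable]: "W a \<in> borel_measurable M" "W b \<in> borel_measurable M"
    using W_measurable ab by auto
  have Y'm: "Y' \<in> borel_measurable (\<F> b)" unfolding Y'_def by measurable
  have Y'i: "integrable M Y'" unfolding Y'_def by (rule integrable_iexp_mult[OF Y(2)]) measurable
  have sumeq: "(\<Sum>t\<in>insert b A. c t \<bullet> (W t \<omega> - W a \<omega>)) =
      v \<bullet> (W b \<omega> - W a \<omega>) + (\<Sum>t\<in>A. c t \<bullet> (W t \<omega> - W b \<omega>))" for \<omega>
    using A by (simp add: v_def inner_sum_left inner_add_left inner_diff_right sum.distrib sum_subtractf)
  have EY': "(LINT \<omega>|M. Y' \<omega>) = (LINT \<omega>|M. Y \<omega>) * complex_of_real (exp (- ((norm v)\<^sup>2 * (b - a) / 2)))"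
    unfolding Y'_def
    using incr_expectation(2)[OF ab Y, of "\<lambda>x. iexp (v \<bullet> x)"] incr_char[OF ab, of v]
    by (simp add: integrable_iexp)
  \<comment> \<open>On (a, b] all indicators equal 1 and the step function is \<open>v\<close>;
    after \<open>b\<close> the node \<open>b\<close> no longer contributes.\<close>
  have energy: "(LINT x|Q. (indicator {a<..} (snd x) * stepf (insert b A) c x)\<^sup>2) =
      (norm v)\<^sup>2 * (b - a) + (LINT x|Q. (indicator {b<..} (snd x) * stepf A c x)\<^sup>2)"
  proof -
    have "(indicator {a<..} (snd x) * stepf (insert b A) c x)\<^sup>2 =
        (incf a b v x)\<^sup>2 + (indicator {b<..} (snd x) * stepf A c x)\<^sup>2" for x
    proof -
      obtain k s where x: "x = (k, s)" by (cases x)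
      consider "s \<le> a" | "a < s" "s \<le> b" | "b < s" by linarith
      then show ?thesis
      proof cases
        case 2
        have "stepf (insert b A) c x = (\<Sum>t\<in>insert b A. c t $ k)"
          unfolding stepf_eq x using 2 ab A by (intro sum.cong) (auto simp: indicator_def)
        then show ?thesis using 2 by (simp add: x incf_def v_def)
      next
        case 3
        then have "stepf (insert b A) c x = stepf A c x"
          unfolding stepf_eq by (subst sum.insert) (use A 3 x in auto)
        then show ?thesis using 3 ab by (simp add: x incf_def)
      qed (use ab in \<open>simp add: x incf_def\<close>)
    qed
    moreover have "integrable Q (\<lambda>x. (indicator {b<..} (snd x) * stepf A c x)\<^sup>2)"
      using A ab by (intro L2_integrable_sq L2_tail L2_stepf) auto
    ultimately show ?thesis
      using L2_integrable_sq[OF L2_incf[OF ab, of v]] incf_inner[OF ab, of v] by simp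
  qed
  have "(LINT \<omega>|M. Y \<omega> * iexp (\<Sum>t\<in>insert b A. c t \<bullet> (W t \<omega> - W a \<omega>))) =
      (LINT \<omega>|M. Y' \<omega> * iexp (\<Sum>t\<in>A. c t \<bullet> (W t \<omega> - W b \<omega>)))"
    unfolding sumeq Y'_def by (simp add: exp_add distrib_left mult.assoc)
  also have "\<dots> = (LINT \<omega>|M. Y' \<omega>) * complex_of_real (exp (- (LINT x|Q. (indicator {b<..} (snd x) * stepf A c x)\<^sup>2) / 2))"
    using A ab Y'm Y'i by (intro insert.IH) auto
  also have "\<dots> = (LINT \<omega>|M. Y \<omega>) * complex_of_real (exp (- (LINT x|Q. (indicator {a<..} (snd x) * stepf (insert b A) c x)\<^sup>2) / 2))"
    unfolding EY' energy minus_add_distrib add_divide_distrib exp_add of_real_mult by (simp only: mult.assoc minus_divide_left)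
  finally show ?case .
qed

text \<open>Freezing \<open>W\<close> at time \<open>a\<close> splits the exponent into an
  \<open>\<F> a\<close>-measurable part, which is absorbed into \<open>Y\<close>, and increments
  after \<open>a\<close>, covered by \<open>step_char_forward\<close>.\<close>

lemma step_char_split:
  fixes Y :: "'a \<Rightarrow> complex"
  assumes S: "finite S" "S \<subseteq> {0..T}" and a: "0 \<le> a" "a \<le> T"
    and Y: "Y \<in> borel_measurable (\<F> a)" "integrable M Y"
  shows "(LINT \<omega>|M. Y \<omega> * iexp (stepG S c \<omega>)) =
    (LINT \<omega>|M. Y \<omega> * iexp (\<Sum>t\<in>S. c t \<bullet> W (min t a) \<omega>)) *
      complex_of_real (exp (- (LINT x|Q. (indicator {a<..} (snd x) * stepf S c x)\<^sup>2) / 2))"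
proof -
  define A where "A = {t\<in>S. a < t}"
  define Y' where "Y' = (\<lambda>\<omega>. Y \<omega> * iexp (\<Sum>t\<in>S. c t \<bullet> W (min t a) \<omega>))"
  have [measurable]: "Y \<in> borel_measurable (\<F> a)" by fact
  have WF: "W (min t a) \<in> borel_measurable (\<F> a)" if "t \<in> S" for t
    using that S a by (intro W_measurable_F) auto
  have sF: "(\<lambda>\<omega>. \<Sum>t\<in>S. c t \<bullet> W (min t a) \<omega>) \<in> borel_measurable (\<F> a)"
    using WF by (intro borel_measurable_sum borel_measurable_inner borel_measurable_const) auto
  have Y'm: "Y' \<in> borel_measurable (\<F> a)" unfolding Y'_def using sF by measurable
  have Y'i: "integrable M Y'"
    unfolding Y'_def by (rule integrable_iexp_mult[OF Y(2) measurable_F_M[OF sF]])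
  have eq: "stepG S c \<omega> = (\<Sum>t\<in>S. c t \<bullet> W (min t a) \<omega>) + (\<Sum>t\<in>A. c t \<bullet> (W t \<omega> - W a \<omega>))" for \<omega>
  proof -
    have "(\<Sum>t\<in>A. c t \<bullet> (W t \<omega> - W a \<omega>)) = (\<Sum>t\<in>S. c t \<bullet> (W t \<omega> - W (min t a) \<omega>))"
      using S by (intro sum.mono_neutral_cong_left) (auto simp: A_def min_def)
    then show ?thesis by (simp add: stepG_def inner_diff_right sum_subtractf)
  qed
  have f_eq: "(indicator {a<..} (snd x) * stepf S c x)\<^sup>2 = (indicator {a<..} (snd x) * stepf A c x)\<^sup>2" for x
  proof (cases "a < snd x")
    case True
    have "stepf A c x = stepf S c x"
      unfolding stepf_eq using S True by (intro sum.mono_neutral_cong_left) (auto simp: A_def indicator_def)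
    then show ?thesis by simp
  qed simp
  have "(LINT \<omega>|M. Y \<omega> * iexp (stepG S c \<omega>)) = (LINT \<omega>|M. Y' \<omega> * iexp (\<Sum>t\<in>A. c t \<bullet> (W t \<omega> - W a \<omega>)))"
    unfolding eq Y'_def by (simp add: exp_add distrib_left mult.assoc)
  also have "\<dots> = (LINT \<omega>|M. Y' \<omega>) * complex_of_real (exp (- (LINT x|Q. (indicator {a<..} (snd x) * stepf A c x)\<^sup>2) / 2))"
    using S a Y'm Y'i by (intro step_char_forward) (auto simp: A_def)
  finally show ?thesis unfolding f_eq Y'_def .
qed

text \<open>Both sides are computed by \<open>step_char_split\<close>. The extra increment leaves
  the part frozen at \<open>a\<close> unchanged and alters only the energy after \<open>a\<close>:
  by a term linear in \<open>l\<close>, the inner product with \<open>incf a b v\<close>, and a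
  quadratic one.\<close>

lemma step_shift:
  fixes Y :: "'a \<Rightarrow> complex"
  assumes S: "finite S" "S \<subseteq> {0..T}" and ab: "0 \<le> a" "a \<le> b" "b \<le> T"
    and Y: "Y \<in> borel_measurable (\<F> a)" "integrable M Y"
  shows "(LINT \<omega>|M. Y \<omega> * iexp (stepG S c \<omega> + l * (v \<bullet> (W b \<omega> - W a \<omega>)))) =
    (LINT \<omega>|M. Y \<omega> * iexp (stepG S c \<omega>)) *
      complex_of_real (exp (- (l * (LINT x|Q. stepf S c x * incf a b v x)) - l\<^sup>2 * ((norm v)\<^sup>2 * (b - a)) / 2))"
proof -
  let ?S = "insert a (insert b S)"
  let ?c = "\<lambda>t. (if t \<in> S then c t else 0) + (if t = b then l *\<^sub>R v else 0) - (if t = a then l *\<^sub>R v else 0)"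
  have S': "finite ?S" "?S \<subseteq> {0..T}" using S ab by auto
  have aT: "a \<le> T" using ab by simp
  have l1: "linear (\<lambda>u. u \<bullet> w)" for w :: "real ^ 'm" by (simp add: linear_iff inner_add_left)
  have G: "stepG ?S ?c \<omega> = stepG S c \<omega> + l * (v \<bullet> (W b \<omega> - W a \<omega>))" for \<omega>
    unfolding stepG_def using sum_insert_two[where \<phi> = "\<lambda>t u. u \<bullet> W t \<omega>" and a = a and b = b and c = c and u = "l *\<^sub>R v", OF S(1) l1]
    by (simp add: inner_diff_right algebra_simps)
  \<comment> \<open>Both \<open>min a a\<close> and \<open>min b a\<close> are \<open>a\<close>, so
    the added and the subtracted coefficient cancel.\<close>
  have Ga: "(\<Sum>t\<in>?S. ?c t \<bullet> W (min t a) \<omega>) = (\<Sum>t\<in>S. c t \<bullet> W (min t a) \<omega>)" for \<omega>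
    using sum_insert_two[where \<phi> = "\<lambda>t u. u \<bullet> W (min t a) \<omega>" and a = a and b = b and c = c and u = "l *\<^sub>R v", OF S(1) l1] ab by (simp add: min_def)
  have f: "stepf ?S ?c x = stepf S c x + l * incf a b v x" for x
  proof -
    obtain k s where x: "x = (k, s)" by (cases x)
    have "linear (\<lambda>u :: real ^ 'm. indicator {0<..t} s * u $ k)" for t
      by (simp add: linear_iff algebra_simps)
    from sum_insert_two[where \<phi> = "\<lambda>t u. indicator {0<..t} s * u $ k" and a = a and b = b and c = c and u = "l *\<^sub>R v", OF S(1) this]
    have "stepf ?S ?c x = stepf S c x + indicator {0<..b} s * (l *\<^sub>R v) $ k - indicator {0<..a} s * (l *\<^sub>R v) $ k"
      by (simp add: stepf_eq x)
    then show ?thesis using ab by (auto simp: x incf_def indicator_def)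
  qed
  have L: "L2 Q (stepf S c)" "L2 Q (incf a b v)" using S ab L2_stepf L2_incf by auto
  have "(indicator {a<..} (snd x) * stepf ?S ?c x)\<^sup>2 = (indicator {a<..} (snd x) * stepf S c x)\<^sup>2
      + 2 * l * (stepf S c x * incf a b v x) + l\<^sup>2 * (incf a b v x)\<^sup>2" for x
    unfolding f by (cases x) (auto simp: incf_def indicator_def power2_eq_square algebra_simps)
  then have en: "(LINT x|Q. (indicator {a<..} (snd x) * stepf ?S ?c x)\<^sup>2) =
      (LINT x|Q. (indicator {a<..} (snd x) * stepf S c x)\<^sup>2)
      + 2 * l * (LINT x|Q. stepf S c x * incf a b v x) + l\<^sup>2 * ((norm v)\<^sup>2 * (b - a))"
    using L2_mult[OF L] L2_integrable_sq[OF L(2)] L2_integrable_sq[OF L2_tail[OF L(1), of a]]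
    by (simp add: incf_inner[OF ab])
  have "(LINT \<omega>|M. Y \<omega> * iexp (stepG S c \<omega> + l * (v \<bullet> (W b \<omega> - W a \<omega>)))) =
      (LINT \<omega>|M. Y \<omega> * iexp (stepG ?S ?c \<omega>))" by (simp only: G)
  also have "\<dots> = (LINT \<omega>|M. Y \<omega> * iexp (\<Sum>t\<in>S. c t \<bullet> W (min t a) \<omega>)) *
      complex_of_real (exp (- (LINT x|Q. (indicator {a<..} (snd x) * stepf ?S ?c x)\<^sup>2) / 2))"
    unfolding step_char_split[OF S' ab(1) aT Y, of ?c] by (simp only: Ga)
  also have "\<dots> = ((LINT \<omega>|M. Y \<omega> * iexp (\<Sum>t\<in>S. c t \<bullet> W (min t a) \<omega>)) *
      complex_of_real (exp (- (LINT x|Q. (indicator {a<..} (snd x) * stepf S c x)\<^sup>2) / 2))) *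
      complex_of_real (exp (- (l * (LINT x|Q. stepf S c x * incf a b v x)) - l\<^sup>2 * ((norm v)\<^sup>2 * (b - a)) / 2))"
  proof -
    have "- (x + 2 * l * y + l\<^sup>2 * z) / 2 = - x / 2 + (- (l * y) - l\<^sup>2 * z / 2)" for x y z :: real
      by (simp add: field_simps)
    note e2 = this
    show ?thesis unfolding en e2 exp_add of_real_mult by (simp only: mult.assoc)
  qed
  also have "(LINT \<omega>|M. Y \<omega> * iexp (\<Sum>t\<in>S. c t \<bullet> W (min t a) \<omega>)) *
      complex_of_real (exp (- (LINT x|Q. (indicator {a<..} (snd x) * stepf S c x)\<^sup>2) / 2)) =
      (LINT \<omega>|M. Y \<omega> * iexp (stepG S c \<omega>))"
    by (rule step_char_split[OF S ab(1) aT Y, of c, symmetric])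
  finally show ?thesis .
qed

end

section \<open>Wiener integrals as limits of step integrals\<close>

context brownian
begin

text \<open>The closure of the pairs of a step function and its Wiener integral: \<open>gauss f G\<close> means that
  \<open>G\<close> is a version of the Wiener integral \<open>\<Sum>k. \<integral> f\<^sub>k dW\<^sup>k\<close>.\<close>

definition gauss :: "('m \<times> real \<Rightarrow> real) \<Rightarrow> ('a \<Rightarrow> real) \<Rightarrow> bool" where
  "gauss f G \<longleftrightarrow> L2 Q f \<and> L2 M G \<and> (\<exists>S c. (\<forall>n. finite (S n) \<and> S n \<subseteq> {0..T}) \<and>
     (\<lambda>n. l2norm Q (\<lambda>x. stepf (S n) (c n) x - f x)) \<longlonglongrightarrow> 0 \<and>
     (\<lambda>n. l2norm M (\<lambda>\<omega>. stepG (S n) (c n) \<omega> - G \<omega>)) \<longlonglongrightarrow> 0)"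

lemma gaussE:
  assumes "gauss f G"
  obtains S c where "L2 Q f" "L2 M G" "\<And>n. finite (S n)" "\<And>n. S n \<subseteq> {0..T}"
    "(\<lambda>n. l2norm Q (\<lambda>x. stepf (S n) (c n) x - f x)) \<longlonglongrightarrow> 0"
    "(\<lambda>n. l2norm M (\<lambda>\<omega>. stepG (S n) (c n) \<omega> - G \<omega>)) \<longlonglongrightarrow> 0"
  using assms unfolding gauss_def by blast

lemma gauss_L2: "gauss f G \<Longrightarrow> L2 Q f" "gauss f G \<Longrightarrow> L2 M G"
  by (auto simp: gauss_def)

lemma gauss_step: "finite S \<Longrightarrow> S \<subseteq> {0..T} \<Longrightarrow> gauss (stepf S c) (stepG S c)"
  unfolding gauss_def
  by (intro conjI L2_stepf L2_stepG exI[of _ "\<lambda>_. S"] exI[of _ "\<lambda>_. c"]) (auto simp: l2norm_def)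

lemma stepf_add:
  assumes "finite S" "finite S'"
  shows "stepf (S \<union> S') (\<lambda>t. (if t \<in> S then c t else 0) + (if t \<in> S' then c' t else 0)) x = stepf S c x + stepf S' c' x"
proof -
  have "stepf S c x = (\<Sum>t\<in>S\<union>S'. indicator {0<..t} (snd x) * (if t \<in> S then c t else 0) $ fst x)"
    unfolding stepf_eq using assms by (intro sum.mono_neutral_cong_left) auto
  moreover have "stepf S' c' x = (\<Sum>t\<in>S\<union>S'. indicator {0<..t} (snd x) * (if t \<in> S' then c' t else 0) $ fst x)"
    unfolding stepf_eq using assms by (intro sum.mono_neutral_cong_left) auto
  ultimately show ?thesis
    by (simp add: stepf_eq sum.distrib[symmetric] distrib_left del: sum.distrib)
qed

lemma stepG_add:
  assumes "finite S" "finite S'"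
  shows "stepG (S \<union> S') (\<lambda>t. (if t \<in> S then c t else 0) + (if t \<in> S' then c' t else 0)) \<omega> = stepG S c \<omega> + stepG S' c' \<omega>"
proof -
  have "stepG S c \<omega> = (\<Sum>t\<in>S\<union>S'. (if t \<in> S then c t else 0) \<bullet> W t \<omega>)"
    unfolding stepG_def using assms by (intro sum.mono_neutral_cong_left) auto
  moreover have "stepG S' c' \<omega> = (\<Sum>t\<in>S\<union>S'. (if t \<in> S' then c' t else 0) \<bullet> W t \<omega>)"
    unfolding stepG_def using assms by (intro sum.mono_neutral_cong_left) auto
  ultimately show ?thesis
    by (simp add: stepG_def sum.distrib[symmetric] inner_add_left del: sum.distrib)
qed

lemma stepf_scale: "stepf S (\<lambda>t. r *\<^sub>R c t) x = r * stepf S c x"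
  by (simp add: stepf_eq sum_distrib_left mult.left_commute)

lemma stepG_scale: "stepG S (\<lambda>t. r *\<^sub>R c t) \<omega> = r * stepG S c \<omega>"
  by (simp add: stepG_def sum_distrib_left)

lemma L2_tendsto_add:
  assumes "\<And>n. L2 N (f n)" "L2 N f'" "\<And>n. L2 N (g n)" "L2 N g'"
    and "(\<lambda>n. l2norm N (\<lambda>x. f n x - f' x)) \<longlonglongrightarrow> 0" "(\<lambda>n. l2norm N (\<lambda>x. g n x - g' x)) \<longlonglongrightarrow> 0"
  shows "(\<lambda>n. l2norm N (\<lambda>x. (f n x + g n x) - (f' x + g' x))) \<longlonglongrightarrow> 0"
proof (rule Lim_null_comparison[where g = "\<lambda>n. l2norm N (\<lambda>x. f n x - f' x) + l2norm N (\<lambda>x. g n x - g' x)"],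
    rule always_eventually, rule allI)
  show "norm (l2norm N (\<lambda>x. (f n x + g n x) - (f' x + g' x))) \<le> l2norm N (\<lambda>x. f n x - f' x) + l2norm N (\<lambda>x. g n x - g' x)" for n
    using l2norm_triangle[OF L2_diff[OF assms(1)[of n] assms(2)] L2_diff[OF assms(3)[of n] assms(4)]]
    by (simp add: algebra_simps)
qed (use tendsto_add[OF assms(5,6)] in simp)

lemma gauss_add:
  assumes "gauss f G" "gauss f' G'"
  shows "gauss (\<lambda>x. f x + f' x) (\<lambda>\<omega>. G \<omega> + G' \<omega>)"
proof -
  obtain S c where 1: "L2 Q f" "L2 M G" "\<And>n. finite (S n)" "\<And>n. S n \<subseteq> {0..T}"
    "(\<lambda>n. l2norm Q (\<lambda>x. stepf (S n) (c n) x - f x)) \<longlonglongrightarrow> 0"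
    "(\<lambda>n. l2norm M (\<lambda>\<omega>. stepG (S n) (c n) \<omega> - G \<omega>)) \<longlonglongrightarrow> 0"
    using gaussE[OF assms(1)] by blast
  obtain S' c' where 2: "L2 Q f'" "L2 M G'" "\<And>n. finite (S' n)" "\<And>n. S' n \<subseteq> {0..T}"
    "(\<lambda>n. l2norm Q (\<lambda>x. stepf (S' n) (c' n) x - f' x)) \<longlonglongrightarrow> 0"
    "(\<lambda>n. l2norm M (\<lambda>\<omega>. stepG (S' n) (c' n) \<omega> - G' \<omega>)) \<longlonglongrightarrow> 0"
    using gaussE[OF assms(2)] by blast
  let ?c = "\<lambda>n t. (if t \<in> S n then c n t else 0) + (if t \<in> S' n then c' n t else 0)"
  show ?thesis
    unfolding gauss_def
  proof (intro conjI exI allI)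
    show "finite (S n \<union> S' n)" "S n \<union> S' n \<subseteq> {0..T}" for n using 1(3,4) 2(3,4) by auto
    show "(\<lambda>n. l2norm Q (\<lambda>x. stepf (S n \<union> S' n) (?c n) x - (f x + f' x))) \<longlonglongrightarrow> 0"
      unfolding stepf_add[OF 1(3) 2(3)]
      by (rule L2_tendsto_add[OF L2_stepf[OF 1(3,4)] 1(1) L2_stepf[OF 2(3,4)] 2(1) 1(5) 2(5)])
    show "(\<lambda>n. l2norm M (\<lambda>\<omega>. stepG (S n \<union> S' n) (?c n) \<omega> - (G \<omega> + G' \<omega>))) \<longlonglongrightarrow> 0"
      unfolding stepG_add[OF 1(3) 2(3)]
      by (rule L2_tendsto_add[OF L2_stepG[OF 1(4)] 1(2) L2_stepG[OF 2(4)] 2(2) 1(6) 2(6)])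
  qed (rule L2_add[OF 1(1) 2(1)], rule L2_add[OF 1(2) 2(2)])
qed

lemma gauss_cmult:
  assumes "gauss f G"
  shows "gauss (\<lambda>x. r * f x) (\<lambda>\<omega>. r * G \<omega>)"
proof -
  obtain S c where 1: "L2 Q f" "L2 M G" "\<And>n. finite (S n)" "\<And>n. S n \<subseteq> {0..T}"
    "(\<lambda>n. l2norm Q (\<lambda>x. stepf (S n) (c n) x - f x)) \<longlonglongrightarrow> 0"
    "(\<lambda>n. l2norm M (\<lambda>\<omega>. stepG (S n) (c n) \<omega> - G \<omega>)) \<longlonglongrightarrow> 0"
    using gaussE[OF assms(1)] by blast
  show ?thesis
    unfolding gauss_def
  proof (intro conjI exI allI)
    show "finite (S n)" "S n \<subseteq> {0..T}" for n using 1 by auto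
    show "(\<lambda>n. l2norm Q (\<lambda>x. stepf (S n) (\<lambda>t. r *\<^sub>R c n t) x - r * f x)) \<longlonglongrightarrow> 0"
      unfolding stepf_scale right_diff_distrib[symmetric] l2norm_cmult
      by (rule tendsto_mult_right_zero[OF 1(5)])
    show "(\<lambda>n. l2norm M (\<lambda>\<omega>. stepG (S n) (\<lambda>t. r *\<^sub>R c n t) \<omega> - r * G \<omega>)) \<longlonglongrightarrow> 0"
      unfolding stepG_scale right_diff_distrib[symmetric] l2norm_cmult
      by (rule tendsto_mult_right_zero[OF 1(6)])
  qed (rule L2_cmult[OF 1(1)], rule L2_cmult[OF 1(2)])
qed

lemma gauss_zero: "gauss (\<lambda>x. 0) (\<lambda>\<omega>. 0)"
  using gauss_step[of "{}"] by (simp add: stepf_def stepG_def case_prod_unfold)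

lemma gauss_sum:
  assumes "\<And>i. i \<in> I \<Longrightarrow> gauss (f i) (G i)"
  shows "gauss (\<lambda>x. \<Sum>i\<in>I. f i x) (\<lambda>\<omega>. \<Sum>i\<in>I. G i \<omega>)"
  using assms by (induction I rule: infinite_finite_induct) (auto intro: gauss_zero gauss_add)

lemma gauss_diff:
  assumes "gauss f G" "gauss f' G'"
  shows "gauss (\<lambda>x. f x - f' x) (\<lambda>\<omega>. G \<omega> - G' \<omega>)"
  using gauss_add[OF assms(1) gauss_cmult[OF assms(2), of "-1"]] by simp

text \<open>A diagonal choice with accuracy 1 / (n + 1) shows that the closure is closed.\<close>

lemma gauss_limit:
  assumes G: "\<And>n. gauss (f n) (G n)" and f': "L2 Q f'" and G': "L2 M G'"
    and 1: "(\<lambda>n. l2norm Q (\<lambda>x. f n x - f' x)) \<longlonglongrightarrow> 0" and 2: "(\<lambda>n. l2norm M (\<lambda>\<omega>. G n \<omega> - G' \<omega>)) \<longlonglongrightarrow> 0"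
  shows "gauss f' G'"
proof -
  have "\<exists>S c. finite S \<and> S \<subseteq> {0..T} \<and> l2norm Q (\<lambda>x. stepf S c x - f n x) < 1 / Suc n \<and>
      l2norm M (\<lambda>\<omega>. stepG S c \<omega> - G n \<omega>) < 1 / Suc n" for n
  proof -
    from G[of n] obtain S c where S: "\<forall>m. finite (S m) \<and> S m \<subseteq> {0..T}"
      "(\<lambda>m. l2norm Q (\<lambda>x. stepf (S m) (c m) x - f n x)) \<longlonglongrightarrow> 0"
      "(\<lambda>m. l2norm M (\<lambda>\<omega>. stepG (S m) (c m) \<omega> - G n \<omega>)) \<longlonglongrightarrow> 0"
      unfolding gauss_def by blast
    have "\<forall>\<^sub>F m in sequentially. l2norm Q (\<lambda>x. stepf (S m) (c m) x - f n x) < 1 / Suc n"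
      "\<forall>\<^sub>F m in sequentially. l2norm M (\<lambda>\<omega>. stepG (S m) (c m) \<omega> - G n \<omega>) < 1 / Suc n"
      by (rule order_tendstoD[OF S(2)], simp, rule order_tendstoD[OF S(3)], simp)
    from eventually_happens[OF eventually_conj[OF this]] obtain m where
      "l2norm Q (\<lambda>x. stepf (S m) (c m) x - f n x) < 1 / Suc n"
      "l2norm M (\<lambda>\<omega>. stepG (S m) (c m) \<omega> - G n \<omega>) < 1 / Suc n" by auto
    with S(1) show ?thesis by blast
  qed
  note * = allI[OF this]
  from choice[OF *] obtain S where
    "\<forall>n. \<exists>c. finite (S n) \<and> S n \<subseteq> {0..T} \<and> l2norm Q (\<lambda>x. stepf (S n) c x - f n x) < 1 / Suc n \<and>
      l2norm M (\<lambda>\<omega>. stepG (S n) c \<omega> - G n \<omega>) < 1 / Suc n" by (rule exE)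
  from choice[OF this] obtain c where
    "\<forall>n. finite (S n) \<and> S n \<subseteq> {0..T} \<and> l2norm Q (\<lambda>x. stepf (S n) (c n) x - f n x) < 1 / Suc n \<and>
      l2norm M (\<lambda>\<omega>. stepG (S n) (c n) \<omega> - G n \<omega>) < 1 / Suc n" by (rule exE)
  then have S: "finite (S n)" "S n \<subseteq> {0..T}"
    and 3: "l2norm Q (\<lambda>x. stepf (S n) (c n) x - f n x) < 1 / Suc n"
    and 4: "l2norm M (\<lambda>\<omega>. stepG (S n) (c n) \<omega> - G n \<omega>) < 1 / Suc n" for n
    by blast+
  show ?thesis
    unfolding gauss_def
  proof (intro conjI exI allI)
    show "(\<lambda>n. l2norm Q (\<lambda>x. stepf (S n) (c n) x - f' x)) \<longlonglongrightarrow> 0"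
    proof (rule Lim_null_comparison[where g = "\<lambda>n. 1 / Suc n + l2norm Q (\<lambda>x. f n x - f' x)"], rule always_eventually, rule allI)
      show "norm (l2norm Q (\<lambda>x. stepf (S n) (c n) x - f' x)) \<le> 1 / Suc n + l2norm Q (\<lambda>x. f n x - f' x)" for n
        using l2norm_triangle3[OF L2_stepf[OF S[of n], of "c n"] gauss_L2(1)[OF G[of n]] f'] 3[of n] by simp
      show "(\<lambda>n. 1 / Suc n + l2norm Q (\<lambda>x. f n x - f' x)) \<longlonglongrightarrow> 0"
        using tendsto_add[OF lim_1_over_n[THEN LIMSEQ_Suc] 1] by simp
    qed
    show "(\<lambda>n. l2norm M (\<lambda>\<omega>. stepG (S n) (c n) \<omega> - G' \<omega>)) \<longlonglongrightarrow> 0"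
    proof (rule Lim_null_comparison[where g = "\<lambda>n. 1 / Suc n + l2norm M (\<lambda>\<omega>. G n \<omega> - G' \<omega>)"], rule always_eventually, rule allI)
      show "norm (l2norm M (\<lambda>\<omega>. stepG (S n) (c n) \<omega> - G' \<omega>)) \<le> 1 / Suc n + l2norm M (\<lambda>\<omega>. G n \<omega> - G' \<omega>)" for n
        using l2norm_triangle3[OF L2_stepG[OF S(2)[of n], of "c n"] gauss_L2(2)[OF G[of n]] G'] 4[of n] by simp
      show "(\<lambda>n. 1 / Suc n + l2norm M (\<lambda>\<omega>. G n \<omega> - G' \<omega>)) \<longlonglongrightarrow> 0"
        using tendsto_add[OF lim_1_over_n[THEN LIMSEQ_Suc] 2] by simp
    qed
  qed (use S f' G' in auto)
qed

lemma gauss_char: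
  assumes "gauss f G"
  shows "(LINT \<omega>|M. iexp (u * G \<omega>)) = complex_of_real (exp (- (l2norm Q f * u)\<^sup>2 / 2))"
proof -
  have step: "(LINT \<omega>|M. iexp (stepG S c \<omega>)) = complex_of_real (exp (- (l2norm Q (stepf S c))\<^sup>2 / 2))"
    if S: "finite S" "S \<subseteq> {0..T}" for S c
  proof -
    have "(LINT \<omega>|M. 1 * iexp (stepG S c \<omega>)) = (LINT \<omega>|M. 1 * iexp (\<Sum>t\<in>S. c t \<bullet> W (min t 0) \<omega>)) *
        complex_of_real (exp (- (LINT x|Q. (indicator {0<..} (snd x) * stepf S c x)\<^sup>2) / 2))"
      using S T_pos by (intro step_char_split) auto
    also have "(LINT \<omega>|M. 1 * iexp (\<Sum>t\<in>S. c t \<bullet> W (min t 0) \<omega>)) = (LINT \<omega>|M. 1)"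
    proof (rule integral_cong_AE)
      have W0: "W (min t 0) = W 0" if "t \<in> S" for t using that S by (auto simp: min_def)
      have "AE \<omega> in M. (\<Sum>t\<in>S. c t \<bullet> W (min t 0) \<omega>) = 0"
        using W_0 by eventually_elim (simp add: W0)
      then show "AE \<omega> in M. 1 * iexp (\<Sum>t\<in>S. c t \<bullet> W (min t 0) \<omega>) = 1"
        by eventually_elim simp
      have [measurable]: "W 0 \<in> borel_measurable M" using W_measurable[of 0] T_pos by auto
      have "(\<lambda>\<omega>. \<Sum>t\<in>S. c t \<bullet> W (min t 0) \<omega>) = (\<lambda>\<omega>. \<Sum>t\<in>S. c t \<bullet> W 0 \<omega>)"
        by (intro ext sum.cong refl) (simp add: W0)
      then have "(\<lambda>\<omega>. \<Sum>t\<in>S. c t \<bullet> W (min t 0) \<omega>) \<in> borel_measurable M"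
        by simp
      then show "(\<lambda>\<omega>. 1 * iexp (\<Sum>t\<in>S. c t \<bullet> W (min t 0) \<omega>)) \<in> borel_measurable M"
        by measurable
    qed simp
    also have "(\<lambda>x. (indicator {0<..} (snd x) * stepf S c x)\<^sup>2) = (\<lambda>x. (stepf S c x)\<^sup>2)"
    proof
      fix x :: "'m \<times> real"
      show "(indicator {0<..} (snd x) * stepf S c x)\<^sup>2 = (stepf S c x)\<^sup>2"
        by (cases "0 < snd x") (auto simp: stepf_eq indicator_def)
    qed
    finally show ?thesis by (simp add: l2norm_sq prob_space)
  qed
  have "gauss (\<lambda>x. u * f x) (\<lambda>\<omega>. u * G \<omega>)" by (rule gauss_cmult[OF assms])
  then obtain S c where 1: "L2 Q (\<lambda>x. u * f x)" "L2 M (\<lambda>\<omega>. u * G \<omega>)" "\<And>n. finite (S n)" "\<And>n. S n \<subseteq> {0..T}"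
    "(\<lambda>n. l2norm Q (\<lambda>x. stepf (S n) (c n) x - u * f x)) \<longlonglongrightarrow> 0"
    "(\<lambda>n. l2norm M (\<lambda>\<omega>. stepG (S n) (c n) \<omega> - u * G \<omega>)) \<longlonglongrightarrow> 0"
    using gaussE by blast
  have "(\<lambda>n. LINT \<omega>|M. 1 * iexp (stepG (S n) (c n) \<omega> + 0)) \<longlonglongrightarrow> (LINT \<omega>|M. 1 * iexp (u * G \<omega> + 0))"
    by (rule iexp_L2_limit[OF _ L2_const[of 1] _ L2_stepG[OF 1(4)] 1(2,6)]) auto
  then have a: "(\<lambda>n. complex_of_real (exp (- (l2norm Q (stepf (S n) (c n)))\<^sup>2 / 2))) \<longlonglongrightarrow> (LINT \<omega>|M. iexp (u * G \<omega>))"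
    by (simp add: step[OF 1(3,4)])
  have "(\<lambda>n. l2norm Q (stepf (S n) (c n))) \<longlonglongrightarrow> l2norm Q (\<lambda>x. u * f x)"
    by (rule L2_tendsto_norm[OF L2_stepf[OF 1(3,4)] 1(1,5)])
  then have "(\<lambda>n. complex_of_real (exp (- (l2norm Q (stepf (S n) (c n)))\<^sup>2 / 2))) \<longlonglongrightarrow>
      complex_of_real (exp (- (l2norm Q (\<lambda>x. u * f x))\<^sup>2 / 2))"
    by (intro tendsto_intros) simp_all
  from LIMSEQ_unique[OF a this] show ?thesis
    by (simp add: l2norm_cmult power_mult_distrib mult.commute)
qed

lemma gauss_moments:
  assumes "gauss f G"
  shows "integrable M (\<lambda>\<omega>. G \<omega> ^ n)"
    and "(LINT \<omega>|M. G \<omega> ^ (2 * n)) = l2norm Q f ^ (2 * n) * (fact (2 * n) / (2 ^ n * fact n))"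
  using gaussian_moments_of_char[OF L2_measurable[OF gauss_L2(2)[OF assms]] l2norm_nonneg gauss_char[OF assms]]
  by auto

text \<open>The case \<open>n = 1\<close> of the even moments, whose constant is then 1.\<close>

lemma gauss_isometry: "gauss f G \<Longrightarrow> l2norm M G = l2norm Q f"
  using gauss_moments(2)[of f G 1] by (simp add: l2norm_def fact_numeral)

text \<open>The limit of \<open>step_shift\<close>: the phases converge by
  \<open>iexp_L2_limit\<close>, the exponent by continuity of the inner product with
  \<open>incf a b v\<close>.\<close>

lemma gauss_shift:
  assumes G: "gauss f G" and ab: "0 \<le> a" "a \<le> b" "b \<le> T" and H: "adapted_bounded a H"
  shows "(LINT \<omega>|M. complex_of_real (H \<omega>) * iexp (G \<omega> + l * (v \<bullet> (W b \<omega> - W a \<omega>)))) =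
    (LINT \<omega>|M. complex_of_real (H \<omega>) * iexp (G \<omega>)) *
      complex_of_real (exp (- (l * (LINT x|Q. f x * incf a b v x)) - l\<^sup>2 * ((norm v)\<^sup>2 * (b - a)) / 2))"
proof -
  obtain S c where 1: "L2 Q f" "L2 M G" "\<And>n. finite (S n)" "\<And>n. S n \<subseteq> {0..T}"
    "(\<lambda>n. l2norm Q (\<lambda>x. stepf (S n) (c n) x - f x)) \<longlonglongrightarrow> 0"
    "(\<lambda>n. l2norm M (\<lambda>\<omega>. stepG (S n) (c n) \<omega> - G \<omega>)) \<longlonglongrightarrow> 0"
    using gaussE[OF G] by blast
  have [measurable]: "W a \<in> borel_measurable M" "W b \<in> borel_measurable M" using W_measurable ab by auto
  have HF: "(\<lambda>\<omega>. complex_of_real (H \<omega>)) \<in> borel_measurable (\<F> a)" using H by (auto simp: adapted_bounded_def)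
  have HM: "(\<lambda>\<omega>. complex_of_real (H \<omega>)) \<in> borel_measurable M" by (rule measurable_F_M[OF HF])
  have Hi: "integrable M (\<lambda>\<omega>. complex_of_real (H \<omega>))" using adapted_bounded_integrable[OF H] by simp
  have Ha: "L2 M (\<lambda>\<omega>. \<bar>H \<omega>\<bar>)" using HM adapted_bounded_measurable[OF H]
    by (intro L2_bound[OF adapted_bounded_L2[OF H]]) auto
  have lim: "(\<lambda>n. LINT \<omega>|M. complex_of_real (H \<omega>) * iexp (stepG (S n) (c n) \<omega> + R \<omega>))
      \<longlonglongrightarrow> (LINT \<omega>|M. complex_of_real (H \<omega>) * iexp (G \<omega> + R \<omega>))" if "R \<in> borel_measurable M" for R
    by (rule iexp_L2_limit[OF HM Ha _ L2_stepG[OF 1(4)] 1(2,6) that]) simp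
  have lim0: "(\<lambda>n. LINT \<omega>|M. complex_of_real (H \<omega>) * iexp (stepG (S n) (c n) \<omega>))
      \<longlonglongrightarrow> (LINT \<omega>|M. complex_of_real (H \<omega>) * iexp (G \<omega>))"
    using lim[of "\<lambda>_. 0"] by simp
  have inner: "(\<lambda>n. LINT x|Q. stepf (S n) (c n) x * incf a b v x) \<longlonglongrightarrow> (LINT x|Q. f x * incf a b v x)"
    by (rule L2_tendsto_inner[OF L2_stepf[OF 1(3,4)] 1(1,5) L2_incf[OF ab]])
  have "(\<lambda>n. LINT \<omega>|M. complex_of_real (H \<omega>) * iexp (stepG (S n) (c n) \<omega> + l * (v \<bullet> (W b \<omega> - W a \<omega>))))
      \<longlonglongrightarrow> (LINT \<omega>|M. complex_of_real (H \<omega>) * iexp (G \<omega>)) *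
      complex_of_real (exp (- (l * (LINT x|Q. f x * incf a b v x)) - l\<^sup>2 * ((norm v)\<^sup>2 * (b - a)) / 2))"
    unfolding step_shift[OF 1(3,4) ab HF Hi]
    by (intro tendsto_mult lim0 tendsto_of_real tendsto_exp tendsto_diff tendsto_minus inner tendsto_const)
  from LIMSEQ_unique[OF lim[of "\<lambda>\<omega>. l * (v \<bullet> (W b \<omega> - W a \<omega>))"] this]
  show ?thesis by simp
qed

section \<open>Deterministic integrands against a single component\<close>

lemma stepf_single:
  assumes "t \<in> {0..T}"
  shows "stepf {t} (\<lambda>_. axis k r) = (\<lambda>(k', s). if k' = k then r * indicator {0<..t} s else 0)"
    and "stepG {t} (\<lambda>_. axis k r) = (\<lambda>\<omega>. r * W t \<omega> $ k)"
  by (auto simp: stepf_def stepG_def axis_def fun_eq_iff inner_axis' inner_vec_def if_distrib if_distribR cong: if_cong)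

lemma gauss_cong: "gauss f G \<Longrightarrow> (\<And>x. f x = f' x) \<Longrightarrow> (\<And>\<omega>. G \<omega> = G' \<omega>) \<Longrightarrow> gauss f' G'"
  by (metis ext)

text \<open>Averaging the approximating simple processes over \<open>M\<close> makes them deterministic without
  destroying the convergence, because the integrand is deterministic.\<close>

definition mean_proc :: "'a simple_proc \<Rightarrow> 'a simple_proc" where
  "mean_proc \<Phi> = map (\<lambda>(a, b, H). (a, b, \<lambda>_. LINT \<omega>|M. H \<omega>)) \<Phi>"

lemma mean_proc_on: "simple_proc_on \<F> t \<Phi> \<Longrightarrow> simple_proc_on \<F> t (mean_proc \<Phi>)"
  by (fastforce simp: simple_proc_on_iff mean_proc_def adapted_bounded_def)

lemma simple_proc_val_bounded:
  assumes "simple_proc_on \<F> t \<Phi>"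
  shows "integrable M (\<lambda>\<omega>. simple_proc_val \<Phi> s \<omega>)"
    and "simple_proc_val (mean_proc \<Phi>) s \<omega>' = (LINT \<omega>|M. simple_proc_val \<Phi> s \<omega>)"
proof -
  have "integrable M (\<lambda>\<omega>. simple_proc_val \<Phi> s \<omega>) \<and>
    simple_proc_val (mean_proc \<Phi>) s \<omega>' = (LINT \<omega>|M. simple_proc_val \<Phi> s \<omega>)"
    using assms
  proof (induction \<Phi>)
    case (Cons x \<Phi>)
    obtain a b H where x: "x = (a, b, H)" by (cases x)
    have "integrable M H" "simple_proc_on \<F> t \<Phi>"
      using Cons.prems by (auto simp: simple_proc_on_iff x intro: adapted_bounded_integrable)
    then show ?case using Cons.IH by (simp add: x mean_proc_def simple_proc_Cons)
  next
    case Nil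
    have "simple_proc_val [] s = (\<lambda>_::'a. 0)" by (simp add: simple_proc_Cons fun_eq_iff)
    then show ?case by (simp add: mean_proc_def)
  qed
  then show "integrable M (\<lambda>\<omega>. simple_proc_val \<Phi> s \<omega>)"
    "simple_proc_val (mean_proc \<Phi>) s \<omega>' = (LINT \<omega>|M. simple_proc_val \<Phi> s \<omega>)" by auto
qed

text \<open>Jensen's inequality for almost every \<open>s\<close>, from Cauchy-Schwarz against 1,
  integrated over time: averaging over the sample space contracts the norm.\<close>

lemma l2norm_mean_le:
  fixes \<phi> :: "real \<times> 'a \<Rightarrow> real"
  assumes \<phi>: "L2 (PM t) \<phi>"
  shows "l2norm (PM t) (\<lambda>(s, _). LINT \<omega>|M. \<phi> (s, \<omega>)) \<le> l2norm (PM t) \<phi>"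
proof -
  interpret P: pair_sigma_finite "Leb t" M by (rule pair_sigma_finite_PM)
  interpret L: finite_measure "Leb t" by (rule finite_measure_Leb)
  have [measurable]: "\<phi> \<in> borel_measurable (PM t)" using \<phi> by auto
  have i2: "integrable (PM t) (\<lambda>x. (\<phi> x)\<^sup>2)" by (rule L2_integrable_sq[OF \<phi>])
  have m: "(\<lambda>s. LINT \<omega>|M. \<phi> (s, \<omega>)) \<in> borel_measurable (Leb t)" by measurable
  have le: "AE s in Leb t. (LINT \<omega>|M. \<phi> (s, \<omega>))\<^sup>2 \<le> (LINT \<omega>|M. (\<phi> (s, \<omega>))\<^sup>2)"
    using P.AE_integrable_fst'[OF i2] AE_space
  proof eventually_elim
    case (elim s)
    then have "L2 M (\<lambda>\<omega>. \<phi> (s, \<omega>))" by (intro L2_I) simp_all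
    from L2_Cauchy_Schwarz[OF this L2_const[of 1]]
    have "\<bar>LINT \<omega>|M. \<phi> (s, \<omega>)\<bar> \<le> l2norm M (\<lambda>\<omega>. \<phi> (s, \<omega>))" by (simp add: l2norm_def prob_space)
    then have "\<bar>LINT \<omega>|M. \<phi> (s, \<omega>)\<bar>\<^sup>2 \<le> (l2norm M (\<lambda>\<omega>. \<phi> (s, \<omega>)))\<^sup>2" by (rule power_mono) simp
    then show ?case by (simp add: l2norm_sq)
  qed
  have i1: "integrable (Leb t) (\<lambda>s. LINT \<omega>|M. (\<phi> (s, \<omega>))\<^sup>2)" by (rule P.integrable_fst'[OF i2])
  have i3: "integrable (Leb t) (\<lambda>s. (LINT \<omega>|M. \<phi> (s, \<omega>))\<^sup>2)"
    by (rule Bochner_Integration.integrable_bound[OF i1]) (use le m in auto)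
  have "(LINT x|PM t. (case x of (s, _) \<Rightarrow> LINT \<omega>|M. \<phi> (s, \<omega>))\<^sup>2) =
      (LINT (s, \<omega>')|PM t. (LINT \<omega>|M. \<phi> (s, \<omega>))\<^sup>2 * 1)" by (simp add: case_prod_unfold)
  also have "\<dots> = (LINT s|Leb t. (LINT \<omega>|M. \<phi> (s, \<omega>))\<^sup>2)"
    by (subst PM_integral_product(2)[OF i3]) (simp_all add: prob_space)
  also have "\<dots> \<le> (LINT s|Leb t. (LINT \<omega>|M. (\<phi> (s, \<omega>))\<^sup>2))"
    by (rule integral_mono_AE[OF i3 i1 le])
  also have "\<dots> = (LINT x|PM t. (\<phi> x)\<^sup>2)" by (rule P.integral_fst'[OF i2])
  finally show ?thesis unfolding l2norm_def by (rule real_sqrt_le_mono)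
qed

text \<open>Turns a scalar integrand against component \<open>k\<close> of \<open>W\<close> into an
  integrand on the space of \<open>Q\<close>.\<close>

definition at_comp :: "'m \<Rightarrow> (real \<Rightarrow> real) \<Rightarrow> 'm \<times> real \<Rightarrow> real" where
  "at_comp k g = (\<lambda>(k', s). if k' = k then g s else 0)"

lemma L2_at_comp:
  assumes g: "L2 (Leb T) g"
  shows "L2 Q (at_comp k g)"
proof (rule L2_Q)
  show "L2 (Leb T) (\<lambda>s. at_comp k g (k', s))" for k'
    using g by (cases "k' = k") (auto simp: at_comp_def L2_zero)
qed

lemma integral_at_comp:
  assumes g: "integrable (Leb T) g"
  shows "integrable Q (at_comp k g)" "(LINT x|Q. at_comp k g x) = (LINT s|Leb T. g s)"
proof -
  have *: "(\<lambda>s. at_comp k g (k', s)) = (if k' = k then g else (\<lambda>_. 0))" for k'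
    by (auto simp: at_comp_def)
  show "integrable Q (at_comp k g)" by (rule integrable_Q) (use g in \<open>simp add: *\<close>)
  from integral_Q[OF this] show "(LINT x|Q. at_comp k g x) = (LINT s|Leb T. g s)"
    by (simp add: * if_distrib[of "integral\<^sup>L _"] cong: if_cong)
qed

lemma l2norm_at_comp:
  assumes g: "L2 (Leb T) g"
  shows "l2norm Q (at_comp k g) = l2norm (Leb T) g"
    and "l2norm (PM T) (\<lambda>(s, _). g s) = l2norm (Leb T) g"
proof -
  have "(\<lambda>x. (at_comp k g x)\<^sup>2) = at_comp k (\<lambda>s. (g s)\<^sup>2)" by (auto simp: at_comp_def fun_eq_iff)
  then show "l2norm Q (at_comp k g) = l2norm (Leb T) g"
    using integral_at_comp(2)[OF L2_integrable_sq[OF g], of k] by (simp add: l2norm_def)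
  have "(LINT x|PM T. (case x of (s, _) \<Rightarrow> g s)\<^sup>2) = (LINT (s, \<omega>)|PM T. (g s)\<^sup>2 * 1)"
    by (simp add: case_prod_unfold)
  also have "\<dots> = (LINT s|Leb T. (g s)\<^sup>2)"
    by (subst PM_integral_product(2)[OF L2_integrable_sq[OF g]]) (simp_all add: prob_space)
  finally show "l2norm (PM T) (\<lambda>(s, _). g s) = l2norm (Leb T) g" by (simp add: l2norm_def)
qed

lemma gauss_W:
  assumes "t \<in> {0..T}"
  shows "gauss (at_comp k (indicator {0<..t})) (\<lambda>\<omega>. W t \<omega> $ k)"
proof -
  have "gauss (stepf {t} (\<lambda>_. axis k 1)) (stepG {t} (\<lambda>_. axis k 1))"
    using assms by (intro gauss_step) auto
  then show ?thesis unfolding stepf_single[OF assms] mult_1 at_comp_def .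
qed

text \<open>The sample point \<omega>' is a dummy, the coefficients being constants. Each interval
  contributes a multiple of a difference of two anchored indicators, that is, of two values of
  \<open>W\<close>.\<close>

lemma gauss_mean_proc:
  assumes "simple_proc_on \<F> T \<Phi>"
  shows "gauss (at_comp k (\<lambda>s. simple_proc_val (mean_proc \<Phi>) s \<omega>'))
    (simple_proc_integral (\<lambda>s \<omega>. W s \<omega> $ k) (mean_proc \<Phi>))"
  using assms
proof (induction \<Phi>)
  case (Cons x \<Phi>)
  obtain a b H where x: "x = (a, b, H)" by (cases x)
  have *: "0 \<le> a" "a \<le> b" "b \<le> T" "simple_proc_on \<F> T \<Phi>"
    using Cons.prems by (auto simp: simple_proc_on_iff x)
  have W: "gauss (at_comp k (indicator {0<..a})) (\<lambda>\<omega>. W a \<omega> $ k)" "gauss (at_comp k (indicator {0<..b})) (\<lambda>\<omega>. W b \<omega> $ k)"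
    using * by (auto intro!: gauss_W)
  show ?case
    by (rule gauss_cong[OF gauss_add[OF gauss_cmult[OF gauss_diff[OF W(2,1)], of "LINT \<omega>|M. H \<omega>"] Cons.IH[OF *(4)]]])
      (use * in \<open>auto simp: x mean_proc_def simple_proc_Cons at_comp_def indicator_def split: prod.splits\<close>)
qed (auto simp: mean_proc_def simple_proc_Cons at_comp_def fun_eq_iff intro!: gauss_cong[OF gauss_zero])

lemma simple_proc_val_L2_Leb:
  assumes "simple_proc_on \<F> T \<Phi>"
  shows "L2 (Leb T) (\<lambda>s. simple_proc_val (mean_proc \<Phi>) s \<omega>')"
  using assms
proof (induction \<Phi>)
  case (Cons x \<Phi>)
  obtain a b H where x: "x = (a, b, H)" by (cases x)
  have *: "0 \<le> a" "a \<le> b" "b \<le> T" "simple_proc_on \<F> T \<Phi>"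
    using Cons.prems by (auto simp: simple_proc_on_iff x)
  show ?case
    using L2_add[OF L2_cmult[OF L2_indicator[OF *(1-3)], of "LINT \<omega>|M. H \<omega>"] Cons.IH[OF *(4)]]
    by (simp add: x mean_proc_def simple_proc_Cons)
qed (simp add: mean_proc_def simple_proc_Cons L2_zero)

text \<open>This makes the coordinates \<open>\<xi> k i\<close> Gaussian. The averaged processes
  converge to \<open>g\<close> on [0, T] and their integrals converge to \<xi>, so the pair lies in
  the closure.\<close>

theorem gauss_ito:
  assumes e: "L2 (Leb T) g" and I: "is_ito_integral M \<F> (\<lambda>s \<omega>. W s \<omega> $ k) T (\<lambda>s \<omega>. g s) \<xi>"
  shows "gauss (at_comp k g) \<xi>"
proof -
  have T0: "0 \<le> T" using T_pos by simp
  let ?I = "simple_proc_integral (\<lambda>s \<omega>. W s \<omega> $ k)"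
  obtain \<Phi> where \<Phi>: "\<And>n. simple_proc_on \<F> T (\<Phi> n)"
    and 1: "(\<lambda>n. l2norm (PM T) (\<lambda>x. (case x of (s, \<omega>) \<Rightarrow> simple_proc_val (\<Phi> n) s \<omega>) - (case x of (s, \<omega>) \<Rightarrow> g s))) \<longlonglongrightarrow> 0"
    and 2: "(\<lambda>n. l2norm M (\<lambda>\<omega>. ?I (\<Phi> n) \<omega> - \<xi> \<omega>)) \<longlonglongrightarrow> 0"
    and 3: "L2 (PM T) (\<lambda>(s, \<omega>). g s)" and 4: "L2 M \<xi>"
    using is_ito_integral_L2[OF I T0 order.refl] by blast
  obtain \<omega>' where "\<omega>' \<in> space M" using not_empty by blast
  let ?m = "\<lambda>n s. simple_proc_val (mean_proc (\<Phi> n)) s \<omega>'"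
  let ?d = "\<lambda>n x. (case x of (s, \<omega>) \<Rightarrow> simple_proc_val (\<Phi> n) s \<omega>) - (case x of (s, \<omega>) \<Rightarrow> g s)"
  have d2: "L2 (PM T) (?d n)" for n by (intro L2_diff simple_proc_L2 \<Phi> 3) simp
  have m_const: "simple_proc_val (mean_proc (\<Phi> n)) s \<omega> = ?m n s" for n s \<omega>
    unfolding simple_proc_val_bounded(2)[OF \<Phi>] ..
  have m2: "L2 (Leb T) (\<lambda>s. ?m n s - g s)" for n
    by (intro L2_diff simple_proc_val_L2_Leb \<Phi> e)
  \<comment> \<open>Averaging leaves \<open>g\<close> unchanged, because \<open>g\<close> does not
    depend on the sample point.\<close>
  have mean_d: "(LINT \<omega>|M. ?d n (s, \<omega>)) = ?m n s - g s" for n s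
    using simple_proc_val_bounded[OF \<Phi>[of n], of s] by (simp add: prob_space)
  have le: "l2norm (Leb T) (\<lambda>s. ?m n s - g s) \<le> l2norm (PM T) (?d n)" for n
    using l2norm_mean_le[OF d2[of n]] unfolding mean_d using l2norm_at_comp(2)[OF m2[of n]] by simp
  have conv: "(\<lambda>n. l2norm (Leb T) (\<lambda>s. ?m n s - g s)) \<longlonglongrightarrow> 0"
    by (rule Lim_null_comparison[OF _ 1]) (use le in auto)
  have convQ: "(\<lambda>n. l2norm Q (\<lambda>x. at_comp k (?m n) x - at_comp k g x)) \<longlonglongrightarrow> 0"
  proof -
    have "(\<lambda>x. at_comp k (?m n) x - at_comp k g x) = at_comp k (\<lambda>s. ?m n s - g s)" for n
      by (auto simp: at_comp_def)
    then show ?thesis using conv by (simp add: l2norm_at_comp[OF m2])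
  qed
  \<comment> \<open>By the isometry the integrals of the averaged and of the original process differ
    by the norm of the difference of the integrands, which is estimated through
    \<open>g\<close>.\<close>
  have convM: "(\<lambda>n. l2norm M (\<lambda>\<omega>. ?I (mean_proc (\<Phi> n)) \<omega> - \<xi> \<omega>)) \<longlonglongrightarrow> 0"
  proof (rule Lim_null_comparison)
    have "l2norm M (\<lambda>\<omega>. ?I (mean_proc (\<Phi> n)) \<omega> - \<xi> \<omega>) \<le>
        (l2norm (Leb T) (\<lambda>s. ?m n s - g s) + l2norm (PM T) (?d n)) + l2norm M (\<lambda>\<omega>. ?I (\<Phi> n) \<omega> - \<xi> \<omega>)" for n
    proof -
      note on = \<Phi>[of n] mean_proc_on[OF \<Phi>[of n]]
      have "l2norm M (\<lambda>\<omega>. ?I (mean_proc (\<Phi> n)) \<omega> - ?I (\<Phi> n) \<omega>) =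
          l2norm (PM T) (\<lambda>(s, \<omega>). simple_proc_val (simple_minus (mean_proc (\<Phi> n)) (\<Phi> n)) s \<omega>)"
      proof -
        have "?I (simple_minus (mean_proc (\<Phi> n)) (\<Phi> n)) = (\<lambda>\<omega>. ?I (mean_proc (\<Phi> n)) \<omega> - ?I (\<Phi> n) \<omega>)"
          by (rule ext) (rule simple_minus(2))
        then show ?thesis using simple_proc_isometry[OF simple_minus_on[OF on(2,1)] order.refl, of k] by simp
      qed
      also have "(\<lambda>(s, \<omega>). simple_proc_val (simple_minus (mean_proc (\<Phi> n)) (\<Phi> n)) s \<omega>) =
          (\<lambda>x. (case x of (s, _) \<Rightarrow> ?m n s - g s) - ?d n x)"
      proof
        fix x :: "real \<times> 'a"
        obtain s \<omega> where x: "x = (s, \<omega>)" by (cases x)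
        show "(case x of (s, \<omega>) \<Rightarrow> simple_proc_val (simple_minus (mean_proc (\<Phi> n)) (\<Phi> n)) s \<omega>) =
          (case x of (s, _) \<Rightarrow> ?m n s - g s) - ?d n x"
          using m_const[of n s \<omega>] by (simp add: x simple_minus(1))
      qed
      also have "l2norm (PM T) (\<lambda>x. (case x of (s, _) \<Rightarrow> ?m n s - g s) - ?d n x) \<le> l2norm (PM T) (\<lambda>(s, _). ?m n s - g s) + l2norm (PM T) (?d n)"
      proof -
        have "L2 (PM T) (\<lambda>(s, _). ?m n s - g s)"
        proof -
          have "(\<lambda>(s, _). ?m n s - g s) = (\<lambda>x. (case x of (s, \<omega>) \<Rightarrow> simple_proc_val (mean_proc (\<Phi> n)) s \<omega>) - (case x of (s, \<omega>) \<Rightarrow> g s))"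
          proof
            fix x :: "real \<times> 'a"
            obtain s \<omega> where x: "x = (s, \<omega>)" by (cases x)
            show "(case x of (s, _) \<Rightarrow> ?m n s - g s) = (case x of (s, \<omega>) \<Rightarrow> simple_proc_val (mean_proc (\<Phi> n)) s \<omega>) - (case x of (s, \<omega>) \<Rightarrow> g s)"
              using m_const[of n s \<omega>] by (simp add: x)
          qed
          then show ?thesis using L2_diff[OF simple_proc_L2(1)[OF on(2) order.refl] 3] by (simp only:)
        qed
        from l2norm_triangle[OF this L2_uminus[OF d2[of n]]] show ?thesis by (simp add: l2norm_uminus)
      qed
      also have "l2norm (PM T) (\<lambda>(s, _). ?m n s - g s) = l2norm (Leb T) (\<lambda>s. ?m n s - g s)"
        by (rule l2norm_at_comp(2)[OF m2])
      finally show ?thesis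
        using l2norm_triangle3[OF simple_proc_L2(2)[OF on(2) order.refl, of k] simple_proc_L2(2)[OF on(1) order.refl, of k] 4]
        by linarith
    qed
    then show "\<forall>\<^sub>F n in sequentially. norm (l2norm M (\<lambda>\<omega>. ?I (mean_proc (\<Phi> n)) \<omega> - \<xi> \<omega>)) \<le>
        (l2norm (Leb T) (\<lambda>s. ?m n s - g s) + l2norm (PM T) (?d n)) + l2norm M (\<lambda>\<omega>. ?I (\<Phi> n) \<omega> - \<xi> \<omega>)"
      by simp
    show "(\<lambda>n. (l2norm (Leb T) (\<lambda>s. ?m n s - g s) + l2norm (PM T) (?d n)) + l2norm M (\<lambda>\<omega>. ?I (\<Phi> n) \<omega> - \<xi> \<omega>)) \<longlonglongrightarrow> 0"
      using tendsto_add[OF tendsto_add[OF conv 1] 2] by simp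
  qed
  show ?thesis
    by (rule gauss_limit[OF gauss_mean_proc[OF \<Phi>] L2_at_comp[OF e] 4 convQ convM])
qed

end

subsection \<open>Hermite polynomials\<close>

text \<open>The three-term recurrence is the form in which derivatives, moments and products are
  handled; \<open>hermite_eq\<close> identifies it with the Rodrigues formula of
  \<open>hermite\<close>.\<close>

fun hermite_rec :: "nat \<Rightarrow> real \<Rightarrow> real" where
  "hermite_rec 0 x = 1"
| "hermite_rec (Suc 0) x = x"
| "hermite_rec (Suc (Suc n)) x = x * hermite_rec (Suc n) x - real (Suc n) * hermite_rec n x"

text \<open>The Appell property. At \<open>n = 0\<close> the truncated index \<open>n - 1\<close> is
  harmless because of the factor \<open>n\<close>.\<close>

lemma hermite_rec_deriv: "(hermite_rec n has_real_derivative real n * hermite_rec (n - 1) x) (at x)"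
proof (induction n x rule: hermite_rec.induct)
  case (1 x)
  then show ?case by simp
next
  case (2 x)
  have "hermite_rec (Suc 0) = (\<lambda>x. x)" by (simp add: fun_eq_iff)
  then show ?case by simp
next
  case (3 n x)
  have eq: "hermite_rec (Suc (Suc n)) = (\<lambda>x. x * hermite_rec (Suc n) x - real (Suc n) * hermite_rec n x)"
    by (simp add: fun_eq_iff)
  have "((\<lambda>x. x * hermite_rec (Suc n) x - real (Suc n) * hermite_rec n x) has_real_derivative
      (1 * hermite_rec (Suc n) x + real (Suc n) * hermite_rec n x * x - real (Suc n) * (real n * hermite_rec (n - 1) x))) (at x)"
    using 3 by (intro DERIV_diff DERIV_mult DERIV_cmult DERIV_ident) simp_all
  moreover have "1 * hermite_rec (Suc n) x + real (Suc n) * hermite_rec n x * x - real (Suc n) * (real n * hermite_rec (n - 1) x)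
      = real (Suc (Suc n)) * hermite_rec (Suc (Suc n) - 1) x"
    by (cases n) (simp_all add: algebra_simps)
  ultimately show ?case unfolding eq by simp
qed

lemma hermite_rec_step: "hermite_rec (Suc n) x = x * hermite_rec n x - real n * hermite_rec (n - 1) x"
  by (cases n) simp_all

text \<open>Differentiating h_n exp(-x^2/2) produces the factor n h_(n-1) - x h_n by the Appell
  property, and this is -h_(n+1) by the recurrence.\<close>

lemma deriv_gauss_hermite:
  "(deriv ^^ n) (\<lambda>y. exp (- (y\<^sup>2 / 2))) = (\<lambda>x. (- 1) ^ n * hermite_rec n x * exp (- (x\<^sup>2 / 2)))"
proof (induction n)
  case (Suc n)
  have "((\<lambda>x. (- 1) ^ n * hermite_rec n x * exp (- (x\<^sup>2 / 2))) has_real_derivative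
      (- 1) ^ Suc n * hermite_rec (Suc n) x * exp (- (x\<^sup>2 / 2))) (at x)" for x
  proof -
    have "((\<lambda>x. (- 1) ^ n * hermite_rec n x * exp (- (x\<^sup>2 / 2))) has_real_derivative
        ((- 1) ^ n * (real n * hermite_rec (n - 1) x)) * exp (- (x\<^sup>2 / 2)) +
        (exp (- (x\<^sup>2 / 2)) * (- x)) * ((- 1) ^ n * hermite_rec n x)) (at x)"
    proof (rule DERIV_mult)
      show "((\<lambda>x. (- 1) ^ n * hermite_rec n x) has_real_derivative (- 1) ^ n * (real n * hermite_rec (n - 1) x)) (at x)"
        by (rule DERIV_cmult[OF hermite_rec_deriv])
      show "((\<lambda>x. exp (- (x\<^sup>2 / 2))) has_real_derivative exp (- (x\<^sup>2 / 2)) * (- x)) (at x)"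
        by (auto intro!: derivative_eq_intros)
    qed
    then show ?thesis by (simp add: hermite_rec_step algebra_simps)
  qed
  then have "deriv (\<lambda>x. (- 1) ^ n * hermite_rec n x * exp (- (x\<^sup>2 / 2))) =
      (\<lambda>x. (- 1) ^ Suc n * hermite_rec (Suc n) x * exp (- (x\<^sup>2 / 2)))"
    by (intro ext DERIV_imp_deriv)
  then show ?case by (simp add: Suc)
qed simp

lemma hermite_eq: "hermite n x = hermite_rec n x"
proof -
  have "(- 1 :: real) ^ n * (- 1) ^ n = 1" by (simp flip: power_mult_distrib)
  moreover have "exp (x\<^sup>2 / 2) * exp (- (x\<^sup>2 / 2)) = 1" by (simp flip: exp_add)
  ultimately show ?thesis
    unfolding hermite_def deriv_gauss_hermite by (simp add: mult_ac)
qed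

lemma hermite_simps:
  "hermite 0 x = 1" "hermite (Suc 0) x = x"
  "hermite (Suc n) x = x * hermite n x - real n * hermite (n - 1) x"
  by (simp_all add: hermite_eq hermite_rec_step)

section \<open>Products of Hermite polynomials over multi-indices\<close>

definition hermite_prod :: "('i \<Rightarrow> real) \<Rightarrow> ('i \<Rightarrow>\<^sub>0 nat) \<Rightarrow> real" where
  "hermite_prod x \<alpha> = (\<Prod>p\<in>Poly_Mapping.keys \<alpha>. hermite (Poly_Mapping.lookup \<alpha> p) (x p))"

text \<open>Since h_0 = 1, the product may run over any finite superset of the support, so that
  neighbouring multi-indices can be compared over one set.\<close>

lemma hermite_prod_superset:
  assumes "finite K" "Poly_Mapping.keys \<alpha> \<subseteq> K"
  shows "hermite_prod x \<alpha> = (\<Prod>p\<in>K. hermite (Poly_Mapping.lookup \<alpha> p) (x p))"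
  unfolding hermite_prod_def using assms
  by (intro prod.mono_neutral_left) (auto simp: hermite_simps in_keys_iff)

lemma multi_fact_superset:
  fixes \<alpha> :: "'m multi_index"
  assumes "finite K" "Poly_Mapping.keys \<alpha> \<subseteq> K"
  shows "multi_fact \<alpha> = (\<Prod>p\<in>K. fact (Poly_Mapping.lookup \<alpha> p))"
  unfolding multi_fact_def using assms
  by (intro prod.mono_neutral_left) (auto simp: in_keys_iff)

lemma multi_fact_pos: "multi_fact \<alpha> > 0"
  unfolding multi_fact_def by (intro prod_pos) auto

lemma keys_diff_single: "Poly_Mapping.keys (\<alpha> - Poly_Mapping.single p (1::nat)) \<subseteq> Poly_Mapping.keys \<alpha>"
  by (auto simp: in_keys_iff lookup_minus)

lemma lookup_diff_single: "Poly_Mapping.lookup (\<alpha> - Poly_Mapping.single p (1::nat)) q =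
    (if q = p then Poly_Mapping.lookup \<alpha> p - 1 else Poly_Mapping.lookup \<alpha> q)"
  by (auto simp: lookup_minus lookup_single when_def)

lemma hermite_prod_diff_single:
  assumes "p \<in> Poly_Mapping.keys \<alpha>"
  shows "hermite_prod x (\<alpha> - Poly_Mapping.single p 1) = hermite (Poly_Mapping.lookup \<alpha> p - 1) (x p) *
    (\<Prod>q\<in>Poly_Mapping.keys \<alpha> - {p}. hermite (Poly_Mapping.lookup \<alpha> q) (x q))"
  by (subst hermite_prod_superset[OF _ keys_diff_single], simp, subst prod.remove[OF _ assms])
    (auto simp: lookup_diff_single simp del: One_nat_def intro!: prod.cong)

lemma multi_fact_diff_single:
  assumes "p \<in> Poly_Mapping.keys (\<alpha> :: 'm multi_index)"
  shows "multi_fact \<alpha> = real (Poly_Mapping.lookup \<alpha> p) * multi_fact (\<alpha> - Poly_Mapping.single p 1)"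
proof -
  have "multi_fact (\<alpha> - Poly_Mapping.single p 1) = fact (Poly_Mapping.lookup \<alpha> p - 1) *
      (\<Prod>q\<in>Poly_Mapping.keys \<alpha> - {p}. fact (Poly_Mapping.lookup \<alpha> q))"
    by (subst multi_fact_superset[OF _ keys_diff_single], simp, subst prod.remove[OF _ assms])
      (auto simp: lookup_diff_single simp del: One_nat_def intro!: prod.cong)
  moreover have "multi_fact \<alpha> = fact (Poly_Mapping.lookup \<alpha> p) *
      (\<Prod>q\<in>Poly_Mapping.keys \<alpha> - {p}. fact (Poly_Mapping.lookup \<alpha> q))"
    unfolding multi_fact_def by (subst prod.remove[OF _ assms]) auto
  moreover have "(fact (Poly_Mapping.lookup \<alpha> p) :: real) = real (Poly_Mapping.lookup \<alpha> p) * fact (Poly_Mapping.lookup \<alpha> p - 1)"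
    using assms by (intro fact_reduce) (simp add: in_keys_iff)
  ultimately show ?thesis by simp
qed

text \<open>The recurrence at the factor \<open>p\<close>, all other factors being common. If
  \<open>p\<close> is not in the support, the lowered index is \<alpha> itself by truncation, with
  coefficient 0.\<close>

lemma hermite_prod_add_single:
  "hermite_prod x (\<alpha> + Poly_Mapping.single p 1) =
    x p * hermite_prod x \<alpha> - real (Poly_Mapping.lookup \<alpha> p) * hermite_prod x (\<alpha> - Poly_Mapping.single p 1)"
proof -
  define K where "K = insert p (Poly_Mapping.keys \<alpha>)"
  have K: "finite K" "p \<in> K" "Poly_Mapping.keys \<alpha> \<subseteq> K" by (auto simp: K_def)
  have l: "Poly_Mapping.lookup (\<alpha> + Poly_Mapping.single p 1) q = (if q = p then Suc (Poly_Mapping.lookup \<alpha> p) else Poly_Mapping.lookup \<alpha> q)" for q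
    by (auto simp: lookup_add lookup_single when_def)
  have K1: "Poly_Mapping.keys (\<alpha> + Poly_Mapping.single p 1) \<subseteq> K"
    by (auto simp: in_keys_iff l K_def simp del: One_nat_def split: if_splits)
  have K2: "Poly_Mapping.keys (\<alpha> - Poly_Mapping.single p 1) \<subseteq> K" using keys_diff_single K by fast
  define R where "R = (\<Prod>q\<in>K - {p}. hermite (Poly_Mapping.lookup \<alpha> q) (x q))"
  have 1: "hermite_prod x (\<alpha> + Poly_Mapping.single p 1) = hermite (Suc (Poly_Mapping.lookup \<alpha> p)) (x p) * R"
    unfolding R_def by (subst hermite_prod_superset[OF K(1) K1], subst prod.remove[OF K(1,2)]) (auto simp: l simp del: One_nat_def intro!: prod.cong)
  have 2: "hermite_prod x \<alpha> = hermite (Poly_Mapping.lookup \<alpha> p) (x p) * R"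
    unfolding R_def by (subst hermite_prod_superset[OF K(1,3)], subst prod.remove[OF K(1,2)]) (auto intro!: prod.cong)
  have 3: "hermite_prod x (\<alpha> - Poly_Mapping.single p 1) = hermite (Poly_Mapping.lookup \<alpha> p - 1) (x p) * R"
    unfolding R_def by (subst hermite_prod_superset[OF K(1) K2], subst prod.remove[OF K(1,2)]) (auto simp: lookup_diff_single simp del: One_nat_def intro!: prod.cong)
  show ?thesis
    unfolding 1 2 3 hermite_simps(3) by (simp add: algebra_simps)
qed

lemma wick_monomial_eq: "wick_monomial \<xi> \<alpha> \<omega> = 1 / sqrt (multi_fact \<alpha>) * hermite_prod (\<lambda>p. \<xi> (fst p) (snd p) \<omega>) \<alpha>"
  by (simp add: wick_monomial_def hermite_prod_def case_prod_unfold)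

lemma wick_monomial_0[simp]: "wick_monomial \<xi> 0 \<omega> = 1"
  by (simp add: wick_monomial_def multi_fact_def)

text \<open>The normalised recurrence, solved for the raised monomial: multiplication by a
  coordinate raises and lowers the index with weights sqrt(\<alpha>_p + 1) and
  sqrt(\<alpha>_p).\<close>

lemma wick_monomial_add_single:
  "sqrt (real (Suc (Poly_Mapping.lookup \<alpha> p))) * wick_monomial \<xi> (\<alpha> + Poly_Mapping.single p 1) \<omega> =
    \<xi> (fst p) (snd p) \<omega> * wick_monomial \<xi> \<alpha> \<omega>
    - sqrt (real (Poly_Mapping.lookup \<alpha> p)) * wick_monomial \<xi> (\<alpha> - Poly_Mapping.single p 1) \<omega>"
proof -
  let ?a = "Poly_Mapping.lookup \<alpha> p"
  have 1: "multi_fact (\<alpha> + Poly_Mapping.single p 1) = real (Suc ?a) * multi_fact \<alpha>"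
    using multi_fact_diff_single[of p "\<alpha> + Poly_Mapping.single p 1"]
    by (simp add: in_keys_iff lookup_add del: One_nat_def)
  have s: "sqrt (real (Suc ?a)) / sqrt (multi_fact (\<alpha> + Poly_Mapping.single p 1)) = 1 / sqrt (multi_fact \<alpha>)"
    unfolding 1 real_sqrt_mult using multi_fact_pos[of \<alpha>] by simp
  \<comment> \<open>If \<open>p\<close> is outside the support both sides vanish; otherwise
    \<alpha>! equals \<alpha>_p times the lowered factorial.\<close>
  have t: "1 / sqrt (multi_fact \<alpha>) * real ?a * h = sqrt (real ?a) * (1 / sqrt (multi_fact (\<alpha> - Poly_Mapping.single p 1)) * h)" for h
  proof (cases "p \<in> Poly_Mapping.keys \<alpha>")
    case True
    then have "?a > 0" by (simp add: in_keys_iff)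
    then have "real ?a = sqrt (real ?a) * sqrt (real ?a)" by simp
    then show ?thesis
      unfolding multi_fact_diff_single[OF True] real_sqrt_mult
      using \<open>?a > 0\<close> multi_fact_pos[of "\<alpha> - Poly_Mapping.single p 1"]
      by (simp add: field_simps)
  qed (simp add: in_keys_iff)
  have "sqrt (real (Suc ?a)) * wick_monomial \<xi> (\<alpha> + Poly_Mapping.single p 1) \<omega> =
      sqrt (real (Suc ?a)) / sqrt (multi_fact (\<alpha> + Poly_Mapping.single p 1)) *
      hermite_prod (\<lambda>p. \<xi> (fst p) (snd p) \<omega>) (\<alpha> + Poly_Mapping.single p 1)"
    by (simp add: wick_monomial_eq)
  also have "\<dots> = \<xi> (fst p) (snd p) \<omega> * wick_monomial \<xi> \<alpha> \<omega> -
     1 / sqrt (multi_fact \<alpha>) * real ?a * hermite_prod (\<lambda>p. \<xi> (fst p) (snd p) \<omega>) (\<alpha> - Poly_Mapping.single p 1)"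
    unfolding s hermite_prod_add_single by (simp add: wick_monomial_eq right_diff_distrib diff_divide_distrib)
  also have "1 / sqrt (multi_fact \<alpha>) * real ?a * hermite_prod (\<lambda>p. \<xi> (fst p) (snd p) \<omega>) (\<alpha> - Poly_Mapping.single p 1)
     = sqrt (real ?a) * wick_monomial \<xi> (\<alpha> - Poly_Mapping.single p 1) \<omega>"
    unfolding t wick_monomial_eq ..
  finally show ?thesis .
qed

section \<open>Variables with moments of all orders\<close>

definition all_moments :: "'a measure \<Rightarrow> ('a \<Rightarrow> real) \<Rightarrow> bool" where
  "all_moments M f \<longleftrightarrow> f \<in> borel_measurable M \<and> (\<forall>n. integrable M (\<lambda>x. \<bar>f x\<bar> ^ n))"

lemma all_moments_measurable[measurable_dest]: "all_moments M f \<Longrightarrow> f \<in> borel_measurable M"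
  by (simp add: all_moments_def)

lemma all_moments_integrable:
  assumes "all_moments M f" shows "integrable M f"
proof -
  have "integrable M (\<lambda>x. \<bar>f x\<bar> ^ 1)" using assms unfolding all_moments_def by blast
  then show ?thesis using assms by (simp add: all_moments_def integrable_abs_iff)
qed

lemma all_moments_L2: "all_moments M f \<Longrightarrow> L2 M f"
  unfolding all_moments_def by (intro L2_I) (auto dest: spec[of _ 2])

text \<open>Closure under products, which \<open>L2\<close> lacks, is the point of the notion:
  polynomials in Gaussian variables stay inside it. The n-th powers are paired by
  Cauchy-Schwarz.\<close>

lemma all_moments_mult:
  assumes "all_moments M f" "all_moments M g"
  shows "all_moments M (\<lambda>x. f x * g x)"
  unfolding all_moments_def
proof (intro conjI allI)
  have [measurable]: "f \<in> borel_measurable M" "g \<in> borel_measurable M" using assms by auto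
  show "(\<lambda>x. f x * g x) \<in> borel_measurable M" by measurable
  fix n
  have "L2 M (\<lambda>x. \<bar>f x\<bar> ^ n)" "L2 M (\<lambda>x. \<bar>g x\<bar> ^ n)"
    using assms by (auto simp: all_moments_def power_mult[symmetric] intro!: L2_I)
  from L2_mult[OF this] show "integrable M (\<lambda>x. \<bar>f x * g x\<bar> ^ n)"
    by (simp add: abs_mult power_mult_distrib)
qed

lemma all_moments_add:
  assumes "all_moments M f" "all_moments M g"
  shows "all_moments M (\<lambda>x. f x + g x)"
  unfolding all_moments_def
proof (intro conjI allI)
  have [measurable]: "f \<in> borel_measurable M" "g \<in> borel_measurable M" using assms by auto
  show "(\<lambda>x. f x + g x) \<in> borel_measurable M" by measurable
  fix n
  have i: "integrable M (\<lambda>x. 2 ^ n * \<bar>f x\<bar> ^ n + 2 ^ n * \<bar>g x\<bar> ^ n)"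
    using assms by (auto simp: all_moments_def)
  have "\<bar>a + b\<bar> ^ n \<le> 2 ^ n * \<bar>a\<bar> ^ n + 2 ^ n * \<bar>b\<bar> ^ n" for a b :: real
  proof -
    have "\<bar>a + b\<bar> ^ n \<le> (2 * max \<bar>a\<bar> \<bar>b\<bar>) ^ n" by (rule power_mono) auto
    also have "\<dots> = 2 ^ n * (max \<bar>a\<bar> \<bar>b\<bar>) ^ n" by (rule power_mult_distrib)
    also have "\<dots> \<le> 2 ^ n * (\<bar>a\<bar> ^ n + \<bar>b\<bar> ^ n)" by (intro mult_left_mono) (auto simp: max_def)
    finally show ?thesis by (simp add: distrib_left)
  qed
  then show "integrable M (\<lambda>x. \<bar>f x + g x\<bar> ^ n)"
    by (intro Bochner_Integration.integrable_bound[OF i]) auto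
qed

lemma (in finite_measure) all_moments_const: "all_moments M (\<lambda>_. c)"
  by (auto simp: all_moments_def)

lemma (in finite_measure) all_moments_cmult: "all_moments M f \<Longrightarrow> all_moments M (\<lambda>x. c * f x)"
  by (rule all_moments_mult[OF all_moments_const])

lemma (in finite_measure) all_moments_diff: "all_moments M f \<Longrightarrow> all_moments M g \<Longrightarrow> all_moments M (\<lambda>x. f x - g x)"
  using all_moments_add[OF _ all_moments_cmult[of g "-1"], of f] by simp

lemma (in finite_measure) all_moments_prod:
  "(\<And>i. i \<in> I \<Longrightarrow> all_moments M (f i)) \<Longrightarrow> all_moments M (\<lambda>x. \<Prod>i\<in>I. f i x)"
  by (induction I rule: infinite_finite_induct) (auto intro: all_moments_const all_moments_mult)

lemma (in finite_measure) all_moments_power: "all_moments M f \<Longrightarrow> all_moments M (\<lambda>x. f x ^ n)"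
  by (induction n) (auto intro: all_moments_const all_moments_mult)

lemma (in finite_measure) all_moments_hermite:
  assumes "all_moments M f" shows "all_moments M (\<lambda>x. hermite n (f x))"
proof (induction n rule: less_induct)
  case (less n)
  show ?case
  proof (cases n)
    case (Suc m)
    then have "all_moments M (\<lambda>x. hermite m (f x))" "all_moments M (\<lambda>x. hermite (m - 1) (f x))"
      using less by auto
    then show ?thesis unfolding Suc hermite_simps(3)
      by (intro all_moments_diff all_moments_mult[OF assms] all_moments_cmult)
  qed (simp add: hermite_simps all_moments_const)
qed

lemma (in finite_measure) all_moments_wick:
  assumes "\<And>k i. all_moments M (\<xi> k i)" shows "all_moments M (wick_monomial \<xi> \<alpha>)"
  unfolding wick_monomial_def
  by (intro all_moments_cmult all_moments_prod) (auto intro: all_moments_hermite assms)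

text \<open>Differentiation under the integral with an explicit error: |exp(ix) - 1 - ix| <= x^2 / 2
  leaves a remainder of order l^2 E[|Z| R^2].\<close>

lemma (in prob_space) char_integral_derivative:
  fixes Z R :: "'a \<Rightarrow> real"
  assumes Z: "all_moments M Z" and R: "all_moments M R" and G[measurable]: "G \<in> borel_measurable M"
  shows "((\<lambda>l. LINT \<omega>|M. complex_of_real (Z \<omega>) * iexp (G \<omega> + l * R \<omega>)) has_vector_derivative
    \<i> * (LINT \<omega>|M. complex_of_real (Z \<omega> * R \<omega>) * iexp (G \<omega>))) (at 0)"
  unfolding has_vector_derivative_def
proof (rule has_derivativeI_sandwich[where e = 1])
  have [measurable]: "Z \<in> borel_measurable M" "R \<in> borel_measurable M" using Z R by auto
  have i: "integrable M (\<lambda>\<omega>. complex_of_real (U \<omega>) * iexp (V \<omega>))"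
    if "all_moments M U" "V \<in> borel_measurable M" for U V
    using all_moments_integrable[OF that(1)] by (intro integrable_iexp_mult that(2)) simp
  let ?K = "LINT \<omega>|M. \<bar>Z \<omega>\<bar> * (R \<omega>)\<^sup>2"
  have K: "integrable M (\<lambda>\<omega>. \<bar>Z \<omega>\<bar> * (R \<omega>)\<^sup>2)"
    using all_moments_integrable[OF all_moments_mult[OF Z all_moments_power[OF R, of 2]]]
    by (subst (asm) integrable_abs_iff[symmetric]) (auto simp: abs_mult)
  show "bounded_linear (\<lambda>x. x *\<^sub>R (\<i> * (LINT \<omega>|M. complex_of_real (Z \<omega> * R \<omega>) * iexp (G \<omega>))))"
    by (rule bounded_linear_scaleR_left)
  show "norm ((LINT \<omega>|M. complex_of_real (Z \<omega>) * iexp (G \<omega> + l * R \<omega>)) -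
       (LINT \<omega>|M. complex_of_real (Z \<omega>) * iexp (G \<omega> + 0 * R \<omega>)) -
       (l - 0) *\<^sub>R (\<i> * (LINT \<omega>|M. complex_of_real (Z \<omega> * R \<omega>) * iexp (G \<omega>)))) / norm (l - 0) \<le> ?K / 2 * \<bar>l\<bar>"
    if "l \<noteq> 0" for l :: real
  proof -
    have 1: "integrable M (\<lambda>\<omega>. complex_of_real (Z \<omega>) * iexp (G \<omega> + l * R \<omega>))"
      "integrable M (\<lambda>\<omega>. complex_of_real (Z \<omega>) * iexp (G \<omega>))"
      "integrable M (\<lambda>\<omega>. complex_of_real (Z \<omega> * R \<omega>) * iexp (G \<omega>))"
      by (intro i Z all_moments_mult R; measurable)+
    define A where "A = (\<lambda>\<omega>. complex_of_real (Z \<omega>) * iexp (G \<omega> + l * R \<omega>))"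
    define B where "B = (\<lambda>\<omega>. complex_of_real (Z \<omega>) * iexp (G \<omega>))"
    define C where "C = (\<lambda>\<omega>. complex_of_real (Z \<omega> * R \<omega>) * iexp (G \<omega>))"
    note 1 = 1[folded A_def B_def C_def]
    let ?f = "\<lambda>\<omega>. A \<omega> - B \<omega> - (\<i> * complex_of_real l) * C \<omega>"
    have eq: "(LINT \<omega>|M. A \<omega>) - (LINT \<omega>|M. B \<omega>) - (l - 0) *\<^sub>R (\<i> * (LINT \<omega>|M. C \<omega>)) = (LINT \<omega>|M. ?f \<omega>)"
      using 1 by (simp add: scaleR_conv_of_real mult.assoc[symmetric] mult.commute[of \<i>])
    have "norm (LINT \<omega>|M. ?f \<omega>) \<le> (LINT \<omega>|M. l\<^sup>2 / 2 * (\<bar>Z \<omega>\<bar> * (R \<omega>)\<^sup>2))"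
    proof (rule norm_integral_le)
      show "integrable M ?f" using 1 by simp
      show "integrable M (\<lambda>\<omega>. l\<^sup>2 / 2 * (\<bar>Z \<omega>\<bar> * (R \<omega>)\<^sup>2))" using K by simp
      fix \<omega>
      have eq': "?f \<omega> = complex_of_real (Z \<omega>) * iexp (G \<omega>) * (iexp (l * R \<omega>) - (1 + \<i> * (l * R \<omega>)))"
        by (simp add: A_def B_def C_def exp_add algebra_simps)
      have "cmod (iexp (l * R \<omega>) - (1 + \<i> * (l * R \<omega>))) \<le> \<bar>l * R \<omega>\<bar>\<^sup>2 / 2"
        using iexp_approx1[of "l * R \<omega>" 1] by (simp add: power2_eq_square)
      then have "norm (?f \<omega>) \<le> \<bar>Z \<omega>\<bar> * (\<bar>l * R \<omega>\<bar>\<^sup>2 / 2)"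
        unfolding eq' norm_mult by (intro mult_mono) auto
      then show "norm (?f \<omega>) \<le> l\<^sup>2 / 2 * (\<bar>Z \<omega>\<bar> * (R \<omega>)\<^sup>2)"
        by (simp add: power_mult_distrib abs_mult mult_ac)
    qed
    also have "\<dots> = ?K / 2 * \<bar>l\<bar> * \<bar>l\<bar>" by (simp add: power2_eq_square mult_ac flip: abs_mult)
    finally have "norm (LINT \<omega>|M. ?f \<omega>) / norm (l - 0) \<le> ?K / 2 * \<bar>l\<bar>" using that by (simp add: divide_le_eq)
    then show ?thesis unfolding eq[symmetric] unfolding A_def B_def C_def by simp
  qed
  show "((\<lambda>l. ?K / 2 * \<bar>l\<bar>) \<longlongrightarrow> 0) (at 0)"
    by (intro tendsto_mult_right_zero tendsto_rabs_zero tendsto_ident_at)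
qed simp

subsection \<open>Gaussian integration by parts\<close>

text \<open>The hypothesis \<open>shift\<close> says that under the weight \<open>Y\<close> the variable \<open>D\<close> behaves like a centred
  Gaussian of variance \<open>\<kappa>\<close> with covariances \<open>\<gamma> p\<close> to the coordinates \<open>x p\<close>. Differentiating it in
  \<open>l\<close> at \<open>0\<close> gives integration by parts against exponentials of the coordinates, and
  differentiating further along the coordinates gives it for polynomials.\<close>

locale gaussian_ibp = prob_space M for M :: "'a measure" +
  fixes x :: "'i \<Rightarrow> 'a \<Rightarrow> real" and \<gamma> :: "'i \<Rightarrow> real" and Y D :: "'a \<Rightarrow> real" and \<kappa> :: real
  assumes x_mom: "\<And>p. all_moments M (x p)" and Y_mom: "all_moments M Y" and D_mom: "all_moments M D"
    and shift: "\<And>S c l. finite S \<Longrightarrow>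
      (LINT \<omega>|M. complex_of_real (Y \<omega>) * iexp ((\<Sum>p\<in>S. c p * x p \<omega>) + l * D \<omega>)) =
      (LINT \<omega>|M. complex_of_real (Y \<omega>) * iexp (\<Sum>p\<in>S. c p * x p \<omega>)) *
        complex_of_real (exp (- (l * (\<Sum>p\<in>S. c p * \<gamma> p)) - l\<^sup>2 * \<kappa> / 2))"
begin

abbreviation "lin S c \<omega> \<equiv> (\<Sum>p\<in>S. c p * x p \<omega>)"

text \<open>Integration by parts against U exp(iL) with L linear in the coordinates: the first term
  differentiates the exponential, \<open>V\<close> stands for the derivative of \<open>U\<close>.
  The exponential is kept so that the identity can be differentiated in the coefficients of
  L.\<close>

definition good :: "('a \<Rightarrow> real) \<Rightarrow> ('a \<Rightarrow> real) \<Rightarrow> bool" where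
  "good U V \<longleftrightarrow> all_moments M U \<and> all_moments M V \<and> (\<forall>S c. finite S \<longrightarrow>
    (LINT \<omega>|M. complex_of_real (Y \<omega> * D \<omega> * U \<omega>) * iexp (lin S c \<omega>)) =
    \<i> * (\<Sum>p\<in>S. c p * \<gamma> p) * (LINT \<omega>|M. complex_of_real (Y \<omega> * U \<omega>) * iexp (lin S c \<omega>)) +
    (LINT \<omega>|M. complex_of_real (Y \<omega> * V \<omega>) * iexp (lin S c \<omega>)))"

lemma goodD:
  assumes "good U V" "finite S"
  shows "(LINT \<omega>|M. complex_of_real (Y \<omega> * D \<omega> * U \<omega>) * iexp (lin S c \<omega>)) =
    \<i> * (\<Sum>p\<in>S. c p * \<gamma> p) * (LINT \<omega>|M. complex_of_real (Y \<omega> * U \<omega>) * iexp (lin S c \<omega>)) +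
    (LINT \<omega>|M. complex_of_real (Y \<omega> * V \<omega>) * iexp (lin S c \<omega>))"
  using assms unfolding good_def by blast

lemma lin_measurable[measurable]: "lin S c \<in> borel_measurable M"
  by (intro borel_measurable_sum borel_measurable_times borel_measurable_const all_moments_measurable x_mom)

lemma integrable_char:
  assumes "all_moments M U"
  shows "integrable M (\<lambda>\<omega>. complex_of_real (U \<omega>) * iexp (lin S c \<omega>))"
  using all_moments_integrable[OF assms] by (intro integrable_iexp_mult lin_measurable) simp

text \<open>The derivative of \<open>shift\<close> at \<open>l = 0\<close>, where the term quadratic
  in \<open>l\<close> drops out.\<close>

lemma good_1: "good (\<lambda>_. 1) (\<lambda>_. 0)"
  unfolding good_def
proof (intro conjI allI impI all_moments_const)
  fix S c assume S: "finite (S :: 'i set)"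
  define g where "g = (\<Sum>p\<in>S. c p * \<gamma> p)"
  define A where "A = (LINT \<omega>|M. complex_of_real (Y \<omega>) * iexp (lin S c \<omega>))"
  have 1: "((\<lambda>l. LINT \<omega>|M. complex_of_real (Y \<omega>) * iexp (lin S c \<omega> + l * D \<omega>)) has_vector_derivative
    \<i> * (LINT \<omega>|M. complex_of_real (Y \<omega> * D \<omega>) * iexp (lin S c \<omega>))) (at 0)"
    by (rule char_integral_derivative[OF Y_mom D_mom lin_measurable])
  have e: "((\<lambda>l. exp (- (l * g) - l\<^sup>2 * \<kappa> / 2)) has_real_derivative - g) (at 0)"
    by (auto intro!: derivative_eq_intros)
  have "((\<lambda>l. A * complex_of_real (exp (- (l * g) - l\<^sup>2 * \<kappa> / 2))) has_vector_derivative A * complex_of_real (- g)) (at 0)"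
    by (rule has_vector_derivative_mult_right[OF has_vector_derivative_of_real[OF e]])
  then have "((\<lambda>l. LINT \<omega>|M. complex_of_real (Y \<omega>) * iexp (lin S c \<omega> + l * D \<omega>)) has_vector_derivative A * complex_of_real (- g)) (at 0)"
    unfolding shift[OF S] A_def g_def .
  from vector_derivative_unique_at[OF 1 this]
  have X: "\<i> * (LINT \<omega>|M. complex_of_real (Y \<omega> * D \<omega>) * iexp (lin S c \<omega>)) = A * complex_of_real (- g)" .
  have "X = \<i> * complex_of_real g * A" if "\<i> * X = A * complex_of_real (- g)" for X
  proof -
    have "X = - (\<i> * (\<i> * X))" by (simp add: mult.assoc[symmetric])
    also have "\<dots> = \<i> * complex_of_real g * A" unfolding that by simp
    finally show ?thesis .
  qed
  from this[OF X] have "(LINT \<omega>|M. complex_of_real (Y \<omega> * D \<omega>) * iexp (lin S c \<omega>)) = \<i> * complex_of_real g * A" .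
  then show "(LINT \<omega>|M. complex_of_real (Y \<omega> * D \<omega> * 1) * iexp (lin S c \<omega>)) =
    \<i> * complex_of_real g * (LINT \<omega>|M. complex_of_real (Y \<omega> * 1) * iexp (lin S c \<omega>)) +
    (LINT \<omega>|M. complex_of_real (Y \<omega> * 0) * iexp (lin S c \<omega>))"
    by (simp only: mult_1_right mult_zero_right of_real_0 mult_zero_left Bochner_Integration.integral_zero add_0_right A_def)
qed

lemma good_linear:
  assumes "good U V" "good U' V'"
  shows "good (\<lambda>\<omega>. a * U \<omega> + b * U' \<omega>) (\<lambda>\<omega>. a * V \<omega> + b * V' \<omega>)"
  unfolding good_def
proof (intro conjI allI impI)
  have m: "all_moments M U" "all_moments M V" "all_moments M U'" "all_moments M V'"
    using assms by (auto simp: good_def)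
  show "all_moments M (\<lambda>\<omega>. a * U \<omega> + b * U' \<omega>)" "all_moments M (\<lambda>\<omega>. a * V \<omega> + b * V' \<omega>)"
    using m by (intro all_moments_add all_moments_cmult; simp)+
  fix S c assume S: "finite (S :: 'i set)"
  define E where "E = (\<lambda>Z. LINT \<omega>|M. complex_of_real (Z \<omega>) * iexp (lin S c \<omega>))"
  have E: "E (\<lambda>\<omega>. Z \<omega> * (a * U1 \<omega> + b * U2 \<omega>)) = complex_of_real a * E (\<lambda>\<omega>. Z \<omega> * U1 \<omega>) + complex_of_real b * E (\<lambda>\<omega>. Z \<omega> * U2 \<omega>)"
    if "all_moments M Z" "all_moments M U1" "all_moments M U2" for Z U1 U2
  proof -
    have "E (\<lambda>\<omega>. Z \<omega> * (a * U1 \<omega> + b * U2 \<omega>)) =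
      (LINT \<omega>|M. complex_of_real a * (complex_of_real (Z \<omega> * U1 \<omega>) * iexp (lin S c \<omega>)) +
        complex_of_real b * (complex_of_real (Z \<omega> * U2 \<omega>) * iexp (lin S c \<omega>)))"
      unfolding E_def by (intro Bochner_Integration.integral_cong refl) (simp add: algebra_simps)
    also have "\<dots> = complex_of_real a * E (\<lambda>\<omega>. Z \<omega> * U1 \<omega>) + complex_of_real b * E (\<lambda>\<omega>. Z \<omega> * U2 \<omega>)"
      unfolding E_def
      using integrable_char[OF all_moments_mult[OF that(1,2)]] integrable_char[OF all_moments_mult[OF that(1,3)]]
      by (subst Bochner_Integration.integral_add) (simp_all del: of_real_mult of_real_sum)
    finally show ?thesis .
  qed
  have g: "E (\<lambda>\<omega>. Y \<omega> * D \<omega> * U \<omega>) = \<i> * (\<Sum>p\<in>S. c p * \<gamma> p) * E (\<lambda>\<omega>. Y \<omega> * U \<omega>) + E (\<lambda>\<omega>. Y \<omega> * V \<omega>)"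
    "E (\<lambda>\<omega>. Y \<omega> * D \<omega> * U' \<omega>) = \<i> * (\<Sum>p\<in>S. c p * \<gamma> p) * E (\<lambda>\<omega>. Y \<omega> * U' \<omega>) + E (\<lambda>\<omega>. Y \<omega> * V' \<omega>)"
    unfolding E_def by (rule goodD[OF assms(1) S], rule goodD[OF assms(2) S])
  have "E (\<lambda>\<omega>. Y \<omega> * D \<omega> * (a * U \<omega> + b * U' \<omega>)) =
      \<i> * (\<Sum>p\<in>S. c p * \<gamma> p) * E (\<lambda>\<omega>. Y \<omega> * (a * U \<omega> + b * U' \<omega>)) + E (\<lambda>\<omega>. Y \<omega> * (a * V \<omega> + b * V' \<omega>))"
    unfolding E[OF all_moments_mult[OF Y_mom D_mom] m(1,3)] E[OF Y_mom m(1,3)] E[OF Y_mom m(2,4)] g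
    by (simp add: algebra_simps)
  then show "(LINT \<omega>|M. complex_of_real (Y \<omega> * D \<omega> * (a * U \<omega> + b * U' \<omega>)) * iexp (lin S c \<omega>)) =
    \<i> * (\<Sum>p\<in>S. c p * \<gamma> p) * (LINT \<omega>|M. complex_of_real (Y \<omega> * (a * U \<omega> + b * U' \<omega>)) * iexp (lin S c \<omega>)) +
    (LINT \<omega>|M. complex_of_real (Y \<omega> * (a * V \<omega> + b * V' \<omega>)) * iexp (lin S c \<omega>))"
    unfolding E_def .
qed

text \<open>The identity for the exponent L + l x_p is differentiated at \<open>l = 0\<close>. Its
  prefactor there is g + l \<gamma>_p, and the product rule produces the new summand
  \<open>\<gamma> p * U\<close>.\<close>

lemma good_coord:
  assumes UV: "good U V"
  shows "good (\<lambda>\<omega>. x p \<omega> * U \<omega>) (\<lambda>\<omega>. \<gamma> p * U \<omega> + x p \<omega> * V \<omega>)"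
  unfolding good_def
proof (intro conjI allI impI)
  have m: "all_moments M U" "all_moments M V" using UV by (auto simp: good_def)
  show "all_moments M (\<lambda>\<omega>. x p \<omega> * U \<omega>)" "all_moments M (\<lambda>\<omega>. \<gamma> p * U \<omega> + x p \<omega> * V \<omega>)"
    using m x_mom by (intro all_moments_add all_moments_cmult all_moments_mult; simp)+
  fix S c assume S: "finite (S :: 'i set)"
  define E where "E = (\<lambda>Z. LINT \<omega>|M. complex_of_real (Z \<omega>) * iexp (lin S c \<omega>))"
  define F where "F = (\<lambda>Z l. LINT \<omega>|M. complex_of_real (Z \<omega>) * iexp (lin S c \<omega> + l * x p \<omega>))"
  define g where "g = (\<Sum>p\<in>S. c p * \<gamma> p)"
  let ?S = "insert p S"
  \<comment> \<open>Whether or not \<open>p\<close> lies in \<open>S\<close>, its coefficient is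
    increased by \<open>l\<close>.\<close>
  let ?c = "\<lambda>l q. (if q \<in> S then c q else 0) + (if q = p then l else 0)"
  have sumS: "(\<Sum>q\<in>?S. ?c l q * h q) = (\<Sum>q\<in>S. c q * h q) + l * h p" for l and h :: "'i \<Rightarrow> real"
  proof -
    have "(\<Sum>q\<in>?S. ?c l q * h q) = (\<Sum>q\<in>?S. (if q \<in> S then c q * h q else 0) + (if q = p then l * h q else 0))"
      by (intro sum.cong) (auto simp: distrib_right)
    also have "\<dots> = (\<Sum>q\<in>?S. if q \<in> S then c q * h q else 0) + l * h p"
      using S by (simp add: sum.distrib)
    also have "(\<Sum>q\<in>?S. if q \<in> S then c q * h q else 0) = (\<Sum>q\<in>S. c q * h q)"
      using S by (intro sum.mono_neutral_cong_right) auto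
    finally show ?thesis .
  qed
  have eq: "F (\<lambda>\<omega>. Y \<omega> * D \<omega> * U \<omega>) l = \<i> * complex_of_real (g + l * \<gamma> p) * F (\<lambda>\<omega>. Y \<omega> * U \<omega>) l + F (\<lambda>\<omega>. Y \<omega> * V \<omega>) l" for l
  proof -
    have "finite ?S" using S by simp
    then have "(LINT \<omega>|M. complex_of_real (Y \<omega> * D \<omega> * U \<omega>) * iexp (lin ?S (?c l) \<omega>)) =
      \<i> * (\<Sum>p\<in>?S. ?c l p * \<gamma> p) * (LINT \<omega>|M. complex_of_real (Y \<omega> * U \<omega>) * iexp (lin ?S (?c l) \<omega>)) +
      (LINT \<omega>|M. complex_of_real (Y \<omega> * V \<omega>) * iexp (lin ?S (?c l) \<omega>))"
      by (rule goodD[OF UV])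
    then show ?thesis unfolding sumS F_def g_def .
  qed
  have F': "(F Z has_vector_derivative \<i> * E (\<lambda>\<omega>. Z \<omega> * x p \<omega>)) (at 0)" if "all_moments M Z" for Z
    unfolding F_def E_def by (rule char_integral_derivative[OF that x_mom lin_measurable])
  have F0: "F Z 0 = E Z" for Z by (simp add: F_def E_def)
  have m': "all_moments M (\<lambda>\<omega>. Y \<omega> * D \<omega> * U \<omega>)" "all_moments M (\<lambda>\<omega>. Y \<omega> * U \<omega>)" "all_moments M (\<lambda>\<omega>. Y \<omega> * V \<omega>)"
    using m Y_mom D_mom by (intro all_moments_mult; simp)+
  have gd: "((\<lambda>l. complex_of_real (g + l * \<gamma> p)) has_vector_derivative complex_of_real (\<gamma> p)) (at 0)"
    by (rule has_vector_derivative_of_real) (auto intro!: derivative_eq_intros)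
  have "((\<lambda>l. \<i> * complex_of_real (g + l * \<gamma> p)) has_vector_derivative \<i> * complex_of_real (\<gamma> p)) (at 0)"
    by (rule has_vector_derivative_mult_right[OF gd])
  from has_vector_derivative_add[OF has_vector_derivative_mult[OF this F'[OF m'(2)]] F'[OF m'(3)]]
  have "((\<lambda>l. \<i> * complex_of_real (g + l * \<gamma> p) * F (\<lambda>\<omega>. Y \<omega> * U \<omega>) l + F (\<lambda>\<omega>. Y \<omega> * V \<omega>) l) has_vector_derivative
      \<i> * complex_of_real g * (\<i> * E (\<lambda>\<omega>. Y \<omega> * U \<omega> * x p \<omega>)) + \<i> * complex_of_real (\<gamma> p) * E (\<lambda>\<omega>. Y \<omega> * U \<omega>)
      + \<i> * E (\<lambda>\<omega>. Y \<omega> * V \<omega> * x p \<omega>)) (at 0)"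
    by (simp add: F0)
  note der = this
  have feq: "F (\<lambda>\<omega>. Y \<omega> * D \<omega> * U \<omega>) = (\<lambda>l. \<i> * complex_of_real (g + l * \<gamma> p) * F (\<lambda>\<omega>. Y \<omega> * U \<omega>) l + F (\<lambda>\<omega>. Y \<omega> * V \<omega>) l)"
    by (rule ext) (rule eq)
  have "(F (\<lambda>\<omega>. Y \<omega> * D \<omega> * U \<omega>) has_vector_derivative
      \<i> * complex_of_real g * (\<i> * E (\<lambda>\<omega>. Y \<omega> * U \<omega> * x p \<omega>)) + \<i> * complex_of_real (\<gamma> p) * E (\<lambda>\<omega>. Y \<omega> * U \<omega>)
      + \<i> * E (\<lambda>\<omega>. Y \<omega> * V \<omega> * x p \<omega>)) (at 0)"
    unfolding feq by (rule der)
  from vector_derivative_unique_at[OF F'[OF m'(1)] this]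
  have "\<i> * E (\<lambda>\<omega>. Y \<omega> * D \<omega> * U \<omega> * x p \<omega>) = \<i> * (\<i> * complex_of_real g * E (\<lambda>\<omega>. Y \<omega> * U \<omega> * x p \<omega>) +
      (complex_of_real (\<gamma> p) * E (\<lambda>\<omega>. Y \<omega> * U \<omega>) + E (\<lambda>\<omega>. Y \<omega> * V \<omega> * x p \<omega>)))"
    by (simp add: algebra_simps)
  then have 1: "E (\<lambda>\<omega>. Y \<omega> * D \<omega> * U \<omega> * x p \<omega>) = \<i> * complex_of_real g * E (\<lambda>\<omega>. Y \<omega> * U \<omega> * x p \<omega>) +
      (complex_of_real (\<gamma> p) * E (\<lambda>\<omega>. Y \<omega> * U \<omega>) + E (\<lambda>\<omega>. Y \<omega> * V \<omega> * x p \<omega>))"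
    by (subst (asm) mult_cancel_left) simp
  have i: "integrable M (\<lambda>\<omega>. complex_of_real (Y \<omega> * U \<omega>) * iexp (lin S c \<omega>))"
    "integrable M (\<lambda>\<omega>. complex_of_real (Y \<omega> * V \<omega> * x p \<omega>) * iexp (lin S c \<omega>))"
    by (rule integrable_char[OF m'(2)], rule integrable_char[OF all_moments_mult[OF m'(3) x_mom]])
  have "E (\<lambda>\<omega>. Y \<omega> * (\<gamma> p * U \<omega> + x p \<omega> * V \<omega>)) =
      (LINT \<omega>|M. complex_of_real (\<gamma> p) * (complex_of_real (Y \<omega> * U \<omega>) * iexp (lin S c \<omega>)) +
        complex_of_real (Y \<omega> * V \<omega> * x p \<omega>) * iexp (lin S c \<omega>))"
    unfolding E_def by (intro Bochner_Integration.integral_cong refl) (simp add: algebra_simps)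
  also have "\<dots> = complex_of_real (\<gamma> p) * E (\<lambda>\<omega>. Y \<omega> * U \<omega>) + E (\<lambda>\<omega>. Y \<omega> * V \<omega> * x p \<omega>)"
    unfolding E_def using i by (subst Bochner_Integration.integral_add) (simp_all del: of_real_mult of_real_sum)
  finally have 2: "E (\<lambda>\<omega>. Y \<omega> * (\<gamma> p * U \<omega> + x p \<omega> * V \<omega>)) = \<dots>" .
  have "E (\<lambda>\<omega>. Y \<omega> * D \<omega> * (x p \<omega> * U \<omega>)) = \<i> * complex_of_real g * E (\<lambda>\<omega>. Y \<omega> * (x p \<omega> * U \<omega>)) +
      E (\<lambda>\<omega>. Y \<omega> * (\<gamma> p * U \<omega> + x p \<omega> * V \<omega>))"
  proof -
    have e: "(\<lambda>\<omega>. Y \<omega> * D \<omega> * (x p \<omega> * U \<omega>)) = (\<lambda>\<omega>. Y \<omega> * D \<omega> * U \<omega> * x p \<omega>)"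
      "(\<lambda>\<omega>. Y \<omega> * (x p \<omega> * U \<omega>)) = (\<lambda>\<omega>. Y \<omega> * U \<omega> * x p \<omega>)"
      by (simp_all add: fun_eq_iff mult_ac)
    show ?thesis unfolding 2 e by (rule 1)
  qed
  then show "(LINT \<omega>|M. complex_of_real (Y \<omega> * D \<omega> * (x p \<omega> * U \<omega>)) * iexp (lin S c \<omega>)) =
    \<i> * (\<Sum>p\<in>S. c p * \<gamma> p) * (LINT \<omega>|M. complex_of_real (Y \<omega> * (x p \<omega> * U \<omega>)) * iexp (lin S c \<omega>)) +
    (LINT \<omega>|M. complex_of_real (Y \<omega> * (\<gamma> p * U \<omega> + x p \<omega> * V \<omega>)) * iexp (lin S c \<omega>))"
    unfolding E_def g_def .
qed

text \<open>\<open>V\<close> is the derivative of \<open>U\<close> in the direction \<open>\<gamma>\<close>; stated so that it composes under products.\<close>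

definition dpair :: "('a \<Rightarrow> real) \<Rightarrow> ('a \<Rightarrow> real) \<Rightarrow> bool" where
  "dpair U V \<longleftrightarrow> (\<forall>U0 V0. good U0 V0 \<longrightarrow> good (\<lambda>\<omega>. U \<omega> * U0 \<omega>) (\<lambda>\<omega>. V \<omega> * U0 \<omega> + U \<omega> * V0 \<omega>))"

lemma dpair_coord: "dpair (x p) (\<lambda>_. \<gamma> p)"
  by (simp add: dpair_def good_coord)

lemma dpair_linear:
  assumes "dpair U V" "dpair U' V'"
  shows "dpair (\<lambda>\<omega>. a * U \<omega> + b * U' \<omega>) (\<lambda>\<omega>. a * V \<omega> + b * V' \<omega>)"
  unfolding dpair_def
proof (intro allI impI)
  fix U0 V0 assume g: "good U0 V0"
  have "good (\<lambda>\<omega>. a * (U \<omega> * U0 \<omega>) + b * (U' \<omega> * U0 \<omega>))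
      (\<lambda>\<omega>. a * (V \<omega> * U0 \<omega> + U \<omega> * V0 \<omega>) + b * (V' \<omega> * U0 \<omega> + U' \<omega> * V0 \<omega>))"
    using assms g by (intro good_linear) (auto simp: dpair_def)
  then show "good (\<lambda>\<omega>. (a * U \<omega> + b * U' \<omega>) * U0 \<omega>) (\<lambda>\<omega>. (a * V \<omega> + b * V' \<omega>) * U0 \<omega> + (a * U \<omega> + b * U' \<omega>) * V0 \<omega>)"
    by (simp add: algebra_simps)
qed

lemma dpair_mult:
  assumes "dpair U V" "dpair U' V'"
  shows "dpair (\<lambda>\<omega>. U \<omega> * U' \<omega>) (\<lambda>\<omega>. V \<omega> * U' \<omega> + U \<omega> * V' \<omega>)"
  unfolding dpair_def
proof (intro allI impI)
  fix U0 V0 assume g: "good U0 V0"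
  have "good (\<lambda>\<omega>. U' \<omega> * U0 \<omega>) (\<lambda>\<omega>. V' \<omega> * U0 \<omega> + U' \<omega> * V0 \<omega>)"
    using assms(2) g by (simp add: dpair_def)
  then have "good (\<lambda>\<omega>. U \<omega> * (U' \<omega> * U0 \<omega>)) (\<lambda>\<omega>. V \<omega> * (U' \<omega> * U0 \<omega>) + U \<omega> * (V' \<omega> * U0 \<omega> + U' \<omega> * V0 \<omega>))"
    using assms(1) unfolding dpair_def by blast
  then show "good (\<lambda>\<omega>. U \<omega> * U' \<omega> * U0 \<omega>) (\<lambda>\<omega>. (V \<omega> * U' \<omega> + U \<omega> * V' \<omega>) * U0 \<omega> + U \<omega> * U' \<omega> * V0 \<omega>)"
    by (simp add: algebra_simps)
qed

lemma dpair_1: "dpair (\<lambda>_. 1) (\<lambda>_. 0)"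
  by (simp add: dpair_def)

lemma dpair_prod:
  assumes "finite K" "\<And>p. p \<in> K \<Longrightarrow> dpair (U p) (V p)"
  shows "dpair (\<lambda>\<omega>. \<Prod>p\<in>K. U p \<omega>) (\<lambda>\<omega>. \<Sum>p\<in>K. V p \<omega> * (\<Prod>q\<in>K - {p}. U q \<omega>))"
  using assms
proof (induction K)
  case empty
  then show ?case by (simp add: dpair_1)
next
  case (insert a K)
  have eq: "(\<Prod>q\<in>insert a K - {p}. U q \<omega>) = U a \<omega> * (\<Prod>q\<in>K - {p}. U q \<omega>)" if "p \<in> K" for p \<omega>
  proof -
    have "insert a K - {p} = insert a (K - {p})" using that insert.hyps by auto
    then show ?thesis using insert.hyps by simp
  qed
  have "(\<Sum>p\<in>insert a K. V p \<omega> * (\<Prod>q\<in>insert a K - {p}. U q \<omega>)) =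
      V a \<omega> * (\<Prod>p\<in>K. U p \<omega>) + U a \<omega> * (\<Sum>p\<in>K. V p \<omega> * (\<Prod>q\<in>K - {p}. U q \<omega>))" for \<omega>
    using insert.hyps by (simp add: eq sum_distrib_left mult.left_commute cong: sum.cong)
  moreover have "dpair (\<lambda>\<omega>. U a \<omega> * (\<Prod>p\<in>K. U p \<omega>))
      (\<lambda>\<omega>. V a \<omega> * (\<Prod>p\<in>K. U p \<omega>) + U a \<omega> * (\<Sum>p\<in>K. V p \<omega> * (\<Prod>q\<in>K - {p}. U q \<omega>)))"
    using insert by (intro dpair_mult) auto
  ultimately show ?case using insert.hyps by simp
qed

text \<open>Strong induction through the recurrence. Its derivative is brought back to n h_(n-1) by
  substituting the recurrence one step lower.\<close>

lemma dpair_hermite: "dpair (\<lambda>\<omega>. hermite n (x p \<omega>)) (\<lambda>\<omega>. \<gamma> p * (real n * hermite (n - 1) (x p \<omega>)))"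
proof (induction n rule: less_induct)
  case (less n)
  show ?case
  proof (cases n)
    case 0
    then show ?thesis by (simp add: hermite_simps dpair_1)
  next
    case (Suc m)
    have dp: "dpair (\<lambda>\<omega>. 1 * (x p \<omega> * hermite m (x p \<omega>)) + (- real m) * hermite (m - 1) (x p \<omega>))
       (\<lambda>\<omega>. 1 * (\<gamma> p * hermite m (x p \<omega>) + x p \<omega> * (\<gamma> p * (real m * hermite (m - 1) (x p \<omega>)))) +
         (- real m) * (\<gamma> p * (real (m - 1) * hermite (m - 1 - 1) (x p \<omega>))))"
      by (rule dpair_linear[OF dpair_mult[OF dpair_coord less.IH] less.IH]) (use Suc in auto)
    have E1: "1 * (\<gamma> p * hermite m y + y * (\<gamma> p * (real m * hermite (m - 1) y))) +
         (- real m) * (\<gamma> p * (real (m - 1) * hermite (m - 1 - 1) y)) =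
         \<gamma> p * (real n * hermite (n - 1) y)" for y
    proof (cases m)
      case 0
      then show ?thesis by (simp add: Suc)
    next
      case m: (Suc k)
      have *: "hermite m y = y * hermite (m - 1) y - real (m - 1) * hermite (m - 1 - 1) y"
        unfolding m diff_Suc_1 by (rule hermite_simps(3))
      have "\<gamma> p * H2 + y * (\<gamma> p * (a * H1)) + (- a) * (\<gamma> p * (b * H0)) = \<gamma> p * ((a + 1) * H2)"
        if "H2 = y * H1 - b * H0" for H0 H1 H2 a b :: real
        unfolding that by (simp add: algebra_simps)
      from this[OF *, of "real m"] show ?thesis using Suc by simp
    qed
    have E2: "hermite n y = 1 * (y * hermite m y) + (- real m) * hermite (m - 1) y" for y
      unfolding Suc hermite_simps(3) by simp
    show ?thesis using dp unfolding E1 E2[symmetric] .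
  qed
qed

lemma dpair_hermite_prod:
  "dpair (\<lambda>\<omega>. hermite_prod (\<lambda>p. x p \<omega>) \<alpha>)
    (\<lambda>\<omega>. \<Sum>p\<in>Poly_Mapping.keys \<alpha>. \<gamma> p * real (Poly_Mapping.lookup \<alpha> p) * hermite_prod (\<lambda>p. x p \<omega>) (\<alpha> - Poly_Mapping.single p 1))"
proof -
  have "dpair (\<lambda>\<omega>. \<Prod>p\<in>Poly_Mapping.keys \<alpha>. hermite (Poly_Mapping.lookup \<alpha> p) (x p \<omega>))
    (\<lambda>\<omega>. \<Sum>p\<in>Poly_Mapping.keys \<alpha>. (\<gamma> p * (real (Poly_Mapping.lookup \<alpha> p) * hermite (Poly_Mapping.lookup \<alpha> p - 1) (x p \<omega>))) *
       (\<Prod>q\<in>Poly_Mapping.keys \<alpha> - {p}. hermite (Poly_Mapping.lookup \<alpha> q) (x q \<omega>)))"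
    by (intro dpair_prod dpair_hermite) simp
  moreover have "(\<Sum>p\<in>Poly_Mapping.keys \<alpha>. (\<gamma> p * (real (Poly_Mapping.lookup \<alpha> p) * hermite (Poly_Mapping.lookup \<alpha> p - 1) (x p \<omega>))) *
       (\<Prod>q\<in>Poly_Mapping.keys \<alpha> - {p}. hermite (Poly_Mapping.lookup \<alpha> q) (x q \<omega>))) =
     (\<Sum>p\<in>Poly_Mapping.keys \<alpha>. \<gamma> p * real (Poly_Mapping.lookup \<alpha> p) * hermite_prod (\<lambda>p. x p \<omega>) (\<alpha> - Poly_Mapping.single p 1))" for \<omega>
    by (intro sum.cong refl) (simp add: hermite_prod_diff_single mult_ac del: One_nat_def)
  ultimately show ?thesis unfolding hermite_prod_def[of _ \<alpha>] by (simp del: One_nat_def)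
qed

text \<open>The pair acts on the constant 1, for which \<open>good_1\<close> holds; an empty set of
  coordinates removes the exponential.\<close>

lemma dpair_IBP:
  assumes "dpair U V"
  shows "(LINT \<omega>|M. Y \<omega> * D \<omega> * U \<omega>) = (LINT \<omega>|M. Y \<omega> * V \<omega>)"
proof -
  have "good (\<lambda>\<omega>. U \<omega> * 1) (\<lambda>\<omega>. V \<omega> * 1 + U \<omega> * 0)"
    using assms good_1 unfolding dpair_def by blast
  then have "good U V" by simp
  then have "(LINT \<omega>|M. complex_of_real (Y \<omega> * D \<omega> * U \<omega>) * iexp (lin {} (\<lambda>_. 0) \<omega>)) =
    \<i> * (\<Sum>p\<in>{}. 0 * \<gamma> p) * (LINT \<omega>|M. complex_of_real (Y \<omega> * U \<omega>) * iexp (lin {} (\<lambda>_. 0) \<omega>)) +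
    (LINT \<omega>|M. complex_of_real (Y \<omega> * V \<omega>) * iexp (lin {} (\<lambda>_. 0) \<omega>))"
    by (intro goodD) simp_all
  then have "complex_of_real (LINT \<omega>|M. Y \<omega> * D \<omega> * U \<omega>) = complex_of_real (LINT \<omega>|M. Y \<omega> * V \<omega>)"
    by (simp flip: integral_complex_of_real)
  then show ?thesis by simp
qed

end

text \<open>\<alpha>! is \<alpha>_p times the lowered factorial, so one square root of \<alpha>_p
  survives the normalisation.\<close>

lemma wick_derivative_coefficient:
  fixes \<alpha> :: "'m multi_index"
  assumes "p \<in> Poly_Mapping.keys \<alpha>"
  shows "1 / sqrt (multi_fact \<alpha>) * (real (Poly_Mapping.lookup \<alpha> p) * h) =
    sqrt (real (Poly_Mapping.lookup \<alpha> p)) * (1 / sqrt (multi_fact (\<alpha> - Poly_Mapping.single p 1)) * h)"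
proof -
  let ?a = "Poly_Mapping.lookup \<alpha> p"
  have "?a > 0" using assms by (simp add: in_keys_iff)
  then have "real ?a = sqrt (real ?a) * sqrt (real ?a)" by simp
  then show ?thesis
    unfolding multi_fact_diff_single[OF assms] real_sqrt_mult
    using \<open>?a > 0\<close> multi_fact_pos[of "\<alpha> - Poly_Mapping.single p 1"] by (simp add: field_simps)
qed

text \<open>The normalised form of \<open>dpair_hermite_prod\<close>: differentiation in the
  direction \<gamma> lowers the index at \<open>p\<close> with weight \<gamma>_p
  sqrt(\<alpha>_p).\<close>

lemma dpair_wick:
  fixes \<xi> :: "'m \<Rightarrow> nat \<Rightarrow> 'a \<Rightarrow> real"
  assumes "gaussian_ibp M (\<lambda>p. \<xi> (fst p) (snd p)) \<gamma> Y D \<kappa>"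
  shows "gaussian_ibp.dpair M (\<lambda>p. \<xi> (fst p) (snd p)) \<gamma> Y D (wick_monomial \<xi> \<alpha>)
    (\<lambda>\<omega>. \<Sum>p\<in>Poly_Mapping.keys \<alpha>. \<gamma> p * (sqrt (real (Poly_Mapping.lookup \<alpha> p)) *
       wick_monomial \<xi> (\<alpha> - Poly_Mapping.single p 1) \<omega>))"
proof -
  interpret gaussian_ibp M "\<lambda>p. \<xi> (fst p) (snd p)" \<gamma> Y D \<kappa> by fact
  let ?r = "1 / sqrt (multi_fact \<alpha>)"
  have 1: "(\<lambda>\<omega>. ?r * hermite_prod (\<lambda>p. \<xi> (fst p) (snd p) \<omega>) \<alpha> + 0 * 1) = wick_monomial \<xi> \<alpha>"
    by (simp add: fun_eq_iff wick_monomial_eq)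
  have 2: "?r * (\<Sum>p\<in>Poly_Mapping.keys \<alpha>. \<gamma> p * real (Poly_Mapping.lookup \<alpha> p) *
        hermite_prod (\<lambda>p. \<xi> (fst p) (snd p) \<omega>) (\<alpha> - Poly_Mapping.single p 1)) + 0 * 0 =
      (\<Sum>p\<in>Poly_Mapping.keys \<alpha>. \<gamma> p * (sqrt (real (Poly_Mapping.lookup \<alpha> p)) *
       wick_monomial \<xi> (\<alpha> - Poly_Mapping.single p 1) \<omega>))" for \<omega>
  proof -
    have "?r * (\<gamma> p * real (Poly_Mapping.lookup \<alpha> p) * hermite_prod (\<lambda>p. \<xi> (fst p) (snd p) \<omega>) (\<alpha> - Poly_Mapping.single p 1)) =
       \<gamma> p * (sqrt (real (Poly_Mapping.lookup \<alpha> p)) * wick_monomial \<xi> (\<alpha> - Poly_Mapping.single p 1) \<omega>)"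
      if "p \<in> Poly_Mapping.keys \<alpha>" for p
      unfolding wick_monomial_eq wick_derivative_coefficient[OF that, symmetric] by (simp only: mult_ac)
    then show ?thesis by (simp only: sum_distrib_left mult_zero_right add_0_right cong: sum.cong)
  qed
  \<comment> \<open>A zero multiple of the constant pair turns \<open>dpair_linear\<close> into a
    scaling rule; the equations \<open>1\<close> and \<open>2\<close> clear the zeros away.\<close>
  show ?thesis
    using dpair_linear[OF dpair_hermite_prod[of \<alpha>] dpair_1, of ?r 0] unfolding 1 2 .
qed

subsection \<open>Wick monomials\<close>

locale gaussian_coordinates = brownian M \<F> T W
  for M :: "'a measure" and \<F> T and W :: "real \<Rightarrow> 'a \<Rightarrow> real ^ 'm::finite" +
  fixes e :: "nat \<Rightarrow> real \<Rightarrow> real" and \<xi> :: "'m \<Rightarrow> nat \<Rightarrow> 'a \<Rightarrow> real"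
  assumes e_complete: "complete_orthonormal T e"
    and \<xi>_ito: "\<And>k i. is_ito_integral M \<F> (\<lambda>s \<omega>. W s \<omega> $ k) T (\<lambda>s \<omega>. e i s) (\<xi> k i)"
begin

abbreviation "wick \<equiv> wick_monomial \<xi>"
abbreviation "coord p \<equiv> \<xi> (fst p) (snd p)"
abbreviation "ecomp p \<equiv> at_comp (fst p) (e (snd p))"

lemma e_L2: "L2 (Leb T) (e i)"
  using e_complete by (simp add: complete_orthonormal_def)

lemma coord_gauss: "gauss (ecomp p) (coord p)"
  by (rule gauss_ito[OF e_L2 \<xi>_ito])

lemma gauss_all_moments:
  assumes "gauss f G" shows "all_moments M G"
  using gauss_moments(1)[OF assms] gauss_L2(2)[OF assms]
  by (auto simp: all_moments_def power_abs[symmetric] integrable_abs_iff)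

lemma coord_moments: "all_moments M (\<xi> k i)"
  using gauss_all_moments[OF coord_gauss[of "(k, i)"]] by simp

lemma wick_moments: "all_moments M (wick \<alpha>)"
  by (rule all_moments_wick[OF coord_moments])

lemma wick_L2: "L2 M (wick \<alpha>)"
  by (rule all_moments_L2[OF wick_moments])

lemma lin_gauss: "gauss (\<lambda>z. \<Sum>p\<in>S. c p * ecomp p z) (\<lambda>\<omega>. \<Sum>p\<in>S. c p * coord p \<omega>)"
  by (intro gauss_sum gauss_cmult coord_gauss)

lemma ecomp_inner: "(LINT z|Q. ecomp p z * ecomp q z) = (if p = q then 1 else 0)"
proof (cases "fst p = fst q")
  case True
  have "(\<lambda>z. ecomp p z * ecomp q z) = at_comp (fst p) (\<lambda>s. e (snd p) s * e (snd q) s)"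
    using True by (auto simp: at_comp_def fun_eq_iff)
  then have "(LINT z|Q. ecomp p z * ecomp q z) = (LINT s|Leb T. e (snd p) s * e (snd q) s)"
    using integral_at_comp(2)[OF L2_mult[OF e_L2 e_L2]] by simp
  also have "\<dots> = (if snd p = snd q then 1 else 0)"
    using e_complete by (simp add: complete_orthonormal_def)
  finally show ?thesis using True by (auto simp: prod_eq_iff)
next
  case False
  have "(\<lambda>z. ecomp p z * ecomp q z) = (\<lambda>_. 0)"
    using False by (auto simp: at_comp_def fun_eq_iff)
  then show ?thesis using False by auto
qed

lemma ecomp_incf:
  "(LINT z|Q. ecomp p z * incf a b (axis k 1) z) =
    (if fst p = k then (LINT s|Leb T. e (snd p) s * indicator {a<..b} s) else 0)"
  if "0 \<le> a" "a \<le> b" "b \<le> T"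
proof (cases "fst p = k")
  case True
  have "(\<lambda>z. ecomp p z * incf a b (axis k 1) z) = at_comp k (\<lambda>s. e (snd p) s * indicator {a<..b} s)"
    using True by (auto simp: at_comp_def incf_def axis_def fun_eq_iff)
  then show ?thesis
    using True integral_at_comp(2)[OF L2_mult[OF e_L2 L2_indicator[OF that]]] by simp
next
  case False
  then have "(\<lambda>z. ecomp p z * incf a b (axis k 1) z) = (\<lambda>_. 0)"
    by (auto simp: at_comp_def incf_def axis_def fun_eq_iff)
  then show ?thesis using False by simp
qed

text \<open>The instance with trivial weight and \<open>D\<close> a coordinate, which yields
  orthonormality. Here \<open>shift\<close> is the Gaussian transform of a linear form, its energy
  expanded by orthonormality of the e_i.\<close>

lemma ibp_coord: "gaussian_ibp M coord (\<lambda>p. if p = q then 1 else 0) (\<lambda>_. 1) (coord q) 1"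
proof unfold_locales
  fix S :: "('m \<times> nat) set" and c and l :: real assume S: "finite S"
  let ?f = "\<lambda>z. \<Sum>p\<in>S. c p * ecomp p z" and ?G = "\<lambda>\<omega>. \<Sum>p\<in>S. c p * coord p \<omega>"
  have G: "gauss ?f ?G" by (rule lin_gauss)
  have G': "gauss (\<lambda>z. ?f z + l * ecomp q z) (\<lambda>\<omega>. ?G \<omega> + l * coord q \<omega>)"
    by (intro gauss_add G gauss_cmult coord_gauss)
  have L: "L2 Q ?f" "L2 Q (ecomp q)" using gauss_L2(1)[OF G] gauss_L2(1)[OF coord_gauss] by auto
  have inner: "(LINT z|Q. ?f z * ecomp q z) = (\<Sum>p\<in>S. c p * (if p = q then 1 else 0))"
  proof -
    have "(LINT z|Q. ?f z * ecomp q z) = (LINT z|Q. (\<Sum>p\<in>S. c p * (ecomp p z * ecomp q z)))"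
      by (simp add: sum_distrib_right mult.assoc)
    also have "\<dots> = (\<Sum>p\<in>S. (LINT z|Q. c p * (ecomp p z * ecomp q z)))"
      by (intro Bochner_Integration.integral_sum integrable_mult_right L2_mult gauss_L2(1)[OF coord_gauss])
    finally show ?thesis by (simp add: ecomp_inner)
  qed
  have "(l2norm Q (\<lambda>z. ?f z + l * ecomp q z))\<^sup>2 = (LINT z|Q. (?f z)\<^sup>2 + 2 * l * (?f z * ecomp q z) + l\<^sup>2 * (ecomp q z * ecomp q z))"
    unfolding l2norm_sq by (intro Bochner_Integration.integral_cong refl) (simp add: power2_eq_square algebra_simps)
  also have "\<dots> = (l2norm Q ?f)\<^sup>2 + 2 * l * (\<Sum>p\<in>S. c p * (if p = q then 1 else 0)) + l\<^sup>2"
    using L2_integrable_sq[OF L(1)] L2_mult[OF L] L2_mult[OF L(2) L(2)]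
    by (simp add: inner ecomp_inner l2norm_sq)
  finally have n: "(l2norm Q (\<lambda>z. ?f z + l * ecomp q z))\<^sup>2 = (l2norm Q ?f)\<^sup>2 + 2 * l * (\<Sum>p\<in>S. c p * (if p = q then 1 else 0)) + l\<^sup>2" .
  have e2: "- (x + 2 * l * y + l\<^sup>2) / 2 = - x / 2 + (- (l * y) - l\<^sup>2 * 1 / 2)" for x y :: real
    by (simp add: field_simps)
  have "(LINT \<omega>|M. iexp (?G \<omega> + l * coord q \<omega>)) = complex_of_real (exp (- (l2norm Q (\<lambda>z. ?f z + l * ecomp q z))\<^sup>2 / 2))"
    using gauss_char[OF G', of 1] by (simp del: of_real_add of_real_sum)
  also have "\<dots> = complex_of_real (exp (- (l2norm Q ?f)\<^sup>2 / 2)) * complex_of_real (exp (- (l * (\<Sum>p\<in>S. c p * (if p = q then 1 else 0))) - l\<^sup>2 * 1 / 2))"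
    unfolding n e2 exp_add of_real_mult ..
  also have "complex_of_real (exp (- (l2norm Q ?f)\<^sup>2 / 2)) = (LINT \<omega>|M. iexp (?G \<omega>))"
    using gauss_char[OF G, of 1] by (simp del: of_real_add of_real_sum)
  finally show "(LINT \<omega>|M. complex_of_real 1 * iexp (?G \<omega> + l * coord q \<omega>)) =
      (LINT \<omega>|M. complex_of_real 1 * iexp (?G \<omega>)) *
      complex_of_real (exp (- (l * (\<Sum>p\<in>S. c p * (if p = q then 1 else 0))) - l\<^sup>2 * 1 / 2))"
    unfolding of_real_1 mult_1 .
qed (auto intro: coord_moments all_moments_const)

lemma adapted_bounded_moments:
  assumes "adapted_bounded a H" shows "all_moments M H"
proof -
  have [measurable]: "H \<in> borel_measurable M" by (rule adapted_bounded_measurable[OF assms])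
  obtain C where C: "\<And>\<omega>. \<omega> \<in> space M \<Longrightarrow> \<bar>H \<omega>\<bar> \<le> C" using assms by (auto simp: adapted_bounded_def)
  have "integrable M (\<lambda>\<omega>. \<bar>H \<omega>\<bar> ^ n)" for n
  proof (rule Bochner_Integration.integrable_bound[of M "\<lambda>_. C ^ n"])
    show "AE \<omega> in M. norm (\<bar>H \<omega>\<bar> ^ n) \<le> norm (C ^ n)"
    proof (rule AE_I2)
      fix \<omega> assume "\<omega> \<in> space M"
      then have "\<bar>H \<omega>\<bar> ^ n \<le> C ^ n" by (intro power_mono C) auto
      then show "norm (\<bar>H \<omega>\<bar> ^ n) \<le> norm (C ^ n)" by (simp add: power_abs[symmetric])
    qed
  qed simp_all
  then show ?thesis by (simp add: all_moments_def)
qed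

text \<open>The instance for one term of a simple process, with weight \<open>H\<close> and an
  increment of component \<open>k\<close>. The covariance with coordinate (k, i) is the integral of
  e_i over (a, b], and \<open>shift\<close> is \<open>gauss_shift\<close>.\<close>

lemma ibp_incr:
  assumes ab: "0 \<le> a" "a \<le> b" "b \<le> T" and H: "adapted_bounded a H"
  shows "gaussian_ibp M coord (\<lambda>p. if fst p = k then (LINT s|Leb T. e (snd p) s * indicator {a<..b} s) else 0)
    H (\<lambda>\<omega>. W b \<omega> $ k - W a \<omega> $ k) (b - a)"
proof unfold_locales
  let ?\<gamma> = "\<lambda>p. if fst p = k then (LINT s|Leb T. e (snd p) s * indicator {a<..b} s) else 0"
  show "all_moments M (coord p)" for p by (rule coord_moments)
  show "all_moments M H" by (rule adapted_bounded_moments[OF H])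
  have "gauss (\<lambda>z. at_comp k (indicator {0<..b}) z - at_comp k (indicator {0<..a}) z) (\<lambda>\<omega>. W b \<omega> $ k - W a \<omega> $ k)"
    using ab by (intro gauss_diff gauss_W) auto
  then show "all_moments M (\<lambda>\<omega>. W b \<omega> $ k - W a \<omega> $ k)" by (rule gauss_all_moments)
  fix S :: "('m \<times> nat) set" and c and l :: real assume S: "finite S"
  let ?f = "\<lambda>z. \<Sum>p\<in>S. c p * ecomp p z" and ?G = "\<lambda>\<omega>. \<Sum>p\<in>S. c p * coord p \<omega>"
  have G: "gauss ?f ?G" by (rule lin_gauss)
  have inner: "(LINT z|Q. ?f z * incf a b (axis k 1) z) = (\<Sum>p\<in>S. c p * ?\<gamma> p)"
  proof -
    have "(LINT z|Q. ?f z * incf a b (axis k 1) z) = (LINT z|Q. (\<Sum>p\<in>S. c p * (ecomp p z * incf a b (axis k 1) z)))"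
      by (simp add: sum_distrib_right mult.assoc)
    also have "\<dots> = (\<Sum>p\<in>S. (LINT z|Q. c p * (ecomp p z * incf a b (axis k 1) z)))"
      by (intro Bochner_Integration.integral_sum integrable_mult_right L2_mult gauss_L2(1)[OF coord_gauss] L2_incf ab)
    finally show ?thesis by (simp add: ecomp_incf[OF ab])
  qed
  have ax: "axis k 1 \<bullet> (W b \<omega> - W a \<omega>) = W b \<omega> $ k - W a \<omega> $ k" for \<omega> by (simp add: inner_axis')
  show "(LINT \<omega>|M. complex_of_real (H \<omega>) * iexp (?G \<omega> + l * (W b \<omega> $ k - W a \<omega> $ k))) =
      (LINT \<omega>|M. complex_of_real (H \<omega>) * iexp (?G \<omega>)) *
      complex_of_real (exp (- (l * (\<Sum>p\<in>S. c p * ?\<gamma> p)) - l\<^sup>2 * (b - a) / 2))"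
    using gauss_shift[OF G ab H, of l "axis k 1"] unfolding ax inner by (simp only: norm_axis_real abs_one power_one mult_1)
qed

lemma wick_IBP_incr:
  assumes ab: "0 \<le> a" "a \<le> b" "b \<le> T" and H: "adapted_bounded a H"
  shows "(LINT \<omega>|M. H \<omega> * (W b \<omega> $ k - W a \<omega> $ k) * wick \<alpha> \<omega>) =
    (\<Sum>p\<in>Poly_Mapping.keys \<alpha>. (if fst p = k then (LINT s|Leb T. e (snd p) s * indicator {a<..b} s) else 0) *
      (sqrt (real (Poly_Mapping.lookup \<alpha> p)) * (LINT \<omega>|M. H \<omega> * wick (\<alpha> - Poly_Mapping.single p 1) \<omega>)))"
proof -
  let ?\<gamma> = "\<lambda>p. if fst p = k then (LINT s|Leb T. e (snd p) s * indicator {a<..b} s) else 0"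
  note ibp = ibp_incr[OF ab H, of k]
  have "(LINT \<omega>|M. H \<omega> * (W b \<omega> $ k - W a \<omega> $ k) * wick \<alpha> \<omega>) =
    (LINT \<omega>|M. H \<omega> * (\<Sum>p\<in>Poly_Mapping.keys \<alpha>. ?\<gamma> p * (sqrt (real (Poly_Mapping.lookup \<alpha> p)) * wick (\<alpha> - Poly_Mapping.single p 1) \<omega>)))"
    by (rule gaussian_ibp.dpair_IBP[OF ibp dpair_wick[OF ibp]])
  also have "\<dots> = (LINT \<omega>|M. (\<Sum>p\<in>Poly_Mapping.keys \<alpha>. (?\<gamma> p * sqrt (real (Poly_Mapping.lookup \<alpha> p))) * (H \<omega> * wick (\<alpha> - Poly_Mapping.single p 1) \<omega>)))"
    by (intro Bochner_Integration.integral_cong refl) (simp add: sum_distrib_left mult_ac)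
  also have "\<dots> = (\<Sum>p\<in>Poly_Mapping.keys \<alpha>. (LINT \<omega>|M. (?\<gamma> p * sqrt (real (Poly_Mapping.lookup \<alpha> p))) * (H \<omega> * wick (\<alpha> - Poly_Mapping.single p 1) \<omega>)))"
    by (intro Bochner_Integration.integral_sum integrable_mult_right L2_mult wick_L2 adapted_bounded_L2[OF H])
  finally show ?thesis by (simp add: mult.assoc del: One_nat_def)
qed

section \<open>Orthonormality of the Wick monomials\<close>

lemma wick_sum_delta:
  "(\<Sum>p\<in>Poly_Mapping.keys \<alpha>. (if p = q then 1 else 0) * (sqrt (real (Poly_Mapping.lookup \<alpha> p)) * wick (\<alpha> - Poly_Mapping.single p 1) \<omega>)) =
    sqrt (real (Poly_Mapping.lookup \<alpha> q)) * wick (\<alpha> - Poly_Mapping.single q 1) \<omega>"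
proof -
  have "(\<Sum>p\<in>Poly_Mapping.keys \<alpha>. (if p = q then 1 else 0) * (sqrt (real (Poly_Mapping.lookup \<alpha> p)) * wick (\<alpha> - Poly_Mapping.single p 1) \<omega>)) =
    (\<Sum>p\<in>Poly_Mapping.keys \<alpha>. if p = q then sqrt (real (Poly_Mapping.lookup \<alpha> q)) * wick (\<alpha> - Poly_Mapping.single q 1) \<omega> else 0)"
    by (intro sum.cong) auto
  then show ?thesis by (auto simp: in_keys_iff)
qed

text \<open>The raising relation writes the left side as the mean of coordinate q times the
  monomials of \<alpha>' and \<beta>, minus a lowering term. Integration by parts in that coordinate
  differentiates both monomials; the derivative of the first cancels the lowering term, that of the
  second remains.\<close>

lemma wick_orth_step:
  assumes q: "q \<in> Poly_Mapping.keys \<alpha>"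
  shows "sqrt (real (Poly_Mapping.lookup \<alpha> q)) * (LINT \<omega>|M. wick \<alpha> \<omega> * wick \<beta> \<omega>) =
    sqrt (real (Poly_Mapping.lookup \<beta> q)) *
      (LINT \<omega>|M. wick (\<alpha> - Poly_Mapping.single q 1) \<omega> * wick (\<beta> - Poly_Mapping.single q 1) \<omega>)"
proof -
  define \<alpha>' where "\<alpha>' = \<alpha> - Poly_Mapping.single q 1"
  let ?d = "\<lambda>\<alpha> \<omega>. sqrt (real (Poly_Mapping.lookup \<alpha> q)) * wick (\<alpha> - Poly_Mapping.single q 1) \<omega>"
  have \<alpha>: "\<alpha> = \<alpha>' + Poly_Mapping.single q 1"
    unfolding \<alpha>'_def using q
    by (intro poly_mapping_eqI) (auto simp: lookup_add lookup_minus lookup_single when_def in_keys_iff)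
  have l: "Poly_Mapping.lookup \<alpha> q = Suc (Poly_Mapping.lookup \<alpha>' q)"
    unfolding \<alpha> by (simp add: lookup_add)
  have rec: "sqrt (real (Poly_Mapping.lookup \<alpha> q)) * wick \<alpha> \<omega> = coord q \<omega> * wick \<alpha>' \<omega> - ?d \<alpha>' \<omega>" for \<omega>
    unfolding l by (subst (1) \<alpha>) (rule wick_monomial_add_single)
  note ibp = ibp_coord[of q]
  have dp: "gaussian_ibp.dpair M coord (\<lambda>p. if p = q then 1 else 0) (\<lambda>_. 1) (coord q) (wick \<alpha>) (?d \<alpha>)" for \<alpha>
    using dpair_wick[OF ibp, of \<alpha>] unfolding wick_sum_delta .
  have I: "integrable M (\<lambda>\<omega>. c * wick \<alpha> \<omega> * wick \<beta> \<omega>)" for c \<alpha> \<beta>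
    using L2_mult[OF L2_cmult[OF wick_L2] wick_L2] by simp
  have I3: "integrable M (\<lambda>\<omega>. coord q \<omega> * (wick \<alpha>' \<omega> * wick \<beta> \<omega>))"
    by (intro all_moments_integrable all_moments_mult coord_moments wick_moments)
  have "(LINT \<omega>|M. 1 * coord q \<omega> * (wick \<alpha>' \<omega> * wick \<beta> \<omega>)) = (LINT \<omega>|M. 1 * (?d \<alpha>' \<omega> * wick \<beta> \<omega> + wick \<alpha>' \<omega> * ?d \<beta> \<omega>))"
    by (rule gaussian_ibp.dpair_IBP[OF ibp gaussian_ibp.dpair_mult[OF ibp dp dp]])
  also have "\<dots> = (LINT \<omega>|M. ?d \<alpha>' \<omega> * wick \<beta> \<omega>) + (LINT \<omega>|M. ?d \<beta> \<omega> * wick \<alpha>' \<omega>)"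
    using I[of "sqrt (real (Poly_Mapping.lookup \<alpha>' q))"] I[of "sqrt (real (Poly_Mapping.lookup \<beta> q))"]
    by (simp add: mult.commute[of "wick \<alpha>' _"] del: One_nat_def)
  finally have a: "(LINT \<omega>|M. coord q \<omega> * (wick \<alpha>' \<omega> * wick \<beta> \<omega>)) - (LINT \<omega>|M. ?d \<alpha>' \<omega> * wick \<beta> \<omega>) = (LINT \<omega>|M. ?d \<beta> \<omega> * wick \<alpha>' \<omega>)"
    by simp
  have "sqrt (real (Poly_Mapping.lookup \<alpha> q)) * (LINT \<omega>|M. wick \<alpha> \<omega> * wick \<beta> \<omega>) =
      (LINT \<omega>|M. (sqrt (real (Poly_Mapping.lookup \<alpha> q)) * wick \<alpha> \<omega>) * wick \<beta> \<omega>)"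
    by (simp add: mult.assoc)
  also have "\<dots> = (LINT \<omega>|M. coord q \<omega> * (wick \<alpha>' \<omega> * wick \<beta> \<omega>) - ?d \<alpha>' \<omega> * wick \<beta> \<omega>)"
    unfolding rec by (intro Bochner_Integration.integral_cong refl) (simp add: algebra_simps)
  also have "\<dots> = (LINT \<omega>|M. coord q \<omega> * (wick \<alpha>' \<omega> * wick \<beta> \<omega>)) - (LINT \<omega>|M. ?d \<alpha>' \<omega> * wick \<beta> \<omega>)"
    by (rule Bochner_Integration.integral_diff[OF I3 I])
  also have "\<dots> = (LINT \<omega>|M. ?d \<beta> \<omega> * wick \<alpha>' \<omega>)" by (rule a)
  finally show ?thesis by (simp add: \<alpha>'_def mult_ac del: One_nat_def)
qed

definition mdeg :: "'m multi_index \<Rightarrow> nat" where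
  "mdeg \<alpha> = (\<Sum>p\<in>Poly_Mapping.keys \<alpha>. Poly_Mapping.lookup \<alpha> p)"

lemma mdeg_diff_single:
  assumes "p \<in> Poly_Mapping.keys \<alpha>"
  shows "mdeg (\<alpha> - Poly_Mapping.single p 1) < mdeg \<alpha>"
proof -
  have "mdeg (\<alpha> - Poly_Mapping.single p 1) = (\<Sum>q\<in>Poly_Mapping.keys \<alpha>. Poly_Mapping.lookup (\<alpha> - Poly_Mapping.single p 1) q)"
    unfolding mdeg_def using keys_diff_single[of \<alpha> p] by (intro sum.mono_neutral_left) (auto simp: in_keys_iff)
  also have "\<dots> < mdeg \<alpha>"
    unfolding mdeg_def using assms by (intro sum_strict_mono_ex1) (auto simp: lookup_diff_single in_keys_iff simp del: One_nat_def)
  finally show ?thesis .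
qed

text \<open>Induction on the degree of \<alpha>, since \<open>wick_orth_step\<close> lowers both
  indices at once.\<close>

theorem wick_orthonormal: "(LINT \<omega>|M. wick \<alpha> \<omega> * wick \<beta> \<omega>) = (if \<alpha> = \<beta> then 1 else 0)"
proof (induction "mdeg \<alpha>" arbitrary: \<alpha> \<beta> rule: less_induct)
  case less
  show ?case
  proof (cases "\<alpha> = 0")
    case True
    show ?thesis
    proof (cases "\<beta> = 0")
      case False
      then obtain q where q: "q \<in> Poly_Mapping.keys \<beta>" by (metis all_not_in_conv keys_eq_empty)
      \<comment> \<open>For \<open>\<alpha> = 0\<close> the step is applied with the roles
        exchanged; the weight on its right-hand side is then \<open>sqrt 0\<close>.\<close>
      have "sqrt (real (Poly_Mapping.lookup \<beta> q)) * (LINT \<omega>|M. wick \<beta> \<omega> * wick \<alpha> \<omega>) = 0"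
        using wick_orth_step[OF q, of \<alpha>] True by simp
      then have "(LINT \<omega>|M. wick \<beta> \<omega> * wick \<alpha> \<omega>) = 0" using q by (simp add: in_keys_iff)
      then show ?thesis using True False by (simp add: mult.commute)
    qed (use True in \<open>simp add: prob_space\<close>)
  next
    case False
    then obtain q where q: "q \<in> Poly_Mapping.keys \<alpha>" by (metis all_not_in_conv keys_eq_empty)
    let ?\<alpha> = "\<alpha> - Poly_Mapping.single q 1" and ?\<beta> = "\<beta> - Poly_Mapping.single q 1"
    have IH: "(LINT \<omega>|M. wick ?\<alpha> \<omega> * wick ?\<beta> \<omega>) = (if ?\<alpha> = ?\<beta> then 1 else 0)"
      by (rule less.hyps[OF mdeg_diff_single[OF q]])
    have pos: "sqrt (real (Poly_Mapping.lookup \<alpha> q)) > 0" using q by (simp add: in_keys_iff)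
    have step: "sqrt (real (Poly_Mapping.lookup \<alpha> q)) * (LINT \<omega>|M. wick \<alpha> \<omega> * wick \<beta> \<omega>) =
        sqrt (real (Poly_Mapping.lookup \<beta> q)) * (if ?\<alpha> = ?\<beta> then 1 else 0)"
      using wick_orth_step[OF q, of \<beta>] unfolding IH .
    show ?thesis
    proof (cases "\<alpha> = \<beta>")
      case True
      then show ?thesis using step pos by simp
    next
      case neq: False
      \<comment> \<open>Truncated subtraction can make the lowered indices agree for
        \<open>\<alpha> \<noteq> \<beta>\<close>, but only if \<beta> vanishes at \<open>q\<close>,
        and then the weight is 0.\<close>
      have "sqrt (real (Poly_Mapping.lookup \<beta> q)) * (if ?\<alpha> = ?\<beta> then 1 else 0) = 0"
      proof (rule ccontr)
        assume "\<not> ?thesis"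
        then have b: "Poly_Mapping.lookup \<beta> q > 0" and eq: "?\<alpha> = ?\<beta>" by (auto split: if_splits)
        have "\<alpha> = \<beta>"
        proof (rule poly_mapping_eqI)
          fix r
          have "Poly_Mapping.lookup ?\<alpha> r = Poly_Mapping.lookup ?\<beta> r" using eq by simp
          then show "Poly_Mapping.lookup \<alpha> r = Poly_Mapping.lookup \<beta> r"
            using b q by (auto simp: lookup_diff_single in_keys_iff simp del: One_nat_def split: if_splits)
        qed
        then show False using neq by simp
      qed
      then have "sqrt (real (Poly_Mapping.lookup \<alpha> q)) * (LINT \<omega>|M. wick \<alpha> \<omega> * wick \<beta> \<omega>) = 0"
        by (simp only: step)
      then show ?thesis using pos neq by simp
    qed
  qed
qed

end

subsection \<open>Completeness of the Wick monomials\<close>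

context gaussian_coordinates
begin

definition orth :: "('a \<Rightarrow> real) \<Rightarrow> bool" where
  "orth Z \<longleftrightarrow> L2 M Z \<and> (\<forall>\<alpha>. (LINT \<omega>|M. Z \<omega> * wick \<alpha> \<omega>) = 0)"

text \<open>A Wick monomial times a linear form is a combination of Wick monomials, so one power of
  the form is traded for other indices; hence \<alpha> varies in the induction.\<close>

lemma orth_polynomial:
  assumes Z: "orth Z" and S: "finite S"
  shows "(LINT \<omega>|M. Z \<omega> * ((\<Sum>p\<in>S. c p * coord p \<omega>) ^ n * wick \<alpha> \<omega>)) = 0"
proof (induction n arbitrary: \<alpha>)
  case 0
  then show ?case using Z by (simp add: orth_def)
next
  case (Suc n)
  let ?G = "\<lambda>\<omega>. \<Sum>p\<in>S. c p * coord p \<omega>"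
  have Z2: "L2 M Z" using Z by (simp add: orth_def)
  have mG: "all_moments M ?G" by (rule gauss_all_moments[OF lin_gauss])
  let ?u = "\<lambda>p. c p * sqrt (real (Suc (Poly_Mapping.lookup \<alpha> p)))" and ?v = "\<lambda>p. c p * sqrt (real (Poly_Mapping.lookup \<alpha> p))"
  let ?T = "\<lambda>\<beta> \<omega>. Z \<omega> * (?G \<omega> ^ n * wick \<beta> \<omega>)"
  have I: "integrable M (?T \<beta>)" for \<beta>
    by (intro L2_mult Z2 all_moments_L2 all_moments_mult all_moments_power mG wick_moments)
  have "Z \<omega> * (?G \<omega> ^ Suc n * wick \<alpha> \<omega>) =
    (\<Sum>p\<in>S. ?u p * ?T (\<alpha> + Poly_Mapping.single p 1) \<omega> + ?v p * ?T (\<alpha> - Poly_Mapping.single p 1) \<omega>)" for \<omega>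
  proof -
    have "c p * (coord p \<omega> * wick \<alpha> \<omega>) = ?u p * wick (\<alpha> + Poly_Mapping.single p 1) \<omega> + ?v p * wick (\<alpha> - Poly_Mapping.single p 1) \<omega>" for p
    proof -
      have alg: "c * (x * w) = (c * s) * w1 + (c * r) * w2" if "s * w1 = x * w - r * w2" for c x w s w1 r w2 :: real
      proof -
        have "x * w = s * w1 + r * w2" using that by simp
        then show ?thesis by (simp only: distrib_left mult.assoc)
      qed
      show ?thesis by (rule alg[OF wick_monomial_add_single])
    qed
    then have "?G \<omega> * wick \<alpha> \<omega> = (\<Sum>p\<in>S. ?u p * wick (\<alpha> + Poly_Mapping.single p 1) \<omega> + ?v p * wick (\<alpha> - Poly_Mapping.single p 1) \<omega>)"
      by (simp add: sum_distrib_right mult.assoc del: One_nat_def)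
    moreover have "Z \<omega> * (?G \<omega> ^ Suc n * wick \<alpha> \<omega>) = Z \<omega> * ?G \<omega> ^ n * (?G \<omega> * wick \<alpha> \<omega>)" by simp
    ultimately have "Z \<omega> * (?G \<omega> ^ Suc n * wick \<alpha> \<omega>) = Z \<omega> * ?G \<omega> ^ n *
      (\<Sum>p\<in>S. ?u p * wick (\<alpha> + Poly_Mapping.single p 1) \<omega> + ?v p * wick (\<alpha> - Poly_Mapping.single p 1) \<omega>)"
      by (simp only:)
    also have "\<dots> = (\<Sum>p\<in>S. ?u p * ?T (\<alpha> + Poly_Mapping.single p 1) \<omega> + ?v p * ?T (\<alpha> - Poly_Mapping.single p 1) \<omega>)"
    proof -
      have "z * g * (u * w1 + v * w2) = u * (z * (g * w1)) + v * (z * (g * w2))" for z g u w1 v w2 :: real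
        by (simp add: algebra_simps)
      then show ?thesis by (subst sum_distrib_left) (intro sum.cong refl)
    qed
    finally show ?thesis .
  qed
  then have "(LINT \<omega>|M. Z \<omega> * (?G \<omega> ^ Suc n * wick \<alpha> \<omega>)) =
    (LINT \<omega>|M. (\<Sum>p\<in>S. ?u p * ?T (\<alpha> + Poly_Mapping.single p 1) \<omega> + ?v p * ?T (\<alpha> - Poly_Mapping.single p 1) \<omega>))"
    by (simp only:)
  also have "\<dots> = (\<Sum>p\<in>S. (LINT \<omega>|M. ?u p * ?T (\<alpha> + Poly_Mapping.single p 1) \<omega> + ?v p * ?T (\<alpha> - Poly_Mapping.single p 1) \<omega>))"
    by (intro Bochner_Integration.integral_sum Bochner_Integration.integrable_add integrable_mult_right I)
  also have "\<dots> = (\<Sum>p\<in>S. 0)"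
  proof (rule sum.cong[OF refl])
    fix p
    have "(LINT \<omega>|M. ?u p * ?T (\<alpha> + Poly_Mapping.single p 1) \<omega> + ?v p * ?T (\<alpha> - Poly_Mapping.single p 1) \<omega>) =
      ?u p * (LINT \<omega>|M. ?T (\<alpha> + Poly_Mapping.single p 1) \<omega>) + ?v p * (LINT \<omega>|M. ?T (\<alpha> - Poly_Mapping.single p 1) \<omega>)"
      by (subst Bochner_Integration.integral_add[OF integrable_mult_right[OF I] integrable_mult_right[OF I]])
        (simp only: integral_mult_right_zero)
    then show "(LINT \<omega>|M. ?u p * ?T (\<alpha> + Poly_Mapping.single p 1) \<omega> + ?v p * ?T (\<alpha> - Poly_Mapping.single p 1) \<omega>) = 0"
      by (simp only: Suc.IH mult_zero_right add_0_right)
  qed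
  finally show ?case by simp
qed

text \<open>The Taylor polynomials of exp(iG) contribute nothing. The remainder of order N is at
  most E[|Z| |G|^N] / N!, which Cauchy-Schwarz and the Gaussian moments bound by the norm of Z times
  sqrt((2 s^2)^N / N!), and this tends to 0.\<close>

lemma orth_char_lin:
  assumes Z: "orth Z" and S: "finite S"
  shows "(LINT \<omega>|M. complex_of_real (Z \<omega>) * iexp (\<Sum>p\<in>S. c p * coord p \<omega>)) = 0"
proof -
  let ?G = "\<lambda>\<omega>. \<Sum>p\<in>S. c p * coord p \<omega>"
  let ?I = "LINT \<omega>|M. complex_of_real (Z \<omega>) * iexp (?G \<omega>)"
  let ?s = "l2norm Q (\<lambda>z. \<Sum>p\<in>S. c p * ecomp p z)"
  have Z2: "L2 M Z" using Z by (simp add: orth_def)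
  have G: "gauss (\<lambda>z. \<Sum>p\<in>S. c p * ecomp p z) ?G" by (rule lin_gauss)
  have mG: "all_moments M ?G" by (rule gauss_all_moments[OF G])
  have [measurable]: "Z \<in> borel_measurable M" "?G \<in> borel_measurable M" using Z2 mG by auto
  have GN2: "L2 M (\<lambda>\<omega>. \<bar>?G \<omega>\<bar> ^ N)" for N
    using all_moments_L2[OF all_moments_power[OF mG, of N]]
    by (rule L2_bound) (auto simp: power_abs[symmetric])
  have Za: "L2 M (\<lambda>\<omega>. \<bar>Z \<omega>\<bar>)" by (rule L2_bound[OF Z2]) auto
  have ZGi: "integrable M (\<lambda>\<omega>. Z \<omega> * ?G \<omega> ^ k)" for k
    by (intro L2_mult Z2 all_moments_L2 all_moments_power mG)
  have zero: "(LINT \<omega>|M. Z \<omega> * ?G \<omega> ^ k) = 0" for k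
    using orth_polynomial[OF Z S, of c k 0] by simp
  have bound: "cmod ?I \<le> l2norm M Z * sqrt ((2 * ?s\<^sup>2) ^ Suc n / fact (Suc n))" for n
  proof -
    let ?N = "Suc n"
    let ?P = "\<lambda>\<omega>. \<Sum>k\<le>n. complex_of_real (Z \<omega> * ?G \<omega> ^ k) * (\<i> ^ k / fact k)"
    have Pi: "integrable M ?P" using ZGi
      by (intro Bochner_Integration.integrable_sum integrable_mult_left integrable_of_real) auto
    have P0: "(LINT \<omega>|M. ?P \<omega>) = 0"
    proof -
      have "(LINT \<omega>|M. ?P \<omega>) = (\<Sum>k\<le>n. (LINT \<omega>|M. complex_of_real (Z \<omega> * ?G \<omega> ^ k) * (\<i> ^ k / fact k)))"
        by (intro Bochner_Integration.integral_sum integrable_mult_left integrable_of_real ZGi)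
      also have "\<dots> = (\<Sum>k\<le>n. 0)"
      proof (rule sum.cong[OF refl])
        fix k
        have "(LINT \<omega>|M. complex_of_real (Z \<omega> * ?G \<omega> ^ k) * (\<i> ^ k / fact k)) =
            (LINT \<omega>|M. complex_of_real (Z \<omega> * ?G \<omega> ^ k)) * (\<i> ^ k / fact k)"
          by (rule integral_mult_left_zero)
        also have "(LINT \<omega>|M. complex_of_real (Z \<omega> * ?G \<omega> ^ k)) = complex_of_real (LINT \<omega>|M. Z \<omega> * ?G \<omega> ^ k)"
          by (rule integral_complex_of_real)
        finally show "(LINT \<omega>|M. complex_of_real (Z \<omega> * ?G \<omega> ^ k) * (\<i> ^ k / fact k)) = 0"
          unfolding zero by simp
      qed
      finally show ?thesis by simp
    qed
    have Ii: "integrable M (\<lambda>\<omega>. complex_of_real (Z \<omega>) * iexp (?G \<omega>))"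
      using L2_integrable[OF Z2] by (intro integrable_iexp_mult) auto
    have "?I = (LINT \<omega>|M. complex_of_real (Z \<omega>) * iexp (?G \<omega>) - ?P \<omega>)"
      by (subst Bochner_Integration.integral_diff[OF Ii Pi]) (simp only: P0 diff_0_right)
    also have "cmod \<dots> \<le> (LINT \<omega>|M. (1 / fact ?N) * (\<bar>Z \<omega>\<bar> * \<bar>?G \<omega>\<bar> ^ ?N))"
    proof (rule norm_integral_le)
      show "integrable M (\<lambda>\<omega>. complex_of_real (Z \<omega>) * iexp (?G \<omega>) - ?P \<omega>)"
        by (rule Bochner_Integration.integrable_diff[OF Ii Pi])
      show "integrable M (\<lambda>\<omega>. (1 / fact ?N) * (\<bar>Z \<omega>\<bar> * \<bar>?G \<omega>\<bar> ^ ?N))"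
        by (intro integrable_mult_right L2_mult Za GN2)
      fix \<omega>
      have "?P \<omega> = complex_of_real (Z \<omega>) * (\<Sum>k\<le>n. (\<i> * complex_of_real (?G \<omega>)) ^ k / fact k)"
        by (simp only: sum_distrib_left) (intro sum.cong refl, simp add: power_mult_distrib del: of_real_sum)
      then have "complex_of_real (Z \<omega>) * iexp (?G \<omega>) - ?P \<omega> =
          complex_of_real (Z \<omega>) * (iexp (?G \<omega>) - (\<Sum>k\<le>n. (\<i> * complex_of_real (?G \<omega>)) ^ k / fact k))"
        by (simp only: right_diff_distrib)
      then have "cmod (complex_of_real (Z \<omega>) * iexp (?G \<omega>) - ?P \<omega>) =
          \<bar>Z \<omega>\<bar> * cmod (iexp (?G \<omega>) - (\<Sum>k\<le>n. (\<i> * complex_of_real (?G \<omega>)) ^ k / fact k))"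
        by (simp only: norm_mult norm_of_real)
      also have "\<dots> \<le> \<bar>Z \<omega>\<bar> * (\<bar>?G \<omega>\<bar> ^ ?N / fact ?N)"
        by (intro mult_left_mono iexp_approx1) simp
      finally show "cmod (complex_of_real (Z \<omega>) * iexp (?G \<omega>) - ?P \<omega>) \<le> (1 / fact ?N) * (\<bar>Z \<omega>\<bar> * \<bar>?G \<omega>\<bar> ^ ?N)"
        by simp
    qed
    also have "\<dots> = (1 / fact ?N) * (LINT \<omega>|M. \<bar>Z \<omega>\<bar> * \<bar>?G \<omega>\<bar> ^ ?N)" by (rule integral_mult_right_zero)
    also have "\<dots> \<le> (1 / fact ?N) * (l2norm M Z * sqrt (?s ^ (2 * ?N) * (fact (2 * ?N) / (2 ^ ?N * fact ?N))))"
    proof (rule mult_left_mono)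
      have "l2norm M (\<lambda>\<omega>. \<bar>?G \<omega>\<bar> ^ ?N) = sqrt (LINT \<omega>|M. ?G \<omega> ^ (2 * ?N))"
        unfolding l2norm_def by (simp only: power_mult[symmetric] mult.commute[of ?N 2] power_even_abs even_mult_iff even_two_times_div_two dvd_triv_left)
      also have "(LINT \<omega>|M. ?G \<omega> ^ (2 * ?N)) = ?s ^ (2 * ?N) * (fact (2 * ?N) / (2 ^ ?N * fact ?N))"
        by (rule gauss_moments(2)[OF G])
      finally have GN: "l2norm M (\<lambda>\<omega>. \<bar>?G \<omega>\<bar> ^ ?N) = sqrt (?s ^ (2 * ?N) * (fact (2 * ?N) / (2 ^ ?N * fact ?N)))" .
      have nZ: "l2norm M (\<lambda>\<omega>. \<bar>Z \<omega>\<bar>) = l2norm M Z" by (simp add: l2norm_def)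
      show "(LINT \<omega>|M. \<bar>Z \<omega>\<bar> * \<bar>?G \<omega>\<bar> ^ ?N) \<le> l2norm M Z * sqrt (?s ^ (2 * ?N) * (fact (2 * ?N) / (2 ^ ?N * fact ?N)))"
        using L2_Cauchy_Schwarz[OF Za GN2[of ?N]] unfolding GN nZ by (rule order_trans[OF abs_ge_self])
    qed simp
    also have "\<dots> = l2norm M Z * sqrt ((1 / fact ?N)\<^sup>2 * (?s ^ (2 * ?N) * (fact (2 * ?N) / (2 ^ ?N * fact ?N))))"
      by (simp only: real_sqrt_mult) simp
    also have "\<dots> \<le> l2norm M Z * sqrt ((2 * ?s\<^sup>2) ^ ?N / fact ?N)"
    proof (intro mult_left_mono real_sqrt_le_mono)
      \<comment> \<open>Bounding the central binomial coefficient gives (2N)! <= 4^N N!^2, enough to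
        control the moment of order 2N divided by N!^2.\<close>
      have "(fact (2 * ?N) :: nat) = fact ?N * fact ?N * (2 * ?N choose ?N)"
        using binomial_fact_lemma[of ?N "2 * ?N"] by simp
      also have "\<dots> \<le> fact ?N * fact ?N * 2 ^ (2 * ?N)" by (rule mult_le_mono2[OF binomial_le_pow2])
      finally have "(fact (2 * ?N) :: nat) \<le> fact ?N * fact ?N * 2 ^ (2 * ?N)" .
      then have "real (fact (2 * ?N)) \<le> real (fact ?N * fact ?N * 2 ^ (2 * ?N))" by (rule of_nat_mono)
      then have f: "fact (2 * ?N) \<le> (fact ?N * fact ?N * 2 ^ (2 * ?N) :: real)" by (simp only: of_nat_mult of_nat_fact of_nat_power of_nat_numeral)
      have "(1 / fact ?N)\<^sup>2 * (?s ^ (2 * ?N) * (fact (2 * ?N) / (2 ^ ?N * fact ?N))) \<le>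
          (1 / fact ?N)\<^sup>2 * (?s ^ (2 * ?N) * ((fact ?N * fact ?N * 2 ^ (2 * ?N)) / (2 ^ ?N * fact ?N)))"
        by (intro mult_left_mono divide_right_mono f) simp_all
      also have "\<dots> = (2 * ?s\<^sup>2) ^ ?N / fact ?N"
      proof -
        have "(1 / F)\<^sup>2 * (a * ((F * F * (b * b)) / (b * F))) = b * a / F" if "F \<noteq> 0" "b \<noteq> 0" for F a b :: real
          using that by (simp add: power2_eq_square field_simps)
        note alg = this
        have p1: "(2 :: real) ^ (2 * ?N) = 2 ^ ?N * 2 ^ ?N" by (simp only: mult_2 power_add)
        have p2: "(2 * ?s\<^sup>2) ^ ?N = 2 ^ ?N * ?s ^ (2 * ?N)" by (simp only: power_mult_distrib power_mult)
        show ?thesis unfolding p1 p2 by (rule alg) simp_all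
      qed
      finally show "(1 / fact ?N)\<^sup>2 * (?s ^ (2 * ?N) * (fact (2 * ?N) / (2 ^ ?N * fact ?N))) \<le> (2 * ?s\<^sup>2) ^ ?N / fact ?N" .
    qed simp
    finally show ?thesis .
  qed
  have "(\<lambda>n. (2 * ?s\<^sup>2) ^ n / fact n) \<longlonglongrightarrow> 0"
    using summable_LIMSEQ_zero[OF summable_exp[of "2 * ?s\<^sup>2"]] by (simp add: field_simps)
  then have "(\<lambda>n. l2norm M Z * sqrt ((2 * ?s\<^sup>2) ^ Suc n / fact (Suc n))) \<longlonglongrightarrow> l2norm M Z * sqrt 0"
    by (intro tendsto_mult tendsto_const tendsto_real_sqrt) (rule LIMSEQ_Suc)
  then have "cmod ?I \<le> l2norm M Z * sqrt 0"
    by (rule LIMSEQ_le_const) (use bound in blast)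
  then show ?thesis by simp
qed

text \<open>Each of the m components is approximated within \<epsilon>^2 / m in squared norm, and
  the finitely many approximations are collected in one index set.\<close>

lemma ecomp_dense:
  assumes f: "L2 Q f" and "\<epsilon> > 0"
  obtains S c where "finite S" "l2norm Q (\<lambda>z. (\<Sum>p\<in>S. c p * ecomp p z) - f z) < \<epsilon>"
proof -
  define m where "m = real CARD('m)"
  have m: "m > 0" by (simp add: m_def)
  have f2: "L2 (Leb T) (\<lambda>s. f (k, s))" for k
  proof (rule L2_I)
    show "(\<lambda>s. f (k, s)) \<in> borel_measurable (Leb T)"
      by (rule measurable_Pair2[OF L2_measurable[OF f, unfolded Q_def]]) simp
    show "integrable (Leb T) (\<lambda>s. (f (k, s))\<^sup>2)" by (rule integrable_QD[OF L2_integrable_sq[OF f]])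
  qed
  have "\<exists>n c. (LINT s|Leb T. (f (k, s) - (\<Sum>i<n. c i * e i s))\<^sup>2) < \<epsilon>\<^sup>2 / m" for k
  proof -
    have "\<epsilon>\<^sup>2 / m > 0" using \<open>\<epsilon> > 0\<close> m by simp
    with f2[of k] e_complete show ?thesis unfolding complete_orthonormal_def by blast
  qed
  then have "\<forall>k. \<exists>n. \<exists>c. (LINT s|Leb T. (f (k, s) - (\<Sum>i<n. c i * e i s))\<^sup>2) < \<epsilon>\<^sup>2 / m" by blast
  from choice[OF this] obtain n where "\<forall>k. \<exists>c. (LINT s|Leb T. (f (k, s) - (\<Sum>i<n k. c i * e i s))\<^sup>2) < \<epsilon>\<^sup>2 / m" by (rule exE)
  from choice[OF this] obtain c where c: "\<forall>k. (LINT s|Leb T. (f (k, s) - (\<Sum>i<n k. c k i * e i s))\<^sup>2) < \<epsilon>\<^sup>2 / m" by (rule exE)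
  define S where "S = (SIGMA k:UNIV. {..<n k})"
  define c' where "c' = (\<lambda>(k, i). c k i)"
  have S: "finite S" by (simp add: S_def)
  have sum: "(\<Sum>p\<in>S. c' p * ecomp p (k, s)) = (\<Sum>i<n k. c k i * e i s)" for k s
  proof -
    have "(\<Sum>p\<in>S. c' p * ecomp p (k, s)) = (\<Sum>k'\<in>UNIV. \<Sum>i<n k'. c k' i * at_comp k' (e i) (k, s))"
      unfolding S_def by (subst sum.Sigma) (auto simp: c'_def case_prod_unfold)
    also have "\<dots> = (\<Sum>k'\<in>UNIV. if k' = k then (\<Sum>i<n k. c k i * e i s) else 0)"
      by (intro sum.cong refl) (auto simp: at_comp_def)
    finally show ?thesis by simp
  qed
  let ?g = "\<lambda>z. (\<Sum>p\<in>S. c' p * ecomp p z) - f z"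
  have g2: "L2 Q ?g" by (intro L2_diff f gauss_L2(1)[OF lin_gauss])
  have "(l2norm Q ?g)\<^sup>2 = (\<Sum>k\<in>UNIV. (LINT s|Leb T. (?g (k, s))\<^sup>2))"
    unfolding l2norm_sq by (rule integral_Q[OF L2_integrable_sq[OF g2]])
  also have "\<dots> = (\<Sum>k\<in>UNIV. (LINT s|Leb T. (f (k, s) - (\<Sum>i<n k. c k i * e i s))\<^sup>2))"
    unfolding sum by (simp add: power2_commute)
  also have "\<dots> < (\<Sum>k\<in>(UNIV :: 'm set). \<epsilon>\<^sup>2 / m)" using c by (intro sum_strict_mono) auto
  also have "\<dots> = \<epsilon>\<^sup>2" using m by (simp add: m_def)
  finally have "l2norm Q ?g < \<epsilon>" using \<open>\<epsilon> > 0\<close> by (intro power2_less_imp_less[of _ \<epsilon>]) auto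
  with S show ?thesis by (rule that)
qed

text \<open>The isometry turns density of the e_i into mean-square approximation of \<open>G\<close>
  by linear forms in the coordinates, for which \<open>orth_char_lin\<close> holds.\<close>

lemma orth_char:
  assumes Z: "orth Z" and G: "gauss f G"
  shows "(LINT \<omega>|M. complex_of_real (Z \<omega>) * iexp (G \<omega>)) = 0"
proof -
  have Z2: "L2 M Z" using Z by (simp add: orth_def)
  have [measurable]: "Z \<in> borel_measurable M" using Z2 by auto
  have Za: "L2 M (\<lambda>\<omega>. \<bar>Z \<omega>\<bar>)" by (rule L2_bound[OF Z2]) auto
  have "\<forall>n. \<exists>S c. finite S \<and> l2norm Q (\<lambda>z. (\<Sum>p\<in>S. c p * ecomp p z) - f z) < 1 / Suc n"
  proof
    fix n
    show "\<exists>S c. finite S \<and> l2norm Q (\<lambda>z. (\<Sum>p\<in>S. c p * ecomp p z) - f z) < 1 / Suc n"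
      by (rule ecomp_dense[OF gauss_L2(1)[OF G], where \<epsilon> = "1 / Suc n"]) (simp, blast)
  qed
  from choice[OF this] obtain S where "\<forall>n. \<exists>c. finite (S n) \<and> l2norm Q (\<lambda>z. (\<Sum>p\<in>S n. c p * ecomp p z) - f z) < 1 / Suc n" by (rule exE)
  from choice[OF this] obtain c where Sc: "\<forall>n. finite (S n) \<and> l2norm Q (\<lambda>z. (\<Sum>p\<in>S n. c n p * ecomp p z) - f z) < 1 / Suc n" by (rule exE)
  let ?G = "\<lambda>n \<omega>. \<Sum>p\<in>S n. c n p * coord p \<omega>"
  have GL: "gauss (\<lambda>z. \<Sum>p\<in>S n. c n p * ecomp p z) (?G n)" for n by (rule lin_gauss)
  have le: "l2norm M (\<lambda>\<omega>. ?G n \<omega> - G \<omega>) \<le> 1 / Suc n" for n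
    using gauss_isometry[OF gauss_diff[OF GL[of n] G]] Sc by (simp add: less_imp_le)
  have conv: "(\<lambda>n. l2norm M (\<lambda>\<omega>. ?G n \<omega> - G \<omega>)) \<longlonglongrightarrow> 0"
    by (rule Lim_null_comparison[OF _ lim_1_over_n[THEN LIMSEQ_Suc]]) (use le in simp)
  have "(\<lambda>n. LINT \<omega>|M. complex_of_real (Z \<omega>) * iexp (?G n \<omega> + 0)) \<longlonglongrightarrow> (LINT \<omega>|M. complex_of_real (Z \<omega>) * iexp (G \<omega> + 0))"
    by (rule iexp_L2_limit[OF _ Za _ gauss_L2(2)[OF GL] gauss_L2(2)[OF G] conv]) auto
  moreover have "(LINT \<omega>|M. complex_of_real (Z \<omega>) * iexp (?G n \<omega> + 0)) = 0" for n
    using orth_char_lin[OF Z, of "S n" "c n"] Sc by (simp only: add_0_right)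
  ultimately have "(\<lambda>n. 0) \<longlonglongrightarrow> (LINT \<omega>|M. complex_of_real (Z \<omega>) * iexp (G \<omega> + 0))" by (simp only:)
  from LIMSEQ_unique[OF this tendsto_const] show ?thesis by simp
qed

text \<open>The indicators are introduced one at a time. If a weight U is annihilated by all
  Gaussian phases, then so are U cos G and U sin G: a factor cos(tR) or sin(tR) only changes the
  phase to G + tR and G - tR, again Wiener integrals. The one-dimensional uniqueness statement then
  inserts the indicator of B at R. The arbitrary phase \<open>G\<close> in the claim is what makes
  the induction close.\<close>

lemma orth_cylinder:
  assumes Z: "orth Z" and l: "\<forall>(R, B)\<in>set l. (\<exists>f. gauss f R) \<and> B \<in> sets borel" and G: "gauss f G"
  shows "(LINT \<omega>|M. (Z \<omega> * (\<Prod>(R, B)\<leftarrow>l. indicator B (R \<omega>))) * cos (G \<omega>)) = 0"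
    and "(LINT \<omega>|M. (Z \<omega> * (\<Prod>(R, B)\<leftarrow>l. indicator B (R \<omega>))) * sin (G \<omega>)) = 0"
proof -
  have Z2: "L2 M Z" using Z by (simp add: orth_def)
  have Zm[measurable]: "Z \<in> borel_measurable M" using Z2 by auto
  have m: "(\<lambda>\<omega>. (\<Prod>(R, B)\<leftarrow>l. indicator B (R \<omega>)) :: real) \<in> borel_measurable M \<and>
      (\<forall>\<omega>. \<bar>(\<Prod>(R, B)\<leftarrow>l. indicator B (R \<omega>)) :: real\<bar> \<le> 1)"
    if "\<forall>(R, B)\<in>set l. (\<exists>f. gauss f R) \<and> B \<in> sets borel" for l :: "(('a \<Rightarrow> real) \<times> real set) list"
    using that
  proof (induction l)
    case (Cons x l)
    obtain R B where x: "x = (R, B)" by (cases x)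
    then obtain f where [measurable]: "R \<in> borel_measurable M" "B \<in> sets borel" using Cons.prems gauss_L2(2) by auto
    then show ?case using Cons by (auto simp: x indicator_def)
  qed simp
  have "\<forall>f G. gauss f G \<longrightarrow> (LINT \<omega>|M. (Z \<omega> * (\<Prod>(R, B)\<leftarrow>l. indicator B (R \<omega>))) * cos (G \<omega>)) = 0 \<and>
      (LINT \<omega>|M. (Z \<omega> * (\<Prod>(R, B)\<leftarrow>l. indicator B (R \<omega>))) * sin (G \<omega>)) = 0"
    using l
  proof (induction l)
    case Nil
    show ?case
    proof (intro allI impI)
      fix f G assume G: "gauss f G"
      have "G \<in> borel_measurable M" using gauss_L2(2)[OF G] by auto
      from integral_mult_iexp[OF L2_integrable[OF Z2] this] orth_char[OF Z G]
      show "(LINT \<omega>|M. (Z \<omega> * (\<Prod>(R, B)\<leftarrow>[]. indicator B (R \<omega>))) * cos (G \<omega>)) = 0 \<and>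
        (LINT \<omega>|M. (Z \<omega> * (\<Prod>(R, B)\<leftarrow>[]. indicator B (R \<omega>))) * sin (G \<omega>)) = 0"
        by (simp add: complex_eq_iff)
    qed
  next
    case (Cons x l)
    obtain R B where x: "x = (R, B)" by (cases x)
    then obtain g where R: "gauss g R" and B: "B \<in> sets borel" using Cons.prems by auto
    have l: "\<forall>(R, B)\<in>set l. (\<exists>f. gauss f R) \<and> B \<in> sets borel" using Cons.prems by auto
    define U where "U = (\<lambda>\<omega>. Z \<omega> * (\<Prod>(R, B)\<leftarrow>l. indicator B (R \<omega>)))"
    have Um: "U \<in> borel_measurable M" and Ub: "\<bar>U \<omega>\<bar> \<le> \<bar>Z \<omega>\<bar>" for \<omega>
      using m[OF l] by (auto simp: U_def abs_mult mult_left_le)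
    have Ui: "integrable M U"
      by (rule Bochner_Integration.integrable_bound[OF L2_integrable[OF Z2] Um]) (use Ub in auto)
    have IH: "(LINT \<omega>|M. U \<omega> * cos (G \<omega>)) = 0" "(LINT \<omega>|M. U \<omega> * sin (G \<omega>)) = 0" if "gauss f G" for f G
      using Cons.IH[OF l] that by (auto simp: U_def)
    have Rm[measurable]: "R \<in> borel_measurable M" using gauss_L2(2)[OF R] by auto
    show ?case
    proof (intro allI impI)
      fix f G assume G: "gauss f G"
      have Gm[measurable]: "G \<in> borel_measurable M" using gauss_L2(2)[OF G] by auto
      note [measurable] = Um
      have gp: "gauss (\<lambda>z. f z + t * g z) (\<lambda>\<omega>. G \<omega> + t * R \<omega>)" "gauss (\<lambda>z. f z - t * g z) (\<lambda>\<omega>. G \<omega> - t * R \<omega>)" for t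
        by (intro gauss_add gauss_diff gauss_cmult G R)+
      have bi: "integrable M (\<lambda>\<omega>. U \<omega> * h \<omega>)" if "h \<in> borel_measurable M" "\<And>\<omega>. \<bar>h \<omega>\<bar> \<le> 1" for h
        by (rule Bochner_Integration.integrable_bound[OF Ui])
          (use that Um in \<open>auto simp: abs_mult mult_left_le\<close>)
      have tr: "U \<omega> * cos (G \<omega>) * cos (t * R \<omega>) = 1/2 * (U \<omega> * cos (G \<omega> + t * R \<omega>)) + 1/2 * (U \<omega> * cos (G \<omega> - t * R \<omega>))"
        "U \<omega> * cos (G \<omega>) * sin (t * R \<omega>) = 1/2 * (U \<omega> * sin (G \<omega> + t * R \<omega>)) - 1/2 * (U \<omega> * sin (G \<omega> - t * R \<omega>))"
        "U \<omega> * sin (G \<omega>) * cos (t * R \<omega>) = 1/2 * (U \<omega> * sin (G \<omega> + t * R \<omega>)) + 1/2 * (U \<omega> * sin (G \<omega> - t * R \<omega>))"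
        "U \<omega> * sin (G \<omega>) * sin (t * R \<omega>) = 1/2 * (U \<omega> * cos (G \<omega> - t * R \<omega>)) - 1/2 * (U \<omega> * cos (G \<omega> + t * R \<omega>))" for t \<omega>
        by (simp_all add: cos_add cos_diff sin_add sin_diff algebra_simps)
      have ints: "integrable M (\<lambda>\<omega>. U \<omega> * cos (G \<omega> + t * R \<omega>))" "integrable M (\<lambda>\<omega>. U \<omega> * cos (G \<omega> - t * R \<omega>))"
        "integrable M (\<lambda>\<omega>. U \<omega> * sin (G \<omega> + t * R \<omega>))" "integrable M (\<lambda>\<omega>. U \<omega> * sin (G \<omega> - t * R \<omega>))" for t
        by (rule bi; simp)+
      have "(LINT \<omega>|M. (U \<omega> * cos (G \<omega>)) * indicator B (R \<omega>)) = 0"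
      proof (rule integral_indicator_eq_0_of_char[OF _ Rm _ _ B])
        show "integrable M (\<lambda>\<omega>. U \<omega> * cos (G \<omega>))" by (rule bi) simp_all
        show "(LINT \<omega>|M. U \<omega> * cos (G \<omega>) * cos (t * R \<omega>)) = 0" for t
          unfolding tr using IH[OF gp(1)[of t]] IH[OF gp(2)[of t]] ints[of t] by simp
        show "(LINT \<omega>|M. U \<omega> * cos (G \<omega>) * sin (t * R \<omega>)) = 0" for t
          unfolding tr using IH[OF gp(1)[of t]] IH[OF gp(2)[of t]] ints[of t] by simp
      qed
      moreover have "(LINT \<omega>|M. (U \<omega> * sin (G \<omega>)) * indicator B (R \<omega>)) = 0"
      proof (rule integral_indicator_eq_0_of_char[OF _ Rm _ _ B])
        show "integrable M (\<lambda>\<omega>. U \<omega> * sin (G \<omega>))" by (rule bi) simp_all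
        show "(LINT \<omega>|M. U \<omega> * sin (G \<omega>) * cos (t * R \<omega>)) = 0" for t
          unfolding tr using IH[OF gp(1)[of t]] IH[OF gp(2)[of t]] ints[of t] by simp
        show "(LINT \<omega>|M. U \<omega> * sin (G \<omega>) * sin (t * R \<omega>)) = 0" for t
          unfolding tr using IH[OF gp(1)[of t]] IH[OF gp(2)[of t]] ints[of t] by simp
      qed
      moreover have "(Z \<omega> * (\<Prod>(R, B)\<leftarrow>x # l. indicator B (R \<omega>))) * h = (U \<omega> * h) * indicator B (R \<omega>)" for \<omega> h
        by (simp add: x U_def)
      ultimately show "(LINT \<omega>|M. (Z \<omega> * (\<Prod>(R, B)\<leftarrow>x # l. indicator B (R \<omega>))) * cos (G \<omega>)) = 0 \<and>
          (LINT \<omega>|M. (Z \<omega> * (\<Prod>(R, B)\<leftarrow>x # l. indicator B (R \<omega>))) * sin (G \<omega>)) = 0"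
        by (simp only: simp_thms)
    qed
  qed
  then show "(LINT \<omega>|M. (Z \<omega> * (\<Prod>(R, B)\<leftarrow>l. indicator B (R \<omega>))) * cos (G \<omega>)) = 0"
    "(LINT \<omega>|M. (Z \<omega> * (\<Prod>(R, B)\<leftarrow>l. indicator B (R \<omega>))) * sin (G \<omega>)) = 0" using G by blast+
qed

end

section \<open>From Gaussian phases to the noise algebra\<close>

context gaussian_coordinates
begin

abbreviation "noise t \<equiv> noise_algebra M W t"

lemma noise_sets:
  "sets (noise t) = sigma_sets (space M) (\<Union>s\<in>{0..t}. {W s -` A \<inter> space M | A. A \<in> sets borel})"
  unfolding noise_algebra_def by (rule sets_measure_of) auto

lemma noise_space: "space (noise t) = space M"
  unfolding noise_algebra_def by (rule space_measure_of) auto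

lemma noise_subalgebra: "subalgebra M (noise T)"
  unfolding subalgebra_def
proof
  show "space (noise T) = space M" by (rule noise_space)
  show "sets (noise T) \<subseteq> sets M"
    unfolding noise_sets
  proof (rule sets.sigma_sets_subset)
    show "(\<Union>s\<in>{0..T}. {W s -` A \<inter> space M | A. A \<in> sets borel}) \<subseteq> sets M"
      using measurable_sets[OF W_measurable] by auto
  qed
qed

lemma noise_mono: "t \<le> T \<Longrightarrow> sets (noise t) \<subseteq> sets (noise T)"
  unfolding noise_sets by (rule sigma_sets_mono', rule UN_mono) auto

text \<open>Finite lists of constraints make the family stable under intersection, by
  concatenation.\<close>

definition cylinders :: "'a set set" where
  "cylinders = {{\<omega> \<in> space M. \<forall>(s, k, B)\<in>set l. W s \<omega> $ k \<in> B} | l :: (real \<times> 'm \<times> real set) list.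
     \<forall>(s, k, B)\<in>set l. s \<in> {0..T} \<and> B \<in> sets borel}"

text \<open>Borel measurability of a vector is that of its components, so every \<open>W s\<close>
  is measurable for the algebra generated by the cylinders.\<close>

lemma noise_cylinders: "sets (noise T) \<subseteq> sigma_sets (space M) cylinders"
  unfolding noise_sets
proof (rule sigma_sets_mono)
  let ?N = "sigma (space M) cylinders"
  have C: "cylinders \<subseteq> Pow (space M)" by (auto simp: cylinders_def)
  have sN: "sets ?N = sigma_sets (space M) cylinders" "space ?N = space M"
    using C by (auto simp: sets_measure_of space_measure_of)
  have c: "(\<lambda>\<omega>. W s \<omega> $ k) \<in> borel_measurable ?N" if "s \<in> {0..T}" for s k
  proof (rule measurableI)
    fix B :: "real set" assume "B \<in> sets borel"
    then have "{\<omega> \<in> space M. \<forall>(s, k, B)\<in>set [(s, k, B)]. W s \<omega> $ k \<in> B} \<in> cylinders"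
      unfolding cylinders_def using that by (intro CollectI exI[of _ "[(s, k, B)]"]) auto
    moreover have "(\<lambda>\<omega>. W s \<omega> $ k) -` B \<inter> space ?N = {\<omega> \<in> space M. \<forall>(s, k, B)\<in>set [(s, k, B)]. W s \<omega> $ k \<in> B}"
      using sN by auto
    ultimately show "(\<lambda>\<omega>. W s \<omega> $ k) -` B \<inter> space ?N \<in> sets ?N"
      unfolding sN(1) by (auto intro: sigma_sets.Basic)
  qed simp
  have "W s \<in> borel_measurable ?N" if "s \<in> {0..T}" for s
    using c[OF that] by (subst borel_measurable_euclidean_space) (auto simp: Basis_vec_def inner_axis)
  then show "(\<Union>s\<in>{0..T}. {W s -` A \<inter> space M | A. A \<in> sets borel}) \<subseteq> sigma_sets (space M) cylinders"
    using measurable_sets[of _ ?N borel] unfolding sN by blast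
qed

text \<open>Dynkin's argument: the events over which \<open>Z\<close> integrates to 0 include the
  intersection-stable cylinders and are closed under complements and disjoint countable
  unions.\<close>

lemma orth_noise_set:
  assumes Z: "orth Z" and A: "A \<in> sets (noise T)"
  shows "(LINT \<omega>|M. Z \<omega> * indicator A \<omega>) = 0"
proof -
  have Z2: "L2 M Z" using Z by (simp add: orth_def)
  have Zi: "integrable M Z" by (rule L2_integrable[OF Z2])
  have Zm[measurable]: "Z \<in> borel_measurable M" using Z2 by auto
  have C: "cylinders \<subseteq> Pow (space M)" by (auto simp: cylinders_def)
  have mc: "{\<omega> \<in> space M. \<forall>(s, k, B)\<in>set l. W s \<omega> $ k \<in> B} \<in> sets M"
    if "\<forall>(s, k, B)\<in>set l. s \<in> {0..T} \<and> B \<in> sets borel" for l :: "(real \<times> 'm \<times> real set) list"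
    using that
  proof (induction l)
    case (Cons x l)
    obtain s k B where x: "x = (s, k, B)" by (cases x)
    have "s \<in> {0..T}" "B \<in> sets borel" using Cons.prems by (auto simp: x)
    then have "(\<lambda>\<omega>. W s \<omega> $ k) \<in> borel_measurable M"
      using W_measurable[of s] by auto
    then have "(\<lambda>\<omega>. W s \<omega> $ k) -` B \<inter> space M \<in> sets M"
      using \<open>B \<in> sets borel\<close> by (rule measurable_sets)
    moreover have "{\<omega> \<in> space M. \<forall>(s, k, B)\<in>set (x # l). W s \<omega> $ k \<in> B} =
        ((\<lambda>\<omega>. W s \<omega> $ k) -` B \<inter> space M) \<inter> {\<omega> \<in> space M. \<forall>(s, k, B)\<in>set l. W s \<omega> $ k \<in> B}"
      by (auto simp: x)
    moreover have "{\<omega> \<in> space M. \<forall>(s, k, B)\<in>set l. W s \<omega> $ k \<in> B} \<in> sets M"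
      using Cons.prems by (intro Cons.IH) simp
    ultimately show ?case by (simp only: sets.Int)
  qed simp
  have ind: "indicator {\<omega> \<in> space M. \<forall>(s, k, B)\<in>set l. W s \<omega> $ k \<in> B} \<omega>
      = (\<Prod>(R, B)\<leftarrow>map (\<lambda>(s, k, B). (\<lambda>\<omega>. W s \<omega> $ k, B)) l. indicator B (R \<omega>) :: real)" if "\<omega> \<in> space M" for \<omega> l
  proof (induction l)
    case (Cons x l)
    obtain s k B where x: "x = (s, k, B)" by (cases x)
    have "indicator {\<omega> \<in> space M. \<forall>(s, k, B)\<in>set (x # l). W s \<omega> $ k \<in> B} \<omega>
        = indicator B (W s \<omega> $ k) * (indicator {\<omega> \<in> space M. \<forall>(s, k, B)\<in>set l. W s \<omega> $ k \<in> B} \<omega> :: real)"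
      using that by (cases "W s \<omega> $ k \<in> B") (simp_all add: x indicator_def)
    then show ?case unfolding Cons.IH by (simp add: x)
  qed (use that in simp)
  have cyl: "E \<in> sets M \<and> (LINT \<omega>|M. Z \<omega> * indicator E \<omega>) = 0" if "E \<in> cylinders" for E
  proof -
    obtain l where l: "\<forall>(s, k, B)\<in>set l. s \<in> {0..T} \<and> B \<in> sets borel"
      and E: "E = {\<omega> \<in> space M. \<forall>(s, k, B)\<in>set l. W s \<omega> $ k \<in> B}"
      using \<open>E \<in> cylinders\<close> unfolding cylinders_def by blast
    let ?l = "map (\<lambda>(s, k, B). (\<lambda>\<omega>. W s \<omega> $ k, B)) l"
    have l': "\<forall>(R, B)\<in>set ?l. (\<exists>f. gauss f R) \<and> B \<in> sets borel"
    proof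
      fix y assume "y \<in> set ?l"
      then obtain s k B where y: "y = (\<lambda>\<omega>. W s \<omega> $ k, B)" "(s, k, B) \<in> set l" by auto
      then have "s \<in> {0..T}" "B \<in> sets borel" using l by auto
      then have "\<exists>f. gauss f (\<lambda>\<omega>. W s \<omega> $ k)" using gauss_W by auto
      then show "case y of (R, B) \<Rightarrow> (\<exists>f. gauss f R) \<and> B \<in> sets borel" using y \<open>B \<in> sets borel\<close> by simp
    qed
    \<comment> \<open>The zero phase is used, whose cosine is 1.\<close>
    have "(LINT \<omega>|M. Z \<omega> * indicator E \<omega>) = (LINT \<omega>|M. (Z \<omega> * (\<Prod>(R, B)\<leftarrow>?l. indicator B (R \<omega>))) * cos ((\<lambda>_. 0) \<omega>))"
      unfolding E by (intro Bochner_Integration.integral_cong refl) (simp only: ind cos_zero mult_1_right)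
    also have "\<dots> = 0" by (rule orth_cylinder(1)[OF Z l' gauss_zero])
    finally have "(LINT \<omega>|M. Z \<omega> * indicator E \<omega>) = 0" .
    moreover have "E \<in> sets M" unfolding E using l by (rule mc)
    ultimately show ?thesis by simp
  qed
  have IS: "Int_stable cylinders"
  proof (rule Int_stableI)
    fix a b assume "a \<in> cylinders" "b \<in> cylinders"
    then obtain l l' where l: "\<forall>(s, k, B)\<in>set l. s \<in> {0..T} \<and> B \<in> sets borel" "a = {\<omega> \<in> space M. \<forall>(s, k, B)\<in>set l. W s \<omega> $ k \<in> B}"
      and l': "\<forall>(s, k, B)\<in>set l'. s \<in> {0..T} \<and> B \<in> sets borel" "b = {\<omega> \<in> space M. \<forall>(s, k, B)\<in>set l'. W s \<omega> $ k \<in> B}"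
      unfolding cylinders_def by blast
    have "a \<inter> b = {\<omega> \<in> space M. \<forall>(s, k, B)\<in>set (l @ l'). W s \<omega> $ k \<in> B}"
      unfolding l(2) l'(2) set_append ball_Un by blast
    moreover have "\<forall>(s, k, B)\<in>set (l @ l'). s \<in> {0..T} \<and> B \<in> sets borel"
      using l(1) l'(1) unfolding set_append ball_Un by (rule conjI)
    ultimately show "a \<inter> b \<in> cylinders"
      unfolding cylinders_def by (intro CollectI exI[of _ "l @ l'"] conjI)
  qed
  have "space M \<in> cylinders" unfolding cylinders_def by (intro CollectI exI[of _ "[]"]) auto
  then have Omega: "(LINT \<omega>|M. Z \<omega> * indicator (space M) \<omega>) = 0" using cyl by blast
  have ind_i: "integrable M (\<lambda>\<omega>. Z \<omega> * indicator E \<omega>)" if "E \<in> sets M" for E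
    using integrable_mult_indicator[OF that Zi] by (simp add: mult.commute)
  have "A \<in> sigma_sets (space M) cylinders" using noise_cylinders A by auto
  then have "A \<in> sets M \<and> (LINT \<omega>|M. Z \<omega> * indicator A \<omega>) = 0"
  proof (induction rule: sigma_sets_induct_disjoint[OF IS C, consumes 1, case_names basic empty compl union])
    case (basic A)
    then show ?case by (rule cyl)
  next
    case empty
    then show ?case by simp
  next
    case (compl A)
    have "(LINT \<omega>|M. Z \<omega> * indicator (space M - A) \<omega>) = (LINT \<omega>|M. Z \<omega> * indicator (space M) \<omega> - Z \<omega> * indicator A \<omega>)"
      by (intro Bochner_Integration.integral_cong refl) (auto simp: indicator_def)
    also have "\<dots> = 0" using Omega compl.IH ind_i[of A] ind_i[of "space M"] by simp
    finally show ?case using compl.IH by auto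
  next
    case (union A)
    have Am: "\<And>i. A i \<in> sets M" and A0: "\<And>i. (LINT \<omega>|M. Z \<omega> * indicator (A i) \<omega>) = 0" using union.IH by auto
    have "(\<lambda>n. LINT \<omega>|M. Z \<omega> * indicator (\<Union>i<n. A i) \<omega>) \<longlonglongrightarrow> (LINT \<omega>|M. Z \<omega> * indicator (\<Union>i. A i) \<omega>)"
    proof (rule integral_dominated_convergence[where w = "\<lambda>\<omega>. \<bar>Z \<omega>\<bar>"])
      show "AE \<omega> in M. (\<lambda>n. Z \<omega> * indicator (\<Union>i<n. A i) \<omega>) \<longlonglongrightarrow> Z \<omega> * indicator (\<Union>i. A i) \<omega>"
      proof (rule AE_I2)
        fix \<omega>
        show "(\<lambda>n. Z \<omega> * indicator (\<Union>i<n. A i) \<omega>) \<longlonglongrightarrow> Z \<omega> * indicator (\<Union>i. A i) \<omega>"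
          by (intro tendsto_mult tendsto_const LIMSEQ_indicator_UN)
      qed
      show "integrable M (\<lambda>\<omega>. \<bar>Z \<omega>\<bar>)" using Zi by simp
      show "(\<lambda>\<omega>. Z \<omega> * indicator (\<Union>i. A i) \<omega>) \<in> borel_measurable M" using Am by measurable
      show "(\<lambda>\<omega>. Z \<omega> * indicator (\<Union>i<n. A i) \<omega>) \<in> borel_measurable M" for n using Am by measurable
      show "AE \<omega> in M. norm (Z \<omega> * indicator (\<Union>i<n. A i) \<omega>) \<le> \<bar>Z \<omega>\<bar>" for n
        by (auto simp: indicator_def)
    qed
    moreover have "(LINT \<omega>|M. Z \<omega> * indicator (\<Union>i<n. A i) \<omega>) = 0" for n
    proof -
      have "indicator (\<Union>i<n. A i) \<omega> = (\<Sum>i<n. indicator (A i) \<omega> :: real)" for \<omega>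
        using union.hyps by (intro indicator_UN_disjoint) (auto simp: disjoint_family_on_def)
      then have "(LINT \<omega>|M. Z \<omega> * indicator (\<Union>i<n. A i) \<omega>) = (LINT \<omega>|M. (\<Sum>i<n. Z \<omega> * indicator (A i) \<omega>))"
        by (simp add: sum_distrib_left)
      also have "\<dots> = (\<Sum>i<n. (LINT \<omega>|M. Z \<omega> * indicator (A i) \<omega>))"
        by (intro Bochner_Integration.integral_sum ind_i Am)
      finally show ?thesis by (simp add: A0)
    qed
    ultimately have "(LINT \<omega>|M. Z \<omega> * indicator (\<Union>i. A i) \<omega>) = 0"
      by (simp add: LIMSEQ_const_iff)
    then show ?case using Am by auto
  qed
  then show ?thesis by simp
qed

text \<open>All integrals of \<open>Z\<close> over noise events vanish, so its conditional
  expectation is 0, and noise-measurable factors can be pulled out.\<close>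

lemma orth_noise:
  assumes Z: "orth Z" and Y: "Y \<in> borel_measurable (noise T)" "L2 M Y"
  shows "(LINT \<omega>|M. Z \<omega> * Y \<omega>) = 0"
proof -
  have Z2: "L2 M Z" using Z by (simp add: orth_def)
  have [measurable]: "Z \<in> borel_measurable M" using Z2 by auto
  interpret S: finite_measure_subalgebra M "noise T" by standard (rule noise_subalgebra)
  have "AE \<omega> in M. real_cond_exp M (noise T) Z \<omega> = 0"
  proof (rule S.real_cond_exp_charact)
    fix A assume A: "A \<in> sets (noise T)"
    show "(\<integral>\<omega>\<in>A. Z \<omega> \<partial>M) = (\<integral>\<omega>\<in>A. 0 \<partial>M)"
      using orth_noise_set[OF Z A] by (simp add: set_lebesgue_integral_def mult.commute)
  qed (use L2_integrable[OF Z2] in auto)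
  then have "(LINT \<omega>|M. Y \<omega> * real_cond_exp M (noise T) Z \<omega>) = 0"
    by (intro integral_eq_zero_AE) auto
  moreover have "(LINT \<omega>|M. Y \<omega> * real_cond_exp M (noise T) Z \<omega>) = (LINT \<omega>|M. Y \<omega> * Z \<omega>)"
    by (rule S.real_cond_exp_intg(2)[OF L2_mult[OF Y(2) Z2] Y(1)]) simp
  ultimately show ?thesis by (simp add: mult.commute)
qed

section \<open>Remainders of finite partial sums\<close>

definition remainder :: "('a \<Rightarrow> real) \<Rightarrow> 'm multi_index set \<Rightarrow> 'a \<Rightarrow> real" where
  "remainder X A \<omega> = X \<omega> - (\<Sum>\<alpha>\<in>A. (LINT \<omega>|M. wick \<alpha> \<omega> * X \<omega>) * wick \<alpha> \<omega>)"

context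
  fixes X :: "'a \<Rightarrow> real" assumes X2: "L2 M X"
begin

lemma remainder_L2: "L2 M (remainder X A)"
  unfolding remainder_def[abs_def] by (intro L2_diff X2 L2_sum L2_cmult wick_L2)

text \<open>By orthonormality the finite sum is the orthogonal projection of \<open>X\<close>:
  subtracting it removes exactly the coefficients in \<open>A\<close>.\<close>

lemma remainder_wick:
  assumes "finite A"
  shows "(LINT \<omega>|M. remainder X A \<omega> * wick \<beta> \<omega>) = (if \<beta> \<in> A then 0 else (LINT \<omega>|M. wick \<beta> \<omega> * X \<omega>))"
proof -
  let ?u = "\<lambda>\<alpha>. LINT \<omega>|M. wick \<alpha> \<omega> * X \<omega>"
  have i: "integrable M (\<lambda>\<omega>. ?u \<alpha> * (wick \<alpha> \<omega> * wick \<beta> \<omega>))" for \<alpha>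
    by (intro integrable_mult_right L2_mult wick_L2)
  have "(LINT \<omega>|M. remainder X A \<omega> * wick \<beta> \<omega>) = (LINT \<omega>|M. wick \<beta> \<omega> * X \<omega> - (\<Sum>\<alpha>\<in>A. ?u \<alpha> * (wick \<alpha> \<omega> * wick \<beta> \<omega>)))"
    unfolding remainder_def by (simp add: left_diff_distrib sum_distrib_right mult.assoc mult.commute[of "X _"])
  also have "\<dots> = ?u \<beta> - (LINT \<omega>|M. (\<Sum>\<alpha>\<in>A. ?u \<alpha> * (wick \<alpha> \<omega> * wick \<beta> \<omega>)))"
    by (intro Bochner_Integration.integral_diff Bochner_Integration.integrable_sum i L2_mult wick_L2 X2)
  also have "(LINT \<omega>|M. (\<Sum>\<alpha>\<in>A. ?u \<alpha> * (wick \<alpha> \<omega> * wick \<beta> \<omega>))) = (\<Sum>\<alpha>\<in>A. (LINT \<omega>|M. ?u \<alpha> * (wick \<alpha> \<omega> * wick \<beta> \<omega>)))"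
    by (intro Bochner_Integration.integral_sum i)
  also have "\<dots> = (\<Sum>\<alpha>\<in>A. if \<alpha> = \<beta> then ?u \<alpha> else 0)"
    by (intro sum.cong refl) (simp add: wick_orthonormal)
  also have "\<dots> = (if \<beta> \<in> A then ?u \<beta> else 0)" using assms by simp
  finally show ?thesis by simp
qed

text \<open>Pythagoras: the difference lies in the span of monomials from \<open>B\<close>, to which
  \<open>remainder X B\<close> is orthogonal.\<close>

lemma remainder_insert:
  assumes "finite A" "finite B" "A \<subseteq> B"
  shows "(l2norm M (\<lambda>\<omega>. remainder X A \<omega> - remainder X B \<omega>))\<^sup>2 = (l2norm M (remainder X A))\<^sup>2 - (l2norm M (remainder X B))\<^sup>2"
proof -
  let ?u = "\<lambda>\<alpha>. LINT \<omega>|M. wick \<alpha> \<omega> * X \<omega>"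
  have d: "remainder X A \<omega> - remainder X B \<omega> = (\<Sum>\<alpha>\<in>B - A. ?u \<alpha> * wick \<alpha> \<omega>)" for \<omega>
    unfolding remainder_def using sum.subset_diff[OF assms(3,2), of "\<lambda>\<alpha>. ?u \<alpha> * wick \<alpha> \<omega>"] by simp
  have "(LINT \<omega>|M. remainder X B \<omega> * (remainder X A \<omega> - remainder X B \<omega>)) = (LINT \<omega>|M. (\<Sum>\<alpha>\<in>B - A. ?u \<alpha> * (remainder X B \<omega> * wick \<alpha> \<omega>)))"
    unfolding d by (simp add: sum_distrib_left mult.left_commute)
  also have "\<dots> = (\<Sum>\<alpha>\<in>B - A. ?u \<alpha> * (LINT \<omega>|M. remainder X B \<omega> * wick \<alpha> \<omega>))"
    by (subst Bochner_Integration.integral_sum) (auto intro!: L2_mult remainder_L2 wick_L2)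
  also have "\<dots> = 0" using assms by (intro sum.neutral) (simp add: remainder_wick)
  finally have 0: "(LINT \<omega>|M. remainder X B \<omega> * (remainder X A \<omega> - remainder X B \<omega>)) = 0" .
  have "(l2norm M (remainder X A))\<^sup>2 = (LINT \<omega>|M. (remainder X B \<omega>)\<^sup>2 + 2 * (remainder X B \<omega> * (remainder X A \<omega> - remainder X B \<omega>))
      + (remainder X A \<omega> - remainder X B \<omega>)\<^sup>2)"
    unfolding l2norm_sq by (intro Bochner_Integration.integral_cong refl) (simp add: power2_eq_square algebra_simps)
  also have "\<dots> = (l2norm M (remainder X B))\<^sup>2 + 2 * 0 + (l2norm M (\<lambda>\<omega>. remainder X A \<omega> - remainder X B \<omega>))\<^sup>2"
    using L2_integrable_sq[OF remainder_L2[of B]] L2_integrable_sq[OF L2_diff[OF remainder_L2[of A] remainder_L2[of B]]]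
      L2_mult[OF remainder_L2[of B] L2_diff[OF remainder_L2[of A] remainder_L2[of B]]]
    by (simp add: l2norm_sq 0)
  finally show ?thesis by simp
qed

lemma remainder_antimono:
  assumes "finite A" "finite B" "A \<subseteq> B"
  shows "l2norm M (remainder X B) \<le> l2norm M (remainder X A)"
proof -
  have "0 \<le> (l2norm M (remainder X A))\<^sup>2 - (l2norm M (remainder X B))\<^sup>2"
    unfolding remainder_insert[OF assms, symmetric] by simp
  then have "(l2norm M (remainder X B))\<^sup>2 \<le> (l2norm M (remainder X A))\<^sup>2" by simp
  then show ?thesis by (rule power2_le_imp_le) (rule l2norm_nonneg)
qed

text \<open>Along finite sets realising the infimum of the remainders, the partial sums converge by
  completeness of \<open>L\<^sup>2\<close>; what remains of \<open>X\<close> is orthogonal to every Wick monomial, hence vanishes.\<close>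

lemma remainder_small:
  assumes Y: "Y \<in> borel_measurable (noise T)" "AE \<omega> in M. X \<omega> = Y \<omega>" and "\<epsilon> > 0"
  shows "\<exists>A. finite A \<and> l2norm M (remainder X A) < \<epsilon>"
proof -
  define v where "v = (\<lambda>A. (l2norm M (remainder X A))\<^sup>2)"
  define \<delta> where "\<delta> = (INF A\<in>Collect finite. v A)"
  have bdd: "bdd_below (v ` Collect finite)" by (rule bdd_belowI[of _ 0]) (auto simp: v_def)
  have \<delta>_le: "\<delta> \<le> v A" if "finite A" for A
    unfolding \<delta>_def using bdd that by (intro cINF_lower) auto
  have "\<exists>A. finite A \<and> v A < \<delta> + 1 / Suc n" for n
  proof (rule ccontr)
    assume "\<not> ?thesis"
    then have "\<delta> + 1 / Suc n \<le> \<delta>" unfolding \<delta>_def by (intro cINF_greatest) (auto simp: not_less)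
    then show False by simp
  qed
  then have "\<forall>n. \<exists>A. finite A \<and> v A < \<delta> + 1 / Suc n" by blast
  from choice[OF this] obtain A where A: "\<forall>n. finite (A n) \<and> v (A n) < \<delta> + 1 / Suc n" by (rule exE)
  \<comment> \<open>Unions make the sequence nested, as Pythagoras requires, and can only decrease
    \<open>v\<close>.\<close>
  define B where "B = (\<lambda>n. \<Union>i\<le>n. A i)"
  have B: "finite (B n)" "m \<le> n \<Longrightarrow> B m \<subseteq> B n" "A n \<subseteq> B n" for m n
    subgoal using A by (simp add: B_def)
    subgoal unfolding B_def by (rule UN_mono) auto
    subgoal unfolding B_def by blast
    done
  have vB: "v (B n) < \<delta> + 1 / Suc n" for n
  proof -
    have "v (B n) \<le> v (A n)" unfolding v_def using A B(1,3)[of n] by (intro power_mono remainder_antimono) auto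
    then show ?thesis using A by (meson le_less_trans)
  qed
  let ?r = "\<lambda>n. remainder X (B n)"
  \<comment> \<open>For nested sets the squared distance is a difference of two values of
    \<open>v\<close>, the larger of which exceeds the infimum \<delta> by less than 1 / (m + 1),
    with m the smaller index.\<close>
  have diff: "(l2norm M (\<lambda>\<omega>. ?r m \<omega> - ?r n \<omega>))\<^sup>2 \<le> 1 / Suc (min m n)" for m n
  proof -
    have *: "(l2norm M (\<lambda>\<omega>. ?r m \<omega> - ?r n \<omega>))\<^sup>2 \<le> 1 / Suc m" if "m \<le> n" for m n
      using remainder_insert[OF B(1) B(1) B(2)[OF that]] vB[of m] \<delta>_le[OF B(1)[of n]] by (simp add: v_def)
    show ?thesis
      using *[of m n] *[of n m] l2norm_diff_commute[of M "?r m" "?r n"] by (cases "m \<le> n") (auto simp: min_def)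
  qed
  obtain Z where Z2: "L2 M Z" and Z: "(\<lambda>n. l2norm M (\<lambda>\<omega>. ?r n \<omega> - Z \<omega>)) \<longlonglongrightarrow> 0"
  proof (rule L2_complete[of ?r])
    show "L2 M (?r n)" for n by (rule remainder_L2)
    fix \<epsilon> :: real assume "\<epsilon> > 0"
    then obtain N where N: "1 / Suc N < \<epsilon>\<^sup>2" by (meson nat_approx_posE zero_less_power)
    have "l2norm M (\<lambda>\<omega>. ?r m \<omega> - ?r n \<omega>) < \<epsilon>" if "m \<ge> N" "n \<ge> N" for m n
    proof (rule power2_less_imp_less)
      have "1 / real (Suc (min m n)) \<le> 1 / Suc N" using that by (intro divide_left_mono) auto
      then show "(l2norm M (\<lambda>\<omega>. ?r m \<omega> - ?r n \<omega>))\<^sup>2 < \<epsilon>\<^sup>2" using diff[of m n] N by linarith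
    qed (use \<open>\<epsilon> > 0\<close> in simp)
    then show "\<exists>N. \<forall>m\<ge>N. \<forall>n\<ge>N. l2norm M (\<lambda>\<omega>. ?r m \<omega> - ?r n \<omega>) < \<epsilon>" by blast
  qed
  have "(LINT \<omega>|M. Z \<omega> * wick \<beta> \<omega>) = 0" for \<beta>
  proof -
    let ?u = "LINT \<omega>|M. wick \<beta> \<omega> * X \<omega>"
    \<comment> \<open>Adding a missing \<beta> to \<open>B n\<close> lowers \<open>v\<close> by the
      square of its coefficient; as \<open>v\<close> cannot fall below \<delta>, that coefficient is
      small.\<close>
    have le: "\<bar>LINT \<omega>|M. ?r n \<omega> * wick \<beta> \<omega>\<bar> \<le> sqrt (1 / Suc n)" for n
    proof (cases "\<beta> \<in> B n")
      case False
      let ?d = "\<lambda>\<omega>. remainder X (B n) \<omega> - remainder X (insert \<beta> (B n)) \<omega>"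
      have "?d \<omega> = ?u * wick \<beta> \<omega>" for \<omega> using False B(1)[of n] by (simp add: remainder_def)
      then have "(l2norm M ?d)\<^sup>2 = ?u\<^sup>2"
        by (simp add: l2norm_cmult power_mult_distrib l2norm_sq) (simp add: power2_eq_square wick_orthonormal)
      then have "?u\<^sup>2 \<le> 1 / Suc n"
        using remainder_insert[OF _ _ subset_insertI, of "B n" \<beta>] B(1)[of n] vB[of n] \<delta>_le[of "insert \<beta> (B n)"] by (auto simp: v_def)
      then have "sqrt (?u\<^sup>2) \<le> sqrt (1 / Suc n)" by (rule real_sqrt_le_mono)
      then show ?thesis using False B(1)[of n] by (simp add: remainder_wick)
    qed (use B(1) in \<open>simp add: remainder_wick\<close>)
    have "(\<lambda>n. LINT \<omega>|M. ?r n \<omega> * wick \<beta> \<omega>) \<longlonglongrightarrow> 0"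
    proof (rule Lim_null_comparison[where g = "\<lambda>n. sqrt (1 / Suc n)"])
      show "\<forall>\<^sub>F n in sequentially. norm (LINT \<omega>|M. ?r n \<omega> * wick \<beta> \<omega>) \<le> sqrt (1 / Suc n)" using le by simp
      show "(\<lambda>n. sqrt (1 / Suc n)) \<longlonglongrightarrow> 0"
        using tendsto_real_sqrt[OF lim_1_over_n[THEN LIMSEQ_Suc]] by simp
    qed
    moreover have "(\<lambda>n. LINT \<omega>|M. ?r n \<omega> * wick \<beta> \<omega>) \<longlonglongrightarrow> (LINT \<omega>|M. Z \<omega> * wick \<beta> \<omega>)"
      by (rule L2_tendsto_inner[OF remainder_L2 Z2 Z wick_L2])
    ultimately show ?thesis using LIMSEQ_unique by blast
  qed
  then have oZ: "orth Z" using Z2 by (simp add: orth_def)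
  have Ym: "Y \<in> borel_measurable M" by (rule measurable_from_subalg[OF noise_subalgebra Y(1)])
  have Y2: "L2 M Y" by (rule L2_cong_AE[OF X2 Ym]) (use Y(2) in auto)
  have "(LINT \<omega>|M. Z \<omega> * X \<omega>) = (LINT \<omega>|M. Z \<omega> * Y \<omega>)"
    using Y(2) Ym X2 Z2 by (intro integral_cong_AE) auto
  then have ZX: "(LINT \<omega>|M. Z \<omega> * X \<omega>) = 0" using orth_noise[OF oZ Y(1) Y2] by simp
  \<comment> \<open>\<open>Z\<close> is orthogonal to \<open>X\<close>, a functional of the noise,
    and to every Wick monomial, hence to all remainders and so to their limit, which is
    \<open>Z\<close> itself.\<close>
  have rZ: "(LINT \<omega>|M. ?r n \<omega> * Z \<omega>) = 0" for n
  proof -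
    define u where "u = (\<lambda>\<alpha>. LINT \<omega>|M. wick \<alpha> \<omega> * X \<omega>)"
    have i: "integrable M (\<lambda>\<omega>. u \<alpha> * (Z \<omega> * wick \<alpha> \<omega>))" for \<alpha>
      by (rule integrable_mult_right, rule L2_mult[OF Z2 wick_L2])
    have "?r n \<omega> * Z \<omega> = Z \<omega> * X \<omega> - (\<Sum>\<alpha>\<in>B n. u \<alpha> * (Z \<omega> * wick \<alpha> \<omega>))" for \<omega>
      unfolding remainder_def u_def left_diff_distrib sum_distrib_right
      by (intro arg_cong2[where f = minus] sum.cong refl) (simp_all only: mult_ac)
    then have "(LINT \<omega>|M. ?r n \<omega> * Z \<omega>) = (LINT \<omega>|M. Z \<omega> * X \<omega> - (\<Sum>\<alpha>\<in>B n. u \<alpha> * (Z \<omega> * wick \<alpha> \<omega>)))"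
      by simp
    also have "\<dots> = (LINT \<omega>|M. Z \<omega> * X \<omega>) - (LINT \<omega>|M. (\<Sum>\<alpha>\<in>B n. u \<alpha> * (Z \<omega> * wick \<alpha> \<omega>)))"
      by (rule Bochner_Integration.integral_diff[OF L2_mult[OF Z2 X2]]) (rule Bochner_Integration.integrable_sum, rule i)
    also have "(LINT \<omega>|M. (\<Sum>\<alpha>\<in>B n. u \<alpha> * (Z \<omega> * wick \<alpha> \<omega>))) = (\<Sum>\<alpha>\<in>B n. (LINT \<omega>|M. u \<alpha> * (Z \<omega> * wick \<alpha> \<omega>)))"
      by (rule Bochner_Integration.integral_sum, rule i)
    also have "\<dots> = 0" using oZ by (simp add: orth_def)
    finally show ?thesis using ZX by simp
  qed
  have "(\<lambda>n. LINT \<omega>|M. ?r n \<omega> * Z \<omega>) \<longlonglongrightarrow> (LINT \<omega>|M. Z \<omega> * Z \<omega>)"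
    by (rule L2_tendsto_inner[OF remainder_L2 Z2 Z Z2])
  then have "(LINT \<omega>|M. Z \<omega> * Z \<omega>) = 0" unfolding rZ by (simp add: LIMSEQ_const_iff)
  then have Z0: "l2norm M Z = 0" by (simp add: l2norm_def power2_eq_square)
  have "(\<lambda>n. l2norm M (?r n)) \<longlonglongrightarrow> 0"
    using L2_tendsto_norm[OF remainder_L2 Z2 Z] by (simp add: Z0)
  from order_tendstoD(2)[OF this \<open>\<epsilon> > 0\<close>] obtain n where "l2norm M (?r n) < \<epsilon>"
    by (auto dest: eventually_happens)
  then show ?thesis using B(1) by blast
qed

text \<open>Remainders decrease under inclusion, so one good finite set settles all larger ones and
  the convergence is unconditional.\<close>

theorem wick_complete:
  assumes Y: "Y \<in> borel_measurable (noise T)" "AE \<omega> in M. X \<omega> = Y \<omega>"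
  shows "((\<lambda>A. l2norm M (remainder X A)) \<longlongrightarrow> 0) (finite_subsets_at_top UNIV)"
proof (rule tendstoI)
  fix \<epsilon> :: real assume "\<epsilon> > 0"
  obtain A where A: "finite A" "l2norm M (remainder X A) < \<epsilon>" using remainder_small[OF Y \<open>\<epsilon> > 0\<close>] by blast
  show "\<forall>\<^sub>F B in finite_subsets_at_top UNIV. dist (l2norm M (remainder X B)) 0 < \<epsilon>"
    unfolding eventually_finite_subsets_at_top
  proof (intro exI[of _ A] conjI allI impI)
    fix B assume "finite B \<and> A \<subseteq> B \<and> B \<subseteq> UNIV"
    then have "l2norm M (remainder X B) \<le> l2norm M (remainder X A)" by (intro remainder_antimono A) auto
    then show "dist (l2norm M (remainder X B)) 0 < \<epsilon>" using A by simp
  qed (use A in auto)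
qed

end

end

subsection \<open>Ito integrals against Wick monomials\<close>

context gaussian_coordinates
begin

lemma measurable_Leb_mono:
  assumes "f \<in> borel_measurable (Leb T)" "t \<le> T" shows "f \<in> borel_measurable (Leb t)"
  by (rule measurable_restrict_mono[OF assms(1)]) (use assms(2) in auto)

lemma integrable_Leb_mono:
  fixes f :: "real \<Rightarrow> real"
  assumes "integrable (Leb T) f" "t \<le> T" shows "integrable (Leb t) f"
  by (rule Equivalence_Lebesgue_Henstock_Integration.integrable_subinterval[OF assms(1)]) (use assms(2) in auto)

lemma L2_Leb_mono: "L2 (Leb T) f \<Longrightarrow> t \<le> T \<Longrightarrow> L2 (Leb t) f"
  by (rule L2_I) (auto intro: measurable_Leb_mono integrable_Leb_mono dest: L2_integrable_sq L2_measurable)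

lemma integral_Leb_supported:
  fixes f :: "real \<Rightarrow> real"
  assumes "t \<le> T" "\<And>s. s > t \<Longrightarrow> f s = 0"
  shows "(LINT s|Leb T. f s) = (LINT s|Leb t. f s)"
proof -
  have "(LINT s|Leb T. f s) = (LINT s|lebesgue. indicator {0..T} s *\<^sub>R f s)" by (rule integral_restrict_space) auto
  also have "\<dots> = (LINT s|lebesgue. indicator {0..t} s *\<^sub>R f s)"
    using assms by (intro Bochner_Integration.integral_cong refl) (auto simp: indicator_def not_le)
  also have "\<dots> = (LINT s|Leb t. f s)" by (rule integral_restrict_space[symmetric]) auto
  finally show ?thesis .
qed

lemma nn_integral_Leb_mono:
  "t \<le> T \<Longrightarrow> (\<integral>\<^sup>+s. f s \<partial>Leb t) \<le> (\<integral>\<^sup>+s. f s \<partial>Leb T)"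
  by (subst (1 2) nn_integral_restrict_space) (auto intro!: nn_integral_mono simp: indicator_def)

lemma L2_PM_product:
  assumes f: "L2 (Leb t) f" and g: "L2 M g"
  shows "L2 (PM t) (\<lambda>(s, \<omega>). f s * g \<omega>)"
proof (rule L2_I)
  have [measurable]: "f \<in> borel_measurable (Leb t)" "g \<in> borel_measurable M" using f g by auto
  show "(\<lambda>(s, \<omega>). f s * g \<omega>) \<in> borel_measurable (PM t)" by measurable
  have "(\<lambda>x. (case x of (s, \<omega>) \<Rightarrow> f s * g \<omega>)\<^sup>2) = (\<lambda>(s, \<omega>). (f s)\<^sup>2 * (g \<omega>)\<^sup>2)"
    by (auto simp: power_mult_distrib)
  then show "integrable (PM t) (\<lambda>x. (case x of (s, \<omega>) \<Rightarrow> f s * g \<omega>)\<^sup>2)"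
    using PM_integral_product(1)[OF L2_integrable_sq[OF f] L2_integrable_sq[OF g]] by simp
qed

lemma L2_PM_wick: "t \<le> T \<Longrightarrow> L2 (PM t) (\<lambda>(s, \<omega>). e i s * wick \<alpha> \<omega>)"
  by (intro L2_PM_product L2_Leb_mono[OF e_L2] wick_L2)

text \<open>Both sides are additive over the list. For one interval the left side is given by
  \<open>wick_IBP_incr\<close>, and on the right the integral over time and sample space
  factorises.\<close>

lemma simple_proc_wick:
  assumes "simple_proc_on \<F> t \<Phi>" and t: "0 \<le> t" "t \<le> T"
  shows "(LINT \<omega>|M. simple_proc_integral (\<lambda>s \<omega>. W s \<omega> $ k) \<Phi> \<omega> * wick \<alpha> \<omega>) =
    (\<Sum>p\<in>Poly_Mapping.keys \<alpha>. if fst p = k then sqrt (real (Poly_Mapping.lookup \<alpha> p)) *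
      (LINT x|PM t. (case x of (s, \<omega>) \<Rightarrow> simple_proc_val \<Phi> s \<omega>) *
        (case x of (s, \<omega>) \<Rightarrow> e (snd p) s * wick (\<alpha> - Poly_Mapping.single p 1) \<omega>)) else 0)"
  using assms(1)
proof (induction \<Phi>)
  case Nil
  then show ?case by (simp add: simple_proc_Cons case_prod_unfold cong: if_cong)
next
  case (Cons x \<Phi>)
  obtain a b H where x: "x = (a, b, H)" by (cases x)
  have *: "0 \<le> a" "a \<le> b" "b \<le> t" "adapted_bounded a H" "simple_proc_on \<F> t \<Phi>"
    using Cons.prems by (auto simp: simple_proc_on_iff x)
  let ?w = "\<lambda>p. wick (\<alpha> - Poly_Mapping.single p 1)"
  have bT: "b \<le> T" using * t by simp
  have H2: "L2 M H" by (rule adapted_bounded_L2[OF *(4)])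
  have i1: "integrable M (\<lambda>\<omega>. H \<omega> * (W b \<omega> $ k - W a \<omega> $ k) * wick \<alpha> \<omega>)"
  proof -
    have "L2 M (\<lambda>\<omega>. H \<omega> * (W b \<omega> $ k - W a \<omega> $ k))"
      using simple_proc_L2(2)[of t "[(a, b, H)]" k] * t by (simp add: simple_proc_Cons[abs_def] simple_proc_on_iff)
    then show ?thesis by (rule L2_mult[OF _ wick_L2])
  qed
  have i2: "integrable M (\<lambda>\<omega>. simple_proc_integral (\<lambda>s \<omega>. W s \<omega> $ k) \<Phi> \<omega> * wick \<alpha> \<omega>)"
    by (intro L2_mult simple_proc_L2(2)[OF *(5) t(2)] wick_L2)
  have p1: "(LINT x|PM t. (case x of (s, \<omega>) \<Rightarrow> simple_proc_val ((a, b, H) # \<Phi>) s \<omega>) * (case x of (s, \<omega>) \<Rightarrow> e (snd p) s * ?w p \<omega>))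
      = (LINT s|Leb T. e (snd p) s * indicator {a<..b} s) * (LINT \<omega>|M. H \<omega> * ?w p \<omega>) +
        (LINT x|PM t. (case x of (s, \<omega>) \<Rightarrow> simple_proc_val \<Phi> s \<omega>) * (case x of (s, \<omega>) \<Rightarrow> e (snd p) s * ?w p \<omega>))" for p
  proof -
    have j1: "integrable (PM t) (\<lambda>x. (case x of (s, \<omega>) \<Rightarrow> H \<omega> * indicator {a<..b} s) * (case x of (s, \<omega>) \<Rightarrow> e (snd p) s * ?w p \<omega>))"
      by (intro L2_mult PM_L2_product[OF *(4,1,2,3)] L2_PM_wick t)
    have j2: "integrable (PM t) (\<lambda>x. (case x of (s, \<omega>) \<Rightarrow> simple_proc_val \<Phi> s \<omega>) * (case x of (s, \<omega>) \<Rightarrow> e (snd p) s * ?w p \<omega>))"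
      by (intro L2_mult simple_proc_L2(1)[OF *(5) t(2)] L2_PM_wick t)
    have ei: "integrable (Leb t) (\<lambda>s. e (snd p) s * indicator {a<..b} s)"
    proof (rule L2_mult[OF L2_Leb_mono[OF e_L2 t(2)]], rule L2_I)
      note i = square_integral_const(1)[OF *(1,2,3)]
      then show "(indicator {a<..b} :: real \<Rightarrow> real) \<in> borel_measurable (Leb t)" by simp
      have "(\<lambda>x. (indicator {a<..b} x :: real)\<^sup>2) = indicator {a<..b}" by (auto simp: indicator_def fun_eq_iff)
      with i show "integrable (Leb t) (\<lambda>x. (indicator {a<..b} x :: real)\<^sup>2)" by simp
    qed
    have "(LINT x|PM t. (case x of (s, \<omega>) \<Rightarrow> H \<omega> * indicator {a<..b} s) * (case x of (s, \<omega>) \<Rightarrow> e (snd p) s * ?w p \<omega>))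
        = (LINT (s, \<omega>)|PM t. (e (snd p) s * indicator {a<..b} s) * (H \<omega> * ?w p \<omega>))"
      by (intro Bochner_Integration.integral_cong refl) (simp add: case_prod_unfold mult_ac)
    also have "\<dots> = (LINT s|Leb t. e (snd p) s * indicator {a<..b} s) * (LINT \<omega>|M. H \<omega> * ?w p \<omega>)"
      by (rule PM_integral_product(2)[OF ei L2_mult[OF H2 wick_L2]])
    \<comment> \<open>The indicator vanishes beyond \<open>t\<close>, so the covariance, an integral
      over [0, T], may be taken over [0, t].\<close>
    also have "(LINT s|Leb t. e (snd p) s * indicator {a<..b} s) = (LINT s|Leb T. e (snd p) s * indicator {a<..b} s)"
      using * t by (intro integral_Leb_supported[symmetric]) auto
    finally have "(LINT x|PM t. (case x of (s, \<omega>) \<Rightarrow> H \<omega> * indicator {a<..b} s) * (case x of (s, \<omega>) \<Rightarrow> e (snd p) s * ?w p \<omega>))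
        = (LINT s|Leb T. e (snd p) s * indicator {a<..b} s) * (LINT \<omega>|M. H \<omega> * ?w p \<omega>)" .
    moreover have "(case x of (s, \<omega>) \<Rightarrow> simple_proc_val ((a, b, H) # \<Phi>) s \<omega>) * (case x of (s, \<omega>) \<Rightarrow> e (snd p) s * ?w p \<omega>)
       = (case x of (s, \<omega>) \<Rightarrow> H \<omega> * indicator {a<..b} s) * (case x of (s, \<omega>) \<Rightarrow> e (snd p) s * ?w p \<omega>)
       + (case x of (s, \<omega>) \<Rightarrow> simple_proc_val \<Phi> s \<omega>) * (case x of (s, \<omega>) \<Rightarrow> e (snd p) s * ?w p \<omega>)" for x
      by (simp only: simple_proc_Cons case_prod_unfold distrib_right)
    ultimately show ?thesis using Bochner_Integration.integral_add[OF j1 j2] by simp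
  qed
  have "(LINT \<omega>|M. simple_proc_integral (\<lambda>s \<omega>. W s \<omega> $ k) (x # \<Phi>) \<omega> * wick \<alpha> \<omega>) =
      (LINT \<omega>|M. H \<omega> * (W b \<omega> $ k - W a \<omega> $ k) * wick \<alpha> \<omega>) + (LINT \<omega>|M. simple_proc_integral (\<lambda>s \<omega>. W s \<omega> $ k) \<Phi> \<omega> * wick \<alpha> \<omega>)"
    unfolding x simple_proc_Cons distrib_right by (rule Bochner_Integration.integral_add[OF i1 i2])
  then show ?case
    unfolding Cons.IH[OF *(5)] wick_IBP_incr[OF *(1,2) bT *(4)] x p1 sum.distrib[symmetric]
    by (simp only:) (intro sum.cong refl, simp add: distrib_left mult_ac del: One_nat_def)
qed

text \<open>Both sides are mean-square continuous along the approximating simple processes, the sum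
  over the support of \<alpha> being finite.\<close>

lemma ito_wick:
  assumes I: "is_ito_integral M \<F> (\<lambda>s \<omega>. W s \<omega> $ k) t \<phi> I" and t: "0 \<le> t" "t \<le> T"
  shows "(LINT \<omega>|M. I \<omega> * wick \<alpha> \<omega>) =
    (\<Sum>p\<in>Poly_Mapping.keys \<alpha>. if fst p = k then sqrt (real (Poly_Mapping.lookup \<alpha> p)) *
      (LINT x|PM t. (case x of (s, \<omega>) \<Rightarrow> \<phi> s \<omega>) *
        (case x of (s, \<omega>) \<Rightarrow> e (snd p) s * wick (\<alpha> - Poly_Mapping.single p 1) \<omega>)) else 0)" (is "_ = ?R")
proof -
  obtain \<Phi> where \<Phi>: "\<And>n. simple_proc_on \<F> t (\<Phi> n)"
    "(\<lambda>n. l2norm (PM t) (\<lambda>x. (case x of (s, \<omega>) \<Rightarrow> simple_proc_val (\<Phi> n) s \<omega>) - (case x of (s, \<omega>) \<Rightarrow> \<phi> s \<omega>))) \<longlonglongrightarrow> 0"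
    "(\<lambda>n. l2norm M (\<lambda>\<omega>. simple_proc_integral (\<lambda>s \<omega>. W s \<omega> $ k) (\<Phi> n) \<omega> - I \<omega>)) \<longlonglongrightarrow> 0"
    "L2 (PM t) (\<lambda>(s, \<omega>). \<phi> s \<omega>)" "L2 M I"
    using is_ito_integral_L2[OF I t] by blast
  have "(\<lambda>n. LINT \<omega>|M. simple_proc_integral (\<lambda>s \<omega>. W s \<omega> $ k) (\<Phi> n) \<omega> * wick \<alpha> \<omega>) \<longlonglongrightarrow> (LINT \<omega>|M. I \<omega> * wick \<alpha> \<omega>)"
    by (rule L2_tendsto_inner[OF simple_proc_L2(2)[OF \<Phi>(1) t(2)] \<Phi>(5,3) wick_L2])
  moreover have "(\<lambda>n. LINT \<omega>|M. simple_proc_integral (\<lambda>s \<omega>. W s \<omega> $ k) (\<Phi> n) \<omega> * wick \<alpha> \<omega>) \<longlonglongrightarrow> ?R"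
    unfolding simple_proc_wick[OF \<Phi>(1) t]
  proof (rule tendsto_sum)
    fix p
    have "(\<lambda>n. LINT x|PM t. (case x of (s, \<omega>) \<Rightarrow> simple_proc_val (\<Phi> n) s \<omega>) *
        (case x of (s, \<omega>) \<Rightarrow> e (snd p) s * wick (\<alpha> - Poly_Mapping.single p 1) \<omega>))
      \<longlonglongrightarrow> (LINT x|PM t. (case x of (s, \<omega>) \<Rightarrow> \<phi> s \<omega>) *
        (case x of (s, \<omega>) \<Rightarrow> e (snd p) s * wick (\<alpha> - Poly_Mapping.single p 1) \<omega>))"
      by (rule L2_tendsto_inner[OF simple_proc_L2(1)[OF \<Phi>(1) t(2)] \<Phi>(4,2) L2_PM_wick[OF t(2)]])
    from tendsto_mult[OF tendsto_const this, of "sqrt (real (Poly_Mapping.lookup \<alpha> p))"]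
    show "(\<lambda>n. if fst p = k then sqrt (real (Poly_Mapping.lookup \<alpha> p)) * (LINT x|PM t. (case x of (s, \<omega>) \<Rightarrow> simple_proc_val (\<Phi> n) s \<omega>) *
        (case x of (s, \<omega>) \<Rightarrow> e (snd p) s * wick (\<alpha> - Poly_Mapping.single p 1) \<omega>)) else 0)
      \<longlonglongrightarrow> (if fst p = k then sqrt (real (Poly_Mapping.lookup \<alpha> p)) * (LINT x|PM t. (case x of (s, \<omega>) \<Rightarrow> \<phi> s \<omega>) *
        (case x of (s, \<omega>) \<Rightarrow> e (snd p) s * wick (\<alpha> - Poly_Mapping.single p 1) \<omega>)) else 0)"
      by (cases "fst p = k") (simp_all only: if_True if_False simp_thms tendsto_const)
  qed
  ultimately show ?thesis by (rule LIMSEQ_unique)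
qed

text \<open>Fubini's theorem in the form the system requires, with e_i outside the
  expectation.\<close>

lemma PM_inner_iterated:
  assumes \<phi>: "L2 (PM t) (\<lambda>(s, \<omega>). \<phi> s \<omega>)" and t: "t \<le> T"
  shows "integrable (Leb t) (\<lambda>s. e i s * (LINT \<omega>|M. \<phi> s \<omega> * wick \<alpha> \<omega>))"
    and "(LINT x|PM t. (case x of (s, \<omega>) \<Rightarrow> \<phi> s \<omega>) * (case x of (s, \<omega>) \<Rightarrow> e i s * wick \<alpha> \<omega>)) =
      (LINT s|Leb t. e i s * (LINT \<omega>|M. \<phi> s \<omega> * wick \<alpha> \<omega>))"
proof -
  interpret P: pair_sigma_finite "Leb t" M by (rule pair_sigma_finite_PM)
  have i: "integrable (PM t) (\<lambda>x. (case x of (s, \<omega>) \<Rightarrow> \<phi> s \<omega>) * (case x of (s, \<omega>) \<Rightarrow> e i s * wick \<alpha> \<omega>))"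
    by (rule L2_mult[OF \<phi> L2_PM_wick[OF t]])
  have eq: "(LINT \<omega>|M. \<phi> s \<omega> * (e i s * wick \<alpha> \<omega>)) = e i s * (LINT \<omega>|M. \<phi> s \<omega> * wick \<alpha> \<omega>)" for s
    by (simp only: mult.left_commute[of _ "e i s"] integral_mult_right_zero)
  show "integrable (Leb t) (\<lambda>s. e i s * (LINT \<omega>|M. \<phi> s \<omega> * wick \<alpha> \<omega>))"
    using P.integrable_fst'[OF i] by (simp add: eq)
  show "(LINT x|PM t. (case x of (s, \<omega>) \<Rightarrow> \<phi> s \<omega>) * (case x of (s, \<omega>) \<Rightarrow> e i s * wick \<alpha> \<omega>)) =
      (LINT s|Leb t. e i s * (LINT \<omega>|M. \<phi> s \<omega> * wick \<alpha> \<omega>))"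
    using P.integral_fst'[OF i] by (simp add: eq)
qed

end

subsection \<open>Moments of the solution\<close>

text \<open>Under the weight exp(-2ct) the integral term is at most half of the weighted supremum
  \<open>S\<close>, so S <= a + S/2. The bound \<open>C\<close> makes \<open>S\<close> finite, which
  allows it to be absorbed, but does not enter the result.\<close>

lemma Gronwall_nn:
  fixes \<gamma> :: "real \<Rightarrow> ennreal"
  assumes T: "T \<ge> 0" and c: "c > 0" and C: "\<And>t. t \<in> {0..T} \<Longrightarrow> \<gamma> t \<le> ennreal C"
    and le: "\<And>t. t \<in> {0..T} \<Longrightarrow> \<gamma> t \<le> ennreal a + ennreal c * (\<integral>\<^sup>+s. \<gamma> s \<partial>lebesgue_on {0..t})"
    and a: "a \<ge> 0" and t: "t \<in> {0..T}"
  shows "\<gamma> t \<le> ennreal (2 * a * exp (2 * c * T))"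
proof -
  define S where "S = (SUP t\<in>{0..T}. \<gamma> t * ennreal (exp (- (2 * c * t))))"
  have "S \<le> ennreal (max C 0)"
    unfolding S_def
  proof (rule SUP_least)
    fix t assume t: "t \<in> {0..T}"
    have "\<gamma> t * ennreal (exp (- (2 * c * t))) \<le> ennreal (max C 0) * ennreal 1"
      using C[OF t] t c by (intro mult_mono ennreal_leI) (auto intro: order_trans ennreal_leI)
    then show "\<gamma> t * ennreal (exp (- (2 * c * t))) \<le> ennreal (max C 0)" by simp
  qed
  then have "S < \<infinity>" by (rule le_less_trans) simp
  then obtain S' where S': "S' \<ge> 0" "S = ennreal S'" by (cases S) auto
  have \<gamma>_le: "\<gamma> s \<le> ennreal (S' * exp (2 * c * s))" if s: "s \<in> {0..T}" for s
  proof -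
    have "\<gamma> s = \<gamma> s * ennreal (exp (- (2 * c * s))) * ennreal (exp (2 * c * s))"
      by (simp add: mult.assoc ennreal_mult[symmetric] exp_add[symmetric])
    also have "\<dots> \<le> S * ennreal (exp (2 * c * s))"
      unfolding S_def by (intro mult_right_mono SUP_upper s) auto
    finally show ?thesis using S' by (simp add: ennreal_mult)
  qed
  have step: "\<gamma> t * ennreal (exp (- (2 * c * t))) \<le> ennreal (a + S' / 2)" if t: "t \<in> {0..T}" for t
  proof -
    \<comment> \<open>A primitive of the bound on \<gamma>; its factor \<open>1 / (2 * c)\<close>
      meets \<open>c\<close> and leaves half of \<open>S'\<close>.\<close>
    have "((\<lambda>s. S' / (2 * c) * exp (2 * c * s)) has_vector_derivative S' * exp (2 * c * x)) (at x within {0..t})" for x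
      using c by (auto intro!: derivative_eq_intros simp: has_real_derivative_iff_has_vector_derivative[symmetric])
    then have "((\<lambda>s. S' * exp (2 * c * s)) has_integral (S' / (2 * c) * exp (2 * c * t) - S' / (2 * c) * exp (2 * c * 0))) {0..t}"
      using t by (intro fundamental_theorem_of_calculus) auto
    then have "(\<integral>\<^sup>+s. ennreal (S' * exp (2 * c * s)) * indicator {0..t} s \<partial>lborel) = ennreal (S' / (2 * c) * exp (2 * c * t) - S' / (2 * c) * exp (2 * c * 0))"
      using S' by (intro nn_integral_has_integral_lebesgue') auto
    moreover have "(\<integral>\<^sup>+s. \<gamma> s \<partial>lebesgue_on {0..t}) \<le> (\<integral>\<^sup>+s. ennreal (S' * exp (2 * c * s)) \<partial>lebesgue_on {0..t})"
      using \<gamma>_le t by (intro nn_integral_mono) auto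
    moreover have "(\<integral>\<^sup>+s. ennreal (S' * exp (2 * c * s)) \<partial>lebesgue_on {0..t}) = (\<integral>\<^sup>+s. ennreal (S' * exp (2 * c * s)) * indicator {0..t} s \<partial>lborel)"
      by (subst nn_integral_restrict_space) (auto simp: nn_integral_completion)
    ultimately have "(\<integral>\<^sup>+s. \<gamma> s \<partial>lebesgue_on {0..t}) \<le> ennreal (S' / (2 * c) * exp (2 * c * t))"
      using S' c by (auto elim!: order_trans intro!: ennreal_leI)
    then have "\<gamma> t \<le> ennreal a + ennreal c * ennreal (S' / (2 * c) * exp (2 * c * t))"
      by (intro order_trans[OF le[OF t]] add_left_mono mult_left_mono) auto
    also have "\<dots> = ennreal (a + S' / 2 * exp (2 * c * t))"
      using a S' c by (simp add: ennreal_mult[symmetric] ennreal_plus[symmetric] del: ennreal_plus)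
    finally have "\<gamma> t * ennreal (exp (- (2 * c * t))) \<le> ennreal (a + S' / 2 * exp (2 * c * t)) * ennreal (exp (- (2 * c * t)))"
      by (rule mult_right_mono) simp
    also have "\<dots> = ennreal (a * exp (- (2 * c * t)) + S' / 2)"
      using a S' by (simp add: ennreal_mult[symmetric] distrib_right mult.assoc exp_add[symmetric])
    also have "\<dots> \<le> ennreal (a + S' / 2)"
      using a c t by (intro ennreal_leI add_right_mono mult_left_le) auto
    finally show ?thesis .
  qed
  then have "S \<le> ennreal (a + S' / 2)" unfolding S_def by (rule SUP_least)
  then have "S' \<le> 2 * a" using S' a by (auto simp: ennreal_le_iff2 simp del: ennreal_plus)
  then have "S' * exp (2 * c * t) \<le> 2 * a * exp (2 * c * T)"
    using t c a by (intro mult_mono) auto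
  then show ?thesis by (intro order_trans[OF \<gamma>_le[OF t]] ennreal_leI)
qed

section \<open>Joint measurability of the solution\<close>

locale sde = gaussian_coordinates M \<F> T W e \<xi>
  for M :: "'a measure" and \<F> T and W :: "real \<Rightarrow> 'a \<Rightarrow> real ^ 'm::finite" and e \<xi> +
  fixes K :: real and F :: "real \<Rightarrow> real ^ 'd::finite \<Rightarrow> real ^ 'd"
    and B :: "real \<Rightarrow> real ^ 'd \<Rightarrow> real ^ 'm ^ 'd" and x0 :: "real ^ 'd" and X :: "real \<Rightarrow> 'a \<Rightarrow> real ^ 'd"
  assumes F_meas: "(\<lambda>(t, x). F t x) \<in> borel_measurable (restrict_space borel {0..T} \<Otimes>\<^sub>M borel)"
    and K_pos: "K > 0"
    and F_growth: "\<And>t x. t \<in> {0..T} \<Longrightarrow> (norm (F t x))\<^sup>2 \<le> K\<^sup>2 * (1 + (norm x)\<^sup>2)"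
    and X: "strong_solution M \<F> T W F B x0 X"
begin

lemma X_measurable: "t \<in> {0..T} \<Longrightarrow> X t \<in> borel_measurable M"
  using X by (intro measurable_F_M[of _ t]) (auto simp: strong_solution_def)

lemma X_continuous: "\<omega> \<in> space M \<Longrightarrow> continuous_on {0..T} (\<lambda>t. X t \<omega>)"
  using X by (simp add: strong_solution_def)

text \<open>Extends the time index to all reals, so that \<open>X\<close> can be sampled on a grid
  without leaving [0, T].\<close>

definition clampT :: "real \<Rightarrow> real" where "clampT s = min T (max 0 s)"

lemma clamp_in: "clampT s \<in> {0..T}" using T_pos by (auto simp: clampT_def)

lemma clamp_eq: "s \<in> {0..T} \<Longrightarrow> clampT s = s" by (auto simp: clampT_def)

text \<open>Continuous paths are limits of the processes sampled on the grid of mesh 1 / (n + 1);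
  these involve countably many times and are therefore jointly measurable.\<close>

lemma X_clamp_measurable: "(\<lambda>(s, \<omega>). X (clampT s) \<omega>) \<in> borel_measurable (borel \<Otimes>\<^sub>M M)"
proof (rule borel_measurable_LIMSEQ_metric[where f =
      "\<lambda>n x. X (clampT (real_of_int \<lceil>fst x * real (Suc n)\<rceil> / real (Suc n))) (snd x)"])
  let ?c = "\<lambda>n (s::real). real_of_int \<lceil>s * real (Suc n)\<rceil> / real (Suc n)"
  show "(\<lambda>x. X (clampT (?c n (fst x))) (snd x)) \<in> borel_measurable (borel \<Otimes>\<^sub>M M)" for n
  proof (rule measurable_compose_countable[where f = "\<lambda>i x. X (clampT (real_of_int i / real (Suc n))) (snd x)" and g = "\<lambda>x. \<lceil>fst x * real (Suc n)\<rceil>"])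
    show "(\<lambda>x. X (clampT (real_of_int i / real (Suc n))) (snd x)) \<in> borel_measurable (borel \<Otimes>\<^sub>M M)" for i
      by (rule measurable_compose[OF measurable_snd X_measurable[OF clamp_in]])
    show "(\<lambda>x. \<lceil>fst x * real (Suc n)\<rceil>) \<in> measurable (borel \<Otimes>\<^sub>M M) (count_space UNIV)" by measurable
  qed
  fix x :: "real \<times> 'a" assume "x \<in> space (borel \<Otimes>\<^sub>M M)"
  then obtain s \<omega> where x: "x = (s, \<omega>)" "\<omega> \<in> space M" by (auto simp: space_pair_measure)
  have "(\<lambda>n. ?c n s) \<longlonglongrightarrow> s"
  proof (rule LIM_zero_cancel, rule Lim_null_comparison[where g = "\<lambda>n. 1 / Suc n"])
    have "\<bar>?c n s - s\<bar> \<le> 1 / Suc n" for n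
    proof -
      have "?c n s - s = (real_of_int \<lceil>s * real (Suc n)\<rceil> - s * real (Suc n)) / Suc n" by (simp add: diff_divide_distrib)
      also have "\<bar>\<dots>\<bar> \<le> 1 / Suc n" unfolding abs_divide by (intro divide_mono) linarith+
      finally show ?thesis .
    qed
    then show "\<forall>\<^sub>F n in sequentially. norm (?c n s - s) \<le> 1 / Suc n" by simp
    show "(\<lambda>n. 1 / real (Suc n)) \<longlonglongrightarrow> 0" by (rule LIMSEQ_Suc[OF lim_1_over_n])
  qed
  then have "(\<lambda>n. clampT (?c n s)) \<longlonglongrightarrow> clampT s"
    unfolding clampT_def by (intro tendsto_min tendsto_max tendsto_const)
  then have "(\<lambda>n. X (clampT (?c n s)) \<omega>) \<longlonglongrightarrow> X (clampT s) \<omega>"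
    by (rule continuous_on_tendsto_compose[OF X_continuous[OF x(2)]]) (use clamp_in in auto)
  then show "(\<lambda>n. X (clampT (?c n (fst x))) (snd x)) \<longlonglongrightarrow> (case x of (s, \<omega>) \<Rightarrow> X (clampT s) \<omega>)" by (simp add: x)
qed

text \<open>\<open>Leb t\<close> carries the Lebesgue sets while \<open>F\<close> is Borel in time;
  projecting to the Borel algebra makes the composition with \<open>F\<close> measurable.\<close>

lemma fst_Leb: "fst \<in> measurable (PM t) (restrict_space borel {0..t})"
  by (rule measurable_restrict_space2)
    (auto simp: space_pair_measure intro!: measurable_compose[OF measurable_fst] measurable_restrict_space1 measurable_completion)

lemma X_joint:
  assumes t: "t \<le> T" shows "(\<lambda>(s, \<omega>). X s \<omega>) \<in> borel_measurable (PM t)"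
proof -
  have "(\<lambda>x. (fst x, snd x)) \<in> measurable (PM t) (borel \<Otimes>\<^sub>M M)"
    using measurable_restrict_space3[OF fst_Leb] by (intro measurable_Pair measurable_snd measurable_compose[OF fst_Leb] measurable_restrict_space1) auto
  from measurable_compose[OF this X_clamp_measurable]
  have "(\<lambda>x. X (clampT (fst x)) (snd x)) \<in> borel_measurable (PM t)" by simp
  then show ?thesis
    by (rule measurable_cong[THEN iffD1, rotated]) (use t in \<open>auto simp: space_pair_measure clamp_eq\<close>)
qed

lemma F_joint:
  assumes t: "t \<le> T" shows "(\<lambda>(s, \<omega>). F s (X s \<omega>)) \<in> borel_measurable (PM t)"
proof -
  have "fst \<in> measurable (PM t) (restrict_space borel {0..T})"
    by (rule measurable_restrict_space2[OF _ measurable_compose[OF fst_Leb measurable_restrict_space1]])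
      (use t in \<open>auto simp: space_pair_measure\<close>)
  then have "(\<lambda>x. (fst x, X (fst x) (snd x))) \<in> measurable (PM t) (restrict_space borel {0..T} \<Otimes>\<^sub>M borel)"
    using X_joint[OF t] by (intro measurable_Pair) (simp_all add: case_prod_unfold)
  from measurable_compose[OF this F_meas] show ?thesis by (simp add: case_prod_unfold)
qed

end

lemma norm_sq_vec: "(norm (v :: real ^ 'n))\<^sup>2 = (\<Sum>j\<in>UNIV. (v $ j)\<^sup>2)"
  unfolding power2_norm_eq_inner inner_vec_def by (simp add: power2_eq_square)

lemma sum3_sq_le: "(a + b + c)\<^sup>2 \<le> 3 * a\<^sup>2 + 3 * b\<^sup>2 + 3 * (c::real)\<^sup>2"
  using sum_squares_bound[of a b] sum_squares_bound[of a c] sum_squares_bound[of b c]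
  by (simp add: power2_eq_square algebra_simps)

section \<open>Pathwise and mean-square bounds\<close>

context sde
begin

definition drift :: "real \<Rightarrow> 'd \<Rightarrow> 'a \<Rightarrow> real" where
  "drift t j \<omega> = (LINT s|Leb t. F s (X s \<omega>) $ j)"

text \<open>Stands for the sum of the stochastic integrals at time \<open>t\<close>. It is defined
  from the path, so that no version of the integrals has to be selected for each
  \<open>t\<close>.\<close>

definition mart :: "real \<Rightarrow> 'd \<Rightarrow> 'a \<Rightarrow> real" where
  "mart t j \<omega> = X t \<omega> $ j - x0 $ j - drift t j \<omega>"

text \<open>A bound for \<open>mart t j\<close> in mean square, uniform in \<open>t\<close>: the
  energy on [0, T] dominates that on all shorter intervals.\<close>

definition bnd :: "'d \<Rightarrow> real" where
  "bnd j = (\<Sum>k\<in>UNIV. l2norm (PM T) (\<lambda>(s, \<omega>). B s (X s \<omega>) $ j $ k))"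

lemma F_comp_joint: "t \<le> T \<Longrightarrow> (\<lambda>(s, \<omega>). F s (X s \<omega>) $ j) \<in> borel_measurable (PM t)"
  using measurable_compose[OF F_joint measurable_vec_nth, of t _ j] by (simp add: case_prod_unfold)

lemma q_joint: "t \<le> T \<Longrightarrow> (\<lambda>(s, \<omega>). (norm (X s \<omega>))\<^sup>2) \<in> borel_measurable (PM t)"
  using X_joint[of t] by (simp add: case_prod_unfold)

context
  fixes \<omega> t assumes \<omega>: "\<omega> \<in> space M" and t: "t \<in> {0..T}"
begin

lemma q_path: "integrable (Leb t) (\<lambda>s. (norm (X s \<omega>))\<^sup>2)"
proof -
  interpret L: finite_measure "Leb t" by (rule finite_measure_Leb)
  have "bounded ((\<lambda>s. X s \<omega>) ` {0..T})"
    by (intro compact_imp_bounded compact_continuous_image X_continuous[OF \<omega>] compact_Icc)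
  then obtain C where C: "\<And>s. s \<in> {0..T} \<Longrightarrow> norm (X s \<omega>) \<le> C" unfolding bounded_iff by blast
  show ?thesis
  proof (rule L.integrable_const_bound[of _ "C\<^sup>2"])
    show "AE s in Leb t. norm ((norm (X s \<omega>))\<^sup>2) \<le> C\<^sup>2"
      using C t by (intro AE_I2) (auto intro!: power_mono)
    show "(\<lambda>s. (norm (X s \<omega>))\<^sup>2) \<in> borel_measurable (Leb t)"
      using measurable_Pair1[OF q_joint \<omega>, of t] t by simp
  qed
qed

lemma F_path: "L2 (Leb t) (\<lambda>s. F s (X s \<omega>) $ j)"
proof (rule L2_I)
  interpret L: finite_measure "Leb t" by (rule finite_measure_Leb)
  show m: "(\<lambda>s. F s (X s \<omega>) $ j) \<in> borel_measurable (Leb t)"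
    using measurable_Pair1[OF F_comp_joint \<omega>, of t] t by simp
  show "integrable (Leb t) (\<lambda>s. (F s (X s \<omega>) $ j)\<^sup>2)"
  proof (rule Bochner_Integration.integrable_bound)
    show "integrable (Leb t) (\<lambda>s. K\<^sup>2 * (1 + (norm (X s \<omega>))\<^sup>2))"
      by (intro integrable_mult_right Bochner_Integration.integrable_add q_path L.integrable_const)
    show "(\<lambda>s. (F s (X s \<omega>) $ j)\<^sup>2) \<in> borel_measurable (Leb t)" using m by simp
    show "AE s in Leb t. norm ((F s (X s \<omega>) $ j)\<^sup>2) \<le> norm (K\<^sup>2 * (1 + (norm (X s \<omega>))\<^sup>2))"
    proof (rule AE_I2)
      fix s assume "s \<in> space (Leb t)"
      then have "(norm (F s (X s \<omega>)))\<^sup>2 \<le> K\<^sup>2 * (1 + (norm (X s \<omega>))\<^sup>2)" using t by (intro F_growth) auto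
      moreover have "(F s (X s \<omega>) $ j)\<^sup>2 \<le> (norm (F s (X s \<omega>)))\<^sup>2"
        using component_le_norm_cart[of "F s (X s \<omega>)" j] by (simp add: abs_le_square_iff[symmetric])
      ultimately show "norm ((F s (X s \<omega>) $ j)\<^sup>2) \<le> norm (K\<^sup>2 * (1 + (norm (X s \<omega>))\<^sup>2))" by simp
    qed
  qed
qed

text \<open>Cauchy-Schwarz in time followed by the growth bound on \<open>F\<close>; continuity of
  the path makes all the integrals finite.\<close>

lemma drift_sq: "(\<Sum>j\<in>UNIV. (drift t j \<omega>)\<^sup>2) \<le> T * K\<^sup>2 * (T + (LINT s|Leb t. (norm (X s \<omega>))\<^sup>2))"
proof -
  interpret L: finite_measure "Leb t" by (rule finite_measure_Leb)
  have one: "(l2norm (Leb t) (\<lambda>_. 1))\<^sup>2 = t" using t by (simp add: l2norm_sq measure_restrict_space)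
  have D: "(drift t j \<omega>)\<^sup>2 \<le> t * (LINT s|Leb t. (F s (X s \<omega>) $ j)\<^sup>2)" for j
  proof -
    have "\<bar>drift t j \<omega>\<bar> \<le> l2norm (Leb t) (\<lambda>s. F s (X s \<omega>) $ j) * l2norm (Leb t) (\<lambda>_. 1)"
      using L2_Cauchy_Schwarz[OF F_path[of j] L.L2_const[of 1]] by (simp add: drift_def)
    then have "\<bar>drift t j \<omega>\<bar>\<^sup>2 \<le> (l2norm (Leb t) (\<lambda>s. F s (X s \<omega>) $ j) * l2norm (Leb t) (\<lambda>_. 1))\<^sup>2" by (rule power_mono) simp
    then have "(drift t j \<omega>)\<^sup>2 \<le> (l2norm (Leb t) (\<lambda>s. F s (X s \<omega>) $ j))\<^sup>2 * (l2norm (Leb t) (\<lambda>_. 1))\<^sup>2"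
      by (simp add: power_mult_distrib)
    then show ?thesis unfolding one unfolding l2norm_sq by (simp add: mult.commute)
  qed
  have "(\<Sum>j\<in>UNIV. (drift t j \<omega>)\<^sup>2) \<le> (\<Sum>j\<in>UNIV. t * (LINT s|Leb t. (F s (X s \<omega>) $ j)\<^sup>2))"
    by (intro sum_mono D)
  also have "\<dots> = t * (LINT s|Leb t. (\<Sum>j\<in>UNIV. (F s (X s \<omega>) $ j)\<^sup>2))"
    by (subst Bochner_Integration.integral_sum) (auto simp: sum_distrib_left intro: L2_integrable_sq[OF F_path])
  also have "\<dots> \<le> t * (LINT s|Leb t. K\<^sup>2 * (1 + (norm (X s \<omega>))\<^sup>2))"
  proof (intro mult_left_mono integral_mono)
    show "integrable (Leb t) (\<lambda>s. \<Sum>j\<in>UNIV. (F s (X s \<omega>) $ j)\<^sup>2)"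
      by (intro Bochner_Integration.integrable_sum L2_integrable_sq F_path)
    show "integrable (Leb t) (\<lambda>s. K\<^sup>2 * (1 + (norm (X s \<omega>))\<^sup>2))"
      by (intro integrable_mult_right Bochner_Integration.integrable_add q_path L.integrable_const)
    show "(\<Sum>j\<in>UNIV. (F s (X s \<omega>) $ j)\<^sup>2) \<le> K\<^sup>2 * (1 + (norm (X s \<omega>))\<^sup>2)" if "s \<in> space (Leb t)" for s
      using F_growth[of s "X s \<omega>"] that t by (simp add: norm_sq_vec)
  qed (use t in simp)
  also have "(LINT s|Leb t. K\<^sup>2 * (1 + (norm (X s \<omega>))\<^sup>2)) = K\<^sup>2 * (t + (LINT s|Leb t. (norm (X s \<omega>))\<^sup>2))"
    using t by (subst integral_mult_right_zero, subst Bochner_Integration.integral_add[OF _ q_path])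
      (auto simp: measure_restrict_space L.integrable_const)
  also have "t * (K\<^sup>2 * (t + (LINT s|Leb t. (norm (X s \<omega>))\<^sup>2))) \<le> T * (K\<^sup>2 * (T + (LINT s|Leb t. (norm (X s \<omega>))\<^sup>2)))"
    using t by (intro mult_mono mult_left_mono add_right_mono) auto
  finally show ?thesis by (simp add: mult.assoc)
qed

text \<open>Nonnegative extended integrals allow expectations to be taken before second moments are
  known to be finite. The factors 3 come from squaring a sum of three terms.\<close>

lemma norm_X_le:
  "ennreal ((norm (X t \<omega>))\<^sup>2) \<le> ennreal (3 * (norm x0)\<^sup>2 + 3 * T\<^sup>2 * K\<^sup>2) + ennreal (3 * (\<Sum>j\<in>UNIV. (mart t j \<omega>)\<^sup>2)) +
    ennreal (3 * T * K\<^sup>2) * (\<integral>\<^sup>+s. ennreal ((norm (X s \<omega>))\<^sup>2) \<partial>Leb t)"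
proof -
  let ?q = "LINT s|Leb t. (norm (X s \<omega>))\<^sup>2"
  have gen: "ennreal (a + b + c * q) = ennreal a + ennreal b + ennreal c * ennreal q"
    if "a \<ge> 0" "b \<ge> 0" "c \<ge> 0" "q \<ge> 0" for a b c q :: real
    using that by (simp add: ennreal_mult)
  have "(norm (X t \<omega>))\<^sup>2 = (\<Sum>j\<in>UNIV. (x0 $ j + mart t j \<omega> + drift t j \<omega>)\<^sup>2)"
    by (simp add: norm_sq_vec mart_def)
  also have "\<dots> \<le> (\<Sum>j\<in>UNIV. 3 * (x0 $ j)\<^sup>2 + 3 * (mart t j \<omega>)\<^sup>2 + 3 * (drift t j \<omega>)\<^sup>2)"
    by (intro sum_mono sum3_sq_le)
  also have "\<dots> = 3 * (norm x0)\<^sup>2 + 3 * (\<Sum>j\<in>UNIV. (mart t j \<omega>)\<^sup>2) + 3 * (\<Sum>j\<in>UNIV. (drift t j \<omega>)\<^sup>2)"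
    by (simp add: sum.distrib sum_distrib_left norm_sq_vec)
  also have "\<dots> \<le> (3 * (norm x0)\<^sup>2 + 3 * T\<^sup>2 * K\<^sup>2) + 3 * (\<Sum>j\<in>UNIV. (mart t j \<omega>)\<^sup>2) + 3 * T * K\<^sup>2 * ?q"
    using drift_sq by (simp add: distrib_left power2_eq_square[of T] mult_ac)
  finally have "ennreal ((norm (X t \<omega>))\<^sup>2) \<le> ennreal ((3 * (norm x0)\<^sup>2 + 3 * T\<^sup>2 * K\<^sup>2) + 3 * (\<Sum>j\<in>UNIV. (mart t j \<omega>)\<^sup>2) + 3 * T * K\<^sup>2 * ?q)"
    by (rule ennreal_leI)
  also have "?q \<ge> 0" by simp
  then have "ennreal ((3 * (norm x0)\<^sup>2 + 3 * T\<^sup>2 * K\<^sup>2) + 3 * (\<Sum>j\<in>UNIV. (mart t j \<omega>)\<^sup>2) + 3 * T * K\<^sup>2 * ?q) =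
      ennreal (3 * (norm x0)\<^sup>2 + 3 * T\<^sup>2 * K\<^sup>2) + ennreal (3 * (\<Sum>j\<in>UNIV. (mart t j \<omega>)\<^sup>2)) + ennreal (3 * T * K\<^sup>2) * ennreal ?q"
    using T_pos by (intro gen) (auto intro!: sum_nonneg add_nonneg_nonneg mult_nonneg_nonneg)
  also have "ennreal ?q = (\<integral>\<^sup>+s. ennreal ((norm (X s \<omega>))\<^sup>2) \<partial>Leb t)"
    by (intro nn_integral_eq_integral[symmetric] q_path) simp
  finally show ?thesis .
qed

end

lemma drift_measurable: "t \<le> T \<Longrightarrow> drift t j \<in> borel_measurable M"
proof -
  assume t: "t \<le> T"
  interpret L: finite_measure "Leb t" by (rule finite_measure_Leb)
  have "(\<lambda>(\<omega>, s). F s (X s \<omega>) $ j) \<in> borel_measurable (M \<Otimes>\<^sub>M Leb t)"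
    using measurable_pair_swap[OF F_comp_joint[OF t]] by (simp add: case_prod_unfold)
  then show ?thesis unfolding drift_def[abs_def] by (rule L.borel_measurable_lebesgue_integral)
qed

lemma l2norm_PM_mono:
  assumes f: "L2 (PM T) f" "L2 (PM t) f" and t: "t \<le> T"
  shows "l2norm (PM t) f \<le> l2norm (PM T) f"
proof -
  have m: "(\<lambda>x. ennreal ((f x)\<^sup>2)) \<in> borel_measurable (PM T)" "(\<lambda>x. ennreal ((f x)\<^sup>2)) \<in> borel_measurable (PM t)"
    using f by (auto dest: L2_measurable)
  have "(\<integral>\<^sup>+x. ennreal ((f x)\<^sup>2) \<partial>PM t) = (\<integral>\<^sup>+s. \<integral>\<^sup>+\<omega>. ennreal ((f (s, \<omega>))\<^sup>2) \<partial>M \<partial>Leb t)"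
    by (rule nn_integral_fst[OF m(2), symmetric])
  also have "\<dots> \<le> (\<integral>\<^sup>+s. \<integral>\<^sup>+\<omega>. ennreal ((f (s, \<omega>))\<^sup>2) \<partial>M \<partial>Leb T)" by (rule nn_integral_Leb_mono[OF t])
  also have "\<dots> = (\<integral>\<^sup>+x. ennreal ((f x)\<^sup>2) \<partial>PM T)" by (rule nn_integral_fst[OF m(1)])
  finally have "(l2norm (PM t) f)\<^sup>2 \<le> (l2norm (PM T) f)\<^sup>2"
    unfolding nn_integral_L2[OF f(1)] nn_integral_L2[OF f(2)] by (simp add: ennreal_le_iff)
  then show ?thesis by (rule power2_le_imp_le) simp
qed

lemma l2norm_sum: "finite S \<Longrightarrow> (\<And>i. i \<in> S \<Longrightarrow> L2 N (f i)) \<Longrightarrow> l2norm N (\<lambda>x. \<Sum>i\<in>S. f i x) \<le> (\<Sum>i\<in>S. l2norm N (f i))"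
proof (induction S rule: finite_induct)
  case (insert i S)
  have "l2norm N (\<lambda>x. f i x + (\<Sum>i\<in>S. f i x)) \<le> l2norm N (f i) + l2norm N (\<lambda>x. \<Sum>i\<in>S. f i x)"
    by (intro l2norm_triangle L2_sum insert.prems) auto
  with insert show ?case by (simp add: order_trans)
qed (simp add: l2norm_def)

lemma ito_ex:
  assumes t: "t \<in> {0..T}"
  obtains I where "\<And>j k. is_ito_integral M \<F> (\<lambda>s \<omega>. W s \<omega> $ k) t (\<lambda>s \<omega>. B s (X s \<omega>) $ j $ k) (I j k)"
    "\<And>j. AE \<omega> in M. mart t j \<omega> = (\<Sum>k\<in>UNIV. I j k \<omega>)"
proof -
  have "\<exists>I :: 'd \<Rightarrow> 'm \<Rightarrow> 'a \<Rightarrow> real.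
        (\<forall>j k. is_ito_integral M \<F> (\<lambda>s \<omega>. W s \<omega> $ k) t (\<lambda>s \<omega>. B s (X s \<omega>) $ j $ k) (I j k)) \<and>
        (AE \<omega> in M. \<forall>j.
           X t \<omega> $ j = x0 $ j + (LINT s|lebesgue_on {0..t}. F s (X s \<omega>) $ j) + (\<Sum>k\<in>UNIV. I j k \<omega>))"
    using X t unfolding strong_solution_def by simp
  then obtain I where I: "\<forall>j k. is_ito_integral M \<F> (\<lambda>s \<omega>. W s \<omega> $ k) t (\<lambda>s \<omega>. B s (X s \<omega>) $ j $ k) (I j k)"
    "AE \<omega> in M. \<forall>j. X t \<omega> $ j = x0 $ j + (LINT s|lebesgue_on {0..t}. F s (X s \<omega>) $ j) + (\<Sum>k\<in>UNIV. I j k \<omega>)"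
    by (elim exE conjE)
  have "AE \<omega> in M. mart t j \<omega> = (\<Sum>k\<in>UNIV. I j k \<omega>)" for j
    using I(2) by (rule AE_mp) (auto intro!: AE_I2 simp: mart_def drift_def)
  with I(1) show thesis by (intro that) auto
qed

lemma B_L2: "t \<in> {0..T} \<Longrightarrow> L2 (PM t) (\<lambda>(s, \<omega>). B s (X s \<omega>) $ j $ k)"
  by (rule ito_ex[of t]) (auto intro: ito_isometry(2))

text \<open>\<open>mart t j\<close> agrees almost surely with the sum of the stochastic integrals,
  to which the isometry applies; enlarging [0, t] to [0, T] removes the dependence on
  \<open>t\<close>.\<close>

lemma mart_L2:
  assumes t: "t \<in> {0..T}"
  shows "L2 M (mart t j)" "l2norm M (mart t j) \<le> bnd j"
proof -
  obtain I where I: "\<And>j k. is_ito_integral M \<F> (\<lambda>s \<omega>. W s \<omega> $ k) t (\<lambda>s \<omega>. B s (X s \<omega>) $ j $ k) (I j k)"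
    and AE: "\<And>j. AE \<omega> in M. mart t j \<omega> = (\<Sum>k\<in>UNIV. I j k \<omega>)"
    using ito_ex[OF t] by blast
  have t': "0 \<le> t" "t \<le> T" using t by auto
  note iso = ito_isometry[OF I t']
  have m: "mart t j \<in> borel_measurable M"
    unfolding mart_def[abs_def] using drift_measurable[OF t'(2)] measurable_vec_nth[OF X_measurable[OF t]]
    by (intro borel_measurable_diff borel_measurable_const)
  have S2: "L2 M (\<lambda>\<omega>. \<Sum>k\<in>UNIV. I j k \<omega>)" by (intro L2_sum iso)
  show "L2 M (mart t j)" by (rule L2_cong_AE[OF S2 m AE])
  have "l2norm M (mart t j) = l2norm M (\<lambda>\<omega>. \<Sum>k\<in>UNIV. I j k \<omega>)"
    using S2 by (intro l2norm_cong_AE AE m) auto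
  also have "\<dots> \<le> (\<Sum>k\<in>UNIV. l2norm M (I j k))" by (intro l2norm_sum iso) simp
  also have "\<dots> \<le> bnd j"
    unfolding bnd_def iso(3) using T_pos by (intro sum_mono l2norm_PM_mono B_L2 t') (use t' in auto)
  finally show "l2norm M (mart t j) \<le> bnd j" .
qed

end

section \<open>Uniform second moments\<close>

context sde
begin

definition trunc :: "nat \<Rightarrow> 'a set" where
  "trunc n = {\<omega> \<in> space M. (\<integral>\<^sup>+s. ennreal ((norm (X s \<omega>))\<^sup>2) \<partial>Leb T) \<le> ennreal (real n)}"

lemma q_swap_measurable: "t \<le> T \<Longrightarrow> (\<lambda>\<omega>. \<integral>\<^sup>+s. ennreal ((norm (X s \<omega>))\<^sup>2) \<partial>Leb t) \<in> borel_measurable M"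
proof -
  assume t: "t \<le> T"
  interpret L: finite_measure "Leb t" by (rule finite_measure_Leb)
  have "(\<lambda>(\<omega>, s). ennreal ((norm (X s \<omega>))\<^sup>2)) \<in> borel_measurable (M \<Otimes>\<^sub>M Leb t)"
    using measurable_pair_swap[OF q_joint[OF t]] by (simp add: case_prod_unfold)
  then show ?thesis by (rule L.borel_measurable_nn_integral)
qed

lemma trunc_sets[measurable]: "trunc n \<in> sets M"
  unfolding trunc_def using q_swap_measurable[of T] by measurable

lemma q_measurable: "t \<in> {0..T} \<Longrightarrow> (\<lambda>\<omega>. ennreal ((norm (X t \<omega>))\<^sup>2)) \<in> borel_measurable M"
  using X_measurable[of t] by simp

text \<open>On the event \<open>trunc n\<close> the second moments are finite, so that Gronwall's inequality applies;
  the resulting bound does not depend on \<open>n\<close>.\<close>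

lemma X_moment:
  "\<exists>C\<ge>0. \<forall>t\<in>{0..T}. (\<integral>\<^sup>+\<omega>. ennreal ((norm (X t \<omega>))\<^sup>2) \<partial>M) \<le> ennreal C"
proof -
  define a0 where "a0 = 3 * (norm x0)\<^sup>2 + 3 * T\<^sup>2 * K\<^sup>2"
  define a where "a = a0 + 3 * (\<Sum>j\<in>UNIV. (bnd j)\<^sup>2)"
  define c where "c = 3 * T * K\<^sup>2"
  have c: "c > 0" using T_pos K_pos by (simp add: c_def)
  have a0: "a0 \<ge> 0" by (simp add: a0_def)
  have a: "a \<ge> 0" using a0 by (simp add: a_def sum_nonneg)
  define \<gamma> where "\<gamma> = (\<lambda>n t. \<integral>\<^sup>+\<omega>. ennreal ((norm (X t \<omega>))\<^sup>2) * indicator (trunc n) \<omega> \<partial>M)"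
  let ?J = "\<lambda>t \<omega>. \<integral>\<^sup>+s. ennreal ((norm (X s \<omega>))\<^sup>2) \<partial>Leb t"
  have mart: "(\<integral>\<^sup>+\<omega>. ennreal (3 * (\<Sum>j\<in>UNIV. (mart t j \<omega>)\<^sup>2)) \<partial>M) \<le> ennreal (3 * (\<Sum>j\<in>UNIV. (bnd j)\<^sup>2))" if t: "t \<in> {0..T}" for t
  proof -
    have i: "integrable M (\<lambda>\<omega>. (mart t j \<omega>)\<^sup>2)" for j by (rule L2_integrable_sq[OF mart_L2(1)[OF t]])
    have "(\<integral>\<^sup>+\<omega>. ennreal (3 * (\<Sum>j\<in>UNIV. (mart t j \<omega>)\<^sup>2)) \<partial>M) = ennreal (LINT \<omega>|M. 3 * (\<Sum>j\<in>UNIV. (mart t j \<omega>)\<^sup>2))"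
      using i by (intro nn_integral_eq_integral integrable_mult_right Bochner_Integration.integrable_sum) (auto simp: sum_nonneg)
    also have "(LINT \<omega>|M. 3 * (\<Sum>j\<in>UNIV. (mart t j \<omega>)\<^sup>2)) = 3 * (\<Sum>j\<in>UNIV. (l2norm M (mart t j))\<^sup>2)"
      using i by (simp add: l2norm_sq Bochner_Integration.integral_sum)
    also have "ennreal \<dots> \<le> ennreal (3 * (\<Sum>j\<in>UNIV. (bnd j)\<^sup>2))"
      using mart_L2(2)[OF t] by (intro ennreal_leI mult_left_mono sum_mono power_mono) auto
    finally show ?thesis .
  qed
  \<comment> \<open>The indicator is kept on the path integral and dropped from the other terms,
    whose means are already bounded. So the truncation may depend on the whole path, and no stopping
    of the stochastic integral is involved.\<close>
  have bound: "\<gamma> n t \<le> ennreal a + ennreal c * (\<integral>\<^sup>+\<omega>. ?J t \<omega> * indicator (trunc n) \<omega> \<partial>M)" if t: "t \<in> {0..T}" for n t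
  proof -
    have [measurable]: "mart t j \<in> borel_measurable M" for j using mart_L2(1)[OF t] by auto
    have [measurable]: "?J t \<in> borel_measurable M" using q_swap_measurable[of t] t by simp
    have "\<gamma> n t \<le> (\<integral>\<^sup>+\<omega>. (ennreal a0 + ennreal (3 * (\<Sum>j\<in>UNIV. (mart t j \<omega>)\<^sup>2))) + ennreal c * (?J t \<omega> * indicator (trunc n) \<omega>) \<partial>M)"
      unfolding \<gamma>_def
    proof (rule nn_integral_mono)
      fix \<omega> assume "\<omega> \<in> space M"
      from norm_X_le[OF this t]
      show "ennreal ((norm (X t \<omega>))\<^sup>2) * indicator (trunc n) \<omega> \<le>
        (ennreal a0 + ennreal (3 * (\<Sum>j\<in>UNIV. (mart t j \<omega>)\<^sup>2))) + ennreal c * (?J t \<omega> * indicator (trunc n) \<omega>)"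
        by (cases "\<omega> \<in> trunc n") (simp_all add: a0_def c_def)
    qed
    also have "\<dots> = (\<integral>\<^sup>+\<omega>. ennreal a0 + ennreal (3 * (\<Sum>j\<in>UNIV. (mart t j \<omega>)\<^sup>2)) \<partial>M) + (\<integral>\<^sup>+\<omega>. ennreal c * (?J t \<omega> * indicator (trunc n) \<omega>) \<partial>M)"
      by (rule nn_integral_add) measurable
    also have "(\<integral>\<^sup>+\<omega>. ennreal c * (?J t \<omega> * indicator (trunc n) \<omega>) \<partial>M) = ennreal c * (\<integral>\<^sup>+\<omega>. ?J t \<omega> * indicator (trunc n) \<omega> \<partial>M)"
      by (rule nn_integral_cmult) measurable
    also have "(\<integral>\<^sup>+\<omega>. ennreal a0 + ennreal (3 * (\<Sum>j\<in>UNIV. (mart t j \<omega>)\<^sup>2)) \<partial>M) = ennreal a0 + (\<integral>\<^sup>+\<omega>. ennreal (3 * (\<Sum>j\<in>UNIV. (mart t j \<omega>)\<^sup>2)) \<partial>M)"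
      by (subst nn_integral_add) (auto simp: emeasure_space_1)
    also have "\<dots> \<le> ennreal a0 + ennreal (3 * (\<Sum>j\<in>UNIV. (bnd j)\<^sup>2))" by (intro add_left_mono mart t)
    also have "\<dots> = ennreal a" using a0 by (simp add: a_def ennreal_plus[symmetric] sum_nonneg del: ennreal_plus)
    finally show ?thesis by (simp add: add_right_mono)
  qed
  \<comment> \<open>Tonelli's theorem turns the truncated path integral into the time integral of
    \<open>\<gamma> n\<close>.\<close>
  have le: "\<gamma> n t \<le> ennreal a + ennreal c * (\<integral>\<^sup>+s. \<gamma> n s \<partial>Leb t)" if t: "t \<in> {0..T}" for n t
  proof -
    interpret P: pair_sigma_finite "Leb t" M by (rule pair_sigma_finite_PM)
    have [measurable]: "(\<lambda>(s, \<omega>). (norm (X s \<omega>))\<^sup>2) \<in> borel_measurable (PM t)" using q_joint[of t] t by simp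
    have "(\<integral>\<^sup>+\<omega>. ?J t \<omega> * indicator (trunc n) \<omega> \<partial>M) = (\<integral>\<^sup>+\<omega>. \<integral>\<^sup>+s. ennreal ((norm (X s \<omega>))\<^sup>2) * indicator (trunc n) \<omega> \<partial>Leb t \<partial>M)"
    proof (rule nn_integral_cong)
      fix \<omega> assume "\<omega> \<in> space M"
      then have "(\<lambda>s. (norm (X s \<omega>))\<^sup>2) \<in> borel_measurable (Leb t)" using q_path[OF _ t] by auto
      then show "?J t \<omega> * indicator (trunc n) \<omega> = (\<integral>\<^sup>+s. ennreal ((norm (X s \<omega>))\<^sup>2) * indicator (trunc n) \<omega> \<partial>Leb t)"
        by (intro nn_integral_multc[symmetric]) simp
    qed
    also have "\<dots> = (\<integral>\<^sup>+s. \<gamma> n s \<partial>Leb t)"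
      unfolding \<gamma>_def by (rule P.Fubini') measurable
    finally show ?thesis using bound[OF t, of n] by (simp only:)
  qed
  \<comment> \<open>On \<open>trunc n\<close> the path integral is at most \<open>n\<close>, which
    supplies the a priori bound in Gronwall's inequality.\<close>
  have fin: "\<gamma> n t \<le> ennreal (a + c * n)" if t: "t \<in> {0..T}" for n t
  proof -
    have "(\<integral>\<^sup>+\<omega>. ?J t \<omega> * indicator (trunc n) \<omega> \<partial>M) \<le> (\<integral>\<^sup>+\<omega>. ennreal (real n) \<partial>M)"
    proof (rule nn_integral_mono)
      fix \<omega>
      have "?J t \<omega> \<le> ?J T \<omega>" using t by (intro nn_integral_Leb_mono) simp
      then show "?J t \<omega> * indicator (trunc n) \<omega> \<le> ennreal (real n)"
        by (auto simp: trunc_def indicator_def intro: order_trans)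
    qed
    then have "(\<integral>\<^sup>+\<omega>. ?J t \<omega> * indicator (trunc n) \<omega> \<partial>M) \<le> ennreal (real n)" by (simp add: emeasure_space_1)
    then have "ennreal a + ennreal c * (\<integral>\<^sup>+\<omega>. ?J t \<omega> * indicator (trunc n) \<omega> \<partial>M) \<le> ennreal a + ennreal c * ennreal (real n)"
      by (intro add_left_mono mult_left_mono) auto
    also have "\<dots> = ennreal (a + c * n)" using a c by (simp add: ennreal_mult)
    finally show ?thesis by (rule order_trans[OF bound[OF t]])
  qed
  have \<gamma>_le: "\<gamma> n t \<le> ennreal (2 * a * exp (2 * c * T))" if t: "t \<in> {0..T}" for n t
    by (rule Gronwall_nn[where C = "a + c * n"]) (use T_pos c fin le a t in auto)
  show ?thesis
  proof (intro exI conjI ballI)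
    show "0 \<le> 2 * a * exp (2 * c * T)" using a by simp
    fix t assume t: "t \<in> {0..T}"
    have [measurable]: "X t \<in> borel_measurable M" by (rule X_measurable[OF t])
    \<comment> \<open>Monotone convergence removes the truncation: paths are continuous, so every
      sample point lies in some \<open>trunc n\<close>.\<close>
    have inc: "incseq (\<lambda>n \<omega>. ennreal ((norm (X t \<omega>))\<^sup>2) * indicator (trunc n) \<omega>)"
    proof (rule incseq_SucI, rule le_funI)
      fix n \<omega>
      have "\<omega> \<in> trunc n \<Longrightarrow> \<omega> \<in> trunc (Suc n)" by (auto simp: trunc_def elim!: order_trans intro!: ennreal_leI)
      then show "ennreal ((norm (X t \<omega>))\<^sup>2) * indicator (trunc n) \<omega> \<le> ennreal ((norm (X t \<omega>))\<^sup>2) * indicator (trunc (Suc n)) \<omega>"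
        by (auto simp: indicator_def)
    qed
    have "(\<integral>\<^sup>+\<omega>. ennreal ((norm (X t \<omega>))\<^sup>2) \<partial>M) \<le> (\<integral>\<^sup>+\<omega>. (SUP n. ennreal ((norm (X t \<omega>))\<^sup>2) * indicator (trunc n) \<omega>) \<partial>M)"
    proof (rule nn_integral_mono)
      fix \<omega> assume \<omega>: "\<omega> \<in> space M"
      have Tin: "T \<in> {0..T}" using T_pos by simp
      have "?J T \<omega> = ennreal (LINT s|Leb T. (norm (X s \<omega>))\<^sup>2)"
        by (intro nn_integral_eq_integral q_path[OF \<omega> Tin]) simp
      moreover obtain n where "(LINT s|Leb T. (norm (X s \<omega>))\<^sup>2) \<le> real n" using real_arch_simple by blast
      ultimately have "\<omega> \<in> trunc n" using \<omega> by (simp add: trunc_def ennreal_leI)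
      then show "ennreal ((norm (X t \<omega>))\<^sup>2) \<le> (SUP n. ennreal ((norm (X t \<omega>))\<^sup>2) * indicator (trunc n) \<omega>)"
        by (intro SUP_upper2[of n]) auto
    qed
    also have "\<dots> = (SUP n. \<gamma> n t)"
      unfolding \<gamma>_def by (rule nn_integral_monotone_convergence_SUP[OF inc]) measurable
    also have "\<dots> \<le> ennreal (2 * a * exp (2 * c * T))" by (intro SUP_least \<gamma>_le t)
    finally show "(\<integral>\<^sup>+\<omega>. ennreal ((norm (X t \<omega>))\<^sup>2) \<partial>M) \<le> ennreal (2 * a * exp (2 * c * T))" .
  qed
qed

lemma X_comp_measurable: "t \<in> {0..T} \<Longrightarrow> (\<lambda>\<omega>. X t \<omega> $ j) \<in> borel_measurable M"
  by (rule measurable_vec_nth[OF X_measurable])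

lemma X_L2:
  assumes t: "t \<in> {0..T}" shows "L2 M (\<lambda>\<omega>. X t \<omega> $ j)"
proof (rule L2_of_nn_integral[OF X_comp_measurable[OF t]])
  obtain C where C: "C \<ge> 0" "\<forall>t\<in>{0..T}. (\<integral>\<^sup>+\<omega>. ennreal ((norm (X t \<omega>))\<^sup>2) \<partial>M) \<le> ennreal C" using X_moment by blast
  have "(\<integral>\<^sup>+\<omega>. ennreal ((X t \<omega> $ j)\<^sup>2) \<partial>M) \<le> (\<integral>\<^sup>+\<omega>. ennreal ((norm (X t \<omega>))\<^sup>2) \<partial>M)"
    using component_le_norm_cart[of "X t _" j] by (intro nn_integral_mono ennreal_leI) (simp add: abs_le_square_iff[symmetric])
  also have "\<dots> \<le> ennreal C" by (rule bspec[OF C(2) t])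
  also have "\<dots> < \<infinity>" by simp
  finally show "(\<integral>\<^sup>+\<omega>. ennreal ((X t \<omega> $ j)\<^sup>2) \<partial>M) < \<infinity>" .
qed

lemma F_L2:
  assumes t: "t \<in> {0..T}" shows "L2 (PM t) (\<lambda>(s, \<omega>). F s (X s \<omega>) $ j)"
proof (rule L2_of_nn_integral)
  have t': "t \<le> T" using t by simp
  show m: "(\<lambda>(s, \<omega>). F s (X s \<omega>) $ j) \<in> borel_measurable (PM t)" by (rule F_comp_joint[OF t'])
  interpret L: finite_measure "Leb t" by (rule finite_measure_Leb)
  obtain C where C: "C \<ge> 0" "\<forall>t\<in>{0..T}. (\<integral>\<^sup>+\<omega>. ennreal ((norm (X t \<omega>))\<^sup>2) \<partial>M) \<le> ennreal C" using X_moment by blast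
  have "(\<integral>\<^sup>+x. ennreal ((case x of (s, \<omega>) \<Rightarrow> F s (X s \<omega>) $ j)\<^sup>2) \<partial>PM t) = (\<integral>\<^sup>+s. \<integral>\<^sup>+\<omega>. ennreal ((F s (X s \<omega>) $ j)\<^sup>2) \<partial>M \<partial>Leb t)"
    using m by (subst nn_integral_fst[symmetric]) auto
  also have "\<dots> \<le> (\<integral>\<^sup>+s. ennreal (K\<^sup>2 * (1 + C)) \<partial>Leb t)"
  proof (rule nn_integral_mono)
    fix s assume "s \<in> space (Leb t)"
    then have s: "s \<in> {0..T}" using t by auto
    have "(\<integral>\<^sup>+\<omega>. ennreal ((F s (X s \<omega>) $ j)\<^sup>2) \<partial>M) \<le> (\<integral>\<^sup>+\<omega>. ennreal (K\<^sup>2) * (1 + ennreal ((norm (X s \<omega>))\<^sup>2)) \<partial>M)"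
    proof (rule nn_integral_mono)
      fix \<omega>
      have "(F s (X s \<omega>) $ j)\<^sup>2 \<le> (norm (F s (X s \<omega>)))\<^sup>2"
        using component_le_norm_cart[of "F s (X s \<omega>)" j] by (simp add: abs_le_square_iff[symmetric])
      also have "\<dots> \<le> K\<^sup>2 * (1 + (norm (X s \<omega>))\<^sup>2)" by (rule F_growth[OF s])
      finally have "ennreal ((F s (X s \<omega>) $ j)\<^sup>2) \<le> ennreal (K\<^sup>2 * (1 + (norm (X s \<omega>))\<^sup>2))" by (rule ennreal_leI)
      then show "ennreal ((F s (X s \<omega>) $ j)\<^sup>2) \<le> ennreal (K\<^sup>2) * (1 + ennreal ((norm (X s \<omega>))\<^sup>2))"
        by (simp add: ennreal_mult)
    qed
    also have "\<dots> = ennreal (K\<^sup>2) * (1 + (\<integral>\<^sup>+\<omega>. ennreal ((norm (X s \<omega>))\<^sup>2) \<partial>M))"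
      using q_measurable[OF s] by (subst nn_integral_cmult, simp, subst nn_integral_add) (auto simp: emeasure_space_1)
    also have "\<dots> \<le> ennreal (K\<^sup>2) * (1 + ennreal C)" by (intro mult_left_mono add_left_mono bspec[OF C(2) s]) auto
    also have "\<dots> = ennreal (K\<^sup>2 * (1 + C))" using C(1) by (simp add: ennreal_mult)
    finally show "(\<integral>\<^sup>+\<omega>. ennreal ((F s (X s \<omega>) $ j)\<^sup>2) \<partial>M) \<le> ennreal (K\<^sup>2 * (1 + C))" .
  qed
  also have "\<dots> = ennreal (K\<^sup>2 * (1 + C)) * emeasure (Leb t) (space (Leb t))" by (rule nn_integral_const)
  also have "\<dots> < \<infinity>" using L.emeasure_finite[of "space (Leb t)"] by (simp add: ennreal_mult_eq_top_iff less_top[symmetric])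
  finally show "(\<integral>\<^sup>+x. ennreal ((case x of (s, \<omega>) \<Rightarrow> F s (X s \<omega>) $ j)\<^sup>2) \<partial>PM t) < \<infinity>" .
qed

end

subsection \<open>The propagator system\<close>

context sde
begin

lemma chaos_coeff_component:
  assumes t: "t \<in> {0..T}"
  shows "chaos_coeff M \<xi> X \<alpha> t $ j = (LINT \<omega>|M. wick \<alpha> \<omega> * X t \<omega> $ j)"
proof -
  have [measurable]: "X t \<in> borel_measurable M" "wick \<alpha> \<in> borel_measurable M"
    using X_measurable[OF t] wick_L2 by auto
  have "integrable M (\<lambda>\<omega>. wick \<alpha> \<omega> *\<^sub>R X t \<omega>)"
  proof (rule Bochner_Integration.integrable_bound)
    show "integrable M (\<lambda>\<omega>. \<Sum>i\<in>UNIV. \<bar>wick \<alpha> \<omega> * X t \<omega> $ i\<bar>)"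
      by (intro Bochner_Integration.integrable_sum integrable_abs L2_mult wick_L2 X_L2 t)
    show "AE \<omega> in M. norm (wick \<alpha> \<omega> *\<^sub>R X t \<omega>) \<le> norm (\<Sum>i\<in>UNIV. \<bar>wick \<alpha> \<omega> * X t \<omega> $ i\<bar>)"
    proof (rule AE_I2)
      fix \<omega>
      have "norm (wick \<alpha> \<omega> *\<^sub>R X t \<omega>) \<le> (\<Sum>i\<in>UNIV. \<bar>(wick \<alpha> \<omega> *\<^sub>R X t \<omega>) $ i\<bar>)" by (rule norm_le_l1_cart)
      then show "norm (wick \<alpha> \<omega> *\<^sub>R X t \<omega>) \<le> norm (\<Sum>i\<in>UNIV. \<bar>wick \<alpha> \<omega> * X t \<omega> $ i\<bar>)" by (simp add: sum_nonneg)
    qed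
  qed measurable
  from integral_bounded_linear[OF bounded_linear_vec_nth this, of j]
  show ?thesis by (simp add: chaos_coeff_def)
qed

lemma X_noise:
  assumes t: "t \<in> {0..T}"
  obtains Y where "Y \<in> borel_measurable (noise T)" "AE \<omega> in M. X t \<omega> = Y \<omega>"
proof -
  obtain Y where Y: "Y \<in> borel_measurable (noise t)" "AE \<omega> in M. X t \<omega> = Y \<omega>"
    using X t unfolding strong_solution_def by blast
  have "Y \<in> borel_measurable (noise T)"
    by (rule measurable_from_subalg[OF _ Y(1)]) (use noise_mono[of t] noise_space t in \<open>auto simp: subalgebra_def\<close>)
  then show thesis using Y(2) by (rule that)
qed

text \<open>The squared norm of the vector remainder is the sum of the squared remainders of its
  components, and \<open>wick_complete\<close> covers each component.\<close>

lemma chaos_expansion: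
  assumes t: "t \<in> {0..T}"
  shows "has_chaos_expansion M \<xi> (\<lambda>\<alpha>. chaos_coeff M \<xi> X \<alpha> t) (X t)"
proof -
  obtain Y where Y: "Y \<in> borel_measurable (noise T)" "AE \<omega> in M. X t \<omega> = Y \<omega>"
    by (rule X_noise[OF t])
  have lim: "((\<lambda>A. l2norm M (remainder (\<lambda>\<omega>. X t \<omega> $ j) A)) \<longlongrightarrow> 0) (finite_subsets_at_top UNIV)" for j
    by (rule wick_complete[OF X_L2[OF t] measurable_vec_nth[OF Y(1)]]) (use Y(2) in auto)
  have "((\<lambda>A. \<Sum>j\<in>UNIV. (l2norm M (remainder (\<lambda>\<omega>. X t \<omega> $ j) A))\<^sup>2) \<longlongrightarrow> (\<Sum>j\<in>(UNIV :: 'd set). 0\<^sup>2)) (finite_subsets_at_top UNIV)"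
    by (intro tendsto_sum tendsto_power lim)
  then have "((\<lambda>A. ennreal (\<Sum>j\<in>UNIV. (l2norm M (remainder (\<lambda>\<omega>. X t \<omega> $ j) A))\<^sup>2)) \<longlongrightarrow> ennreal 0) (finite_subsets_at_top UNIV)"
    by (intro tendsto_ennrealI) simp
  moreover have "(\<integral>\<^sup>+\<omega>. ennreal ((norm (X t \<omega> - (\<Sum>\<alpha>\<in>A. wick \<alpha> \<omega> *\<^sub>R chaos_coeff M \<xi> X \<alpha> t)))\<^sup>2) \<partial>M) =
      ennreal (\<Sum>j\<in>UNIV. (l2norm M (remainder (\<lambda>\<omega>. X t \<omega> $ j) A))\<^sup>2)" for A
  proof -
    have eq: "(norm (X t \<omega> - (\<Sum>\<alpha>\<in>A. wick \<alpha> \<omega> *\<^sub>R chaos_coeff M \<xi> X \<alpha> t)))\<^sup>2 = (\<Sum>j\<in>UNIV. (remainder (\<lambda>\<omega>. X t \<omega> $ j) A \<omega>)\<^sup>2)" for \<omega>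
      unfolding norm_sq_vec remainder_def chaos_coeff_component[OF t, symmetric]
      by (simp add: mult.commute)
    have i: "integrable M (\<lambda>\<omega>. (remainder (\<lambda>\<omega>. X t \<omega> $ j) A \<omega>)\<^sup>2)" for j
      by (rule L2_integrable_sq[OF remainder_L2[OF X_L2[OF t]]])
    have "(\<integral>\<^sup>+\<omega>. ennreal (\<Sum>j\<in>UNIV. (remainder (\<lambda>\<omega>. X t \<omega> $ j) A \<omega>)\<^sup>2) \<partial>M) = ennreal (LINT \<omega>|M. (\<Sum>j\<in>UNIV. (remainder (\<lambda>\<omega>. X t \<omega> $ j) A \<omega>)\<^sup>2))"
      by (intro nn_integral_eq_integral Bochner_Integration.integrable_sum i) (simp add: sum_nonneg)
    also have "(LINT \<omega>|M. (\<Sum>j\<in>UNIV. (remainder (\<lambda>\<omega>. X t \<omega> $ j) A \<omega>)\<^sup>2)) = (\<Sum>j\<in>UNIV. (l2norm M (remainder (\<lambda>\<omega>. X t \<omega> $ j) A))\<^sup>2)"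
      unfolding l2norm_sq by (rule Bochner_Integration.integral_sum, rule i)
    finally show ?thesis unfolding eq .
  qed
  ultimately show ?thesis unfolding has_chaos_expansion_def by simp
qed

lemma wick_mean: "(LINT \<omega>|M. wick \<alpha> \<omega>) = (if \<alpha> = 0 then 1 else 0)"
  using wick_orthonormal[of \<alpha> 0] by simp

text \<open>Links the sum over the whole support, as integration by parts produces it, with the
  inner sum over \<open>i\<close> in the system.\<close>

lemma sum_keys_component:
  "(\<Sum>p\<in>Poly_Mapping.keys \<alpha>. if fst p = k then f p else 0) = (\<Sum>i | Poly_Mapping.lookup \<alpha> (k, i) \<noteq> 0. f (k, i))"
proof -
  have "(\<Sum>p\<in>Poly_Mapping.keys \<alpha>. if fst p = k then f p else 0) = (\<Sum>p\<in>{p \<in> Poly_Mapping.keys \<alpha>. fst p = k}. f p)"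
    by (rule sum.inter_filter[symmetric]) simp
  also have "{p \<in> Poly_Mapping.keys \<alpha>. fst p = k} = Pair k ` {i. Poly_Mapping.lookup \<alpha> (k, i) \<noteq> 0}"
    by (auto simp: in_keys_iff image_iff)
  also have "(\<Sum>p\<in>Pair k ` {i. Poly_Mapping.lookup \<alpha> (k, i) \<noteq> 0}. f p) = (\<Sum>i | Poly_Mapping.lookup \<alpha> (k, i) \<noteq> 0. f (k, i))"
    by (subst sum.reindex) (auto simp: inj_on_def)
  finally show ?thesis .
qed

definition drift_rhs :: "'m multi_index \<Rightarrow> 'd \<Rightarrow> real \<Rightarrow> real" where
  "drift_rhs \<alpha> j t = (LINT \<omega>|M. F t (X t \<omega>) $ j * wick \<alpha> \<omega>)"

definition noise_rhs :: "'m multi_index \<Rightarrow> 'd \<Rightarrow> 'm \<Rightarrow> real \<Rightarrow> real" where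
  "noise_rhs \<alpha> j k t = (\<Sum>i | Poly_Mapping.lookup \<alpha> (k, i) \<noteq> 0. sqrt (real (Poly_Mapping.lookup \<alpha> (k, i))) * e i t *
     (LINT \<omega>|M. B t (X t \<omega>) $ j $ k * wick (\<alpha> - Poly_Mapping.single (k, i) 1) \<omega>))"

text \<open>\<open>ito_wick\<close>, with Fubini's theorem applied to each of its finitely many
  terms.\<close>

lemma noise_rhs_ito:
  assumes t: "t \<in> {0..T}" and I: "is_ito_integral M \<F> (\<lambda>s \<omega>. W s \<omega> $ k) t (\<lambda>s \<omega>. B s (X s \<omega>) $ j $ k) I"
  shows "integrable (Leb t) (noise_rhs \<alpha> j k)"
    and "(LINT \<omega>|M. I \<omega> * wick \<alpha> \<omega>) = (LINT s|Leb t. noise_rhs \<alpha> j k s)"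
proof -
  have t': "0 \<le> t" "t \<le> T" using t by auto
  let ?b = "\<lambda>i s. sqrt (real (Poly_Mapping.lookup \<alpha> (k, i))) * (e i s * (LINT \<omega>|M. B s (X s \<omega>) $ j $ k * wick (\<alpha> - Poly_Mapping.single (k, i) 1) \<omega>))"
  note it = PM_inner_iterated[OF ito_isometry(2)[OF I t'] t'(2)]
  have i: "integrable (Leb t) (?b i)" for i by (rule integrable_mult_right, rule it)
  have eq: "noise_rhs \<alpha> j k = (\<lambda>s. \<Sum>i | Poly_Mapping.lookup \<alpha> (k, i) \<noteq> 0. ?b i s)"
    by (simp add: noise_rhs_def fun_eq_iff mult.assoc)
  show "integrable (Leb t) (noise_rhs \<alpha> j k)" unfolding eq by (rule Bochner_Integration.integrable_sum, rule i)
  have "(LINT s|Leb t. noise_rhs \<alpha> j k s) = (\<Sum>i | Poly_Mapping.lookup \<alpha> (k, i) \<noteq> 0. (LINT s|Leb t. ?b i s))"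
    unfolding eq by (rule Bochner_Integration.integral_sum, rule i)
  also have "\<dots> = (LINT \<omega>|M. I \<omega> * wick \<alpha> \<omega>)"
    unfolding ito_wick[OF I t'] sum_keys_component it(2) by simp
  finally show "(LINT \<omega>|M. I \<omega> * wick \<alpha> \<omega>) = (LINT s|Leb t. noise_rhs \<alpha> j k s)" by simp
qed

lemma drift_rhs_integral:
  assumes t: "t \<in> {0..T}"
  shows "integrable (Leb t) (drift_rhs \<alpha> j)"
    and "(LINT \<omega>|M. drift t j \<omega> * wick \<alpha> \<omega>) = (LINT s|Leb t. drift_rhs \<alpha> j s)"
proof -
  interpret P: pair_sigma_finite "Leb t" M by (rule pair_sigma_finite_PM)
  interpret L: finite_measure "Leb t" by (rule finite_measure_Leb)
  have "L2 (PM t) (\<lambda>(s, \<omega>). wick \<alpha> \<omega>)" using L2_PM_product[OF L.L2_const[of 1] wick_L2[of \<alpha>]] by simp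
  from L2_mult[OF F_L2[OF t, of j] this]
  have i: "integrable (PM t) (\<lambda>(s, \<omega>). F s (X s \<omega>) $ j * wick \<alpha> \<omega>)" by (simp add: case_prod_unfold)
  show "integrable (Leb t) (drift_rhs \<alpha> j)"
    unfolding drift_rhs_def[abs_def] using P.integrable_fst'[OF i] by simp
  show "(LINT \<omega>|M. drift t j \<omega> * wick \<alpha> \<omega>) = (LINT s|Leb t. drift_rhs \<alpha> j s)"
    unfolding drift_rhs_def[abs_def] drift_def using P.Fubini_integral[OF i] by simp
qed

text \<open>The components of the equation are multiplied by the Wick monomial. Monomials other than
  the constant have mean 0, which gives the initial value; drift and stochastic integral give time
  integrals.\<close>

lemma propagator_integral:
  assumes t: "t \<in> {0..T}"
  shows "chaos_coeff M \<xi> X \<alpha> t $ j = x0 $ j * (if \<alpha> = 0 then 1 else 0) +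
    (LINT s|Leb t. drift_rhs \<alpha> j s + (\<Sum>k\<in>UNIV. noise_rhs \<alpha> j k s))"
    and "integrable (Leb t) (\<lambda>s. drift_rhs \<alpha> j s + (\<Sum>k\<in>UNIV. noise_rhs \<alpha> j k s))"
proof -
  obtain I where I: "\<And>j k. is_ito_integral M \<F> (\<lambda>s \<omega>. W s \<omega> $ k) t (\<lambda>s \<omega>. B s (X s \<omega>) $ j $ k) (I j k)"
    and AE: "\<And>j. AE \<omega> in M. mart t j \<omega> = (\<Sum>k\<in>UNIV. I j k \<omega>)"
    using ito_ex[OF t] by blast
  have t': "0 \<le> t" "t \<le> T" using t by auto
  have I2: "L2 M (I j k)" for k by (rule ito_isometry(1)[OF I t'])
  note ni = noise_rhs_ito[OF t I]
  note di = drift_rhs_integral[OF t]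
  show "integrable (Leb t) (\<lambda>s. drift_rhs \<alpha> j s + (\<Sum>k\<in>UNIV. noise_rhs \<alpha> j k s))"
    by (intro Bochner_Integration.integrable_add Bochner_Integration.integrable_sum di ni)
  have "drift t j = (\<lambda>\<omega>. X t \<omega> $ j - x0 $ j - mart t j \<omega>)" by (simp add: mart_def fun_eq_iff)
  then have D2: "L2 M (drift t j)" by (simp add: L2_diff L2_const X_L2[OF t] mart_L2(1)[OF t])
  have "(LINT \<omega>|M. mart t j \<omega> * wick \<alpha> \<omega>) = (LINT \<omega>|M. (\<Sum>k\<in>UNIV. I j k \<omega> * wick \<alpha> \<omega>))"
  proof (rule integral_cong_AE)
    show "AE \<omega> in M. mart t j \<omega> * wick \<alpha> \<omega> = (\<Sum>k\<in>UNIV. I j k \<omega> * wick \<alpha> \<omega>)"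
      using AE[of j] by (rule AE_mp) (auto intro!: AE_I2 simp: sum_distrib_right)
  qed (use I2 mart_L2(1)[OF t, of j] wick_L2[of \<alpha>] in measurable)
  also have "\<dots> = (\<Sum>k\<in>UNIV. (LINT \<omega>|M. I j k \<omega> * wick \<alpha> \<omega>))"
    by (intro Bochner_Integration.integral_sum L2_mult I2 wick_L2)
  also have "\<dots> = (\<Sum>k\<in>UNIV. (LINT s|Leb t. noise_rhs \<alpha> j k s))" unfolding ni ..
  finally have mart: "(LINT \<omega>|M. mart t j \<omega> * wick \<alpha> \<omega>) = (\<Sum>k\<in>UNIV. (LINT s|Leb t. noise_rhs \<alpha> j k s))" .
  have "chaos_coeff M \<xi> X \<alpha> t $ j = (LINT \<omega>|M. x0 $ j * wick \<alpha> \<omega> + (drift t j \<omega> * wick \<alpha> \<omega> + mart t j \<omega> * wick \<alpha> \<omega>))"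
    unfolding chaos_coeff_component[OF t]
    by (intro Bochner_Integration.integral_cong refl) (simp add: mart_def algebra_simps)
  also have "\<dots> = (LINT \<omega>|M. x0 $ j * wick \<alpha> \<omega>) + ((LINT \<omega>|M. drift t j \<omega> * wick \<alpha> \<omega>) + (LINT \<omega>|M. mart t j \<omega> * wick \<alpha> \<omega>))"
    using L2_mult[OF D2 wick_L2[of \<alpha>]] L2_mult[OF mart_L2(1)[OF t] wick_L2[of \<alpha>]] L2_integrable[OF wick_L2[of \<alpha>]] by simp
  also have "\<dots> = x0 $ j * (if \<alpha> = 0 then 1 else 0) + ((LINT s|Leb t. drift_rhs \<alpha> j s) + (\<Sum>k\<in>UNIV. (LINT s|Leb t. noise_rhs \<alpha> j k s)))"
    unfolding mart di(2) by (simp add: wick_mean)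
  also have "(LINT s|Leb t. drift_rhs \<alpha> j s) + (\<Sum>k\<in>UNIV. (LINT s|Leb t. noise_rhs \<alpha> j k s)) =
      (LINT s|Leb t. drift_rhs \<alpha> j s + (\<Sum>k\<in>UNIV. noise_rhs \<alpha> j k s))"
    by (subst Bochner_Integration.integral_add[OF di(1) Bochner_Integration.integrable_sum[OF ni(1)]])
      (simp add: Bochner_Integration.integral_sum[OF ni(1)])
  finally show "chaos_coeff M \<xi> X \<alpha> t $ j = x0 $ j * (if \<alpha> = 0 then 1 else 0) +
    (LINT s|Leb t. drift_rhs \<alpha> j s + (\<Sum>k\<in>UNIV. noise_rhs \<alpha> j k s))" .
qed

end

text \<open>On [0, T] the function \<open>u\<close> coincides with \<open>c\<close> plus an
  indefinite integral, so Lebesgue differentiation makes \<open>g\<close> its derivative almost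
  everywhere, one-sided at the endpoints.\<close>

lemma solves_ode_aeI:
  assumes T: "T \<ge> 0" and g: "integrable (lebesgue_on {0..T}) g"
    and u: "\<And>t. t \<in> {0..T} \<Longrightarrow> u t = c + (LINT s|lebesgue_on {0..t}. g s)"
  shows "u 0 = c" "solves_ode_ae T u g"
proof -
  have gi: "integrable (lebesgue_on {0..t}) g" if "t \<in> {0..T}" for t
    by (rule Equivalence_Lebesgue_Henstock_Integration.integrable_subinterval[OF g]) (use that in auto)
  have ug: "u t = c + integral {0..t} g" if "t \<in> {0..T}" for t
    using u[OF that] lebesgue_integral_eq_integral[OF gi[OF that]] by simp
  show u0: "u 0 = c" using ug[of 0] T by simp
  obtain N where N: "negligible N" "\<And>x. x \<in> {0..T} - N \<Longrightarrow> ((\<lambda>t. integral {0..t} g) has_real_derivative g x) (at x within {0..T})"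
    by (rule Lebesgue_differentiation_real[OF integrable_on_lebesgue_on[OF g]]) auto
  have D: "(u has_real_derivative g x) (at x within {0..T})" if x: "x \<in> {0..T} - N" for x
  proof (rule has_field_derivative_transform_within[where d = 1])
    show "((\<lambda>t. c + integral {0..t} g) has_real_derivative g x) (at x within {0..T})"
      using DERIV_add[OF DERIV_const N(2)[OF x], of c] by simp
  qed (use x ug in auto)
  have "AE x in lebesgue. x \<notin> N" using N(1) by (intro AE_not_in) (simp add: negligible_iff_null_sets)
  then have "AE x in lebesgue. x \<in> {0..T} \<longrightarrow> (u has_real_derivative g x) (at x within {0..T})"
    by eventually_elim (use D in auto)
  then have "AE t in lebesgue_on {0..T}. (u has_real_derivative g t) (at t within {0..T})"
    by (subst AE_restrict_space_iff) auto
  then show "solves_ode_ae T u g" unfolding solves_ode_ae_def u0 using g u by blast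
qed

theorem theorem1:
  fixes M :: "'a measure" and \<F> :: "real \<Rightarrow> 'a measure"
    and T L K :: real
    and W :: "real \<Rightarrow> 'a \<Rightarrow> real ^ 'm"
    and F :: "real \<Rightarrow> real ^ 'd \<Rightarrow> real ^ 'd"
    and B :: "real \<Rightarrow> real ^ 'd \<Rightarrow> real ^ 'm ^ 'd"
    and x0 :: "real ^ 'd"
    and X :: "real \<Rightarrow> 'a \<Rightarrow> real ^ 'd"
    and e :: "nat \<Rightarrow> real \<Rightarrow> real"
    and \<xi> :: "'m \<Rightarrow> nat \<Rightarrow> 'a \<Rightarrow> real"
  assumes T_pos: "T > 0"
    and space: "filtered_prob_space M \<F>"
    and W: "brownian_motion M \<F> T W"
    and F_meas: "(\<lambda>(t, x). F t x) \<in> borel_measurable (restrict_space borel {0..T} \<Otimes>\<^sub>M borel)"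
    and B_meas: "(\<lambda>(t, x). B t x) \<in> borel_measurable (restrict_space borel {0..T} \<Otimes>\<^sub>M borel)"
    and LK_pos: "L > 0" "K > 0"
    and lipschitz: "\<And>t x y. t \<in> {0..T} \<Longrightarrow>
          norm (F t x - F t y) + norm (B t x - B t y) \<le> L * norm (x - y)"
    and growth: "\<And>t x. t \<in> {0..T} \<Longrightarrow>
          (norm (F t x))\<^sup>2 + (norm (B t x))\<^sup>2 \<le> K\<^sup>2 * (1 + (norm x)\<^sup>2)"
    and X: "strong_solution M \<F> T W F B x0 X"
    and e_complete: "complete_orthonormal T e"
    and e_cont: "\<And>i. AE s in lebesgue_on {0..T}. continuous (at s within {0..T}) (e i)"
    and \<xi>: "\<And>k i. is_ito_integral M \<F> (\<lambda>s \<omega>. W s \<omega> $ k) T (\<lambda>s \<omega>. e i s) (\<xi> k i)"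
  shows "(\<forall>t\<in>{0..T}. has_chaos_expansion M \<xi> (\<lambda>\<alpha>. chaos_coeff M \<xi> X \<alpha> t) (X t)) \<and>
    (\<forall>\<alpha> j.
       solves_ode_ae T (\<lambda>t. chaos_coeff M \<xi> X \<alpha> t $ j)
         (\<lambda>t. (LINT \<omega>|M. F t (X t \<omega>) $ j * wick_monomial \<xi> \<alpha> \<omega>) +
            (\<Sum>k\<in>UNIV. \<Sum>i | Poly_Mapping.lookup \<alpha> (k, i) \<noteq> 0.
               sqrt (real (Poly_Mapping.lookup \<alpha> (k, i))) * e i t *
               (LINT \<omega>|M. B t (X t \<omega>) $ j $ k *
                  wick_monomial \<xi> (\<alpha> - Poly_Mapping.single (k, i) 1) \<omega>))) \<and>
       chaos_coeff M \<xi> X \<alpha> 0 $ j = x0 $ j * (if \<alpha> = 0 then 1 else 0))"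
proof -
  interpret prob_space M using space by (simp add: filtered_prob_space_def)
  interpret sde M \<F> T W e \<xi> K F B x0 X
  proof unfold_locales
    show "(norm (F t x))\<^sup>2 \<le> K\<^sup>2 * (1 + (norm x)\<^sup>2)" if "t \<in> {0..T}" for t x
      using growth[OF that, of x] zero_le_power2[of "norm (B t x)"] by linarith
  qed (fact T_pos space W e_complete \<xi> F_meas LK_pos X)+
  have "T \<in> {0..T}" "0 \<le> T" using T_pos by auto
  \<comment> \<open>Integrability of the right-hand side is taken at the final time
    \<open>T\<close>, the integral equation at every \<open>t\<close>.\<close>
  note ode = solves_ode_aeI[OF \<open>0 \<le> T\<close> propagator_integral(2)[OF \<open>T \<in> {0..T}\<close>] propagator_integral(1), unfolded drift_rhs_def noise_rhs_def]
  show ?thesis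
    using chaos_expansion ode by blast
qed

end
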